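(* Let $K$ be a field, let $A$ be a gendo-symmetric finite dimensional $K$-algebra, and let $e\in A$ be an idempotent such that $eA$ is the minimal faithful projective-injective right $A$-module. Then the module category of the bocs $\mathcal{B}=(A,D(A))$ is equivalent, as a $K$-linear category, to the category $\operatorname{mod-}eAe$ of finite dimensional right $eAe$-modules.
   Context: $D=\operatorname{Hom}_K(-,K)$ is the natural duality. Modules are finite dimensional right modules unless otherwise stated; $\operatorname{mod-}A$ is the category of finite dimensional right $A$-modules. Gendo-symmetric: a finite dimensional $K$-algebra $B$ is symmetric if $B\cong D(B)$ as $B$-bimodules. A finite dimensional $K$-algebra $A$ is gendo-symmetric if $A\cong \operatorname{End}_B(M)$ for some finite dimensional symmetric $K$-algebra $B$ and some generator $M\in\operatorname{mod-}B$ (i.e. $B_B$ is a direct summand of a finite direct sum of copies of $M$). For such $A$ there is an idempotent $e$ such that $eA$ is a minimal faithful projective-injective right $A$-module, and $D(A)\cong Ae\otimes_{eAe}eA$ as $A$-bimodules. Bocs: let $W$ be an $A$-bimodule with canonical isomorphisms $c_r: W\to A\otimes_A W$, $c_l: W\to W\otimes_A A$. The pair $(A,W)$ with $A$-bimodule maps $\mu: W\to W\otimes_A W$ and $\epsilon: W\to A$ is a bocs if $(1_W\otimes_A\epsilon)\mu=c_l$, $(\epsilon\otimes_A 1_W)\mu=c_r$ and $(\mu\otimes_A 1_W)\mu=(1_W\otimes_A\mu)\mu$. The bocs structure on $(A,D(A))$: identify $D(A)$ with $Ae\otimes_{eAe}eA$ via an $A$-bimodule isomorphism and set $\mu(ae\otimes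 eb)=(ae\otimes e)\otimes(e\otimes eb)$, $\epsilon(ae\otimes eb)=aeb$ for $a,b\in A$. Module category of a bocs $\mathcal{B}=(A,W)$: objects are the finite dimensional right $A$-modules; $\operatorname{Hom}_{\mathcal B}(M,N):=\operatorname{Hom}_A(M,\operatorname{Hom}_A(W,N))$, where $\operatorname{Hom}_A(W,N)$ is a right $A$-module via $(\varphi a)(w)=\varphi(aw)$. For $f\in\operatorname{Hom}_{\mathcal B}(L,M)$ and $g\in\operatorname{Hom}_{\mathcal B}(M,N)$ the composition is $g*f:=\operatorname{Hom}_A(\mu,N)\,\psi\,\operatorname{Hom}_A(W,g)\,f$, where $\psi:\operatorname{Hom}_A(W,\operatorname{Hom}_A(W,N))\to\operatorname{Hom}_A(W\otimes_A W,N)$ is the adjunction isomorphism. The identity of $M$ is $\operatorname{Hom}_A(\epsilon,M)\,\xi$ with $\xi: M\to\operatorname{Hom}_A(A,M)$ the canonical isomorphism. In the present case composition reads $(g*f)(l)(ae\otimes eb)=g\big(f(l)(ae\otimes e)\big)(e\otimes eb)$. *)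

theory Defs
  imports "HOL-Algebra.Module" "HOL-Algebra.QuotRing" "HOL-Algebra.Free_Abelian_Groups"
begin

text \<open>
  Algebras, modules and bimodules are carrier-based records in the style of \<^theory>\<open>HOL-Algebra.Module\<close>.
  A \<open>K\<close>-algebra is a record of type \<open>('k, 'a) module\<close>: its ring structure together with the scalar
  multiplication by \<open>K\<close>. (The locale \<^locale>\<open>algebra\<close> of the library covers commutative algebras only.)
  As in the library, the \<open>mult\<close> and \<open>one\<close> fields of a record that is used as a module
  carry no meaning.
\<close>

section \<open>Algebras\<close>

definition fin_dim :: "('k, 'c) ring_scheme \<Rightarrow> ('k, 'v, 'x) module_scheme \<Rightarrow> bool" where
  "fin_dim K V \<longleftrightarrow>
    (\<exists>S. finite S \<and> S \<subseteq> carrier V \<and>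
      (\<forall>v\<in>carrier V. \<exists>c\<in>S \<rightarrow> carrier K. v = (\<Oplus>\<^bsub>V\<^esub>s\<in>S. c s \<odot>\<^bsub>V\<^esub> s)))"

definition fd_algebra :: "('k, 'c) ring_scheme \<Rightarrow> ('k, 'a, 'x) module_scheme \<Rightarrow> bool" where
  "fd_algebra K A \<longleftrightarrow>
    field K \<and> ring A \<and> module K A \<and>
    (\<forall>k\<in>carrier K. \<forall>a\<in>carrier A. \<forall>b\<in>carrier A.
      (k \<odot>\<^bsub>A\<^esub> a) \<otimes>\<^bsub>A\<^esub> b = k \<odot>\<^bsub>A\<^esub> (a \<otimes>\<^bsub>A\<^esub> b) \<and>
      a \<otimes>\<^bsub>A\<^esub> (k \<odot>\<^bsub>A\<^esub> b) = k \<odot>\<^bsub>A\<^esub> (a \<otimes>\<^bsub>A\<^esub> b)) \<and>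
    fin_dim K A"

definition algebra_iso :: "('k, 'c) ring_scheme \<Rightarrow> ('k, 'a, 'x) module_scheme \<Rightarrow>
    ('k, 'b, 'y) module_scheme \<Rightarrow> ('a \<Rightarrow> 'b) \<Rightarrow> bool" where
  "algebra_iso K A B \<phi> \<longleftrightarrow>
    \<phi> \<in> ring_iso A B \<and>
    (\<forall>k\<in>carrier K. \<forall>a\<in>carrier A. \<phi> (k \<odot>\<^bsub>A\<^esub> a) = k \<odot>\<^bsub>B\<^esub> \<phi> a)"

definition corner :: "('k, 'a, 'x) module_scheme \<Rightarrow> 'a \<Rightarrow> ('k, 'a, 'x) module_scheme" where
  "corner A e = A\<lparr>carrier := (\<lambda>a. e \<otimes>\<^bsub>A\<^esub> a \<otimes>\<^bsub>A\<^esub> e) ` carrier A, one := e\<rparr>"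


section \<open>Right modules and bimodules\<close>

record ('r, 'm) rmod = "'m ring" +
  ract :: "'m \<Rightarrow> 'r \<Rightarrow> 'm" (infixl \<open>\<triangleleft>\<index>\<close> 70)

record ('l, 'r, 'm) bimod = "('r, 'm) rmod" +
  lact :: "'l \<Rightarrow> 'm \<Rightarrow> 'm" (infixr \<open>\<triangleright>\<index>\<close> 72)

definition right_module :: "('a, 'x) ring_scheme \<Rightarrow> ('a, 'm, 'y) rmod_scheme \<Rightarrow> bool" where
  "right_module A M \<longleftrightarrow>
    abelian_group M \<and>
    (\<forall>m\<in>carrier M. \<forall>a\<in>carrier A. m \<triangleleft>\<^bsub>M\<^esub> a \<in> carrier M) \<and>
    (\<forall>m\<in>carrier M. \<forall>n\<in>carrier M. \<forall>a\<in>carrier A.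
      (m \<oplus>\<^bsub>M\<^esub> n) \<triangleleft>\<^bsub>M\<^esub> a = m \<triangleleft>\<^bsub>M\<^esub> a \<oplus>\<^bsub>M\<^esub> n \<triangleleft>\<^bsub>M\<^esub> a) \<and>
    (\<forall>m\<in>carrier M. \<forall>a\<in>carrier A. \<forall>b\<in>carrier A.
      m \<triangleleft>\<^bsub>M\<^esub> (a \<oplus>\<^bsub>A\<^esub> b) = m \<triangleleft>\<^bsub>M\<^esub> a \<oplus>\<^bsub>M\<^esub> m \<triangleleft>\<^bsub>M\<^esub> b \<and>
      m \<triangleleft>\<^bsub>M\<^esub> (a \<otimes>\<^bsub>A\<^esub> b) = (m \<triangleleft>\<^bsub>M\<^esub> a) \<triangleleft>\<^bsub>M\<^esub> b) \<and>
    (\<forall>m\<in>carrier M. m \<triangleleft>\<^bsub>M\<^esub> \<one>\<^bsub>A\<^esub> = m)"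

definition left_module :: "('a, 'x) ring_scheme \<Rightarrow> ('a, 'r, 'm, 'y) bimod_scheme \<Rightarrow> bool" where
  "left_module A M \<longleftrightarrow>
    abelian_group M \<and>
    (\<forall>a\<in>carrier A. \<forall>m\<in>carrier M. a \<triangleright>\<^bsub>M\<^esub> m \<in> carrier M) \<and>
    (\<forall>a\<in>carrier A. \<forall>m\<in>carrier M. \<forall>n\<in>carrier M.
      a \<triangleright>\<^bsub>M\<^esub> (m \<oplus>\<^bsub>M\<^esub> n) = a \<triangleright>\<^bsub>M\<^esub> m \<oplus>\<^bsub>M\<^esub> a \<triangleright>\<^bsub>M\<^esub> n) \<and>
    (\<forall>a\<in>carrier A. \<forall>b\<in>carrier A. \<forall>m\<in>carrier M.
      (a \<oplus>\<^bsub>A\<^esub> b) \<triangleright>\<^bsub>M\<^esub> m = a \<triangleright>\<^bsub>M\<^esub> m \<oplus>\<^bsub>M\<^esub> b \<triangleright>\<^bsub>M\<^esub> m \<and>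
      (a \<otimes>\<^bsub>A\<^esub> b) \<triangleright>\<^bsub>M\<^esub> m = a \<triangleright>\<^bsub>M\<^esub> (b \<triangleright>\<^bsub>M\<^esub> m)) \<and>
    (\<forall>m\<in>carrier M. \<one>\<^bsub>A\<^esub> \<triangleright>\<^bsub>M\<^esub> m = m)"

text \<open>Bimodules over \<open>K\<close>-algebras are \<open>K\<close>-central: both actions induce the same \<open>K\<close>-structure.\<close>

definition bimodule :: "('k, 'c) ring_scheme \<Rightarrow> ('k, 'a, 'x) module_scheme \<Rightarrow>
    ('k, 'b, 'y) module_scheme \<Rightarrow> ('a, 'b, 'm, 'z) bimod_scheme \<Rightarrow> bool" where
  "bimodule K A B W \<longleftrightarrow>
    left_module A W \<and> right_module B W \<and>
    (\<forall>a\<in>carrier A. \<forall>w\<in>carrier W. \<forall>b\<in>carrier B.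
      (a \<triangleright>\<^bsub>W\<^esub> w) \<triangleleft>\<^bsub>W\<^esub> b = a \<triangleright>\<^bsub>W\<^esub> (w \<triangleleft>\<^bsub>W\<^esub> b)) \<and>
    (\<forall>k\<in>carrier K. \<forall>w\<in>carrier W.
      (k \<odot>\<^bsub>A\<^esub> \<one>\<^bsub>A\<^esub>) \<triangleright>\<^bsub>W\<^esub> w = w \<triangleleft>\<^bsub>W\<^esub> (k \<odot>\<^bsub>B\<^esub> \<one>\<^bsub>B\<^esub>))"

text \<open>A right \<open>A\<close>-module is a \<open>K\<close>-vector space via \<open>k m = m (k 1\<^sub>A)\<close>.\<close>

definition scalar_space :: "('k, 'a, 'x) module_scheme \<Rightarrow> ('a, 'm, 'y) rmod_scheme \<Rightarrow>
    ('k, 'm) module" where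
  "scalar_space A M = \<lparr>carrier = carrier M, monoid.mult = undefined, one = undefined,
     ring.zero = \<zero>\<^bsub>M\<^esub>, ring.add = ring.add M, smult = (\<lambda>k m. m \<triangleleft>\<^bsub>M\<^esub> (k \<odot>\<^bsub>A\<^esub> \<one>\<^bsub>A\<^esub>))\<rparr>"

definition fd_right_module :: "('k, 'c) ring_scheme \<Rightarrow> ('k, 'a, 'x) module_scheme \<Rightarrow>
    ('a, 'm, 'y) rmod_scheme \<Rightarrow> bool" where
  "fd_right_module K A M \<longleftrightarrow> right_module A M \<and> fin_dim K (scalar_space A M)"

text \<open>Homomorphisms are extensional functions, so that equality of morphisms is equality
  on the carrier.\<close>

definition rhom :: "('a, 'x) ring_scheme \<Rightarrow> ('a, 'm, 'y) rmod_scheme \<Rightarrow>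
    ('a, 'n, 'z) rmod_scheme \<Rightarrow> ('m \<Rightarrow> 'n) set" where
  "rhom A M N = {f \<in> carrier M \<rightarrow>\<^sub>E carrier N.
    (\<forall>x\<in>carrier M. \<forall>y\<in>carrier M. f (x \<oplus>\<^bsub>M\<^esub> y) = f x \<oplus>\<^bsub>N\<^esub> f y) \<and>
    (\<forall>x\<in>carrier M. \<forall>a\<in>carrier A. f (x \<triangleleft>\<^bsub>M\<^esub> a) = f x \<triangleleft>\<^bsub>N\<^esub> a)}"

definition bihom :: "('a, 'x) ring_scheme \<Rightarrow> ('b, 'y) ring_scheme \<Rightarrow>
    ('a, 'b, 'v, 'z) bimod_scheme \<Rightarrow> ('a, 'b, 'w, 'u) bimod_scheme \<Rightarrow> ('v \<Rightarrow> 'w) set" where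
  "bihom A B V W = {f \<in> rhom B V W.
    \<forall>a\<in>carrier A. \<forall>x\<in>carrier V. f (a \<triangleright>\<^bsub>V\<^esub> x) = a \<triangleright>\<^bsub>W\<^esub> f x}"

definition bimod_iso :: "('a, 'x) ring_scheme \<Rightarrow> ('b, 'y) ring_scheme \<Rightarrow>
    ('a, 'b, 'v, 'z) bimod_scheme \<Rightarrow> ('a, 'b, 'w, 'u) bimod_scheme \<Rightarrow> ('v \<Rightarrow> 'w) \<Rightarrow> bool" where
  "bimod_iso A B V W f \<longleftrightarrow> f \<in> bihom A B V W \<and> bij_betw f (carrier V) (carrier W)"

text \<open>\<open>Hom\<^sub>A(M, N)\<close> as a \<open>K\<close>-vector space, with \<open>(k f)(m) = f(m) (k 1\<^sub>A)\<close>.\<close>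

definition hom_space :: "('k, 'a, 'x) module_scheme \<Rightarrow> ('a, 'm, 'y) rmod_scheme \<Rightarrow>
    ('a, 'n, 'z) rmod_scheme \<Rightarrow> ('k, 'm \<Rightarrow> 'n) module" where
  "hom_space A M N = \<lparr>carrier = rhom A M N, monoid.mult = undefined, one = undefined,
     ring.zero = (\<lambda>m\<in>carrier M. \<zero>\<^bsub>N\<^esub>),
     ring.add = (\<lambda>f g. \<lambda>m\<in>carrier M. f m \<oplus>\<^bsub>N\<^esub> g m),
     smult = (\<lambda>k f. \<lambda>m\<in>carrier M. f m \<triangleleft>\<^bsub>N\<^esub> (k \<odot>\<^bsub>A\<^esub> \<one>\<^bsub>A\<^esub>))\<rparr>"

definition End_algebra :: "('k, 'a, 'x) module_scheme \<Rightarrow> ('a, 'm, 'y) rmod_scheme \<Rightarrow>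
    ('k, 'm \<Rightarrow> 'm) module" where
  "End_algebra A M = (hom_space A M M)
    \<lparr>monoid.mult := (\<lambda>g f. compose (carrier M) g f), one := (\<lambda>m\<in>carrier M. m)\<rparr>"

text \<open>For \<open>W\<close> an \<open>A\<close>-bimodule, \<open>Hom\<^sub>A(W, N)\<close> as a right \<open>A\<close>-module via \<open>(\<phi> a)(w) = \<phi>(a w)\<close>.\<close>

definition hom_rmod :: "('a, 'x) ring_scheme \<Rightarrow> ('a, 'a, 'w, 'y) bimod_scheme \<Rightarrow>
    ('a, 'n, 'z) rmod_scheme \<Rightarrow> ('a, 'w \<Rightarrow> 'n) rmod" where
  "hom_rmod A W N = \<lparr>carrier = rhom A W N, monoid.mult = undefined, one = undefined,
     ring.zero = (\<lambda>w\<in>carrier W. \<zero>\<^bsub>N\<^esub>),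
     ring.add = (\<lambda>f g. \<lambda>w\<in>carrier W. f w \<oplus>\<^bsub>N\<^esub> g w),
     ract = (\<lambda>f a. \<lambda>w\<in>carrier W. f (a \<triangleright>\<^bsub>W\<^esub> w))\<rparr>"

text \<open>A subset \<open>S\<close> of \<open>A\<close>, with both actions given by multiplication. It is used for \<open>A\<close> itself,
  for \<open>Ae\<close> (an \<open>A\<close>-\<open>eAe\<close>-bimodule) and for \<open>eA\<close> (an \<open>eAe\<close>-\<open>A\<close>-bimodule); forgetting the left action,
  it also provides the right \<open>A\<close>-modules \<open>A\<close> and \<open>eA\<close>.\<close>

definition mult_bimod :: "('a, 'x) ring_scheme \<Rightarrow> 'a set \<Rightarrow> ('a, 'a, 'a) bimod" where
  "mult_bimod A S = \<lparr>carrier = S, monoid.mult = undefined, one = undefined,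
     ring.zero = \<zero>\<^bsub>A\<^esub>, ring.add = ring.add A, ract = monoid.mult A, lact = monoid.mult A\<rparr>"

abbreviation regular :: "('a, 'x) ring_scheme \<Rightarrow> ('a, 'a, 'a) bimod" where
  "regular A \<equiv> mult_bimod A (carrier A)"

abbreviation right_ideal_of :: "('a, 'x) ring_scheme \<Rightarrow> 'a \<Rightarrow> ('a, 'a, 'a) bimod" where
  "right_ideal_of A e \<equiv> mult_bimod A ((\<lambda>a. e \<otimes>\<^bsub>A\<^esub> a) ` carrier A)"

abbreviation left_ideal_of :: "('a, 'x) ring_scheme \<Rightarrow> 'a \<Rightarrow> ('a, 'a, 'a) bimod" where
  "left_ideal_of A e \<equiv> mult_bimod A ((\<lambda>a. a \<otimes>\<^bsub>A\<^esub> e) ` carrier A)"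

text \<open>\<open>D(A) = Hom\<^sub>K(A, K)\<close> with \<open>(a \<phi> b)(x) = \<phi>(b x a)\<close>.\<close>

definition dual_bimod :: "('k, 'c) ring_scheme \<Rightarrow> ('k, 'a, 'x) module_scheme \<Rightarrow>
    ('a, 'a, 'a \<Rightarrow> 'k) bimod" where
  "dual_bimod K A = \<lparr>carrier = {\<phi> \<in> carrier A \<rightarrow>\<^sub>E carrier K.
       (\<forall>x\<in>carrier A. \<forall>y\<in>carrier A. \<phi> (x \<oplus>\<^bsub>A\<^esub> y) = \<phi> x \<oplus>\<^bsub>K\<^esub> \<phi> y) \<and>
       (\<forall>k\<in>carrier K. \<forall>x\<in>carrier A. \<phi> (k \<odot>\<^bsub>A\<^esub> x) = k \<otimes>\<^bsub>K\<^esub> \<phi> x)},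
     monoid.mult = undefined, one = undefined,
     ring.zero = (\<lambda>x\<in>carrier A. \<zero>\<^bsub>K\<^esub>),
     ring.add = (\<lambda>\<phi> \<psi>. \<lambda>x\<in>carrier A. \<phi> x \<oplus>\<^bsub>K\<^esub> \<psi> x),
     ract = (\<lambda>\<phi> b. \<lambda>x\<in>carrier A. \<phi> (b \<otimes>\<^bsub>A\<^esub> x)),
     lact = (\<lambda>a \<phi>. \<lambda>x\<in>carrier A. \<phi> (x \<otimes>\<^bsub>A\<^esub> a))\<rparr>"


section \<open>Gendo-symmetric algebras\<close>

definition direct_sum_decomp :: "('a, 'x) ring_scheme \<Rightarrow> ('a, 'm, 'y) rmod_scheme \<Rightarrow>
    'm set \<Rightarrow> 'm set \<Rightarrow> bool" where
  "direct_sum_decomp A M X Z \<longleftrightarrow>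
    X \<subseteq> carrier M \<and> Z \<subseteq> carrier M \<and>
    right_module A (M\<lparr>carrier := X\<rparr>) \<and> right_module A (M\<lparr>carrier := Z\<rparr>) \<and>
    X \<inter> Z = {\<zero>\<^bsub>M\<^esub>} \<and>
    (\<forall>m\<in>carrier M. \<exists>x\<in>X. \<exists>z\<in>Z. m = x \<oplus>\<^bsub>M\<^esub> z)"

definition iso_to_direct_summand :: "('a, 'x) ring_scheme \<Rightarrow> ('a, 'm, 'y) rmod_scheme \<Rightarrow>
    ('a, 'n, 'z) rmod_scheme \<Rightarrow> bool" where
  "iso_to_direct_summand A X Y \<longleftrightarrow>
    (\<exists>S Z f. direct_sum_decomp A Y S Z \<and> f \<in> rhom A X (Y\<lparr>carrier := S\<rparr>) \<and>
      bij_betw f (carrier X) S)"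

definition direct_power :: "nat \<Rightarrow> ('a, 'm, 'y) rmod_scheme \<Rightarrow> ('a, nat \<Rightarrow> 'm) rmod" where
  "direct_power n M = \<lparr>carrier = {..<n} \<rightarrow>\<^sub>E carrier M, monoid.mult = undefined, one = undefined,
     ring.zero = (\<lambda>i\<in>{..<n}. \<zero>\<^bsub>M\<^esub>),
     ring.add = (\<lambda>x y. \<lambda>i\<in>{..<n}. x i \<oplus>\<^bsub>M\<^esub> y i),
     ract = (\<lambda>x a. \<lambda>i\<in>{..<n}. x i \<triangleleft>\<^bsub>M\<^esub> a)\<rparr>"

definition generator :: "('a, 'x) ring_scheme \<Rightarrow> ('a, 'm, 'y) rmod_scheme \<Rightarrow> bool" where
  "generator B M \<longleftrightarrow> (\<exists>n. iso_to_direct_summand B (regular B) (direct_power n M))"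

definition symmetric_algebra :: "('k, 'c) ring_scheme \<Rightarrow> ('k, 'a, 'x) module_scheme \<Rightarrow> bool" where
  "symmetric_algebra K B \<longleftrightarrow>
    fd_algebra K B \<and> (\<exists>\<theta>. bimod_iso B B (regular B) (dual_bimod K B) \<theta>)"

text \<open>The type argument names the types in which \<open>B\<close> and \<open>M\<close> live; it is arbitrary.\<close>

definition gendo_symmetric :: "('b \<times> 'v) itself \<Rightarrow> ('k, 'c) ring_scheme \<Rightarrow>
    ('k, 'a, 'x) module_scheme \<Rightarrow> bool" where
  "gendo_symmetric T K A \<longleftrightarrow>
    fd_algebra K A \<and>
    (\<exists>(B :: ('k, 'b) module) (M :: ('b, 'v) rmod) \<phi>.
      symmetric_algebra K B \<and> fd_right_module K B M \<and> generator B M \<and>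
      algebra_iso K A (End_algebra B M) \<phi>)"


section \<open>Minimal faithful projective-injective modules\<close>

text \<open>HOL cannot quantify over all modules at once, only over those with carrier in a given type.
  Every finite dimensional module has an isomorphic copy in any type that is large in the
  following sense, because such a type contains a copy of \<open>K\<^sup>n\<close> for all \<open>n\<close>.\<close>

definition large_type :: "'m itself \<Rightarrow> ('k, 'c) ring_scheme \<Rightarrow> bool" where
  "large_type T K \<longleftrightarrow> (\<exists>\<iota> :: 'k list \<Rightarrow> 'm. inj_on \<iota> (lists (carrier K)))"

definition projective_module :: "'u itself \<Rightarrow> ('k, 'c) ring_scheme \<Rightarrow>
    ('k, 'a, 'x) module_scheme \<Rightarrow> ('a, 'm, 'y) rmod_scheme \<Rightarrow> bool" where
  "projective_module T K A P \<longleftrightarrow>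
    (\<forall>(X :: ('a, 'u) rmod) (Y :: ('a, 'u) rmod).
      fd_right_module K A X \<longrightarrow> fd_right_module K A Y \<longrightarrow>
      (\<forall>p\<in>rhom A X Y. p ` carrier X = carrier Y \<longrightarrow>
        (\<forall>f\<in>rhom A P Y. \<exists>g\<in>rhom A P X. \<forall>x\<in>carrier P. p (g x) = f x)))"

definition injective_module :: "'u itself \<Rightarrow> ('k, 'c) ring_scheme \<Rightarrow>
    ('k, 'a, 'x) module_scheme \<Rightarrow> ('a, 'm, 'y) rmod_scheme \<Rightarrow> bool" where
  "injective_module T K A I \<longleftrightarrow>
    (\<forall>(X :: ('a, 'u) rmod) (Y :: ('a, 'u) rmod).
      fd_right_module K A X \<longrightarrow> fd_right_module K A Y \<longrightarrow>
      (\<forall>i\<in>rhom A X Y. inj_on i (carrier X) \<longrightarrow>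
        (\<forall>f\<in>rhom A X I. \<exists>g\<in>rhom A Y I. \<forall>x\<in>carrier X. g (i x) = f x)))"

definition faithful_module :: "('a, 'x) ring_scheme \<Rightarrow> ('a, 'm, 'y) rmod_scheme \<Rightarrow> bool" where
  "faithful_module A M \<longleftrightarrow>
    (\<forall>a\<in>carrier A. (\<forall>m\<in>carrier M. m \<triangleleft>\<^bsub>M\<^esub> a = \<zero>\<^bsub>M\<^esub>) \<longrightarrow> a = \<zero>\<^bsub>A\<^esub>)"

text \<open>Minimality: no proper direct summand is still faithful.\<close>

definition minimal_faithful_proj_inj :: "'u itself \<Rightarrow> ('k, 'c) ring_scheme \<Rightarrow>
    ('k, 'a, 'x) module_scheme \<Rightarrow> ('a, 'm, 'y) rmod_scheme \<Rightarrow> bool" where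
  "minimal_faithful_proj_inj T K A M \<longleftrightarrow>
    fd_right_module K A M \<and> faithful_module A M \<and>
    projective_module T K A M \<and> injective_module T K A M \<and>
    (\<forall>X Z. direct_sum_decomp A M X Z \<longrightarrow> faithful_module A (M\<lparr>carrier := X\<rparr>) \<longrightarrow> X = carrier M)"


section \<open>Tensor products\<close>

text \<open>\<open>M \<otimes>\<^sub>R N\<close> is the free abelian group on \<open>M \<times> N\<close> modulo the subgroup generated by the
  biadditivity and balancedness relations.\<close>

definition tensor_relations :: "('r, 'x) ring_scheme \<Rightarrow> ('r, 'm, 'y) rmod_scheme \<Rightarrow>
    ('r, 's, 'n, 'z) bimod_scheme \<Rightarrow> ('m \<times> 'n \<Rightarrow>\<^sub>0 int) set" where
  "tensor_relations R M N =
    {frag_of (m \<oplus>\<^bsub>M\<^esub> m', n) - frag_of (m, n) - frag_of (m', n) | m m' n.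
      m \<in> carrier M \<and> m' \<in> carrier M \<and> n \<in> carrier N} \<union>
    {frag_of (m, n \<oplus>\<^bsub>N\<^esub> n') - frag_of (m, n) - frag_of (m, n') | m n n'.
      m \<in> carrier M \<and> n \<in> carrier N \<and> n' \<in> carrier N} \<union>
    {frag_of (m \<triangleleft>\<^bsub>M\<^esub> r, n) - frag_of (m, r \<triangleright>\<^bsub>N\<^esub> n) | m r n.
      m \<in> carrier M \<and> r \<in> carrier R \<and> n \<in> carrier N}"

definition tensor_kernel :: "('r, 'x) ring_scheme \<Rightarrow> ('r, 'm, 'y) rmod_scheme \<Rightarrow>
    ('r, 's, 'n, 'z) bimod_scheme \<Rightarrow> ('m \<times> 'n \<Rightarrow>\<^sub>0 int) set" where
  "tensor_kernel R M N =
    generate (free_Abelian_group (carrier M \<times> carrier N)) (tensor_relations R M N)"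

definition tensor_group :: "('r, 'x) ring_scheme \<Rightarrow> ('r, 'm, 'y) rmod_scheme \<Rightarrow>
    ('r, 's, 'n, 'z) bimod_scheme \<Rightarrow> ('m \<times> 'n \<Rightarrow>\<^sub>0 int) set ring" where
  "tensor_group R M N =
    (let Q = free_Abelian_group (carrier M \<times> carrier N) Mod tensor_kernel R M N
     in \<lparr>carrier = carrier Q, monoid.mult = undefined, one = undefined,
         ring.zero = \<one>\<^bsub>Q\<^esub>, ring.add = monoid.mult Q\<rparr>)"

definition pure_tensor :: "('r, 'x) ring_scheme \<Rightarrow> ('r, 'm, 'y) rmod_scheme \<Rightarrow>
    ('r, 's, 'n, 'z) bimod_scheme \<Rightarrow> 'm \<Rightarrow> 'n \<Rightarrow> ('m \<times> 'n \<Rightarrow>\<^sub>0 int) set" where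
  "pure_tensor R M N m n =
    tensor_kernel R M N #>\<^bsub>free_Abelian_group (carrier M \<times> carrier N)\<^esub> frag_of (m, n)"

text \<open>The additive map \<open>m \<otimes> n \<mapsto> \<beta> m n\<close> into the abelian group \<open>G\<close> induced by a biadditive balanced
  \<open>\<beta>\<close>. An element of the tensor product is a coset; for such a \<open>\<beta>\<close> the value does not depend on
  the representative chosen.\<close>

definition tensor_lift :: "('g, 'x) ring_scheme \<Rightarrow> ('m \<Rightarrow> 'n \<Rightarrow> 'g) \<Rightarrow>
    ('m \<times> 'n \<Rightarrow>\<^sub>0 int) set \<Rightarrow> 'g" where
  "tensor_lift G \<beta> t =
    (let c = (SOME c. c \<in> t)
     in \<Oplus>\<^bsub>G\<^esub>p\<in>Poly_Mapping.keys c. [Poly_Mapping.lookup c p] \<cdot>\<^bsub>G\<^esub> \<beta> (fst p) (snd p))"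

text \<open>Outer actions: \<open>l (m \<otimes> n) = l m \<otimes> n\<close> and \<open>(m \<otimes> n) r = m \<otimes> n r\<close>.\<close>

definition tensor :: "('c, 'x) ring_scheme \<Rightarrow> ('l, 'c, 'm, 'y) bimod_scheme \<Rightarrow>
    ('c, 'r, 'n, 'z) bimod_scheme \<Rightarrow> ('l, 'r, ('m \<times> 'n \<Rightarrow>\<^sub>0 int) set) bimod" where
  "tensor R M N =
    (let G = tensor_group R M N
     in \<lparr>carrier = carrier G, monoid.mult = undefined, one = undefined,
         ring.zero = \<zero>\<^bsub>G\<^esub>, ring.add = ring.add G,
         ract = (\<lambda>t r. tensor_lift G (\<lambda>m n. pure_tensor R M N m (n \<triangleleft>\<^bsub>N\<^esub> r)) t),
         lact = (\<lambda>l t. tensor_lift G (\<lambda>m n. pure_tensor R M N (l \<triangleright>\<^bsub>M\<^esub> m) n) t)\<rparr>)"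

text \<open>\<open>f \<otimes> g : M \<otimes>\<^sub>R N \<rightarrow> M' \<otimes>\<^sub>R N'\<close>.\<close>

definition tensor_map :: "('c, 'x) ring_scheme \<Rightarrow> ('l, 'c, 'm2, 'y) bimod_scheme \<Rightarrow>
    ('c, 'r, 'n2, 'z) bimod_scheme \<Rightarrow> ('m \<Rightarrow> 'm2) \<Rightarrow> ('n \<Rightarrow> 'n2) \<Rightarrow>
    ('m \<times> 'n \<Rightarrow>\<^sub>0 int) set \<Rightarrow> ('m2 \<times> 'n2 \<Rightarrow>\<^sub>0 int) set" where
  "tensor_map R M' N' f g =
    tensor_lift (tensor R M' N') (\<lambda>m n. pure_tensor R M' N' (f m) (g n))"

text \<open>The canonical isomorphism \<open>(W \<otimes>\<^sub>A W) \<otimes>\<^sub>A W \<rightarrow> W \<otimes>\<^sub>A (W \<otimes>\<^sub>A W)\<close>.\<close>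

definition tensor_assoc :: "('a, 'x) ring_scheme \<Rightarrow> ('a, 'a, 'w, 'y) bimod_scheme \<Rightarrow>
    (('w \<times> 'w \<Rightarrow>\<^sub>0 int) set \<times> 'w \<Rightarrow>\<^sub>0 int) set \<Rightarrow>
    ('w \<times> ('w \<times> 'w \<Rightarrow>\<^sub>0 int) set \<Rightarrow>\<^sub>0 int) set" where
  "tensor_assoc A W =
    (let WW = tensor A W W; T = tensor A W WW
     in tensor_lift T (\<lambda>s z. tensor_lift T
          (\<lambda>x y. pure_tensor A W WW x (pure_tensor A W W y z)) s))"


section \<open>Linear categories\<close>

text \<open>\<open>Hom C X Y\<close> is the \<open>K\<close>-vector space of morphisms, and \<open>Comp C X Y Z g f\<close> is the composite of
  \<open>f : X \<rightarrow> Y\<close> followed by \<open>g : Y \<rightarrow> Z\<close>.\<close>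

record ('k, 'o, 'h) lin_cat =
  Obj :: "'o set"
  Hom :: "'o \<Rightarrow> 'o \<Rightarrow> ('k, 'h) module"
  Ident :: "'o \<Rightarrow> 'h"
  Comp :: "'o \<Rightarrow> 'o \<Rightarrow> 'o \<Rightarrow> 'h \<Rightarrow> 'h \<Rightarrow> 'h"

abbreviation Mor :: "('k, 'o, 'h) lin_cat \<Rightarrow> 'o \<Rightarrow> 'o \<Rightarrow> 'h set" where
  "Mor C X Y \<equiv> carrier (Hom C X Y)"

definition linear_category :: "('k, 'c) ring_scheme \<Rightarrow> ('k, 'o, 'h) lin_cat \<Rightarrow> bool" where
  "linear_category K C \<longleftrightarrow>
    (\<forall>X\<in>Obj C. \<forall>Y\<in>Obj C. module K (Hom C X Y)) \<and>
    (\<forall>X\<in>Obj C. Ident C X \<in> Mor C X X) \<and>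
    (\<forall>X\<in>Obj C. \<forall>Y\<in>Obj C. \<forall>Z\<in>Obj C. \<forall>f\<in>Mor C X Y. \<forall>g\<in>Mor C Y Z.
      Comp C X Y Z g f \<in> Mor C X Z) \<and>
    (\<forall>X\<in>Obj C. \<forall>Y\<in>Obj C. \<forall>f\<in>Mor C X Y.
      Comp C X X Y f (Ident C X) = f \<and> Comp C X Y Y (Ident C Y) f = f) \<and>
    (\<forall>W\<in>Obj C. \<forall>X\<in>Obj C. \<forall>Y\<in>Obj C. \<forall>Z\<in>Obj C.
      \<forall>f\<in>Mor C W X. \<forall>g\<in>Mor C X Y. \<forall>h\<in>Mor C Y Z.
        Comp C W Y Z h (Comp C W X Y g f) = Comp C W X Z (Comp C X Y Z h g) f) \<and>
    (\<forall>X\<in>Obj C. \<forall>Y\<in>Obj C. \<forall>Z\<in>Obj C.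
      \<forall>f\<in>Mor C X Y. \<forall>f'\<in>Mor C X Y. \<forall>g\<in>Mor C Y Z. \<forall>g'\<in>Mor C Y Z. \<forall>k\<in>carrier K.
        Comp C X Y Z g (f \<oplus>\<^bsub>Hom C X Y\<^esub> f') = Comp C X Y Z g f \<oplus>\<^bsub>Hom C X Z\<^esub> Comp C X Y Z g f' \<and>
        Comp C X Y Z (g \<oplus>\<^bsub>Hom C Y Z\<^esub> g') f = Comp C X Y Z g f \<oplus>\<^bsub>Hom C X Z\<^esub> Comp C X Y Z g' f \<and>
        Comp C X Y Z g (k \<odot>\<^bsub>Hom C X Y\<^esub> f) = k \<odot>\<^bsub>Hom C X Z\<^esub> Comp C X Y Z g f \<and>
        Comp C X Y Z (k \<odot>\<^bsub>Hom C Y Z\<^esub> g) f = k \<odot>\<^bsub>Hom C X Z\<^esub> Comp C X Y Z g f)"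

definition linear_functor :: "('k, 'c) ring_scheme \<Rightarrow> ('k, 'o, 'h) lin_cat \<Rightarrow>
    ('k, 'p, 'i) lin_cat \<Rightarrow> ('o \<Rightarrow> 'p) \<Rightarrow> ('o \<Rightarrow> 'o \<Rightarrow> 'h \<Rightarrow> 'i) \<Rightarrow> bool" where
  "linear_functor K C D F F1 \<longleftrightarrow>
    (\<forall>X\<in>Obj C. F X \<in> Obj D) \<and>
    (\<forall>X\<in>Obj C. \<forall>Y\<in>Obj C. \<forall>f\<in>Mor C X Y. F1 X Y f \<in> Mor D (F X) (F Y)) \<and>
    (\<forall>X\<in>Obj C. \<forall>Y\<in>Obj C. \<forall>f\<in>Mor C X Y. \<forall>g\<in>Mor C X Y. \<forall>k\<in>carrier K.
      F1 X Y (f \<oplus>\<^bsub>Hom C X Y\<^esub> g) = F1 X Y f \<oplus>\<^bsub>Hom D (F X) (F Y)\<^esub> F1 X Y g \<and>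
      F1 X Y (k \<odot>\<^bsub>Hom C X Y\<^esub> f) = k \<odot>\<^bsub>Hom D (F X) (F Y)\<^esub> F1 X Y f) \<and>
    (\<forall>X\<in>Obj C. F1 X X (Ident C X) = Ident D (F X)) \<and>
    (\<forall>X\<in>Obj C. \<forall>Y\<in>Obj C. \<forall>Z\<in>Obj C. \<forall>f\<in>Mor C X Y. \<forall>g\<in>Mor C Y Z.
      F1 X Z (Comp C X Y Z g f) = Comp D (F X) (F Y) (F Z) (F1 Y Z g) (F1 X Y f))"

definition cat_iso :: "('k, 'o, 'h) lin_cat \<Rightarrow> 'o \<Rightarrow> 'o \<Rightarrow> 'h \<Rightarrow> bool" where
  "cat_iso C X Y f \<longleftrightarrow> f \<in> Mor C X Y \<and>
    (\<exists>g\<in>Mor C Y X. Comp C X Y X g f = Ident C X \<and> Comp C Y X Y f g = Ident C Y)"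

definition naturally_isomorphic :: "('k, 'o, 'h) lin_cat \<Rightarrow> ('k, 'p, 'i) lin_cat \<Rightarrow>
    ('o \<Rightarrow> 'p) \<Rightarrow> ('o \<Rightarrow> 'o \<Rightarrow> 'h \<Rightarrow> 'i) \<Rightarrow>
    ('o \<Rightarrow> 'p) \<Rightarrow> ('o \<Rightarrow> 'o \<Rightarrow> 'h \<Rightarrow> 'i) \<Rightarrow> bool" where
  "naturally_isomorphic C D F F1 G G1 \<longleftrightarrow>
    (\<exists>\<eta>. (\<forall>X\<in>Obj C. cat_iso D (F X) (G X) (\<eta> X)) \<and>
      (\<forall>X\<in>Obj C. \<forall>Y\<in>Obj C. \<forall>f\<in>Mor C X Y.
        Comp D (F X) (F Y) (G Y) (\<eta> Y) (F1 X Y f) = Comp D (F X) (G X) (G Y) (G1 X Y f) (\<eta> X)))"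

definition equivalent_linear_categories :: "('k, 'c) ring_scheme \<Rightarrow> ('k, 'o, 'h) lin_cat \<Rightarrow>
    ('k, 'p, 'i) lin_cat \<Rightarrow> bool" where
  "equivalent_linear_categories K C D \<longleftrightarrow>
    linear_category K C \<and> linear_category K D \<and>
    (\<exists>F F1 G G1. linear_functor K C D F F1 \<and> linear_functor K D C G G1 \<and>
      naturally_isomorphic C C (\<lambda>X. G (F X)) (\<lambda>X Y f. G1 (F X) (F Y) (F1 X Y f))
        (\<lambda>X. X) (\<lambda>X Y f. f) \<and>
      naturally_isomorphic D D (\<lambda>X. F (G X)) (\<lambda>X Y f. F1 (G X) (G Y) (G1 X Y f))
        (\<lambda>X. X) (\<lambda>X Y f. f))"

text \<open>\<open>mod-A\<close>; the type argument names the type in which the carriers of the modules live.\<close>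

definition mod_cat :: "'m itself \<Rightarrow> ('k, 'c) ring_scheme \<Rightarrow> ('k, 'a, 'x) module_scheme \<Rightarrow>
    ('k, ('a, 'm) rmod, 'm \<Rightarrow> 'm) lin_cat" where
  "mod_cat T K A = \<lparr>
     Obj = {M. fd_right_module K A M},
     Hom = hom_space A,
     Ident = (\<lambda>M. \<lambda>m\<in>carrier M. m),
     Comp = (\<lambda>L M N g f. compose (carrier L) g f)\<rparr>"


section \<open>Bocses\<close>

definition bocs :: "('k, 'c) ring_scheme \<Rightarrow> ('k, 'a, 'x) module_scheme \<Rightarrow>
    ('a, 'a, 'w, 'y) bimod_scheme \<Rightarrow> ('w \<Rightarrow> ('w \<times> 'w \<Rightarrow>\<^sub>0 int) set) \<Rightarrow> ('w \<Rightarrow> 'a) \<Rightarrow> bool" where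
  "bocs K A W \<mu> \<epsilon> \<longleftrightarrow>
    bimodule K A A W \<and>
    \<mu> \<in> bihom A A W (tensor A W W) \<and> \<epsilon> \<in> bihom A A W (regular A) \<and>
    (\<forall>w\<in>carrier W.
      tensor_map A W (regular A) (\<lambda>x. x) \<epsilon> (\<mu> w) = pure_tensor A W (regular A) w \<one>\<^bsub>A\<^esub> \<and>
      tensor_map A (regular A) W \<epsilon> (\<lambda>x. x) (\<mu> w) = pure_tensor A (regular A) W \<one>\<^bsub>A\<^esub> w \<and>
      tensor_assoc A W (tensor_map A (tensor A W W) W \<mu> (\<lambda>x. x) (\<mu> w)) =
        tensor_map A W (tensor A W W) (\<lambda>x. x) \<mu> (\<mu> w))"

text \<open>The adjunction \<open>\<psi> : Hom\<^sub>A(W, Hom\<^sub>A(W, N)) \<rightarrow> Hom\<^sub>A(W \<otimes>\<^sub>A W, N)\<close>.\<close>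

definition hom_tensor_adj :: "('a, 'x) ring_scheme \<Rightarrow> ('a, 'a, 'w, 'y) bimod_scheme \<Rightarrow>
    ('a, 'n, 'z) rmod_scheme \<Rightarrow> ('w \<Rightarrow> 'w \<Rightarrow> 'n) \<Rightarrow> ('w \<times> 'w \<Rightarrow>\<^sub>0 int) set \<Rightarrow> 'n" where
  "hom_tensor_adj A W N h = (\<lambda>t\<in>carrier (tensor A W W). tensor_lift N (\<lambda>x y. h x y) t)"

text \<open>Composition is \<open>g * f = Hom\<^sub>A(\<mu>, N) \<psi> Hom\<^sub>A(W, g) f\<close>, and the identity of \<open>M\<close> is \<open>Hom\<^sub>A(\<epsilon>, M) \<xi>\<close>
  with \<open>\<xi>(m)(a) = m a\<close>.\<close>

definition bocs_mod_cat :: "'m itself \<Rightarrow> ('k, 'c) ring_scheme \<Rightarrow> ('k, 'a, 'x) module_scheme \<Rightarrow>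
    ('a, 'a, 'w, 'y) bimod_scheme \<Rightarrow> ('w \<Rightarrow> ('w \<times> 'w \<Rightarrow>\<^sub>0 int) set) \<Rightarrow> ('w \<Rightarrow> 'a) \<Rightarrow>
    ('k, ('a, 'm) rmod, 'm \<Rightarrow> 'w \<Rightarrow> 'm) lin_cat" where
  "bocs_mod_cat T K A W \<mu> \<epsilon> = \<lparr>
     Obj = {M. fd_right_module K A M},
     Hom = (\<lambda>M N. hom_space A M (hom_rmod A W N)),
     Ident = (\<lambda>M. \<lambda>m\<in>carrier M. compose (carrier W) (\<lambda>a\<in>carrier A. m \<triangleleft>\<^bsub>M\<^esub> a) \<epsilon>),
     Comp = (\<lambda>L M N g f. \<lambda>l\<in>carrier L.
       compose (carrier W) (hom_tensor_adj A W N (compose (carrier W) g (f l))) \<mu>)\<rparr>"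


section \<open>The bocs structure on \<open>D(A)\<close>\<close>

definition Ae_eA :: "('k, 'a, 'x) module_scheme \<Rightarrow> 'a \<Rightarrow>
    ('a, 'a, ('a \<times> 'a \<Rightarrow>\<^sub>0 int) set) bimod" where
  "Ae_eA A e = tensor (corner A e) (left_ideal_of A e) (right_ideal_of A e)"

abbreviation Ae_eA_pure :: "('k, 'a, 'x) module_scheme \<Rightarrow> 'a \<Rightarrow> 'a \<Rightarrow> 'a \<Rightarrow>
    ('a \<times> 'a \<Rightarrow>\<^sub>0 int) set" where
  "Ae_eA_pure A e \<equiv> pure_tensor (corner A e) (left_ideal_of A e) (right_ideal_of A e)"

text \<open>\<open>\<mu>\<close> and \<open>\<epsilon>\<close> transported along an isomorphism \<open>\<theta> : Ae \<otimes>\<^bsub>eAe\<^esub> eA \<rightarrow> D(A)\<close>: for \<open>x \<in> Ae\<close> and \<open>y \<in> eA\<close>,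
  \<open>\<mu>(\<theta>(x \<otimes> y)) = \<theta>(x \<otimes> e) \<otimes> \<theta>(e \<otimes> y)\<close> and \<open>\<epsilon>(\<theta>(x \<otimes> y)) = x y\<close>.\<close>

definition dual_mu :: "('k, 'c) ring_scheme \<Rightarrow> ('k, 'a, 'x) module_scheme \<Rightarrow> 'a \<Rightarrow>
    (('a \<times> 'a \<Rightarrow>\<^sub>0 int) set \<Rightarrow> 'a \<Rightarrow> 'k) \<Rightarrow>
    ('a \<Rightarrow> 'k) \<Rightarrow> (('a \<Rightarrow> 'k) \<times> ('a \<Rightarrow> 'k) \<Rightarrow>\<^sub>0 int) set" where
  "dual_mu K A e \<theta> = (\<lambda>w\<in>carrier (dual_bimod K A).
     tensor_lift (tensor A (dual_bimod K A) (dual_bimod K A))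
       (\<lambda>x y. pure_tensor A (dual_bimod K A) (dual_bimod K A)
                (\<theta> (Ae_eA_pure A e x e)) (\<theta> (Ae_eA_pure A e e y)))
       (inv_into (carrier (Ae_eA A e)) \<theta> w))"

definition dual_eps :: "('k, 'c) ring_scheme \<Rightarrow> ('k, 'a, 'x) module_scheme \<Rightarrow> 'a \<Rightarrow>
    (('a \<times> 'a \<Rightarrow>\<^sub>0 int) set \<Rightarrow> 'a \<Rightarrow> 'k) \<Rightarrow> ('a \<Rightarrow> 'k) \<Rightarrow> 'a" where
  "dual_eps K A e \<theta> = (\<lambda>w\<in>carrier (dual_bimod K A).
     tensor_lift A (\<lambda>x y. x \<otimes>\<^bsub>A\<^esub> y) (inv_into (carrier (Ae_eA A e)) \<theta> w))"

end

theory Submission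
  imports Defs
begin

text \<open>
  Write \<open>A = End\<^sub>B(M)\<close> with \<open>B\<close> symmetric, symmetrizing form \<open>\<tau>\<close>, and put \<open>U = Hom\<^sub>B(M, B)\<close>, which is \<open>D(M)\<close>
  via \<open>u \<mapsto> \<tau> u\<close>. Since \<open>eA\<close> is faithful, the trace ideal \<open>UeM\<close> is all of \<open>B\<close>; since \<open>eA\<close> is injective and
  embeds into a power of \<open>U\<close>, the idempotent \<open>e\<close> is a sum of maps \<open>x \<mapsto> m u(x)\<close>. Hence \<open>\<tau>\<close> induces a form
  \<open>\<lambda>\<close> on \<open>eAe\<close>, \<open>\<lambda>(m u) = \<tau>(u(m))\<close>, with \<open>\<lambda>(r s) = \<lambda>(s r)\<close>, and \<open>x \<otimes> y \<mapsto> (a \<mapsto> \<lambda>(y a x))\<close> is a bimodule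
  isomorphism \<open>Ae \<otimes>\<^bsub>eAe\<^esub> eA \<cong> D(A)\<close>, because the functionals on \<open>Ae \<otimes>\<^bsub>eAe\<^esub> eA \<cong> M \<otimes>\<^sub>B D(M)\<close> are exactly
  the elements of \<open>End\<^sub>B(M) = A\<close>.

  Given any such isomorphism, a morphism \<open>f : M \<rightarrow> Hom\<^sub>A(D(A), N)\<close> is determined by the map
  \<open>Me \<rightarrow> Ne\<close>, \<open>m \<mapsto> f(m)(e \<otimes> e)\<close>, and every \<open>eAe\<close>-linear map \<open>h\<close> arises, from
  \<open>f(m)(x \<otimes> y) = h(m x) y\<close>. So \<open>M \<mapsto> Me\<close> is a fully faithful functor, and it is essentially surjective since
  \<open>(X \<otimes>\<^bsub>eAe\<^esub> eA) e \<cong> X\<close>.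
\<close>

section \<open>Additive maps\<close>

text \<open>Neither half of the bijectivity of \<open>\<Theta>\<close> comes from counting
  dimensions. Its image is a subspace of D(A) whose only common zero in A is 0, hence all of D(A) by
  reflexivity of finite dimensional spaces. Its kernel is 0 because functionals separate points of
  Ae \<otimes> eA; to represent such functionals, a balanced map \<open>\<omega>\<close> on M and
  Hom_B(M, B) is written down with a fixed expression of 1 as a sum of values p(q), where p is in Ue
  and q is in eM. The functor X |-> Xe is studied for an arbitrary bimodule W isomorphic to Ae
  \<otimes> eA, which covers all choices of the isomorphism at once. Composition in the bocs is
  opaque, so it is rewritten in terms of maps between corners, and the category laws are pulled back
  along the injective maps on morphisms. A further obstacle is typing: tensor products and powers of
  Hom_B(M, B) have carriers in other types than those over which the hypotheses and the categories
  range. Large types admit isomorphic copies, and a functor that copies modules connects the carrier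
  types \<open>'m\<close> and \<open>'n\<close>.\<close>

definition add_hom :: "('g, 'x) ring_scheme \<Rightarrow> ('h, 'y) ring_scheme \<Rightarrow> ('g \<Rightarrow> 'h) set" where
  "add_hom G H = {f \<in> carrier G \<rightarrow> carrier H.
    \<forall>x\<in>carrier G. \<forall>y\<in>carrier G. f (x \<oplus>\<^bsub>G\<^esub> y) = f x \<oplus>\<^bsub>H\<^esub> f y}"

lemma add_homI:
  assumes "\<And>x. x \<in> carrier G \<Longrightarrow> f x \<in> carrier H"
    and "\<And>x y. x \<in> carrier G \<Longrightarrow> y \<in> carrier G \<Longrightarrow> f (x \<oplus>\<^bsub>G\<^esub> y) = f x \<oplus>\<^bsub>H\<^esub> f y"
  shows "f \<in> add_hom G H"
  using assms by (auto simp: add_hom_def)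

lemma add_hom_closed: "f \<in> add_hom G H \<Longrightarrow> x \<in> carrier G \<Longrightarrow> f x \<in> carrier H"
  by (auto simp: add_hom_def)

lemma add_hom_add:
  "f \<in> add_hom G H \<Longrightarrow> x \<in> carrier G \<Longrightarrow> y \<in> carrier G \<Longrightarrow> f (x \<oplus>\<^bsub>G\<^esub> y) = f x \<oplus>\<^bsub>H\<^esub> f y"
  by (auto simp: add_hom_def)

lemma add_hom_group_hom:
  assumes "abelian_group G" "abelian_group H" "f \<in> add_hom G H"
  shows "group_hom (add_monoid G) (add_monoid H) f"
proof -
  interpret G: abelian_group G by fact
  interpret H: abelian_group H by fact
  show ?thesis
    using assms(3) G.a_group H.a_group
    by (auto simp: group_hom_def group_hom_axioms_def hom_def add_hom_def)
qed

lemma add_hom_zero: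
  assumes "abelian_group G" "abelian_group H" "f \<in> add_hom G H"
  shows "f \<zero>\<^bsub>G\<^esub> = \<zero>\<^bsub>H\<^esub>"
  using group_hom.hom_one[OF add_hom_group_hom[OF assms]] by simp

lemma add_hom_uminus:
  assumes "abelian_group G" "abelian_group H" "f \<in> add_hom G H" "x \<in> carrier G"
  shows "f (\<ominus>\<^bsub>G\<^esub> x) = \<ominus>\<^bsub>H\<^esub> f x"
  using group_hom.hom_inv[OF add_hom_group_hom[OF assms(1-3)]] assms(4) by (simp add: a_inv_def)

lemma add_hom_finsum:
  assumes "abelian_group G" "abelian_group H" "f \<in> add_hom G H" "g \<in> I \<rightarrow> carrier G"
  shows "f (\<Oplus>\<^bsub>G\<^esub>i\<in>I. g i) = (\<Oplus>\<^bsub>H\<^esub>i\<in>I. f (g i))"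
proof -
  interpret G: abelian_group G by fact
  interpret H: abelian_group H by fact
  show ?thesis
    using assms(4)
  proof (induction I rule: infinite_finite_induct)
    \<comment> \<open>A sum over an infinite index set has the default value zero, on both
      sides.\<close>
    case (infinite I)
    then show ?case by (simp add: add_hom_zero[OF assms(1-3)])
  next
    case empty
    then show ?case by (simp add: add_hom_zero[OF assms(1-3)])
  next
    case (insert i I)
    have "(\<lambda>i. f (g i)) \<in> I \<rightarrow> carrier H" "f (g i) \<in> carrier H"
      using insert.prems add_hom_closed[OF assms(3)] by auto
    with insert show ?case
      by (auto simp: add_hom_add[OF assms(3)])
  qed
qed

text \<open>Members of \<open>add_hom\<close> need not be extensional, unlike those of
  \<open>rhom\<close>. Composites and sections such as \<open>\<lambda>m. \<beta> m n\<close>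
  therefore belong to it without restriction to the carrier.\<close>

lemma add_hom_compose: "f \<in> add_hom G H \<Longrightarrow> g \<in> add_hom H J \<Longrightarrow> (\<lambda>x. g (f x)) \<in> add_hom G J"
  by (auto simp: add_hom_def Pi_iff)

lemma add_hom_sum:
  assumes G: "abelian_group G" and H: "abelian_group H" and f: "\<And>i. i \<in> I \<Longrightarrow> f i \<in> add_hom G H"
  shows "(\<lambda>x. \<Oplus>\<^bsub>H\<^esub>i\<in>I. f i x) \<in> add_hom G H"
proof -
  interpret H: abelian_group H by fact
  show ?thesis
  proof (rule add_homI)
    fix x y assume x: "x \<in> carrier G" and y: "y \<in> carrier G"
    show "(\<Oplus>\<^bsub>H\<^esub>i\<in>I. f i x) \<in> carrier H" by (rule H.finsum_closed) (use add_hom_closed[OF f x] in auto)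
    have "(\<Oplus>\<^bsub>H\<^esub>i\<in>I. f i (x \<oplus>\<^bsub>G\<^esub> y)) = (\<Oplus>\<^bsub>H\<^esub>i\<in>I. f i x \<oplus>\<^bsub>H\<^esub> f i y)"
      by (rule H.finsum_cong')
        (use add_hom_add[OF f x y] add_hom_closed[OF f x] add_hom_closed[OF f y] in auto)
    also have "\<dots> = (\<Oplus>\<^bsub>H\<^esub>i\<in>I. f i x) \<oplus>\<^bsub>H\<^esub> (\<Oplus>\<^bsub>H\<^esub>i\<in>I. f i y)"
      by (rule H.finsum_addf) (use add_hom_closed[OF f x] add_hom_closed[OF f y] in auto)
    finally show "(\<Oplus>\<^bsub>H\<^esub>i\<in>I. f i (x \<oplus>\<^bsub>G\<^esub> y)) = (\<Oplus>\<^bsub>H\<^esub>i\<in>I. f i x) \<oplus>\<^bsub>H\<^esub> (\<Oplus>\<^bsub>H\<^esub>i\<in>I. f i y)" .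
  qed
qed

text \<open>A submonoid rather than a subgroup: with no case for negatives, inductions stay short.
  For pure tensors nothing is lost, because -(m \<otimes> n) = (-m) \<otimes> n.\<close>

inductive_set addspan :: "('g, 'x) ring_scheme \<Rightarrow> 'g set \<Rightarrow> 'g set" for G X where
  zero: "\<zero>\<^bsub>G\<^esub> \<in> addspan G X"
| incl: "x \<in> X \<Longrightarrow> x \<in> addspan G X"
| add: "x \<in> addspan G X \<Longrightarrow> y \<in> addspan G X \<Longrightarrow> x \<oplus>\<^bsub>G\<^esub> y \<in> addspan G X"

lemma addspan_subset:
  assumes "abelian_group G" "X \<subseteq> carrier G"
  shows "addspan G X \<subseteq> carrier G"
proof
  interpret abelian_group G by fact
  fix x assume "x \<in> addspan G X"
  then show "x \<in> carrier G"
    by induction (use assms(2) in auto)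
qed

lemma addspan_mono:
  assumes "x \<in> addspan G X" "X \<subseteq> Y"
  shows "x \<in> addspan G Y"
  using assms(1) by induction (use assms(2) in \<open>auto intro: addspan.intros\<close>)

lemma addspan_finsum_closed:
  assumes "abelian_group G" "X \<subseteq> carrier G" "\<And>i. i \<in> I \<Longrightarrow> g i \<in> addspan G X"
  shows "(\<Oplus>\<^bsub>G\<^esub>i\<in>I. g i) \<in> addspan G X"
proof -
  interpret abelian_group G by fact
  show ?thesis
    using assms(3)
  proof (induction I rule: infinite_finite_induct)
    case (insert i I)
    moreover have "g \<in> insert i I \<rightarrow> carrier G"
      using insert.prems addspan_subset[OF assms(1,2)] by blast
    ultimately show ?case by (auto intro: addspan.add)
  qed (auto intro: addspan.zero)
qed

lemma addspan_image:
  assumes "abelian_group G" "abelian_group H" "f \<in> add_hom G H" "X \<subseteq> carrier G"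
    and "\<And>x. x \<in> X \<Longrightarrow> f x \<in> addspan H Y" "x \<in> addspan G X"
  shows "f x \<in> addspan H Y"
  using assms(6)
proof induction
  case zero
  show ?case using add_hom_zero[OF assms(1-3)] by (auto intro: addspan.zero)
next
  case (add x y)
  then show ?case
    using addspan_subset[OF assms(1,4)] by (auto simp: add_hom_add[OF assms(3)] subset_iff intro: addspan.add)
qed (use assms in auto)

text \<open>The uniqueness principle behind most later equations. It yields
  \<open>tensor_eqI\<close> and through it \<open>W_eqI\<close>; it is also applied directly to B,
  viewed as the additive span of the values u(m).\<close>

lemma addspan_eq:
  assumes "abelian_group G" "abelian_group H" "X \<subseteq> carrier G"
    and "f \<in> add_hom G H" "g \<in> add_hom G H" "\<And>x. x \<in> X \<Longrightarrow> f x = g x" "t \<in> addspan G X"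
  shows "f t = g t"
  using assms(7)
proof induction
  case zero
  show ?case using add_hom_zero[OF assms(1,2,4)] add_hom_zero[OF assms(1,2,5)] by simp
next
  case (add x y)
  then show ?case
    using addspan_subset[OF assms(1,3)]
    by (auto simp: add_hom_add[OF assms(4)] add_hom_add[OF assms(5)] subset_iff)
qed (use assms in auto)

text \<open>A family indexed by numbers may repeat an element of X, which a sum over a subset of X
  could not express. The sum of two elements concatenates their families.\<close>

lemma addspan_finsum:
  assumes "abelian_group G" "X \<subseteq> carrier G" "t \<in> addspan G X"
  obtains n :: nat and p where "\<And>i. i < n \<Longrightarrow> p i \<in> X" "t = (\<Oplus>\<^bsub>G\<^esub>i\<in>{..<n}. p i)"
proof -
  interpret abelian_group G by fact
  have "\<exists>(n::nat) p. (\<forall>i<n. p i \<in> X) \<and> t = (\<Oplus>\<^bsub>G\<^esub>i\<in>{..<n}. p i)"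
    using assms(3)
  proof induction
    case zero
    then show ?case by (intro exI[of _ 0]) simp
  next
    case (incl x)
    then show ?case
      using assms(2) by (intro exI[of _ 1] exI[of _ "\<lambda>_. x"]) (auto simp: lessThan_Suc)
  next
    case (add x y)
    then obtain n m p q where
      p: "\<forall>i<n. p i \<in> X" "x = (\<Oplus>\<^bsub>G\<^esub>i\<in>{..<n::nat}. p i)" and
      q: "\<forall>i<m. q i \<in> X" "y = (\<Oplus>\<^bsub>G\<^esub>i\<in>{..<m::nat}. q i)" by blast
    define r where "r i = (if i < n then p i else q (i - n))" for i
    have r: "\<forall>i<n+m. r i \<in> X" using p q by (auto simp: r_def)
    have rc: "r \<in> {..<n+m} \<rightarrow> carrier G" using r assms(2) by auto
    have split: "{..<n+m} = {..<n} \<union> {n..<n+m}" by auto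
    have "(\<Oplus>\<^bsub>G\<^esub>i\<in>{..<n+m}. r i) = (\<Oplus>\<^bsub>G\<^esub>i\<in>{..<n}. r i) \<oplus>\<^bsub>G\<^esub> (\<Oplus>\<^bsub>G\<^esub>i\<in>{n..<n+m}. r i)"
      unfolding split by (rule finsum_Un_disjoint) (use rc in auto)
    moreover have "(\<Oplus>\<^bsub>G\<^esub>i\<in>{..<n}. r i) = x"
      unfolding p(2) by (rule finsum_cong') (use p assms(2) in \<open>auto simp: r_def\<close>)
    moreover have "(\<Oplus>\<^bsub>G\<^esub>i\<in>{n..<n+m}. r i) = y"
    proof -
      have im: "{n..<n+m} = (+) n ` {..<m}"
        by (auto simp: image_iff Bex_def) presburger
      have "(\<Oplus>\<^bsub>G\<^esub>i\<in>{n..<n+m}. r i) = (\<Oplus>\<^bsub>G\<^esub>i\<in>{..<m}. r (n + i))"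
        unfolding im by (rule finsum_reindex) (use rc in auto)
      also have "\<dots> = y"
        unfolding q(2) by (rule finsum_cong') (use q assms(2) in \<open>auto simp: r_def\<close>)
      finally show ?thesis .
    qed
    ultimately show ?case using r by (intro exI[of _ "n+m"] exI[of _ r]) auto
  qed
  then show ?thesis using that by blast
qed


lemma (in abelian_group) add_pow_int_0: "[(0::int)] \<cdot>\<^bsub>G\<^esub> x = \<zero>"
  unfolding add_pow_def by (simp add: int_pow_def nat_pow_def)

lemma (in abelian_group) add_pow_int_closed: "x \<in> carrier G \<Longrightarrow> [(k::int)] \<cdot>\<^bsub>G\<^esub> x \<in> carrier G"
  using group.int_pow_closed[OF a_group] by (simp add: add_pow_def)

lemma (in abelian_group) a_inv_zero: "\<ominus> \<zero> = \<zero>"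
  by (rule minus_equality) auto

section \<open>Tensor products\<close>

definition balanced :: "('r, 'x) ring_scheme \<Rightarrow> ('r, 'm, 'y) rmod_scheme \<Rightarrow>
    ('r, 's, 'n, 'z) bimod_scheme \<Rightarrow> ('g, 'u) ring_scheme \<Rightarrow> ('m \<Rightarrow> 'n \<Rightarrow> 'g) \<Rightarrow> bool" where
  "balanced R M N G \<beta> \<longleftrightarrow>
    (\<forall>m\<in>carrier M. \<beta> m \<in> add_hom N G) \<and>
    (\<forall>n\<in>carrier N. (\<lambda>m. \<beta> m n) \<in> add_hom M G) \<and>
    (\<forall>m\<in>carrier M. \<forall>r\<in>carrier R. \<forall>n\<in>carrier N. \<beta> (m \<triangleleft>\<^bsub>M\<^esub> r) n = \<beta> m (r \<triangleright>\<^bsub>N\<^esub> n))"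

lemma balancedI:
  assumes "\<And>m n. m \<in> carrier M \<Longrightarrow> n \<in> carrier N \<Longrightarrow> \<beta> m n \<in> carrier G"
    and "\<And>m n n'. m \<in> carrier M \<Longrightarrow> n \<in> carrier N \<Longrightarrow> n' \<in> carrier N \<Longrightarrow>
      \<beta> m (n \<oplus>\<^bsub>N\<^esub> n') = \<beta> m n \<oplus>\<^bsub>G\<^esub> \<beta> m n'"
    and "\<And>m m' n. m \<in> carrier M \<Longrightarrow> m' \<in> carrier M \<Longrightarrow> n \<in> carrier N \<Longrightarrow>
      \<beta> (m \<oplus>\<^bsub>M\<^esub> m') n = \<beta> m n \<oplus>\<^bsub>G\<^esub> \<beta> m' n"
    and "\<And>m r n. m \<in> carrier M \<Longrightarrow> r \<in> carrier R \<Longrightarrow> n \<in> carrier N \<Longrightarrow>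
      \<beta> (m \<triangleleft>\<^bsub>M\<^esub> r) n = \<beta> m (r \<triangleright>\<^bsub>N\<^esub> n)"
  shows "balanced R M N G \<beta>"
  using assms by (auto simp: balanced_def add_hom_def)

lemma carrier_tensor:
  "carrier (tensor R M N) = carrier (free_Abelian_group (carrier M \<times> carrier N) Mod tensor_kernel R M N)"
  by (simp add: tensor_def tensor_group_def Let_def)

lemma add_tensor:
  "ring.add (tensor R M N) = monoid.mult (free_Abelian_group (carrier M \<times> carrier N) Mod tensor_kernel R M N)"
  by (simp add: tensor_def tensor_group_def Let_def)

lemma zero_tensor:
  "ring.zero (tensor R M N) = one (free_Abelian_group (carrier M \<times> carrier N) Mod tensor_kernel R M N)"
  by (simp add: tensor_def tensor_group_def Let_def)

text \<open>The actions of \<open>tensor\<close> are defined by lifts into the bare group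
  \<open>tensor_group\<close>. Both records have the same carrier, zero and addition, and
  \<open>tensor_lift\<close> depends on nothing else; so the auxiliary record can be
  forgotten.\<close>

lemma tensor_lift_tensor_group: "tensor_lift (tensor_group R M N) = tensor_lift (tensor R M N)"
  by (rule ext)+ (simp add: tensor_lift_def tensor_def Let_def add_pow_def finsum_def
    finprod_def int_pow_def nat_pow_def m_inv_def cong: if_cong)

lemma ract_tensor:
  "t \<triangleleft>\<^bsub>tensor R M N\<^esub> r = tensor_lift (tensor R M N) (\<lambda>m n. pure_tensor R M N m (n \<triangleleft>\<^bsub>N\<^esub> r)) t"
  by (simp flip: tensor_lift_tensor_group) (simp add: tensor_def Let_def)

lemma lact_tensor:
  "l \<triangleright>\<^bsub>tensor R M N\<^esub> t = tensor_lift (tensor R M N) (\<lambda>m n. pure_tensor R M N (l \<triangleright>\<^bsub>M\<^esub> m) n) t"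
  by (simp flip: tensor_lift_tensor_group) (simp add: tensor_def Let_def)

lemma right_moduleD:
  assumes "right_module R M"
  shows "abelian_group M"
    and "\<And>m a. m \<in> carrier M \<Longrightarrow> a \<in> carrier R \<Longrightarrow> m \<triangleleft>\<^bsub>M\<^esub> a \<in> carrier M"
    and "\<And>m n a. m \<in> carrier M \<Longrightarrow> n \<in> carrier M \<Longrightarrow> a \<in> carrier R \<Longrightarrow>
      (m \<oplus>\<^bsub>M\<^esub> n) \<triangleleft>\<^bsub>M\<^esub> a = m \<triangleleft>\<^bsub>M\<^esub> a \<oplus>\<^bsub>M\<^esub> n \<triangleleft>\<^bsub>M\<^esub> a"
    and "\<And>m a b. m \<in> carrier M \<Longrightarrow> a \<in> carrier R \<Longrightarrow> b \<in> carrier R \<Longrightarrow>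
      m \<triangleleft>\<^bsub>M\<^esub> (a \<oplus>\<^bsub>R\<^esub> b) = m \<triangleleft>\<^bsub>M\<^esub> a \<oplus>\<^bsub>M\<^esub> m \<triangleleft>\<^bsub>M\<^esub> b"
    and "\<And>m a b. m \<in> carrier M \<Longrightarrow> a \<in> carrier R \<Longrightarrow> b \<in> carrier R \<Longrightarrow>
      m \<triangleleft>\<^bsub>M\<^esub> (a \<otimes>\<^bsub>R\<^esub> b) = (m \<triangleleft>\<^bsub>M\<^esub> a) \<triangleleft>\<^bsub>M\<^esub> b"
    and "\<And>m. m \<in> carrier M \<Longrightarrow> m \<triangleleft>\<^bsub>M\<^esub> \<one>\<^bsub>R\<^esub> = m"
  using assms by (auto simp: right_module_def)

lemma left_moduleD:
  assumes "left_module R M"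
  shows "abelian_group M"
    and "\<And>m a. m \<in> carrier M \<Longrightarrow> a \<in> carrier R \<Longrightarrow> a \<triangleright>\<^bsub>M\<^esub> m \<in> carrier M"
    and "\<And>m n a. m \<in> carrier M \<Longrightarrow> n \<in> carrier M \<Longrightarrow> a \<in> carrier R \<Longrightarrow>
      a \<triangleright>\<^bsub>M\<^esub> (m \<oplus>\<^bsub>M\<^esub> n) = a \<triangleright>\<^bsub>M\<^esub> m \<oplus>\<^bsub>M\<^esub> a \<triangleright>\<^bsub>M\<^esub> n"
    and "\<And>m a b. m \<in> carrier M \<Longrightarrow> a \<in> carrier R \<Longrightarrow> b \<in> carrier R \<Longrightarrow>
      (a \<oplus>\<^bsub>R\<^esub> b) \<triangleright>\<^bsub>M\<^esub> m = a \<triangleright>\<^bsub>M\<^esub> m \<oplus>\<^bsub>M\<^esub> b \<triangleright>\<^bsub>M\<^esub> m"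
    and "\<And>m a b. m \<in> carrier M \<Longrightarrow> a \<in> carrier R \<Longrightarrow> b \<in> carrier R \<Longrightarrow>
      (a \<otimes>\<^bsub>R\<^esub> b) \<triangleright>\<^bsub>M\<^esub> m = a \<triangleright>\<^bsub>M\<^esub> (b \<triangleright>\<^bsub>M\<^esub> m)"
    and "\<And>m. m \<in> carrier M \<Longrightarrow> \<one>\<^bsub>R\<^esub> \<triangleright>\<^bsub>M\<^esub> m = m"
  using assms by (auto simp: left_module_def)

text \<open>Only the two actions of the middle ring R are assumed. Outer actions come later, in
  contexts with hypotheses of their own, so that a right module whose left action is a dummy can be
  tensored too.\<close>

locale tensor_product =
  fixes R :: "('r, 'x) ring_scheme" and M :: "('l, 'r, 'm, 'y) bimod_scheme"
    and N :: "('r, 's, 'n, 'z) bimod_scheme"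
  assumes M_right: "right_module R M" and N_left: "left_module R N"
begin

sublocale M: abelian_group M using right_moduleD(1)[OF M_right] .
sublocale N: abelian_group N using left_moduleD(1)[OF N_left] .

abbreviation F where "F \<equiv> free_Abelian_group (carrier M \<times> carrier N)"
abbreviation Ker where "Ker \<equiv> tensor_kernel R M N"
abbreviation T where "T \<equiv> tensor R M N"
abbreviation pure where "pure \<equiv> pure_tensor R M N"

lemma relations_subset: "tensor_relations R M N \<subseteq> carrier F"
proof -
  have sub: "Poly_Mapping.keys (a - b) \<subseteq> S"
    if "Poly_Mapping.keys a \<subseteq> S" "Poly_Mapping.keys b \<subseteq> S" for a b :: "('m \<times> 'n) \<Rightarrow>\<^sub>0 int" and S
    using that keys_diff[of a b] by blast
  show ?thesis
  proof
    fix c assume "c \<in> tensor_relations R M N"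
    then have "Poly_Mapping.keys c \<subseteq> carrier M \<times> carrier N"
      unfolding tensor_relations_def
      by (elim UnE CollectE exE conjE; hypsubst; intro sub)
        (simp_all add: right_moduleD(2)[OF M_right] left_moduleD(2)[OF N_left])
    then show "c \<in> carrier F" by simp
  qed
qed

lemma Ker_subgroup: "subgroup Ker F"
  unfolding tensor_kernel_def by (rule group.generate_is_subgroup[OF group_free_Abelian_group relations_subset])

lemma Ker_normal: "normal Ker F"
  using comm_group.subgroup_imp_normal[OF abelian_free_Abelian_group Ker_subgroup] .

sublocale T: abelian_group T
proof (rule comm_group_abelian_groupI)
  have "comm_group (F Mod Ker)"
    by (rule comm_group.abelian_FactGroup[OF abelian_free_Abelian_group Ker_subgroup])
  \<comment> \<open>The quotient is a group written multiplicatively. Folding the three field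
    equations turns its laws into laws for the additive fields of \<open>tensor\<close>.\<close>
  note E = comm_groupE[OF this, folded carrier_tensor add_tensor zero_tensor]
  show "comm_group (add_monoid T)"
    by (rule comm_groupI; unfold partial_object.simps monoid.simps; rule E; assumption)
qed

lemma coset_in_T: "c \<in> carrier F \<Longrightarrow> Ker #>\<^bsub>F\<^esub> c \<in> carrier T"
  unfolding carrier_tensor by (auto simp: FactGroup_def RCOSETS_def)

lemma T_coset:
  assumes "t \<in> carrier T" obtains c where "c \<in> carrier F" "t = Ker #>\<^bsub>F\<^esub> c"
  using assms unfolding carrier_tensor by (auto simp: FactGroup_def RCOSETS_def)

lemma coset_add:
  assumes "c \<in> carrier F" "d \<in> carrier F"
  shows "(Ker #>\<^bsub>F\<^esub> c) \<oplus>\<^bsub>T\<^esub> (Ker #>\<^bsub>F\<^esub> d) = Ker #>\<^bsub>F\<^esub> (c + d)"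
  using normal.rcos_sum[OF Ker_normal assms] unfolding add_tensor by (simp add: FactGroup_def)

lemma coset_zero: "Ker #>\<^bsub>F\<^esub> 0 = \<zero>\<^bsub>T\<^esub>"
  using Ker_subgroup unfolding zero_tensor
  by (auto simp: FactGroup_def r_coset_def)

lemma coset_uminus:
  assumes "c \<in> carrier F"
  shows "Ker #>\<^bsub>F\<^esub> (- c) = \<ominus>\<^bsub>T\<^esub> (Ker #>\<^bsub>F\<^esub> c)"
proof -
  have c: "- c \<in> carrier F" using assms by simp
  have "(Ker #>\<^bsub>F\<^esub> (- c)) \<oplus>\<^bsub>T\<^esub> (Ker #>\<^bsub>F\<^esub> c) = \<zero>\<^bsub>T\<^esub>"
    using coset_add[OF c assms] coset_zero by simp
  then show ?thesis
    using T.minus_equality coset_in_T assms c by metis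
qed

lemma coset_eqI:
  assumes "c \<in> carrier F" "d \<in> carrier F" "c - d \<in> Ker"
  shows "Ker #>\<^bsub>F\<^esub> c = Ker #>\<^bsub>F\<^esub> d"
proof (rule group.repr_independence[OF group_free_Abelian_group _ assms(1) Ker_subgroup, THEN sym, symmetric])
  have "d - c \<in> Ker"
    using subgroup.m_inv_closed[OF Ker_subgroup assms(3)] subgroup.mem_carrier[OF Ker_subgroup assms(3)]
    by simp
  then show "d \<in> Ker #>\<^bsub>F\<^esub> c"
    unfolding r_coset_def by (auto intro!: bexI[of _ "d - c"])
qed

lemma relation_in_Ker: "r \<in> tensor_relations R M N \<Longrightarrow> r \<in> Ker"
  unfolding tensor_kernel_def by (rule generate.incl)

lemma pure_closed [simp, intro]: "m \<in> carrier M \<Longrightarrow> n \<in> carrier N \<Longrightarrow> pure m n \<in> carrier T"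
  unfolding pure_tensor_def by (rule coset_in_T) simp

lemma sum_frag_closed:
  "m \<in> carrier M \<Longrightarrow> n \<in> carrier N \<Longrightarrow> m' \<in> carrier M \<Longrightarrow> n' \<in> carrier N \<Longrightarrow>
    frag_of (m, n) + frag_of (m', n') \<in> carrier F"
  using keys_add[of "frag_of (m, n)" "frag_of (m', n')"] by auto

lemma pure_add_left:
  assumes "m \<in> carrier M" "m' \<in> carrier M" "n \<in> carrier N"
  shows "pure (m \<oplus>\<^bsub>M\<^esub> m') n = pure m n \<oplus>\<^bsub>T\<^esub> pure m' n"
proof -
  have "frag_of (m \<oplus>\<^bsub>M\<^esub> m', n) - (frag_of (m, n) + frag_of (m', n)) \<in> Ker"
    by (rule relation_in_Ker) (use assms in \<open>auto simp: tensor_relations_def algebra_simps\<close>)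
  from coset_eqI[OF _ _ this] show ?thesis
    using assms sum_frag_closed[of m n m' n] by (simp add: pure_tensor_def coset_add)
qed

lemma pure_add_right:
  assumes "m \<in> carrier M" "n \<in> carrier N" "n' \<in> carrier N"
  shows "pure m (n \<oplus>\<^bsub>N\<^esub> n') = pure m n \<oplus>\<^bsub>T\<^esub> pure m n'"
proof -
  have "frag_of (m, n \<oplus>\<^bsub>N\<^esub> n') - (frag_of (m, n) + frag_of (m, n')) \<in> Ker"
    by (rule relation_in_Ker) (use assms in \<open>auto simp: tensor_relations_def algebra_simps\<close>)
  from coset_eqI[OF _ _ this] show ?thesis
    using assms sum_frag_closed[of m n m n'] by (simp add: pure_tensor_def coset_add)
qed

lemma pure_balanced:
  assumes "m \<in> carrier M" "r \<in> carrier R" "n \<in> carrier N"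
  shows "pure (m \<triangleleft>\<^bsub>M\<^esub> r) n = pure m (r \<triangleright>\<^bsub>N\<^esub> n)"
proof -
  have "frag_of (m \<triangleleft>\<^bsub>M\<^esub> r, n) - frag_of (m, r \<triangleright>\<^bsub>N\<^esub> n) \<in> Ker"
    by (rule relation_in_Ker) (use assms in \<open>auto simp: tensor_relations_def\<close>)
  from coset_eqI[OF _ _ this] show ?thesis
    using assms by (simp add: pure_tensor_def right_moduleD(2)[OF M_right] left_moduleD(2)[OF N_left])
qed

lemma balanced_pure: "balanced R M N T pure"
  by (rule balancedI) (auto simp: pure_add_left pure_add_right pure_balanced)

text \<open>The free abelian group is generated by differences of generators, while
  \<open>addspan\<close> has no negatives. They are supplied by additivity in the first argument,
  which makes the negative of a pure tensor pure.\<close>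

lemma tensor_addspan:
  assumes "t \<in> carrier T"
  shows "t \<in> addspan T {pure m n | m n. m \<in> carrier M \<and> n \<in> carrier N}" (is "_ \<in> addspan T ?P")
proof -
  obtain c where c: "c \<in> carrier F" "t = Ker #>\<^bsub>F\<^esub> c" using assms by (rule T_coset)
  have Psub: "?P \<subseteq> carrier T" by auto
  have uminus: "\<ominus>\<^bsub>T\<^esub> s \<in> addspan T ?P" if "s \<in> addspan T ?P" for s
    using that
  proof induction
    case zero
    then show ?case by (simp add: T.a_inv_zero addspan.zero)
  next
    case (incl x)
    then obtain m n where mn: "x = pure m n" "m \<in> carrier M" "n \<in> carrier N" by blast
    have "(\<lambda>m. pure m n) \<in> add_hom M T" using balanced_pure mn by (auto simp: balanced_def)
    from add_hom_uminus[OF M.abelian_group_axioms T.abelian_group_axioms this mn(2)]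
    show ?case using mn by (auto intro!: addspan.incl)
  next
    case (add x y)
    have "x \<in> carrier T" "y \<in> carrier T"
      using add addspan_subset[OF T.abelian_group_axioms Psub] by blast+
    then show ?case using add by (simp add: T.minus_add addspan.add)
  qed
  have "Poly_Mapping.keys c \<subseteq> carrier M \<times> carrier N" using c by simp
  then have "Poly_Mapping.keys c \<subseteq> carrier M \<times> carrier N \<and> Ker #>\<^bsub>F\<^esub> c \<in> addspan T ?P"
  proof (induction c rule: free_Abelian_group_induct[consumes 1])
    case 1
    show ?case by (simp add: coset_zero addspan.zero)
  next
    case (2 x y)
    have "- y \<in> carrier F" using 2 by simp
    then have "Ker #>\<^bsub>F\<^esub> (x - y) = (Ker #>\<^bsub>F\<^esub> x) \<oplus>\<^bsub>T\<^esub> \<ominus>\<^bsub>T\<^esub> (Ker #>\<^bsub>F\<^esub> y)"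
      using 2 coset_add[of x "- y"] coset_uminus[of y] by simp
    then show ?case using 2 keys_diff[of x y] by (auto intro!: addspan.add uminus)
  next
    case (3 a)
    then show ?case by (cases a) (auto intro!: addspan.incl simp: pure_tensor_def)
  qed
  then show ?thesis using c by blast
qed

lemma pure_subset: "{pure m n | m n. m \<in> carrier M \<and> n \<in> carrier N} \<subseteq> carrier T"
  by auto

lemma tensor_eqI:
  assumes "abelian_group G" "f \<in> add_hom T G" "g \<in> add_hom T G"
    and "\<And>m n. m \<in> carrier M \<Longrightarrow> n \<in> carrier N \<Longrightarrow> f (pure m n) = g (pure m n)"
    and "t \<in> carrier T"
  shows "f t = g t"
  by (rule addspan_eq[OF T.abelian_group_axioms assms(1) pure_subset assms(2,3) _ tensor_addspan])
    (use assms in auto)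

context
  fixes G :: "('g, 'u) ring_scheme" and \<beta>
  assumes G: "abelian_group G" and bal: "balanced R M N G \<beta>"
begin

interpretation G: abelian_group G by (rule G)

text \<open>The expression inside \<open>tensor_lift\<close>, taken at an explicit representative
  instead of a chosen one. It is a homomorphism on the free group, which is what makes independence
  of the choice provable.\<close>

definition free_lift :: "('m \<times> 'n \<Rightarrow>\<^sub>0 int) \<Rightarrow> 'g" where
  "free_lift c = (\<Oplus>\<^bsub>G\<^esub>p\<in>Poly_Mapping.keys c. [Poly_Mapping.lookup c p] \<cdot>\<^bsub>G\<^esub> \<beta> (fst p) (snd p))"

lemma beta_closed: "m \<in> carrier M \<Longrightarrow> n \<in> carrier N \<Longrightarrow> \<beta> m n \<in> carrier G"
  using bal by (auto simp: balanced_def add_hom_def)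

text \<open>The support of c + d can be smaller than the union of the two supports. Coefficients
  outside the support are 0, so all three sums may be taken over the union.\<close>

lemma free_lift_superset:
  assumes "finite S" "Poly_Mapping.keys c \<subseteq> S" "S \<subseteq> carrier M \<times> carrier N"
  shows "free_lift c = (\<Oplus>\<^bsub>G\<^esub>p\<in>S. [Poly_Mapping.lookup c p] \<cdot>\<^bsub>G\<^esub> \<beta> (fst p) (snd p))"
  unfolding free_lift_def
  by (rule G.add.finprod_mono_neutral_cong_left)
    (use assms beta_closed in \<open>auto simp: in_keys_iff subset_iff G.add_pow_int_0 G.add_pow_int_closed\<close>)

lemma free_lift_add:
  assumes "c \<in> carrier F" "d \<in> carrier F"
  shows "free_lift (c + d) = free_lift c \<oplus>\<^bsub>G\<^esub> free_lift d"
proof -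
  let ?S = "Poly_Mapping.keys c \<union> Poly_Mapping.keys d"
  have S: "finite ?S" "?S \<subseteq> carrier M \<times> carrier N" using assms by auto
  have closed: "p \<in> ?S \<Longrightarrow> \<beta> (fst p) (snd p) \<in> carrier G" for p
    using S(2) beta_closed by (cases p) auto
  have "free_lift (c + d) = (\<Oplus>\<^bsub>G\<^esub>p\<in>?S. [Poly_Mapping.lookup c p] \<cdot>\<^bsub>G\<^esub> \<beta> (fst p) (snd p) \<oplus>\<^bsub>G\<^esub>
      [Poly_Mapping.lookup d p] \<cdot>\<^bsub>G\<^esub> \<beta> (fst p) (snd p))"
    unfolding free_lift_superset[OF S(1) keys_add S(2)]
    by (rule G.finsum_cong') (use closed in \<open>auto simp: lookup_add G.add.int_pow_mult\<close>)
  also have "\<dots> = free_lift c \<oplus>\<^bsub>G\<^esub> free_lift d"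
    using closed by (subst G.finsum_addf)
      (auto simp: free_lift_superset[OF S(1) _ S(2)])
  finally show ?thesis .
qed

lemma free_lift_frag:
  assumes "m \<in> carrier M" "n \<in> carrier N"
  shows "free_lift (frag_of (m, n)) = \<beta> m n"
  using beta_closed[OF assms] by (simp add: free_lift_def)

lemma free_lift_hom: "free_lift \<in> hom F (add_monoid G)"
proof (rule homI)
  fix c assume "c \<in> carrier F"
  then have "\<beta> (fst p) (snd p) \<in> carrier G" if "p \<in> Poly_Mapping.keys c" for p
    using that beta_closed by (cases p) auto
  then show "free_lift c \<in> carrier (add_monoid G)"
    unfolding free_lift_def by (simp add: Pi_iff)
qed (simp add: free_lift_add)

lemma free_lift_diff:
  assumes "c \<in> carrier F" "d \<in> carrier F"
  shows "free_lift (c - d) = free_lift c \<ominus>\<^bsub>G\<^esub> free_lift d"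
proof -
  interpret group_hom F "add_monoid G" free_lift
    using free_lift_hom G.a_group by (simp add: group_hom_def group_hom_axioms_def)
  show ?thesis
    using hom_inv[OF assms(2)] free_lift_add[of c "- d"] assms
    by (simp add: a_minus_def a_inv_def)
qed

text \<open>The kernel of a homomorphism is a subgroup, so it suffices to evaluate the three kinds
  of generating relations.\<close>

lemma free_lift_Ker:
  assumes "c \<in> Ker" shows "free_lift c = \<zero>\<^bsub>G\<^esub>"
proof -
  interpret group_hom F "add_monoid G" free_lift
    using free_lift_hom G.a_group by (simp add: group_hom_def group_hom_axioms_def)
  have cancel: "x \<oplus>\<^bsub>G\<^esub> y \<ominus>\<^bsub>G\<^esub> x \<ominus>\<^bsub>G\<^esub> y = \<zero>\<^bsub>G\<^esub>" if "x \<in> carrier G" "y \<in> carrier G" for x y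
  proof -
    have "x \<oplus>\<^bsub>G\<^esub> y \<ominus>\<^bsub>G\<^esub> x \<ominus>\<^bsub>G\<^esub> y = (x \<oplus>\<^bsub>G\<^esub> y) \<oplus>\<^bsub>G\<^esub> \<ominus>\<^bsub>G\<^esub> (x \<oplus>\<^bsub>G\<^esub> y)"
      using that by (simp add: a_minus_def G.minus_add G.a_assoc)
    then show ?thesis using that by (simp add: G.r_neg)
  qed
  have "tensor_relations R M N \<subseteq> kernel F (add_monoid G) free_lift"
  proof
    fix c assume c: "c \<in> tensor_relations R M N"
    from c have "free_lift c = \<zero>\<^bsub>G\<^esub>"
      unfolding tensor_relations_def
    proof (elim UnE CollectE exE conjE)
      fix m m' n assume l: "c = frag_of (m \<oplus>\<^bsub>M\<^esub> m', n) - frag_of (m, n) - frag_of (m', n)"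
        "m \<in> carrier M" "m' \<in> carrier M" "n \<in> carrier N"
      have "frag_of (m \<oplus>\<^bsub>M\<^esub> m', n) - frag_of (m, n) \<in> carrier F"
        using l keys_diff[of "frag_of (m \<oplus>\<^bsub>M\<^esub> m', n)" "frag_of (m, n)"] by auto
      moreover have "\<beta> (m \<oplus>\<^bsub>M\<^esub> m') n = \<beta> m n \<oplus>\<^bsub>G\<^esub> \<beta> m' n"
        using bal l by (auto simp: balanced_def add_hom_def)
      ultimately show ?thesis
        using l cancel beta_closed by (simp add: free_lift_diff free_lift_frag)
    next
      fix m n n' assume r: "c = frag_of (m, n \<oplus>\<^bsub>N\<^esub> n') - frag_of (m, n) - frag_of (m, n')"
        "m \<in> carrier M" "n \<in> carrier N" "n' \<in> carrier N"
      have "frag_of (m, n \<oplus>\<^bsub>N\<^esub> n') - frag_of (m, n) \<in> carrier F"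
        using r keys_diff[of "frag_of (m, n \<oplus>\<^bsub>N\<^esub> n')" "frag_of (m, n)"] by auto
      moreover have "\<beta> m (n \<oplus>\<^bsub>N\<^esub> n') = \<beta> m n \<oplus>\<^bsub>G\<^esub> \<beta> m n'"
        using bal r by (auto simp: balanced_def add_hom_def)
      ultimately show ?thesis
        using r cancel beta_closed by (simp add: free_lift_diff free_lift_frag)
    next
      fix m r n assume b: "c = frag_of (m \<triangleleft>\<^bsub>M\<^esub> r, n) - frag_of (m, r \<triangleright>\<^bsub>N\<^esub> n)"
        "m \<in> carrier M" "r \<in> carrier R" "n \<in> carrier N"
      then have "\<beta> (m \<triangleleft>\<^bsub>M\<^esub> r) n = \<beta> m (r \<triangleright>\<^bsub>N\<^esub> n)"
        using bal by (auto simp: balanced_def)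
      then show ?thesis
        using b beta_closed
        by (simp add: free_lift_diff free_lift_frag right_moduleD(2)[OF M_right] 
            left_moduleD(2)[OF N_left] a_minus_def G.r_neg)
    qed
    then show "c \<in> kernel F (add_monoid G) free_lift"
      using subsetD[OF relations_subset c] by (simp add: kernel_def)
  qed
  then have "Ker \<subseteq> kernel F (add_monoid G) free_lift"
    unfolding tensor_kernel_def
    by (rule group.generate_subgroup_incl[OF group_free_Abelian_group _ subgroup_kernel])
  then show ?thesis using assms by (auto simp: kernel_def)
qed

text \<open>Any two elements of the coset differ by an element of \<open>Ker\<close>, where
  \<open>free_lift\<close> vanishes; the choice made by \<open>SOME\<close> is therefore
  harmless.\<close>

lemma tensor_lift_coset:
  assumes "c \<in> carrier F"
  shows "tensor_lift G \<beta> (Ker #>\<^bsub>F\<^esub> c) = free_lift c"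
proof -
  define d where "d = (SOME d. d \<in> Ker #>\<^bsub>F\<^esub> c)"
  have "c \<in> Ker #>\<^bsub>F\<^esub> c"
    using group.rcos_self[OF group_free_Abelian_group assms Ker_subgroup] .
  then have "d \<in> Ker #>\<^bsub>F\<^esub> c" unfolding d_def by (rule someI)
  then obtain k where k: "k \<in> Ker" "d = k + c" by (auto simp: r_coset_def)
  have "k \<in> carrier F" using subgroup.mem_carrier[OF Ker_subgroup k(1)] .
  moreover have "free_lift c \<in> carrier G"
    using free_lift_hom assms by (auto simp: hom_def)
  ultimately have "free_lift d = free_lift c"
    using k assms by (simp only: free_lift_add free_lift_Ker) simp
  then show ?thesis unfolding tensor_lift_def Let_def d_def[symmetric] free_lift_def .
qed

lemma tensor_lift_pure:
  assumes "m \<in> carrier M" "n \<in> carrier N"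
  shows "tensor_lift G \<beta> (pure m n) = \<beta> m n"
  using tensor_lift_coset[of "frag_of (m, n)"] assms by (simp add: pure_tensor_def free_lift_frag)

lemma tensor_lift_add_hom: "tensor_lift G \<beta> \<in> add_hom T G"
proof (rule add_homI)
  fix s t assume "s \<in> carrier T" "t \<in> carrier T"
  then obtain c d where c: "c \<in> carrier F" "s = Ker #>\<^bsub>F\<^esub> c" and d: "d \<in> carrier F" "t = Ker #>\<^bsub>F\<^esub> d"
    using T_coset by metis
  show "tensor_lift G \<beta> s \<in> carrier G"
    using c free_lift_hom by (auto simp: tensor_lift_coset hom_def simp del: carrier_free_Abelian_group_iff)
  have "c + d \<in> carrier F" using c d keys_add[of c d] by auto
  then show "tensor_lift G \<beta> (s \<oplus>\<^bsub>T\<^esub> t) = tensor_lift G \<beta> s \<oplus>\<^bsub>G\<^esub> tensor_lift G \<beta> t"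
    unfolding c(2) d(2) coset_add[OF c(1) d(1)] using c(1) d(1)
    by (simp only: tensor_lift_coset free_lift_add)
qed

end

end

section \<open>Linear algebra over a field\<close>

text \<open>Negatives come from the scalar -1, so closure under them is not a separate proof
  obligation later on.\<close>

lemma submoduleI':
  assumes "module K V" "W \<subseteq> carrier V" "\<zero>\<^bsub>V\<^esub> \<in> W"
    and "\<And>x y. x \<in> W \<Longrightarrow> y \<in> W \<Longrightarrow> x \<oplus>\<^bsub>V\<^esub> y \<in> W"
    and "\<And>k x. k \<in> carrier K \<Longrightarrow> x \<in> W \<Longrightarrow> k \<odot>\<^bsub>V\<^esub> x \<in> W"
  shows "submodule W K V"
proof -
  interpret V: module K V by fact
  have "\<ominus>\<^bsub>V\<^esub> x \<in> W" if "x \<in> W" for x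
    using assms(5)[of "\<ominus>\<^bsub>K\<^esub> \<one>\<^bsub>K\<^esub>" x] that assms(2) V.smult_l_minus[of "\<one>\<^bsub>K\<^esub>" x] by auto
  then show ?thesis using assms by (intro V.submoduleI) auto
qed

lemma submoduleD:
  assumes "module K V" "submodule W K V"
  shows "W \<subseteq> carrier V" "\<zero>\<^bsub>V\<^esub> \<in> W"
    and "\<And>x y. x \<in> W \<Longrightarrow> y \<in> W \<Longrightarrow> x \<oplus>\<^bsub>V\<^esub> y \<in> W"
    and "\<And>k x. k \<in> carrier K \<Longrightarrow> x \<in> W \<Longrightarrow> k \<odot>\<^bsub>V\<^esub> x \<in> W"
  using module.submoduleE[OF assms] subgroup.one_closed[OF submodule.axioms(1)[OF assms(2)]] by auto

lemma submodule_finsum: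
  assumes "module K V" "submodule W K V" "\<And>i. i \<in> I \<Longrightarrow> f i \<in> W"
  shows "(\<Oplus>\<^bsub>V\<^esub>i\<in>I. f i) \<in> W"
proof -
  interpret V: module K V by fact
  note W = submoduleD[OF assms(1,2)]
  show ?thesis
    using assms(3)
  proof (induction I rule: infinite_finite_induct)
    case (insert i I)
    moreover have "f \<in> I \<rightarrow> carrier V" "f i \<in> carrier V" using insert.prems W(1) by auto
    ultimately show ?case using W by auto
  qed (use W in auto)
qed

text \<open>The shape of the sums in \<open>fin_dim\<close>, with one coefficient per element of S.
  For infinite S all these sums take the default value zero; this is why \<open>linspan_base\<close>
  asks for finiteness.\<close>

definition linspan :: "('k, 'c) ring_scheme \<Rightarrow> ('k, 'v, 'x) module_scheme \<Rightarrow> 'v set \<Rightarrow> 'v set" where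
  "linspan K V S = {(\<Oplus>\<^bsub>V\<^esub>s\<in>S. c s \<odot>\<^bsub>V\<^esub> s) | c. c \<in> S \<rightarrow> carrier K}"

lemma linspan_submodule:
  assumes "module K V" "S \<subseteq> carrier V"
  shows "submodule (linspan K V S) K V"
proof -
  interpret V: module K V by fact
  show ?thesis
  proof (rule submoduleI'[OF assms(1)])
    show "linspan K V S \<subseteq> carrier V"
      using assms(2) by (auto simp: linspan_def intro!: V.finsum_closed V.smult_closed)
    have "(\<Oplus>\<^bsub>V\<^esub>s\<in>S. \<zero>\<^bsub>K\<^esub> \<odot>\<^bsub>V\<^esub> s) = (\<Oplus>\<^bsub>V\<^esub>s\<in>S. \<zero>\<^bsub>V\<^esub>)"
      by (rule V.finsum_cong') (use assms(2) in auto)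
    then show "\<zero>\<^bsub>V\<^esub> \<in> linspan K V S"
      unfolding linspan_def by (intro CollectI exI[of _ "\<lambda>_. \<zero>\<^bsub>K\<^esub>"]) auto
  next
    fix x y assume "x \<in> linspan K V S" "y \<in> linspan K V S"
    then obtain c d where c: "c \<in> S \<rightarrow> carrier K" "x = (\<Oplus>\<^bsub>V\<^esub>s\<in>S. c s \<odot>\<^bsub>V\<^esub> s)"
      and d: "d \<in> S \<rightarrow> carrier K" "y = (\<Oplus>\<^bsub>V\<^esub>s\<in>S. d s \<odot>\<^bsub>V\<^esub> s)"
      by (auto simp: linspan_def)
    have "x \<oplus>\<^bsub>V\<^esub> y = (\<Oplus>\<^bsub>V\<^esub>s\<in>S. c s \<odot>\<^bsub>V\<^esub> s \<oplus>\<^bsub>V\<^esub> d s \<odot>\<^bsub>V\<^esub> s)"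
      unfolding c(2) d(2) by (rule V.finsum_addf[symmetric]) (use c d assms(2) in auto)
    also have "\<dots> = (\<Oplus>\<^bsub>V\<^esub>s\<in>S. (c s \<oplus>\<^bsub>K\<^esub> d s) \<odot>\<^bsub>V\<^esub> s)"
      by (rule V.finsum_cong') (use c d assms(2) in \<open>auto simp: V.smult_l_distr Pi_iff subset_iff\<close>)
    finally show "x \<oplus>\<^bsub>V\<^esub> y \<in> linspan K V S"
      unfolding linspan_def using c d by (intro CollectI exI[of _ "\<lambda>s. c s \<oplus>\<^bsub>K\<^esub> d s"]) auto
  next
    fix k x assume k: "k \<in> carrier K" and "x \<in> linspan K V S"
    then obtain c where c: "c \<in> S \<rightarrow> carrier K" "x = (\<Oplus>\<^bsub>V\<^esub>s\<in>S. c s \<odot>\<^bsub>V\<^esub> s)"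
      by (auto simp: linspan_def)
    have "(\<lambda>x. k \<odot>\<^bsub>V\<^esub> x) \<in> add_hom V V"
      by (rule add_homI) (use k in \<open>auto simp: V.smult_r_distr\<close>)
    then have "k \<odot>\<^bsub>V\<^esub> x = (\<Oplus>\<^bsub>V\<^esub>s\<in>S. k \<odot>\<^bsub>V\<^esub> (c s \<odot>\<^bsub>V\<^esub> s))"
      unfolding c(2) by (rule add_hom_finsum[OF V.abelian_group_axioms V.abelian_group_axioms])
        (use c assms(2) in auto)
    also have "\<dots> = (\<Oplus>\<^bsub>V\<^esub>s\<in>S. (k \<otimes>\<^bsub>K\<^esub> c s) \<odot>\<^bsub>V\<^esub> s)"
      by (rule V.finsum_cong') (use c k assms(2) in \<open>auto simp: V.smult_assoc1 Pi_iff subset_iff\<close>)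
    finally show "k \<odot>\<^bsub>V\<^esub> x \<in> linspan K V S"
      unfolding linspan_def using c k by (intro CollectI exI[of _ "\<lambda>s. k \<otimes>\<^bsub>K\<^esub> c s"]) auto
  qed
qed

lemma linspan_base:
  assumes "module K V" "S \<subseteq> carrier V" "finite S" "t \<in> S"
  shows "t \<in> linspan K V S"
proof -
  interpret V: module K V by fact
  have "(\<Oplus>\<^bsub>V\<^esub>s\<in>S. (if s = t then \<one>\<^bsub>K\<^esub> else \<zero>\<^bsub>K\<^esub>) \<odot>\<^bsub>V\<^esub> s) = (\<Oplus>\<^bsub>V\<^esub>s\<in>S. if t = s then s else \<zero>\<^bsub>V\<^esub>)"
    by (rule V.finsum_cong') (use assms(2) in auto)
  also have "\<dots> = t"
    by (rule V.add.finprod_singleton) (use assms in auto)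
  finally show ?thesis
    unfolding linspan_def by (intro CollectI exI[of _ "\<lambda>s. if s = t then \<one>\<^bsub>K\<^esub> else \<zero>\<^bsub>K\<^esub>"]) auto
qed

lemma linspan_least:
  assumes "module K V" "submodule W K V" "S \<subseteq> W"
  shows "linspan K V S \<subseteq> W"
proof -
  have "(\<Oplus>\<^bsub>V\<^esub>s\<in>S. c s \<odot>\<^bsub>V\<^esub> s) \<in> W" if "c \<in> S \<rightarrow> carrier K" for c
    by (rule submodule_finsum[OF assms(1,2)])
      (use that assms(3) submoduleD(4)[OF assms(1,2)] in \<open>auto simp: Pi_iff subset_iff\<close>)
  then show ?thesis by (auto simp: linspan_def)
qed

lemma fin_dim_altdef:
  assumes "module K V"
  shows "fin_dim K V \<longleftrightarrow> (\<exists>S. finite S \<and> S \<subseteq> carrier V \<and> carrier V \<subseteq> linspan K V S)"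
  by (simp add: fin_dim_def linspan_def subset_iff Bex_def Ball_def conj_commute)

text \<open>With its converse \<open>fin_dimE\<close>, this says that some finite set lies in no
  proper subspace. Coefficients disappear, and finite dimension of images, powers and tensor
  products becomes a closure argument.\<close>

lemma fin_dimI:
  assumes "module K V" "finite S" "S \<subseteq> carrier V"
    and "\<And>W. submodule W K V \<Longrightarrow> S \<subseteq> W \<Longrightarrow> carrier V \<subseteq> W"
  shows "fin_dim K V"
proof -
  have "S \<subseteq> linspan K V S" using linspan_base[OF assms(1,3,2)] by blast
  then show ?thesis
    using assms(2,3) assms(4)[OF linspan_submodule[OF assms(1,3)]]
    unfolding fin_dim_altdef[OF assms(1)] by (intro exI[of _ S]) simp
qed

lemma fin_dimE:
  assumes "module K V" "fin_dim K V"
  obtains S where "finite S" "S \<subseteq> carrier V"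
    "\<And>W. submodule W K V \<Longrightarrow> S \<subseteq> W \<Longrightarrow> carrier V \<subseteq> W"
proof -
  obtain S where S: "finite S" "S \<subseteq> carrier V" "carrier V \<subseteq> linspan K V S"
    using assms(2) unfolding fin_dim_altdef[OF assms(1)] by (elim exE conjE)
  show ?thesis
    by (rule that[OF S(1,2)]) (use S(3) linspan_least[OF assms(1)] in \<open>rule subset_trans\<close>)
qed

lemma fin_dim_surj:
  assumes "module K V" "module K V'" "fin_dim K V" "f \<in> add_hom V V'"
    and "\<And>k x. k \<in> carrier K \<Longrightarrow> x \<in> carrier V \<Longrightarrow> f (k \<odot>\<^bsub>V\<^esub> x) = k \<odot>\<^bsub>V'\<^esub> f x"
    and "carrier V' \<subseteq> f ` carrier V"
  shows "fin_dim K V'"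
proof -
  interpret V: module K V by fact
  interpret V': module K V' by fact
  obtain S where S: "finite S" "S \<subseteq> carrier V"
    "\<And>W. submodule W K V \<Longrightarrow> S \<subseteq> W \<Longrightarrow> carrier V \<subseteq> W"
    using fin_dimE[OF assms(1,3)] by blast
  show ?thesis
  proof (rule fin_dimI[OF assms(2), of "f ` S"])
    fix W assume W: "submodule W K V'" "f ` S \<subseteq> W"
    note W' = submoduleD[OF assms(2) W(1)]
    have "submodule {x \<in> carrier V. f x \<in> W} K V"
      by (rule submoduleI'[OF assms(1)]) (use W' assms(5) add_hom_add[OF assms(4)]
        add_hom_zero[OF V.abelian_group_axioms V'.abelian_group_axioms assms(4)] in auto)
    from S(3)[OF this] show "carrier V' \<subseteq> W" using W(2) S(2) assms(6) by blast
  qed (use S assms(4) in \<open>auto simp: add_hom_def\<close>)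
qed

subsection \<open>Linear functionals\<close>

text \<open>The carrier of \<open>dual_bimod\<close> refers only to addition and scalar
  multiplication of its argument. So it serves as the dual of any vector space, not only of an
  algebra.\<close>

abbreviation functionals :: "('k, 'c) ring_scheme \<Rightarrow> ('k, 'v, 'x) module_scheme \<Rightarrow> ('v \<Rightarrow> 'k) set" where
  "functionals K V \<equiv> carrier (dual_bimod K V)"

lemma functionals_iff:
  "\<phi> \<in> functionals K V \<longleftrightarrow> \<phi> \<in> add_hom V K \<and> \<phi> \<in> extensional (carrier V) \<and>
    (\<forall>k\<in>carrier K. \<forall>x\<in>carrier V. \<phi> (k \<odot>\<^bsub>V\<^esub> x) = k \<otimes>\<^bsub>K\<^esub> \<phi> x)"
  by (auto simp: dual_bimod_def add_hom_def PiE_def)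

lemma functionalsI:
  assumes "\<And>x. x \<in> carrier V \<Longrightarrow> \<phi> x \<in> carrier K"
    and "\<And>x y. x \<in> carrier V \<Longrightarrow> y \<in> carrier V \<Longrightarrow> \<phi> (x \<oplus>\<^bsub>V\<^esub> y) = \<phi> x \<oplus>\<^bsub>K\<^esub> \<phi> y"
    and "\<And>k x. k \<in> carrier K \<Longrightarrow> x \<in> carrier V \<Longrightarrow> \<phi> (k \<odot>\<^bsub>V\<^esub> x) = k \<otimes>\<^bsub>K\<^esub> \<phi> x"
    and "\<And>x. x \<notin> carrier V \<Longrightarrow> \<phi> x = undefined"
  shows "\<phi> \<in> functionals K V"
  using assms by (auto simp: functionals_iff add_hom_def extensional_def)

lemma functionalsD:
  assumes "\<phi> \<in> functionals K V"
  shows "\<phi> \<in> add_hom V K" "\<phi> \<in> extensional (carrier V)"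
    and "\<And>x. x \<in> carrier V \<Longrightarrow> \<phi> x \<in> carrier K"
    and "\<And>x y. x \<in> carrier V \<Longrightarrow> y \<in> carrier V \<Longrightarrow> \<phi> (x \<oplus>\<^bsub>V\<^esub> y) = \<phi> x \<oplus>\<^bsub>K\<^esub> \<phi> y"
    and "\<And>k x. k \<in> carrier K \<Longrightarrow> x \<in> carrier V \<Longrightarrow> \<phi> (k \<odot>\<^bsub>V\<^esub> x) = k \<otimes>\<^bsub>K\<^esub> \<phi> x"
  using assms by (auto simp: functionals_iff add_hom_def)

text \<open>Zorn's lemma: the union of a nonempty chain of subspaces that contain W and avoid v is
  again one. No basis is involved, so the result also applies to tensor products whose dimension has
  not been bounded.\<close>

lemma maximal_submodule_avoiding:
  assumes "module K V" "submodule W K V" "v \<notin> W"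
  obtains U where "submodule U K V" "W \<subseteq> U" "v \<notin> U"
    "\<And>U'. submodule U' K V \<Longrightarrow> U \<subseteq> U' \<Longrightarrow> v \<notin> U' \<Longrightarrow> U' = U"
proof -
  let ?A = "{U. submodule U K V \<and> W \<subseteq> U \<and> v \<notin> U}"
  have "\<exists>U\<in>?A. \<forall>X\<in>?A. U \<subseteq> X \<longrightarrow> X = U"
  proof (rule subset_Zorn_nonempty)
    show "?A \<noteq> {}" using assms by blast
  next
    fix C assume C: "C \<noteq> {}" "subset.chain ?A C"
    have sub: "\<And>U. U \<in> C \<Longrightarrow> submodule U K V" "\<And>U. U \<in> C \<Longrightarrow> W \<subseteq> U \<and> v \<notin> U"
      using C by (auto simp: subset.chain_def)
    have tot: "X \<subseteq> Y \<or> Y \<subseteq> X" if "X \<in> C" "Y \<in> C" for X Y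
      using C(2) that by (auto simp: subset.chain_def)
    note D = submoduleD[OF assms(1) sub(1)]
    have "submodule (\<Union>C) K V"
    proof (rule submoduleI'[OF assms(1)])
      fix x y assume "x \<in> \<Union>C" "y \<in> \<Union>C"
      then obtain X Y where "X \<in> C" "Y \<in> C" "x \<in> X" "y \<in> Y" by blast
      then show "x \<oplus>\<^bsub>V\<^esub> y \<in> \<Union>C"
        using tot[of X Y] D(3)[of X x y] D(3)[of Y x y] by blast
    next
      show "\<Union>C \<subseteq> carrier V" using D(1) by (rule Union_least)
      obtain X where X: "X \<in> C" using C(1) by blast
      show "\<zero>\<^bsub>V\<^esub> \<in> \<Union>C" by (rule UnionI[OF X D(2)[OF X]])
    next
      fix k x assume "k \<in> carrier K" "x \<in> \<Union>C"
      then obtain X where X: "X \<in> C" "x \<in> X" by (elim UnionE)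
      show "k \<odot>\<^bsub>V\<^esub> x \<in> \<Union>C" by (rule UnionI[OF X(1) D(4)[OF X(1) \<open>k \<in> carrier K\<close> X(2)]])
    qed
    moreover obtain X where "X \<in> C" using C(1) by blast
    ultimately show "\<Union>C \<in> ?A" using sub(2) by (simp add: Sup_upper2)
  qed
  then obtain U where U: "U \<in> ?A" "\<forall>X\<in>?A. U \<subseteq> X \<longrightarrow> X = U" by (elim bexE)
  show ?thesis
    by (rule that[of U]) (use U in auto)
qed

text \<open>For U maximal among the subspaces that contain W and avoid v, the space V is the direct
  sum of U and the line Kv. The functional is the coefficient of v in this decomposition.\<close>

lemma separating_functional:
  assumes "field K" "module K V" "submodule W K V" "v \<in> carrier V" "v \<notin> W"
  obtains \<phi> where "\<phi> \<in> functionals K V" "\<phi> v = \<one>\<^bsub>K\<^esub>" "\<And>w. w \<in> W \<Longrightarrow> \<phi> w = \<zero>\<^bsub>K\<^esub>"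
proof -
  interpret K: field K by fact
  interpret V: module K V by fact
  obtain U where U: "submodule U K V" "W \<subseteq> U" "v \<notin> U"
    "\<And>U'. submodule U' K V \<Longrightarrow> U \<subseteq> U' \<Longrightarrow> v \<notin> U' \<Longrightarrow> U' = U"
    using maximal_submodule_avoiding[OF assms(2,3,5)] by blast
  note D = submoduleD[OF assms(2) U(1)]
  have Uc: "\<And>u. u \<in> U \<Longrightarrow> u \<in> carrier V" using D(1) by blast
  have scale: "x \<in> U" if "k \<in> carrier K" "k \<noteq> \<zero>\<^bsub>K\<^esub>" "x \<in> carrier V" "k \<odot>\<^bsub>V\<^esub> x \<in> U" for k x
  proof -
    have k: "k \<in> Units K" using that K.field_Units by auto
    then have "x = (inv\<^bsub>K\<^esub> k \<otimes>\<^bsub>K\<^esub> k) \<odot>\<^bsub>V\<^esub> x" using that by simp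
    also have "\<dots> = inv\<^bsub>K\<^esub> k \<odot>\<^bsub>V\<^esub> (k \<odot>\<^bsub>V\<^esub> x)"
      using k that by (simp add: V.smult_assoc1 del: K.Units_l_inv)
    finally show ?thesis using D(4)[OF K.Units_inv_closed[OF k] that(4)] by simp
  qed
  \<comment> \<open>If x is not in U, then U + Kx is strictly larger than U, so by maximality it
    contains v. In v = u + kx the scalar k is not 0, as v is not in U; solving for x shows that x
    lies in U + Kv.\<close>
  have ex: "\<exists>k\<in>carrier K. x \<ominus>\<^bsub>V\<^esub> k \<odot>\<^bsub>V\<^esub> v \<in> U" if x: "x \<in> carrier V" for x
  proof (cases "x \<in> U")
    case True
    then show ?thesis using assms(4) x by (intro bexI[of _ "\<zero>\<^bsub>K\<^esub>"]) (auto simp: a_minus_def V.a_inv_zero)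
  next
    case False
    let ?U = "{u \<oplus>\<^bsub>V\<^esub> k \<odot>\<^bsub>V\<^esub> x | u k. u \<in> U \<and> k \<in> carrier K}"
    have 0: "\<zero>\<^bsub>V\<^esub> \<oplus>\<^bsub>V\<^esub> \<one>\<^bsub>K\<^esub> \<odot>\<^bsub>V\<^esub> x \<in> ?U" using D(2) by blast
    have sub: "U \<subseteq> ?U"
    proof
      fix u assume u: "u \<in> U"
      then have "u = u \<oplus>\<^bsub>V\<^esub> \<zero>\<^bsub>K\<^esub> \<odot>\<^bsub>V\<^esub> x" using x Uc by simp
      then show "u \<in> ?U" using u by blast
    qed
    have "submodule ?U K V"
    proof (rule submoduleI'[OF assms(2)])
      show "?U \<subseteq> carrier V" using Uc x by auto
      show "\<zero>\<^bsub>V\<^esub> \<in> ?U" using sub D(2) by blast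
    next
      fix a b assume "a \<in> ?U" "b \<in> ?U"
      then obtain u k u' k' where a: "u \<in> U" "k \<in> carrier K" "a = u \<oplus>\<^bsub>V\<^esub> k \<odot>\<^bsub>V\<^esub> x"
        and b: "u' \<in> U" "k' \<in> carrier K" "b = u' \<oplus>\<^bsub>V\<^esub> k' \<odot>\<^bsub>V\<^esub> x" by blast
      have "a \<oplus>\<^bsub>V\<^esub> b = (u \<oplus>\<^bsub>V\<^esub> u') \<oplus>\<^bsub>V\<^esub> (k \<oplus>\<^bsub>K\<^esub> k') \<odot>\<^bsub>V\<^esub> x"
        using a b x Uc by (simp add: V.smult_l_distr V.a_ac)
      then show "a \<oplus>\<^bsub>V\<^esub> b \<in> ?U" using a b D(3) by blast
    next
      fix l a assume l: "l \<in> carrier K" and "a \<in> ?U"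
      then obtain u k where a: "u \<in> U" "k \<in> carrier K" "a = u \<oplus>\<^bsub>V\<^esub> k \<odot>\<^bsub>V\<^esub> x" by blast
      have "l \<odot>\<^bsub>V\<^esub> a = l \<odot>\<^bsub>V\<^esub> u \<oplus>\<^bsub>V\<^esub> (l \<otimes>\<^bsub>K\<^esub> k) \<odot>\<^bsub>V\<^esub> x"
        using a l x Uc by (simp add: V.smult_r_distr V.smult_assoc1)
      then show "l \<odot>\<^bsub>V\<^esub> a \<in> ?U" using a l D(4) by blast
    qed
    moreover have "?U \<noteq> U" using 0 False x by auto
    ultimately have "v \<in> ?U" using U(4) sub by blast
    then obtain u k where uk: "u \<in> U" "k \<in> carrier K" "v = u \<oplus>\<^bsub>V\<^esub> k \<odot>\<^bsub>V\<^esub> x" by blast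
    have k: "k \<in> Units K" using uk U(3) x Uc K.field_Units by (cases "k = \<zero>\<^bsub>K\<^esub>") auto
    let ?l = "inv\<^bsub>K\<^esub> k"
    have l: "?l \<in> carrier K" using k by auto
    have "?l \<odot>\<^bsub>V\<^esub> v = ?l \<odot>\<^bsub>V\<^esub> u \<oplus>\<^bsub>V\<^esub> (?l \<otimes>\<^bsub>K\<^esub> k) \<odot>\<^bsub>V\<^esub> x"
      using uk l x Uc by (simp add: V.smult_r_distr V.smult_assoc1)
    also have "\<dots> = ?l \<odot>\<^bsub>V\<^esub> u \<oplus>\<^bsub>V\<^esub> x" using k x by simp
    finally have "x \<ominus>\<^bsub>V\<^esub> ?l \<odot>\<^bsub>V\<^esub> v = \<ominus>\<^bsub>V\<^esub> (?l \<odot>\<^bsub>V\<^esub> u)"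
      using l x uk(1) Uc by (simp add: a_minus_def V.minus_add V.a_ac V.r_neg2 V.r_neg1 V.r_neg)
    also have "\<dots> = (\<ominus>\<^bsub>K\<^esub> ?l) \<odot>\<^bsub>V\<^esub> u" using l uk(1) Uc by (simp add: V.smult_l_minus)
    finally have "x \<ominus>\<^bsub>V\<^esub> ?l \<odot>\<^bsub>V\<^esub> v \<in> U" using D(4) l uk(1) by auto
    then show ?thesis using l by blast
  qed
  have diff: "(a \<ominus>\<^bsub>V\<^esub> b) \<oplus>\<^bsub>V\<^esub> (c \<ominus>\<^bsub>V\<^esub> d) = (a \<oplus>\<^bsub>V\<^esub> c) \<ominus>\<^bsub>V\<^esub> (b \<oplus>\<^bsub>V\<^esub> d)"
    if "a \<in> carrier V" "b \<in> carrier V" "c \<in> carrier V" "d \<in> carrier V" for a b c d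
    using that by (simp add: a_minus_def V.minus_add V.a_ac)
  \<comment> \<open>Two different coefficients k and l would place the nonzero multiple (l - k)v in
    U, and with it v itself.\<close>
  have uniq: "k = l" if "k \<in> carrier K" "l \<in> carrier K" "x \<in> carrier V"
    "x \<ominus>\<^bsub>V\<^esub> k \<odot>\<^bsub>V\<^esub> v \<in> U" "x \<ominus>\<^bsub>V\<^esub> l \<odot>\<^bsub>V\<^esub> v \<in> U" for k l x
  proof (rule ccontr)
    assume neq: "k \<noteq> l"
    have "(x \<ominus>\<^bsub>V\<^esub> k \<odot>\<^bsub>V\<^esub> v) \<oplus>\<^bsub>V\<^esub> (\<ominus>\<^bsub>K\<^esub> \<one>\<^bsub>K\<^esub>) \<odot>\<^bsub>V\<^esub> (x \<ominus>\<^bsub>V\<^esub> l \<odot>\<^bsub>V\<^esub> v) \<in> U"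
      using that D(3,4) by auto
    also have "(x \<ominus>\<^bsub>V\<^esub> k \<odot>\<^bsub>V\<^esub> v) \<oplus>\<^bsub>V\<^esub> (\<ominus>\<^bsub>K\<^esub> \<one>\<^bsub>K\<^esub>) \<odot>\<^bsub>V\<^esub> (x \<ominus>\<^bsub>V\<^esub> l \<odot>\<^bsub>V\<^esub> v) =
        (l \<ominus>\<^bsub>K\<^esub> k) \<odot>\<^bsub>V\<^esub> v"
    proof -
      have "(\<ominus>\<^bsub>K\<^esub> \<one>\<^bsub>K\<^esub>) \<odot>\<^bsub>V\<^esub> (x \<ominus>\<^bsub>V\<^esub> l \<odot>\<^bsub>V\<^esub> v) = \<ominus>\<^bsub>V\<^esub> x \<oplus>\<^bsub>V\<^esub> l \<odot>\<^bsub>V\<^esub> v"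
        using that assms(4) by (simp add: V.smult_l_minus a_minus_def V.minus_add)
      then have "(x \<ominus>\<^bsub>V\<^esub> k \<odot>\<^bsub>V\<^esub> v) \<oplus>\<^bsub>V\<^esub> (\<ominus>\<^bsub>K\<^esub> \<one>\<^bsub>K\<^esub>) \<odot>\<^bsub>V\<^esub> (x \<ominus>\<^bsub>V\<^esub> l \<odot>\<^bsub>V\<^esub> v) =
         (x \<ominus>\<^bsub>V\<^esub> k \<odot>\<^bsub>V\<^esub> v) \<oplus>\<^bsub>V\<^esub> (\<ominus>\<^bsub>V\<^esub> x \<oplus>\<^bsub>V\<^esub> l \<odot>\<^bsub>V\<^esub> v)" by simp
      also have "\<dots> = l \<odot>\<^bsub>V\<^esub> v \<oplus>\<^bsub>V\<^esub> \<ominus>\<^bsub>V\<^esub> (k \<odot>\<^bsub>V\<^esub> v)"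
        using that assms(4) by (simp add: a_minus_def V.a_ac V.r_neg1 V.r_neg2)
      also have "\<dots> = (l \<ominus>\<^bsub>K\<^esub> k) \<odot>\<^bsub>V\<^esub> v"
        using that assms(4) by (simp add: a_minus_def V.smult_l_distr V.smult_l_minus)
      finally show ?thesis .
    qed
    finally have "(l \<ominus>\<^bsub>K\<^esub> k) \<odot>\<^bsub>V\<^esub> v \<in> U" .
    moreover have "l \<ominus>\<^bsub>K\<^esub> k \<noteq> \<zero>\<^bsub>K\<^esub>" using neq that K.minus_equality[of l "\<ominus>\<^bsub>K\<^esub> k"] by (auto simp: a_minus_def)
    ultimately show False using scale[of "l \<ominus>\<^bsub>K\<^esub> k" v] that assms(4) U(3) by auto
  qed
  define f where "f = (\<lambda>x\<in>carrier V. THE k. k \<in> carrier K \<and> x \<ominus>\<^bsub>V\<^esub> k \<odot>\<^bsub>V\<^esub> v \<in> U)"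
  have f: "f x \<in> carrier K \<and> x \<ominus>\<^bsub>V\<^esub> f x \<odot>\<^bsub>V\<^esub> v \<in> U" if "x \<in> carrier V" for x
  proof -
    have "\<exists>!k. k \<in> carrier K \<and> x \<ominus>\<^bsub>V\<^esub> k \<odot>\<^bsub>V\<^esub> v \<in> U" using ex[OF that] uniq that by blast
    from theI'[OF this] show ?thesis using that by (simp add: f_def)
  qed
  have feq: "f x = k" if "x \<in> carrier V" "k \<in> carrier K" "x \<ominus>\<^bsub>V\<^esub> k \<odot>\<^bsub>V\<^esub> v \<in> U" for x k
    using uniq f that by blast
  show ?thesis
  proof
    show "f \<in> functionals K V"
    proof (rule functionalsI)
      fix x y assume x: "x \<in> carrier V" and y: "y \<in> carrier V"
      have "(x \<oplus>\<^bsub>V\<^esub> y) \<ominus>\<^bsub>V\<^esub> (f x \<oplus>\<^bsub>K\<^esub> f y) \<odot>\<^bsub>V\<^esub> v = (x \<ominus>\<^bsub>V\<^esub> f x \<odot>\<^bsub>V\<^esub> v) \<oplus>\<^bsub>V\<^esub> (y \<ominus>\<^bsub>V\<^esub> f y \<odot>\<^bsub>V\<^esub> v)"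
        using f[OF x] f[OF y] x y assms(4) by (simp add: diff V.smult_l_distr)
      then show "f (x \<oplus>\<^bsub>V\<^esub> y) = f x \<oplus>\<^bsub>K\<^esub> f y"
        using f[OF x] f[OF y] x y D(3) by (intro feq) auto
    next
      fix k x assume k: "k \<in> carrier K" and x: "x \<in> carrier V"
      have "k \<odot>\<^bsub>V\<^esub> x \<ominus>\<^bsub>V\<^esub> (k \<otimes>\<^bsub>K\<^esub> f x) \<odot>\<^bsub>V\<^esub> v = k \<odot>\<^bsub>V\<^esub> (x \<ominus>\<^bsub>V\<^esub> f x \<odot>\<^bsub>V\<^esub> v)"
        using f[OF x] k x assms(4)
        by (simp add: a_minus_def V.smult_r_distr V.smult_r_minus V.smult_assoc1)
      then show "f (k \<odot>\<^bsub>V\<^esub> x) = k \<otimes>\<^bsub>K\<^esub> f x"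
        using f[OF x] k x D(4) by (intro feq) auto
    qed (use f in \<open>auto simp: f_def\<close>)
    show "f v = \<one>\<^bsub>K\<^esub>"
      by (rule feq) (use assms(4) D(2) in \<open>auto simp: a_minus_def V.r_neg\<close>)
    show "f w = \<zero>\<^bsub>K\<^esub>" if "w \<in> W" for w
      by (rule feq) (use assms(4) that U(2) Uc in \<open>auto simp: a_minus_def V.a_inv_zero\<close>)
  qed
qed

text \<open>A spanning set of least cardinality: each s lies outside the span of the others, so a
  functional takes the value 1 at s and vanishes on the rest. These functionals read off the
  coefficients of every vector.\<close>

lemma dual_basis:
  assumes "field K" "module K V" "fin_dim K V"
  obtains S d where "finite S" "S \<subseteq> carrier V" "\<And>s. s \<in> S \<Longrightarrow> d s \<in> functionals K V"
    "\<And>v. v \<in> carrier V \<Longrightarrow> v = (\<Oplus>\<^bsub>V\<^esub>s\<in>S. d s v \<odot>\<^bsub>V\<^esub> s)"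
proof -
  interpret K: field K by fact
  interpret V: module K V by fact
  let ?P = "\<lambda>S. finite S \<and> S \<subseteq> carrier V \<and> carrier V \<subseteq> linspan K V S"
  have "\<exists>S. ?P S" using assms(3) fin_dim_altdef[OF assms(2)] by blast
  then obtain S where S: "?P S" "\<And>T. ?P T \<Longrightarrow> card S \<le> card T"
    using exists_least_iff[of "\<lambda>n. \<exists>S. ?P S \<and> card S = n"] by (metis not_le_imp_less)
  have "\<exists>\<phi>\<in>functionals K V. \<phi> s = \<one>\<^bsub>K\<^esub> \<and> (\<forall>t\<in>S - {s}. \<phi> t = \<zero>\<^bsub>K\<^esub>)" if s: "s \<in> S" for s
  proof -
    let ?T = "S - {s}"
    have T: "finite ?T" "?T \<subseteq> carrier V" using S by auto
    note sub = linspan_submodule[OF assms(2) T(2)]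
    have "s \<notin> linspan K V ?T"
    proof
      assume "s \<in> linspan K V ?T"
      then have "S \<subseteq> linspan K V ?T" using linspan_base[OF assms(2) T(2,1)] by blast
      then have "carrier V \<subseteq> linspan K V ?T"
        using linspan_least[OF assms(2) sub] S(1) by blast
      then have "card S \<le> card ?T" using S(2) T by blast
      moreover have "card ?T < card S" using s S(1) by (intro card_Diff1_less) auto
      ultimately show False by simp
    qed
    then obtain \<phi> where "\<phi> \<in> functionals K V" "\<phi> s = \<one>\<^bsub>K\<^esub>" "\<And>w. w \<in> linspan K V ?T \<Longrightarrow> \<phi> w = \<zero>\<^bsub>K\<^esub>"
      using separating_functional[OF assms(1,2) sub] s S(1) by blast
    then show ?thesis using linspan_base[OF assms(2) T(2,1)] by blast
  qed
  then obtain d where d: "\<And>s. s \<in> S \<Longrightarrow> d s \<in> functionals K V"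
    "\<And>s. s \<in> S \<Longrightarrow> d s s = \<one>\<^bsub>K\<^esub>" "\<And>s t. s \<in> S \<Longrightarrow> t \<in> S - {s} \<Longrightarrow> d s t = \<zero>\<^bsub>K\<^esub>"
    by metis
  show ?thesis
  proof
    fix v assume v: "v \<in> carrier V"
    then obtain c where c: "c \<in> S \<rightarrow> carrier K" "v = (\<Oplus>\<^bsub>V\<^esub>s\<in>S. c s \<odot>\<^bsub>V\<^esub> s)"
      using S(1) by (auto simp: linspan_def)
    have "d s v = c s" if s: "s \<in> S" for s
    proof -
      note ds = functionalsD[OF d(1)[OF s]]
      have "d s v = (\<Oplus>\<^bsub>K\<^esub>t\<in>S. d s (c t \<odot>\<^bsub>V\<^esub> t))"
        unfolding c(2) by (rule add_hom_finsum[OF V.abelian_group_axioms K.abelian_group_axioms ds(1)])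
          (use c S in auto)
      also have "\<dots> = (\<Oplus>\<^bsub>K\<^esub>t\<in>S. if s = t then c t else \<zero>\<^bsub>K\<^esub>)"
        by (rule K.finsum_cong') (use c S d s in \<open>auto simp: ds(5) Pi_iff subset_iff\<close>)
      also have "\<dots> = c s" by (rule K.add.finprod_singleton) (use s S c in auto)
      finally show ?thesis .
    qed
    then have "(\<Oplus>\<^bsub>V\<^esub>s\<in>S. c s \<odot>\<^bsub>V\<^esub> s) = (\<Oplus>\<^bsub>V\<^esub>s\<in>S. d s v \<odot>\<^bsub>V\<^esub> s)"
      using c(1) S(1) by (intro V.finsum_cong') (auto simp: Pi_iff subset_iff)
    with c(2) show "v = (\<Oplus>\<^bsub>V\<^esub>s\<in>S. d s v \<odot>\<^bsub>V\<^esub> s)" by (rule trans)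
  qed (use S d in auto)
qed

text \<open>All function groups in use are sets of extensional functions with pointwise addition:
  duals, spaces of homomorphisms, the modules Hom(W, N), finite powers, and Hom_B(M, B). One
  criterion serves them all.\<close>

lemma pointwise_abelian_group:
  assumes "abelian_group G" "C \<subseteq> X \<rightarrow>\<^sub>E carrier G"
    and "(\<lambda>x\<in>X. \<zero>\<^bsub>G\<^esub>) \<in> C"
    and "\<And>f g. f \<in> C \<Longrightarrow> g \<in> C \<Longrightarrow> (\<lambda>x\<in>X. f x \<oplus>\<^bsub>G\<^esub> g x) \<in> C"
    and "\<And>f. f \<in> C \<Longrightarrow> (\<lambda>x\<in>X. \<ominus>\<^bsub>G\<^esub> f x) \<in> C"
    and "carrier H = C" "\<zero>\<^bsub>H\<^esub> = (\<lambda>x\<in>X. \<zero>\<^bsub>G\<^esub>)"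
    and "\<And>f g. f \<in> C \<Longrightarrow> g \<in> C \<Longrightarrow> f \<oplus>\<^bsub>H\<^esub> g = (\<lambda>x\<in>X. f x \<oplus>\<^bsub>G\<^esub> g x)"
  shows "abelian_group H"
proof -
  interpret G: abelian_group G by fact
  have C: "f x \<in> carrier G" if "f \<in> C" "x \<in> X" for f x using assms(2) that by auto
  have ext: "f \<in> extensional X" if "f \<in> C" for f using assms(2) that by (auto simp: PiE_def)
  show ?thesis
  proof (rule abelian_groupI, unfold assms(6,7))
    fix f g assume f: "f \<in> C" and g: "g \<in> C"
    show "f \<oplus>\<^bsub>H\<^esub> g \<in> C" using assms(4,8) f g by simp
    show "f \<oplus>\<^bsub>H\<^esub> g = g \<oplus>\<^bsub>H\<^esub> f" using f g C by (auto simp: assms(8) G.a_comm restrict_def)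
    fix h assume h: "h \<in> C"
    show "f \<oplus>\<^bsub>H\<^esub> g \<oplus>\<^bsub>H\<^esub> h = f \<oplus>\<^bsub>H\<^esub> (g \<oplus>\<^bsub>H\<^esub> h)"
      using f g h C assms(4) by (auto simp: assms(8) G.a_assoc restrict_def)
  next
    fix f assume f: "f \<in> C"
    show "(\<lambda>x\<in>X. \<zero>\<^bsub>G\<^esub>) \<oplus>\<^bsub>H\<^esub> f = f"
      unfolding assms(8)[OF assms(3) f]
      using C[OF f] ext[OF f] by (auto simp: extensional_def)
    show "\<exists>g\<in>C. g \<oplus>\<^bsub>H\<^esub> f = (\<lambda>x\<in>X. \<zero>\<^bsub>G\<^esub>)"
      using assms(5)[OF f] C[OF f]
      by (intro bexI[of _ "\<lambda>x\<in>X. \<ominus>\<^bsub>G\<^esub> f x"])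
        (auto simp: assms(8)[OF assms(5)[OF f] f] G.l_neg intro!: restrict_ext)
  qed (use assms(3) in auto)
qed

text \<open>The same functions as in \<open>dual_bimod\<close>, but as a K-vector space. The
  bimodule record has no scalar multiplication, and its actions mean something only when V is an
  algebra.\<close>

definition dual_space :: "('k, 'c) ring_scheme \<Rightarrow> ('k, 'v, 'x) module_scheme \<Rightarrow> ('k, 'v \<Rightarrow> 'k) module" where
  "dual_space K V = \<lparr>carrier = functionals K V, monoid.mult = undefined, one = undefined,
     ring.zero = (\<lambda>x\<in>carrier V. \<zero>\<^bsub>K\<^esub>),
     ring.add = (\<lambda>\<phi> \<psi>. \<lambda>x\<in>carrier V. \<phi> x \<oplus>\<^bsub>K\<^esub> \<psi> x),
     smult = (\<lambda>k \<phi>. \<lambda>x\<in>carrier V. k \<otimes>\<^bsub>K\<^esub> \<phi> x)\<rparr>"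

lemma dual_space_simps [simp]:
  "carrier (dual_space K V) = functionals K V"
  "\<zero>\<^bsub>dual_space K V\<^esub> = (\<lambda>x\<in>carrier V. \<zero>\<^bsub>K\<^esub>)"
  "\<phi> \<oplus>\<^bsub>dual_space K V\<^esub> \<psi> = (\<lambda>x\<in>carrier V. \<phi> x \<oplus>\<^bsub>K\<^esub> \<psi> x)"
  "k \<odot>\<^bsub>dual_space K V\<^esub> \<phi> = (\<lambda>x\<in>carrier V. k \<otimes>\<^bsub>K\<^esub> \<phi> x)"
  by (simp_all add: dual_space_def)

lemma dual_bimod_simps [simp]:
  "\<zero>\<^bsub>dual_bimod K V\<^esub> = (\<lambda>x\<in>carrier V. \<zero>\<^bsub>K\<^esub>)"
  "\<phi> \<oplus>\<^bsub>dual_bimod K V\<^esub> \<psi> = (\<lambda>x\<in>carrier V. \<phi> x \<oplus>\<^bsub>K\<^esub> \<psi> x)"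
  "\<phi> \<triangleleft>\<^bsub>dual_bimod K V\<^esub> b = (\<lambda>x\<in>carrier V. \<phi> (b \<otimes>\<^bsub>V\<^esub> x))"
  "a \<triangleright>\<^bsub>dual_bimod K V\<^esub> \<phi> = (\<lambda>x\<in>carrier V. \<phi> (x \<otimes>\<^bsub>V\<^esub> a))"
  by (simp_all add: dual_bimod_def)

context
  fixes K :: "('k, 'c) ring_scheme" and V :: "('k, 'v, 'x) module_scheme"
  assumes V: "module K V"
begin

interpretation V: module K V by (rule V)

lemma functionals_zero: "(\<lambda>x\<in>carrier V. \<zero>\<^bsub>K\<^esub>) \<in> functionals K V"
  by (rule functionalsI) auto

lemma functionals_add:
  assumes "\<phi> \<in> functionals K V" "\<psi> \<in> functionals K V"
  shows "(\<lambda>x\<in>carrier V. \<phi> x \<oplus>\<^bsub>K\<^esub> \<psi> x) \<in> functionals K V"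
  using functionalsD(3-)[OF assms(1)] functionalsD(3-)[OF assms(2)]
  by (intro functionalsI) (auto simp: V.R.a_ac V.R.r_distr)

lemma functionals_smult:
  assumes "k \<in> carrier K" "\<phi> \<in> functionals K V"
  shows "(\<lambda>x\<in>carrier V. k \<otimes>\<^bsub>K\<^esub> \<phi> x) \<in> functionals K V"
  using functionalsD(3-)[OF assms(2)] assms(1)
  by (intro functionalsI) (auto simp: V.R.r_distr V.R.m_ac)

lemma functionals_uminus:
  assumes "\<phi> \<in> functionals K V"
  shows "(\<lambda>x\<in>carrier V. \<ominus>\<^bsub>K\<^esub> \<phi> x) \<in> functionals K V"
  using functionalsD(3-)[OF assms(1)]
  by (intro functionalsI) (auto simp: V.R.minus_add V.R.r_minus)

lemma functionals_subset: "functionals K V \<subseteq> carrier V \<rightarrow>\<^sub>E carrier K"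
  by (auto simp: functionals_iff add_hom_def extensional_def)

lemma dual_bimod_abelian_group: "abelian_group (dual_bimod K V)"
  by (rule pointwise_abelian_group[OF V.R.abelian_group_axioms functionals_subset functionals_zero
    functionals_add functionals_uminus]) auto

lemma dual_space_module: "module K (dual_space K V)"
proof (rule moduleI)
  show "abelian_group (dual_space K V)"
    by (rule pointwise_abelian_group[OF V.R.abelian_group_axioms functionals_subset functionals_zero
      functionals_add functionals_uminus]) auto
next
  fix k \<phi> assume k: "k \<in> carrier K" and \<phi>: "\<phi> \<in> carrier (dual_space K V)"
  show "k \<odot>\<^bsub>dual_space K V\<^esub> \<phi> \<in> carrier (dual_space K V)"
    using functionals_smult k \<phi> by simp
next
  fix \<phi> assume \<phi>: "\<phi> \<in> carrier (dual_space K V)"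
  then show "\<one>\<^bsub>K\<^esub> \<odot>\<^bsub>dual_space K V\<^esub> \<phi> = \<phi>"
    using functionalsD(2,3)[of \<phi> K V] by (auto simp: extensional_def)
qed (use V.R.is_cring functionalsD(3)[of _ K V] in \<open>auto simp: V.R.l_distr V.R.r_distr V.R.m_assoc functionals_smult functionals_add intro!: restrict_ext\<close>)

lemma functional_finsum:
  assumes "\<And>i. i \<in> I \<Longrightarrow> f i \<in> functionals K V" "x \<in> carrier V"
  shows "(\<Oplus>\<^bsub>dual_space K V\<^esub>i\<in>I. f i) x = (\<Oplus>\<^bsub>K\<^esub>i\<in>I. f i x)"
proof -
  interpret D: module K "dual_space K V" by (rule dual_space_module)
  have "(\<lambda>\<phi>. \<phi> x) \<in> add_hom (dual_space K V) K"
    by (rule add_homI) (use assms(2) functionalsD(3) in auto)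
  from add_hom_finsum[OF D.abelian_group_axioms V.R.abelian_group_axioms this, of f I] show ?thesis
    using assms(1) by auto
qed

end

text \<open>Apply \<psi> to the expansion of a vector in the elements of S: the coefficients d_s
  then take the part of the vectors, with \<psi>(s) as their coefficients.\<close>

lemma functional_expansion:
  assumes "module K V" "S \<subseteq> carrier V" "\<And>s. s \<in> S \<Longrightarrow> d s \<in> functionals K V"
    and "\<And>v. v \<in> carrier V \<Longrightarrow> v = (\<Oplus>\<^bsub>V\<^esub>s\<in>S. d s v \<odot>\<^bsub>V\<^esub> s)" "\<psi> \<in> functionals K V"
  shows "\<psi> = (\<Oplus>\<^bsub>dual_space K V\<^esub>s\<in>S. \<psi> s \<odot>\<^bsub>dual_space K V\<^esub> d s)" (is "_ = ?r")
proof (rule extensionalityI[OF functionalsD(2)[OF assms(5)]])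
  interpret V: module K V by fact
  interpret D: module K "dual_space K V" by (rule dual_space_module[OF assms(1)])
  note P = functionalsD[OF assms(5)]
  have Sc: "\<And>s. s \<in> S \<Longrightarrow> \<psi> s \<in> carrier K" using assms(2) P(3) by auto
  have fs: "\<psi> s \<odot>\<^bsub>dual_space K V\<^esub> d s \<in> functionals K V" if "s \<in> S" for s
    using D.smult_closed[OF Sc[OF that]] assms(3)[OF that] by simp
  have "?r \<in> functionals K V" using D.finsum_closed[of _ S] fs by simp
  then show "?r \<in> extensional (carrier V)" by (rule functionalsD(2))
  fix x assume x: "x \<in> carrier V"
  have "\<psi> x = \<psi> (\<Oplus>\<^bsub>V\<^esub>s\<in>S. d s x \<odot>\<^bsub>V\<^esub> s)" using assms(4)[OF x] by (rule arg_cong)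
  also have "\<dots> = (\<Oplus>\<^bsub>K\<^esub>s\<in>S. \<psi> (d s x \<odot>\<^bsub>V\<^esub> s))"
    by (rule add_hom_finsum[OF V.abelian_group_axioms V.R.abelian_group_axioms P(1)])
      (use assms(2,3) functionalsD(3)[of _ K V] x in \<open>auto simp: subset_iff\<close>)
  also have "\<dots> = (\<Oplus>\<^bsub>K\<^esub>s\<in>S. (\<psi> s \<odot>\<^bsub>dual_space K V\<^esub> d s) x)"
    by (rule V.R.finsum_cong')
      (use assms(2,3) functionalsD(3)[of _ K V] x P(3,5) Sc V.R.m_comm in \<open>auto simp: subset_iff\<close>)
  also have "\<dots> = ?r x" by (rule functional_finsum[OF assms(1) fs x, symmetric])
  finally show "\<psi> x = ?r x" .
qed

lemma dual_space_fin_dim: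
  assumes "field K" "module K V" "fin_dim K V"
  shows "fin_dim K (dual_space K V)"
proof -
  obtain S d where S: "finite S" "S \<subseteq> carrier V" "\<And>s. s \<in> S \<Longrightarrow> d s \<in> functionals K V"
    "\<And>v. v \<in> carrier V \<Longrightarrow> v = (\<Oplus>\<^bsub>V\<^esub>s\<in>S. d s v \<odot>\<^bsub>V\<^esub> s)"
    using dual_basis[OF assms] by blast
  note D = dual_space_module[OF assms(2)]
  show ?thesis
  proof (rule fin_dimI[OF D, of "d ` S"])
    fix W assume W: "submodule W K (dual_space K V)" "d ` S \<subseteq> W"
    show "carrier (dual_space K V) \<subseteq> W"
    proof
      fix \<psi> assume "\<psi> \<in> carrier (dual_space K V)"
      then have \<psi>: "\<psi> \<in> functionals K V" by simp
      have "(\<Oplus>\<^bsub>dual_space K V\<^esub>s\<in>S. \<psi> s \<odot>\<^bsub>dual_space K V\<^esub> d s) \<in> W"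
        by (rule submodule_finsum[OF D W(1)], rule submoduleD(4)[OF D W(1)])
          (use W(2) S(2) functionalsD(3)[OF \<psi>] in auto)
      then show "\<psi> \<in> W" using functional_expansion[OF assms(2) S(2-4) \<psi>] by simp
    qed
  qed (use S in auto)
qed

text \<open>Reflexivity. Expanding \<psi> in the dual family forces the vector to be v = \<Sum>
  F(d_s) s, and this v works.\<close>

lemma bidual_eval:
  assumes "field K" "module K V" "fin_dim K V" "F \<in> functionals K (dual_space K V)"
  obtains v where "v \<in> carrier V" "\<And>\<psi>. \<psi> \<in> functionals K V \<Longrightarrow> F \<psi> = \<psi> v"
proof -
  interpret K: field K by fact
  interpret V: module K V by fact
  interpret D: module K "dual_space K V" by (rule dual_space_module[OF assms(2)])
  note F' = functionalsD[OF assms(4)]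
  obtain S d where S: "finite S" "S \<subseteq> carrier V" "\<And>s. s \<in> S \<Longrightarrow> d s \<in> functionals K V"
    "\<And>v. v \<in> carrier V \<Longrightarrow> v = (\<Oplus>\<^bsub>V\<^esub>s\<in>S. d s v \<odot>\<^bsub>V\<^esub> s)"
    using dual_basis[OF assms(1-3)] by blast
  define v where "v = (\<Oplus>\<^bsub>V\<^esub>s\<in>S. F (d s) \<odot>\<^bsub>V\<^esub> s)"
  have v: "v \<in> carrier V" unfolding v_def using S(2,3) F'(3) by (auto intro!: V.finsum_closed)
  have "F \<psi> = \<psi> v" if \<psi>: "\<psi> \<in> functionals K V" for \<psi>
  proof -
    note P = functionalsD[OF \<psi>]
    have Sc: "\<And>s. s \<in> S \<Longrightarrow> \<psi> s \<in> carrier K" using S(2) P(3) by auto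
    have "F \<psi> = F (\<Oplus>\<^bsub>dual_space K V\<^esub>s\<in>S. \<psi> s \<odot>\<^bsub>dual_space K V\<^esub> d s)"
      using functional_expansion[OF assms(2) S(2-4) \<psi>] by (rule arg_cong)
    also have "\<dots> = (\<Oplus>\<^bsub>K\<^esub>s\<in>S. F (\<psi> s \<odot>\<^bsub>dual_space K V\<^esub> d s))"
      by (rule add_hom_finsum[OF D.abelian_group_axioms K.abelian_group_axioms F'(1)])
        (use D.smult_closed[OF Sc] S(3) in auto)
    also have "\<dots> = (\<Oplus>\<^bsub>K\<^esub>s\<in>S. \<psi> (F (d s) \<odot>\<^bsub>V\<^esub> s))"
      by (rule K.finsum_cong')
        (use P(3,5) F'(3,5) S(2,3) Sc in \<open>auto simp: K.m_comm subset_iff simp del: dual_space_simps(4)\<close>)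
    also have "\<dots> = \<psi> v"
      unfolding v_def
      by (rule add_hom_finsum[OF V.abelian_group_axioms K.abelian_group_axioms P(1), symmetric])
        (use S(2,3) F'(3) in auto)
    finally show ?thesis .
  qed
  then show ?thesis using that v by blast
qed

text \<open>If T misses some \<phi>, an element F of the bidual vanishes on T but not at \<phi>. By
  reflexivity F is evaluation at a vector v, which is then a common zero of T, so v = 0 and F
  vanishes at \<phi> after all. This replaces a dimension count in
  \<open>Theta_surj\<close>.\<close>

lemma functionals_eq_of_no_common_zero:
  assumes "field K" "module K V" "fin_dim K V" "submodule T K (dual_space K V)"
    and "\<And>v. v \<in> carrier V \<Longrightarrow> (\<And>\<phi>. \<phi> \<in> T \<Longrightarrow> \<phi> v = \<zero>\<^bsub>K\<^esub>) \<Longrightarrow> v = \<zero>\<^bsub>V\<^esub>"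
  shows "T = functionals K V"
proof (rule ccontr)
  interpret K: field K by fact
  interpret V: module K V by fact
  note T = submoduleD[OF dual_space_module[OF assms(2)] assms(4)]
  assume "T \<noteq> functionals K V"
  then obtain \<phi> where \<phi>: "\<phi> \<in> functionals K V" "\<phi> \<notin> T" using T(1) by auto
  then obtain F where F: "F \<in> functionals K (dual_space K V)" "F \<phi> = \<one>\<^bsub>K\<^esub>" "\<And>w. w \<in> T \<Longrightarrow> F w = \<zero>\<^bsub>K\<^esub>"
    using separating_functional[OF assms(1) dual_space_module[OF assms(2)] assms(4)] by auto
  obtain v where v: "v \<in> carrier V" "\<And>\<psi>. \<psi> \<in> functionals K V \<Longrightarrow> F \<psi> = \<psi> v"
    using bidual_eval[OF assms(1-3) F(1)] by blast
  have "v = \<zero>\<^bsub>V\<^esub>"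
  proof (rule assms(5)[OF v(1)])
    fix \<psi> assume "\<psi> \<in> T"
    then show "\<psi> v = \<zero>\<^bsub>K\<^esub>" using v(2)[of \<psi>] F(3)[of \<psi>] T(1) by auto
  qed
  then have "F \<phi> = \<zero>\<^bsub>K\<^esub>"
    using v(2)[OF \<phi>(1)] add_hom_zero[OF V.abelian_group_axioms K.abelian_group_axioms functionalsD(1)[OF \<phi>(1)]]
    by simp
  then show False using F(2) K.one_not_zero by simp
qed


section \<open>Homomorphisms of right modules\<close>

lemma rhomI:
  assumes "\<And>x. x \<in> carrier M \<Longrightarrow> f x \<in> carrier N"
    and "\<And>x y. x \<in> carrier M \<Longrightarrow> y \<in> carrier M \<Longrightarrow> f (x \<oplus>\<^bsub>M\<^esub> y) = f x \<oplus>\<^bsub>N\<^esub> f y"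
    and "\<And>x a. x \<in> carrier M \<Longrightarrow> a \<in> carrier R \<Longrightarrow> f (x \<triangleleft>\<^bsub>M\<^esub> a) = f x \<triangleleft>\<^bsub>N\<^esub> a"
    and "\<And>x. x \<notin> carrier M \<Longrightarrow> f x = undefined"
  shows "f \<in> rhom R M N"
  using assms by (auto simp: rhom_def)

lemma rhomD:
  assumes "f \<in> rhom R M N"
  shows "\<And>x. x \<in> carrier M \<Longrightarrow> f x \<in> carrier N"
    and "\<And>x y. x \<in> carrier M \<Longrightarrow> y \<in> carrier M \<Longrightarrow> f (x \<oplus>\<^bsub>M\<^esub> y) = f x \<oplus>\<^bsub>N\<^esub> f y"
    and "\<And>x a. x \<in> carrier M \<Longrightarrow> a \<in> carrier R \<Longrightarrow> f (x \<triangleleft>\<^bsub>M\<^esub> a) = f x \<triangleleft>\<^bsub>N\<^esub> a"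
    and "f \<in> extensional (carrier M)"
    and "f \<in> add_hom M N"
  using assms by (auto simp: rhom_def add_hom_def PiE_def)

lemma rhom_eqI:
  assumes "f \<in> rhom R M N" "g \<in> rhom R M N'" "\<And>x. x \<in> carrier M \<Longrightarrow> f x = g x"
  shows "f = g"
  by (rule extensionalityI[OF rhomD(4)[OF assms(1)] rhomD(4)[OF assms(2)] assms(3)])

lemma rhom_compose:
  assumes "f \<in> rhom R L M" "g \<in> rhom R M N" "right_module R L"
  shows "compose (carrier L) g f \<in> rhom R L N"
proof -
  interpret L: abelian_group L using right_moduleD(1)[OF assms(3)] .
  show ?thesis
    using rhomD(1-3)[OF assms(1)] rhomD(1-3)[OF assms(2)] right_moduleD(2)[OF assms(3)]
    by (intro rhomI) (auto simp: compose_def)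
qed

lemma rhom_id: "right_module R M \<Longrightarrow> (\<lambda>m\<in>carrier M. m) \<in> rhom R M M"
proof -
  assume M: "right_module R M"
  interpret M: abelian_group M using right_moduleD(1)[OF M] .
  show ?thesis using right_moduleD(2)[OF M] by (intro rhomI) auto
qed

lemma rhom_inv:
  assumes "f \<in> rhom R M N" "bij_betw f (carrier M) (carrier N)" "right_module R M" "right_module R N"
  shows "restrict (inv_into (carrier M) f) (carrier N) \<in> rhom R N M" (is "?g \<in> _")
proof -
  interpret M: abelian_group M using right_moduleD(1)[OF assms(3)] .
  interpret N: abelian_group N using right_moduleD(1)[OF assms(4)] .
  have inj: "inj_on f (carrier M)" and im: "f ` carrier M = carrier N"
    using assms(2) by (auto simp: bij_betw_def)
  have g: "?g y \<in> carrier M" "f (?g y) = y" if "y \<in> carrier N" for y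
    using that im inv_into_into[of y f "carrier M"] f_inv_into_f[of y f "carrier M"] by auto
  have geq: "?g y = x" if "x \<in> carrier M" "f x = y" for x y
    using g[of y] that inj im by (auto simp: inj_on_def)
  show ?thesis
  proof (rule rhomI)
    fix x y assume x: "x \<in> carrier N" and y: "y \<in> carrier N"
    show "?g (x \<oplus>\<^bsub>N\<^esub> y) = ?g x \<oplus>\<^bsub>M\<^esub> ?g y"
      by (rule geq) (use g[OF x] g[OF y] rhomD(2)[OF assms(1)] in auto)
  next
    fix x a assume x: "x \<in> carrier N" and a: "a \<in> carrier R"
    show "?g (x \<triangleleft>\<^bsub>N\<^esub> a) = ?g x \<triangleleft>\<^bsub>M\<^esub> a"
      by (rule geq) (use g[OF x] a rhomD(3)[OF assms(1)] right_moduleD(2)[OF assms(3)] in auto)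
  qed (use g in auto)
qed

lemma hom_space_simps [simp]:
  "carrier (hom_space A M N) = rhom A M N"
  "\<zero>\<^bsub>hom_space A M N\<^esub> = (\<lambda>m\<in>carrier M. \<zero>\<^bsub>N\<^esub>)"
  "f \<oplus>\<^bsub>hom_space A M N\<^esub> g = (\<lambda>m\<in>carrier M. f m \<oplus>\<^bsub>N\<^esub> g m)"
  "k \<odot>\<^bsub>hom_space A M N\<^esub> f = (\<lambda>m\<in>carrier M. f m \<triangleleft>\<^bsub>N\<^esub> (k \<odot>\<^bsub>A\<^esub> \<one>\<^bsub>A\<^esub>))"
  by (simp_all add: hom_space_def)

lemma hom_rmod_simps [simp]:
  "carrier (hom_rmod A W N) = rhom A W N"
  "\<zero>\<^bsub>hom_rmod A W N\<^esub> = (\<lambda>m\<in>carrier W. \<zero>\<^bsub>N\<^esub>)"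
  "f \<oplus>\<^bsub>hom_rmod A W N\<^esub> g = (\<lambda>m\<in>carrier W. f m \<oplus>\<^bsub>N\<^esub> g m)"
  "f \<triangleleft>\<^bsub>hom_rmod A W N\<^esub> a = (\<lambda>w\<in>carrier W. f (a \<triangleright>\<^bsub>W\<^esub> w))"
  by (simp_all add: hom_rmod_def)

lemma scalar_space_simps [simp]:
  "carrier (scalar_space A M) = carrier M"
  "\<zero>\<^bsub>scalar_space A M\<^esub> = \<zero>\<^bsub>M\<^esub>"
  "x \<oplus>\<^bsub>scalar_space A M\<^esub> y = x \<oplus>\<^bsub>M\<^esub> y"
  "k \<odot>\<^bsub>scalar_space A M\<^esub> m = m \<triangleleft>\<^bsub>M\<^esub> (k \<odot>\<^bsub>A\<^esub> \<one>\<^bsub>A\<^esub>)"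
  by (simp_all add: scalar_space_def)

lemma mult_bimod_simps [simp]:
  "carrier (mult_bimod A S) = S"
  "\<zero>\<^bsub>mult_bimod A S\<^esub> = \<zero>\<^bsub>A\<^esub>"
  "x \<oplus>\<^bsub>mult_bimod A S\<^esub> y = x \<oplus>\<^bsub>A\<^esub> y"
  "x \<triangleleft>\<^bsub>mult_bimod A S\<^esub> a = x \<otimes>\<^bsub>A\<^esub> a"
  "a \<triangleright>\<^bsub>mult_bimod A S\<^esub> x = a \<otimes>\<^bsub>A\<^esub> x"
  by (simp_all add: mult_bimod_def)

lemma rhom_subset: "rhom A M N \<subseteq> carrier M \<rightarrow>\<^sub>E carrier N"
  by (auto simp: rhom_def)

lemma rhom_pointwise_closed:
  assumes M: "right_module A M" and N: "right_module A N"
  shows "(\<lambda>m\<in>carrier M. \<zero>\<^bsub>N\<^esub>) \<in> rhom A M N"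
    and "\<And>f g. f \<in> rhom A M N \<Longrightarrow> g \<in> rhom A M N \<Longrightarrow> (\<lambda>m\<in>carrier M. f m \<oplus>\<^bsub>N\<^esub> g m) \<in> rhom A M N"
    and "\<And>f. f \<in> rhom A M N \<Longrightarrow> (\<lambda>m\<in>carrier M. \<ominus>\<^bsub>N\<^esub> f m) \<in> rhom A M N"
proof -
  interpret M: abelian_group M using right_moduleD(1)[OF M] .
  interpret N: abelian_group N using right_moduleD(1)[OF N] .
  have act: "(\<lambda>n. n \<triangleleft>\<^bsub>N\<^esub> a) \<in> add_hom N N" if "a \<in> carrier A" for a
    using right_moduleD(2,3)[OF N] that by (intro add_homI) auto
  show "(\<lambda>m\<in>carrier M. \<zero>\<^bsub>N\<^esub>) \<in> rhom A M N"
    using add_hom_zero[OF N.abelian_group_axioms N.abelian_group_axioms act] right_moduleD(2)[OF M]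
    by (intro rhomI) auto
  show "(\<lambda>m\<in>carrier M. f m \<oplus>\<^bsub>N\<^esub> g m) \<in> rhom A M N" if "f \<in> rhom A M N" "g \<in> rhom A M N" for f g
    using rhomD(1-3)[OF that(1)] rhomD(1-3)[OF that(2)] right_moduleD(2)[OF M] right_moduleD(3)[OF N]
    by (intro rhomI) (auto simp: N.a_ac)
  show "(\<lambda>m\<in>carrier M. \<ominus>\<^bsub>N\<^esub> f m) \<in> rhom A M N" if "f \<in> rhom A M N" for f
    using rhomD(1-3)[OF that(1)] right_moduleD(2)[OF M] 
      add_hom_uminus[OF N.abelian_group_axioms N.abelian_group_axioms act]
    by (intro rhomI) (auto simp: N.minus_add)
qed

lemma rhom_abelian_groups:
  assumes "right_module A M" "right_module A N"
  shows "abelian_group (hom_space A M N)"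
  by (rule pointwise_abelian_group[OF right_moduleD(1)[OF assms(2)] rhom_subset rhom_pointwise_closed[OF assms]])
    auto


section \<open>Finite dimensional algebras\<close>

locale fd_alg =
  fixes K :: "('k, 'c) ring_scheme" and A :: "('k, 'a, 'x) module_scheme"
  assumes fd_algebra: "fd_algebra K A"
begin

sublocale K: field K using fd_algebra by (simp add: fd_algebra_def)
sublocale A: ring A using fd_algebra by (simp add: fd_algebra_def)
sublocale V: module K A using fd_algebra by (simp add: fd_algebra_def)

lemma fin_dim: "fin_dim K A" using fd_algebra by (simp add: fd_algebra_def)

lemma smult_mult:
  assumes "k \<in> carrier K" "a \<in> carrier A" "b \<in> carrier A"
  shows "(k \<odot>\<^bsub>A\<^esub> a) \<otimes>\<^bsub>A\<^esub> b = k \<odot>\<^bsub>A\<^esub> (a \<otimes>\<^bsub>A\<^esub> b)" "a \<otimes>\<^bsub>A\<^esub> (k \<odot>\<^bsub>A\<^esub> b) = k \<odot>\<^bsub>A\<^esub> (a \<otimes>\<^bsub>A\<^esub> b)"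
  using fd_algebra assms by (auto simp: fd_algebra_def)

abbreviation sc where "sc k \<equiv> k \<odot>\<^bsub>A\<^esub> \<one>\<^bsub>A\<^esub>"

lemma sc_closed: "k \<in> carrier K \<Longrightarrow> sc k \<in> carrier A" by simp

lemma sc_mult: "k \<in> carrier K \<Longrightarrow> a \<in> carrier A \<Longrightarrow> sc k \<otimes>\<^bsub>A\<^esub> a = k \<odot>\<^bsub>A\<^esub> a"
  by (simp add: smult_mult)

lemma mult_sc: "k \<in> carrier K \<Longrightarrow> a \<in> carrier A \<Longrightarrow> a \<otimes>\<^bsub>A\<^esub> sc k = k \<odot>\<^bsub>A\<^esub> a"
  by (simp add: smult_mult)

lemma sc_central: "k \<in> carrier K \<Longrightarrow> a \<in> carrier A \<Longrightarrow> a \<otimes>\<^bsub>A\<^esub> sc k = sc k \<otimes>\<^bsub>A\<^esub> a"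
  by (simp add: mult_sc sc_mult)

text \<open>The factors are reversed because scalars act from the right: k(lm) is m times
  \<open>sc l\<close> times \<open>sc k\<close>.\<close>

lemma sc_sc: "k \<in> carrier K \<Longrightarrow> l \<in> carrier K \<Longrightarrow> sc (k \<otimes>\<^bsub>K\<^esub> l) = sc l \<otimes>\<^bsub>A\<^esub> sc k"
  by (simp add: smult_mult V.smult_assoc1[symmetric] K.m_comm)

lemma scalar_space_module:
  assumes M: "right_module A M"
  shows "module K (scalar_space A M)"
proof -
  interpret M: abelian_group M using right_moduleD(1)[OF M] .
  note R = right_moduleD(2-)[OF M]
  show ?thesis
  proof (rule moduleI)
    show "abelian_group (scalar_space A M)"
      by (rule abelian_groupI) (use M.l_neg M.a_inv_closed in \<open>auto simp: M.a_ac\<close>)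
  qed (use R K.is_cring in \<open>auto simp: V.smult_l_distr sc_sc\<close>)
qed

text \<open>Pointwise scaling keeps a homomorphism A-linear because \<open>sc k\<close> is central
  in A.\<close>

lemma hom_space_module:
  assumes M: "right_module A M" and N: "right_module A N"
  shows "module K (hom_space A M N)"
proof -
  interpret M: abelian_group M using right_moduleD(1)[OF M] .
  interpret N: abelian_group N using right_moduleD(1)[OF N] .
  note RM = right_moduleD(2-)[OF M]
  note RN = right_moduleD(2-)[OF N]
  have sm: "(\<lambda>m\<in>carrier M. f m \<triangleleft>\<^bsub>N\<^esub> sc k) \<in> rhom A M N" if "f \<in> rhom A M N" "k \<in> carrier K" for f k
    using rhomD(1-3)[OF that(1)] RM(1) RN(1,2) that(2)
    by (intro rhomI) (auto simp: RN(4)[symmetric] sc_central)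
  show ?thesis
  proof (rule moduleI)
    show "abelian_group (hom_space A M N)" by (rule rhom_abelian_groups[OF M N])
  next
    fix f assume "f \<in> carrier (hom_space A M N)"
    then show "\<one>\<^bsub>K\<^esub> \<odot>\<^bsub>hom_space A M N\<^esub> f = f"
      using rhomD(1,4)[of f A M N] RN(5) by (auto simp: extensional_def)
  qed (use K.is_cring sm rhomD(1)[of _ A M N] RN in \<open>auto simp: V.smult_l_distr sc_sc intro!: restrict_ext\<close>)
qed

end

lemma bimoduleD:
  assumes "bimodule K A B W"
  shows "left_module A W" "right_module B W"
    and "\<And>a w b. a \<in> carrier A \<Longrightarrow> w \<in> carrier W \<Longrightarrow> b \<in> carrier B \<Longrightarrow>
      (a \<triangleright>\<^bsub>W\<^esub> w) \<triangleleft>\<^bsub>W\<^esub> b = a \<triangleright>\<^bsub>W\<^esub> (w \<triangleleft>\<^bsub>W\<^esub> b)"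
    and "\<And>k w. k \<in> carrier K \<Longrightarrow> w \<in> carrier W \<Longrightarrow>
      (k \<odot>\<^bsub>A\<^esub> \<one>\<^bsub>A\<^esub>) \<triangleright>\<^bsub>W\<^esub> w = w \<triangleleft>\<^bsub>W\<^esub> (k \<odot>\<^bsub>B\<^esub> \<one>\<^bsub>B\<^esub>)"
  using assms by (auto simp: bimodule_def)

lemma hom_rmod_right_module:
  assumes A: "ring A" and W: "bimodule K A A W" and N: "right_module A N"
  shows "right_module A (hom_rmod A W N)"
proof -
  interpret A: ring A by fact
  note WD = bimoduleD[OF W]
  interpret W: abelian_group W using right_moduleD(1)[OF WD(2)] .
  interpret N: abelian_group N using right_moduleD(1)[OF N] .
  note LW = left_moduleD(2-)[OF WD(1)]
  note RW = right_moduleD(2-)[OF WD(2)]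
  have sm: "(\<lambda>w\<in>carrier W. f (a \<triangleright>\<^bsub>W\<^esub> w)) \<in> rhom A W N" if "f \<in> rhom A W N" "a \<in> carrier A" for f a
    using rhomD(1-3)[OF that(1)] that(2) LW RW
    by (intro rhomI) (auto simp: WD(3)[symmetric])
  show ?thesis
    unfolding right_module_def
  proof (intro conjI ballI)
    show "abelian_group (hom_rmod A W N)"
      by (rule pointwise_abelian_group[OF right_moduleD(1)[OF N] rhom_subset rhom_pointwise_closed[OF WD(2) N]]) auto
  next
    fix f assume "f \<in> carrier (hom_rmod A W N)"
    then show "f \<triangleleft>\<^bsub>hom_rmod A W N\<^esub> \<one>\<^bsub>A\<^esub> = f"
      using rhomD(4)[of f A W N] LW by (auto simp: extensional_def)
  qed (use sm LW rhomD(2)[of _ A W N] in \<open>auto intro!: restrict_ext\<close>)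
qed

text \<open>H is a record of its own that merely agrees with G on the carrier of H. This covers the
  regular modules, the corner algebra, the ideals Ae and eA, and the corner modules.\<close>

lemma sub_abelian_group:
  assumes "abelian_group G" "carrier H \<subseteq> carrier G" "\<zero>\<^bsub>H\<^esub> = \<zero>\<^bsub>G\<^esub>"
    and "\<And>x y. x \<in> carrier H \<Longrightarrow> y \<in> carrier H \<Longrightarrow> x \<oplus>\<^bsub>H\<^esub> y = x \<oplus>\<^bsub>G\<^esub> y"
    and "\<zero>\<^bsub>G\<^esub> \<in> carrier H" "\<And>x y. x \<in> carrier H \<Longrightarrow> y \<in> carrier H \<Longrightarrow> x \<oplus>\<^bsub>G\<^esub> y \<in> carrier H"
    and "\<And>x. x \<in> carrier H \<Longrightarrow> \<ominus>\<^bsub>G\<^esub> x \<in> carrier H"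
  shows "abelian_group H"
proof -
  interpret G: abelian_group G by fact
  note sub = subsetD[OF assms(2)]
  show ?thesis
  proof (rule abelian_groupI, unfold assms(3))
    fix x assume x: "x \<in> carrier H"
    show "\<exists>y\<in>carrier H. y \<oplus>\<^bsub>H\<^esub> x = \<zero>\<^bsub>G\<^esub>"
      using assms(7)[OF x] x sub[OF x] by (intro bexI[of _ "\<ominus>\<^bsub>G\<^esub> x"]) (auto simp: assms(4) G.l_neg)
  qed (use assms(4-6) sub in \<open>auto simp: G.a_ac\<close>)
qed

lemma (in fd_alg) regular_right_module: "right_module A (regular A)"
proof -
  have "abelian_group (regular A)"
    by (rule sub_abelian_group[OF A.abelian_group_axioms]) auto
  then show ?thesis by (auto simp: right_module_def A.l_distr A.r_distr A.m_assoc)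
qed

lemma (in fd_alg) regular_left_module: "left_module A (regular A)"
proof -
  have "abelian_group (regular A)"
    by (rule sub_abelian_group[OF A.abelian_group_axioms]) auto
  then show ?thesis by (auto simp: left_module_def A.l_distr A.r_distr A.m_assoc)
qed

section \<open>Idempotents: the corner algebra and the one-sided ideals\<close>

locale alg_idem = fd_alg K A for K :: "('k, 'c) ring_scheme" and A :: "('k, 'a, 'x) module_scheme" +
  fixes e :: 'a
  assumes e_closed [simp]: "e \<in> carrier A" and e_idem [simp]: "e \<otimes>\<^bsub>A\<^esub> e = e"
begin

abbreviation eAe where "eAe \<equiv> corner A e"
abbreviation eA where "eA \<equiv> right_ideal_of A e"
abbreviation Ae where "Ae \<equiv> left_ideal_of A e"

lemma mem_eA: "y \<in> (\<lambda>a. e \<otimes>\<^bsub>A\<^esub> a) ` carrier A \<longleftrightarrow> y \<in> carrier A \<and> e \<otimes>\<^bsub>A\<^esub> y = y"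
  by (auto simp: image_iff A.m_assoc[symmetric] intro: bexI[of _ y])

lemma mem_Ae: "y \<in> (\<lambda>a. a \<otimes>\<^bsub>A\<^esub> e) ` carrier A \<longleftrightarrow> y \<in> carrier A \<and> y \<otimes>\<^bsub>A\<^esub> e = y"
  by (auto simp: image_iff A.m_assoc intro: bexI[of _ y])

text \<open>Membership as an equation, without a witness for the image. For the same purpose later
  proofs remove \<open>mult_bimod_simps(1)\<close> from the simpset, as it would unfold
  \<open>carrier eA\<close> into an image before the rules about eA can match.\<close>

lemma carrier_eA: "carrier eA = {y \<in> carrier A. e \<otimes>\<^bsub>A\<^esub> y = y}"
  using mem_eA by auto

lemma carrier_Ae: "carrier Ae = {y \<in> carrier A. y \<otimes>\<^bsub>A\<^esub> e = y}"
  using mem_Ae by auto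

lemma corner_simps:
  "\<zero>\<^bsub>eAe\<^esub> = \<zero>\<^bsub>A\<^esub>" "\<one>\<^bsub>eAe\<^esub> = e" "x \<oplus>\<^bsub>eAe\<^esub> y = x \<oplus>\<^bsub>A\<^esub> y" "x \<otimes>\<^bsub>eAe\<^esub> y = x \<otimes>\<^bsub>A\<^esub> y"
  "k \<odot>\<^bsub>eAe\<^esub> x = k \<odot>\<^bsub>A\<^esub> x"
  by (simp_all add: corner_def)

lemma carrier_corner: "carrier eAe = {y \<in> carrier A. e \<otimes>\<^bsub>A\<^esub> y = y \<and> y \<otimes>\<^bsub>A\<^esub> e = y}"
proof -
  have "y \<in> (\<lambda>a. e \<otimes>\<^bsub>A\<^esub> a \<otimes>\<^bsub>A\<^esub> e) ` carrier A" if "y \<in> carrier A" "e \<otimes>\<^bsub>A\<^esub> y = y" "y \<otimes>\<^bsub>A\<^esub> e = y" for y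
    using that by (intro image_eqI[of _ _ y]) auto
  moreover have "e \<otimes>\<^bsub>A\<^esub> (e \<otimes>\<^bsub>A\<^esub> a \<otimes>\<^bsub>A\<^esub> e) = e \<otimes>\<^bsub>A\<^esub> a \<otimes>\<^bsub>A\<^esub> e" if "a \<in> carrier A" for a
    using that by (simp add: A.m_assoc[symmetric])
  ultimately show ?thesis
    by (auto simp: corner_def A.m_assoc)
qed

lemma corner_fd_algebra: "fd_algebra K eAe"
proof -
  have ag: "abelian_group eAe"
    by (rule sub_abelian_group[OF A.abelian_group_axioms])
      (auto simp: corner_simps carrier_corner A.l_distr A.r_distr A.l_minus A.r_minus)
  have mon: "monoid eAe"
    by (rule monoidI) (auto simp: corner_simps carrier_corner A.m_assoc[symmetric], auto simp: A.m_assoc)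
  have ring: "ring eAe"
    by (rule ringI[OF ag mon]) (auto simp: corner_simps carrier_corner A.l_distr A.r_distr)
  have "module K eAe"
    by (rule moduleI[OF K.is_cring ag])
      (auto simp: corner_simps carrier_corner V.smult_l_distr V.smult_r_distr V.smult_assoc1 smult_mult)
  moreover have "fin_dim K eAe"
  \<comment> \<open>The corner is the image of A under the linear map a |-> eae.\<close>
  proof (rule fin_dim_surj[OF V.module_axioms \<open>module K eAe\<close> fin_dim, of "\<lambda>a. e \<otimes>\<^bsub>A\<^esub> a \<otimes>\<^bsub>A\<^esub> e"])
    show "(\<lambda>a. e \<otimes>\<^bsub>A\<^esub> a \<otimes>\<^bsub>A\<^esub> e) \<in> add_hom A eAe"
      by (rule add_homI) (auto simp: corner_def A.r_distr A.l_distr)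
  qed (auto simp: corner_def smult_mult)
  ultimately show ?thesis
    using ring K.field_axioms
    by (auto simp: fd_algebra_def corner_simps carrier_corner smult_mult)
qed

lemma eA_abelian_group: "abelian_group eA"
  by (rule sub_abelian_group[OF A.abelian_group_axioms])
    (auto simp: carrier_eA A.r_distr A.r_minus simp del: mult_bimod_simps(1))

lemma Ae_abelian_group: "abelian_group Ae"
  by (rule sub_abelian_group[OF A.abelian_group_axioms])
    (auto simp: carrier_Ae A.l_distr A.l_minus simp del: mult_bimod_simps(1))

lemma eA_right_module: "right_module A eA"
  using eA_abelian_group unfolding right_module_def carrier_eA
  by (auto simp: A.l_distr A.r_distr A.m_assoc[symmetric])

lemma eA_left_module: "left_module eAe eA"
  using eA_abelian_group unfolding left_module_def carrier_eA carrier_corner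
  by (auto simp: A.l_distr A.r_distr A.m_assoc[symmetric] corner_simps)

lemma Ae_left_module: "left_module A Ae"
  using Ae_abelian_group unfolding left_module_def carrier_Ae
  by (auto simp: A.l_distr A.r_distr A.m_assoc)

lemma Ae_right_module: "right_module eAe Ae"
  using Ae_abelian_group unfolding right_module_def carrier_Ae carrier_corner
  by (auto simp: A.l_distr A.r_distr A.m_assoc corner_simps)

lemma Ae_mult: "a \<in> carrier A \<Longrightarrow> x \<in> carrier Ae \<Longrightarrow> a \<otimes>\<^bsub>A\<^esub> x \<in> carrier Ae"
  and eA_mult: "a \<in> carrier A \<Longrightarrow> y \<in> carrier eA \<Longrightarrow> y \<otimes>\<^bsub>A\<^esub> a \<in> carrier eA"
  and Ae_A: "x \<in> carrier Ae \<Longrightarrow> x \<in> carrier A" and eA_A: "y \<in> carrier eA \<Longrightarrow> y \<in> carrier A"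
  and Ae_e: "x \<in> carrier Ae \<Longrightarrow> x \<otimes>\<^bsub>A\<^esub> e = x" and eA_e: "y \<in> carrier eA \<Longrightarrow> e \<otimes>\<^bsub>A\<^esub> y = y"
  unfolding carrier_Ae carrier_eA by (auto simp: A.m_assoc[symmetric], auto simp: A.m_assoc)

end

section \<open>The dual of an algebra as a bimodule\<close>

lemma (in fd_alg) dual_bimodule: "bimodule K A A (dual_bimod K A)"
proof -
  let ?D = "dual_bimod K A"
  note ag = dual_bimod_abelian_group[OF V.module_axioms]
  have ext: "restrict \<phi> (carrier A) = \<phi>" if "\<phi> \<in> functionals K A" for \<phi>
    using functionalsD(2)[OF that] by (rule extensional_restrict)
  have l: "(\<lambda>x\<in>carrier A. \<phi> (x \<otimes>\<^bsub>A\<^esub> a)) \<in> functionals K A" if "\<phi> \<in> functionals K A" "a \<in> carrier A" for \<phi> a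
    using functionalsD(3-5)[OF that(1)] that(2)
    by (intro functionalsI) (auto simp: A.l_distr smult_mult)
  have r: "(\<lambda>x\<in>carrier A. \<phi> (a \<otimes>\<^bsub>A\<^esub> x)) \<in> functionals K A" if "\<phi> \<in> functionals K A" "a \<in> carrier A" for \<phi> a
    using functionalsD(3-5)[OF that(1)] that(2)
    by (intro functionalsI) (auto simp: A.r_distr smult_mult)
  have one: "(\<lambda>x\<in>carrier A. \<phi> (x \<otimes>\<^bsub>A\<^esub> \<one>\<^bsub>A\<^esub>)) = \<phi>" "(\<lambda>x\<in>carrier A. \<phi> (\<one>\<^bsub>A\<^esub> \<otimes>\<^bsub>A\<^esub> x)) = \<phi>"
    if "\<phi> \<in> functionals K A" for \<phi>
  proof -
    have "(\<lambda>x\<in>carrier A. \<phi> (x \<otimes>\<^bsub>A\<^esub> \<one>\<^bsub>A\<^esub>)) = restrict \<phi> (carrier A)"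
      "(\<lambda>x\<in>carrier A. \<phi> (\<one>\<^bsub>A\<^esub> \<otimes>\<^bsub>A\<^esub> x)) = restrict \<phi> (carrier A)"
      by (auto intro!: restrict_ext)
    then show "(\<lambda>x\<in>carrier A. \<phi> (x \<otimes>\<^bsub>A\<^esub> \<one>\<^bsub>A\<^esub>)) = \<phi>" "(\<lambda>x\<in>carrier A. \<phi> (\<one>\<^bsub>A\<^esub> \<otimes>\<^bsub>A\<^esub> x)) = \<phi>"
      unfolding ext[OF that] by auto
  qed
  have "left_module A ?D"
    unfolding left_module_def
    using ag l one(1) functionalsD(4)[of _ K A]
    by (auto simp: A.r_distr A.m_assoc intro!: restrict_ext)
  moreover have "right_module A ?D"
    unfolding right_module_def
    using ag r one(2) functionalsD(4)[of _ K A]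
    by (auto simp: A.l_distr A.m_assoc intro!: restrict_ext)
  ultimately show ?thesis
    by (auto simp: bimodule_def A.m_assoc sc_central intro!: restrict_ext)
qed


section \<open>Outer actions on tensor products, and tensor products of maps\<close>

context tensor_product
begin

context
  fixes S :: "('s, 'w) ring_scheme"
  assumes N_right: "right_module S N"
    and N_comm: "\<And>r n s. r \<in> carrier R \<Longrightarrow> n \<in> carrier N \<Longrightarrow> s \<in> carrier S \<Longrightarrow>
      (r \<triangleright>\<^bsub>N\<^esub> n) \<triangleleft>\<^bsub>N\<^esub> s = r \<triangleright>\<^bsub>N\<^esub> (n \<triangleleft>\<^bsub>N\<^esub> s)"
begin

lemma balanced_ract: "s \<in> carrier S \<Longrightarrow> balanced R M N T (\<lambda>m n. pure m (n \<triangleleft>\<^bsub>N\<^esub> s))"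
  using right_moduleD(2,3)[OF N_right]
  by (intro balancedI) (auto simp: pure_add_left pure_add_right pure_balanced N_comm)

lemma ract_pure:
  "m \<in> carrier M \<Longrightarrow> n \<in> carrier N \<Longrightarrow> s \<in> carrier S \<Longrightarrow> pure m n \<triangleleft>\<^bsub>T\<^esub> s = pure m (n \<triangleleft>\<^bsub>N\<^esub> s)"
  unfolding ract_tensor by (rule tensor_lift_pure[OF T.abelian_group_axioms balanced_ract])

lemma ract_add_hom: "s \<in> carrier S \<Longrightarrow> (\<lambda>t. t \<triangleleft>\<^bsub>T\<^esub> s) \<in> add_hom T T"
  unfolding ract_tensor using tensor_lift_add_hom[OF T.abelian_group_axioms balanced_ract]
  by (simp add: eta_contract_eq)

text \<open>Every axiom is an equation between two additive maps of t and is compared on pure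
  tensors, where it reduces to the corresponding axiom of N.\<close>

lemma tensor_right_module:
  assumes "ring S"
  shows "right_module S T"
proof -
  interpret S: ring S by fact
  note act = ract_add_hom
  note N = right_moduleD(2-)[OF N_right]
  have id: "(\<lambda>t. t) \<in> add_hom T T" by (rule add_homI) auto
  show ?thesis
    unfolding right_module_def
  proof (intro conjI ballI)
    fix t a b assume t: "t \<in> carrier T" and a: "a \<in> carrier S" and b: "b \<in> carrier S"
    have sum: "(\<lambda>t. t \<triangleleft>\<^bsub>T\<^esub> a \<oplus>\<^bsub>T\<^esub> t \<triangleleft>\<^bsub>T\<^esub> b) \<in> add_hom T T"
      using add_hom_closed[OF act[OF a]] add_hom_closed[OF act[OF b]]
        add_hom_add[OF act[OF a]] add_hom_add[OF act[OF b]]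
      by (intro add_homI) (auto simp: T.a_ac)
    show "t \<triangleleft>\<^bsub>T\<^esub> (a \<oplus>\<^bsub>S\<^esub> b) = t \<triangleleft>\<^bsub>T\<^esub> a \<oplus>\<^bsub>T\<^esub> t \<triangleleft>\<^bsub>T\<^esub> b"
      by (rule tensor_eqI[OF T.abelian_group_axioms act[OF S.a_closed[OF a b]] sum _ t])
        (use a b N in \<open>auto simp: ract_pure pure_add_right\<close>)
    show "t \<triangleleft>\<^bsub>T\<^esub> (a \<otimes>\<^bsub>S\<^esub> b) = t \<triangleleft>\<^bsub>T\<^esub> a \<triangleleft>\<^bsub>T\<^esub> b"
      by (rule tensor_eqI[OF T.abelian_group_axioms act[OF S.m_closed[OF a b]] 
          add_hom_compose[OF act[OF a] act[OF b]] _ t])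
        (use a b N in \<open>auto simp: ract_pure\<close>)
  next
    fix t assume t: "t \<in> carrier T"
    show "t \<triangleleft>\<^bsub>T\<^esub> \<one>\<^bsub>S\<^esub> = t"
      by (rule tensor_eqI[OF T.abelian_group_axioms act[OF S.one_closed] id _ t])
        (use N in \<open>auto simp: ract_pure\<close>)
  qed (use T.abelian_group_axioms add_hom_closed[OF act] add_hom_add[OF act] in auto)
qed

end

context
  fixes S :: "('l, 'w) ring_scheme"
  assumes M_left: "left_module S M"
    and M_comm: "\<And>r m s. r \<in> carrier R \<Longrightarrow> m \<in> carrier M \<Longrightarrow> s \<in> carrier S \<Longrightarrow>
      (s \<triangleright>\<^bsub>M\<^esub> m) \<triangleleft>\<^bsub>M\<^esub> r = s \<triangleright>\<^bsub>M\<^esub> (m \<triangleleft>\<^bsub>M\<^esub> r)"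
begin

lemma balanced_lact: "s \<in> carrier S \<Longrightarrow> balanced R M N T (\<lambda>m n. pure (s \<triangleright>\<^bsub>M\<^esub> m) n)"
  using left_moduleD(2,3)[OF M_left]
  by (intro balancedI) (auto simp: pure_add_left pure_add_right pure_balanced M_comm[symmetric])

lemma lact_pure:
  "m \<in> carrier M \<Longrightarrow> n \<in> carrier N \<Longrightarrow> s \<in> carrier S \<Longrightarrow> s \<triangleright>\<^bsub>T\<^esub> pure m n = pure (s \<triangleright>\<^bsub>M\<^esub> m) n"
  unfolding lact_tensor by (rule tensor_lift_pure[OF T.abelian_group_axioms balanced_lact])

lemma lact_add_hom: "s \<in> carrier S \<Longrightarrow> (\<lambda>t. s \<triangleright>\<^bsub>T\<^esub> t) \<in> add_hom T T"
  unfolding lact_tensor using tensor_lift_add_hom[OF T.abelian_group_axioms balanced_lact]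
  by (simp add: eta_contract_eq)

end

end


lemma (in tensor_product) tensor_left_module:
  assumes S: "ring S" and M_left: "left_module S M"
    and M_comm: "\<And>r m s. r \<in> carrier R \<Longrightarrow> m \<in> carrier M \<Longrightarrow> s \<in> carrier S \<Longrightarrow>
      (s \<triangleright>\<^bsub>M\<^esub> m) \<triangleleft>\<^bsub>M\<^esub> r = s \<triangleright>\<^bsub>M\<^esub> (m \<triangleleft>\<^bsub>M\<^esub> r)"
  shows "left_module S T"
proof -
  interpret S: ring S by fact
  have act: "(\<lambda>t. s \<triangleright>\<^bsub>T\<^esub> t) \<in> add_hom T T" if "s \<in> carrier S" for s
    by (rule lact_add_hom[OF M_left _ that]) (rule M_comm)
  have pure: "s \<triangleright>\<^bsub>T\<^esub> pure m n = pure (s \<triangleright>\<^bsub>M\<^esub> m) n"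
    if "m \<in> carrier M" "n \<in> carrier N" "s \<in> carrier S" for s m n
    by (rule lact_pure[OF M_left _ that]) (rule M_comm)
  note M = left_moduleD(2-)[OF M_left]
  have id: "(\<lambda>t. t) \<in> add_hom T T" by (rule add_homI) auto
  show ?thesis
    unfolding left_module_def
  proof (intro conjI ballI)
    fix t a b assume t: "t \<in> carrier T" and a: "a \<in> carrier S" and b: "b \<in> carrier S"
    have sum: "(\<lambda>t. a \<triangleright>\<^bsub>T\<^esub> t \<oplus>\<^bsub>T\<^esub> b \<triangleright>\<^bsub>T\<^esub> t) \<in> add_hom T T"
      using add_hom_closed[OF act[OF a]] add_hom_closed[OF act[OF b]]
        add_hom_add[OF act[OF a]] add_hom_add[OF act[OF b]]
      by (intro add_homI) (auto simp: T.a_ac)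
    show "(a \<oplus>\<^bsub>S\<^esub> b) \<triangleright>\<^bsub>T\<^esub> t = a \<triangleright>\<^bsub>T\<^esub> t \<oplus>\<^bsub>T\<^esub> b \<triangleright>\<^bsub>T\<^esub> t"
      by (rule tensor_eqI[OF T.abelian_group_axioms act[OF S.a_closed[OF a b]] sum _ t])
        (use a b M in \<open>auto simp: pure pure_add_left\<close>)
    show "(a \<otimes>\<^bsub>S\<^esub> b) \<triangleright>\<^bsub>T\<^esub> t = a \<triangleright>\<^bsub>T\<^esub> (b \<triangleright>\<^bsub>T\<^esub> t)"
      by (rule tensor_eqI[OF T.abelian_group_axioms act[OF S.m_closed[OF a b]]
          add_hom_compose[OF act[OF b] act[OF a]] _ t])
        (use a b M in \<open>auto simp: pure\<close>)
  next
    fix t assume t: "t \<in> carrier T"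
    show "\<one>\<^bsub>S\<^esub> \<triangleright>\<^bsub>T\<^esub> t = t"
      by (rule tensor_eqI[OF T.abelian_group_axioms act[OF S.one_closed] id _ t])
        (use M in \<open>auto simp: pure\<close>)
  qed (use T.abelian_group_axioms add_hom_closed[OF act] add_hom_add[OF act] in auto)
qed

lemma (in tensor_product) tensor_map_hom:
  assumes "tensor_product R M' N'" "f \<in> add_hom M M'" "g \<in> add_hom N N'"
    and "\<And>m r. m \<in> carrier M \<Longrightarrow> r \<in> carrier R \<Longrightarrow> f (m \<triangleleft>\<^bsub>M\<^esub> r) = f m \<triangleleft>\<^bsub>M'\<^esub> r"
    and "\<And>n r. n \<in> carrier N \<Longrightarrow> r \<in> carrier R \<Longrightarrow> g (r \<triangleright>\<^bsub>N\<^esub> n) = r \<triangleright>\<^bsub>N'\<^esub> g n"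
  shows "tensor_map R M' N' f g \<in> add_hom T (tensor R M' N')"
    and "\<And>m n. m \<in> carrier M \<Longrightarrow> n \<in> carrier N \<Longrightarrow>
      tensor_map R M' N' f g (pure m n) = pure_tensor R M' N' (f m) (g n)"
proof -
  interpret T': tensor_product R M' N' by fact
  have bal: "balanced R M N T'.T (\<lambda>m n. T'.pure (f m) (g n))"
    by (rule balancedI) (use assms(4,5) add_hom_closed[OF assms(2)] add_hom_closed[OF assms(3)]
      add_hom_add[OF assms(2)] add_hom_add[OF assms(3)] in
      \<open>auto simp: T'.pure_add_left T'.pure_add_right T'.pure_balanced\<close>)
  show "tensor_map R M' N' f g \<in> add_hom T (tensor R M' N')"
    unfolding tensor_map_def by (rule tensor_lift_add_hom[OF T'.T.abelian_group_axioms bal])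
  show "tensor_map R M' N' f g (pure m n) = pure_tensor R M' N' (f m) (g n)"
    if "m \<in> carrier M" "n \<in> carrier N" for m n
    unfolding tensor_map_def by (rule tensor_lift_pure[OF T'.T.abelian_group_axioms bal that])
qed


section \<open>Copies of modules in large types\<close>

text \<open>Structure carried along an injection. Outside the image of \<open>\<iota>\<close> the
  operations take arbitrary values, which the module axioms do not see.\<close>

definition transport :: "('m \<Rightarrow> 'n) \<Rightarrow> ('r, 'm, 'y) rmod_scheme \<Rightarrow> ('r, 'n) rmod" where
  "transport \<iota> M = \<lparr>carrier = \<iota> ` carrier M, monoid.mult = undefined, one = undefined,
     ring.zero = \<iota> \<zero>\<^bsub>M\<^esub>,
     ring.add = (\<lambda>x y. \<iota> (inv_into (carrier M) \<iota> x \<oplus>\<^bsub>M\<^esub> inv_into (carrier M) \<iota> y)),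
     ract = (\<lambda>x r. \<iota> (inv_into (carrier M) \<iota> x \<triangleleft>\<^bsub>M\<^esub> r))\<rparr>"

lemma transport_simps:
  assumes "inj_on \<iota> (carrier M)"
  shows "carrier (transport \<iota> M) = \<iota> ` carrier M" "\<zero>\<^bsub>transport \<iota> M\<^esub> = \<iota> \<zero>\<^bsub>M\<^esub>"
    and "\<And>x y. x \<in> carrier M \<Longrightarrow> y \<in> carrier M \<Longrightarrow> \<iota> x \<oplus>\<^bsub>transport \<iota> M\<^esub> \<iota> y = \<iota> (x \<oplus>\<^bsub>M\<^esub> y)"
    and "\<And>x r. x \<in> carrier M \<Longrightarrow> \<iota> x \<triangleleft>\<^bsub>transport \<iota> M\<^esub> r = \<iota> (x \<triangleleft>\<^bsub>M\<^esub> r)"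
  using assms by (simp_all add: transport_def)

lemma right_module_transport:
  assumes M: "right_module R M" and inj: "inj_on \<iota> (carrier M)"
  shows "right_module R (transport \<iota> M)"
proof -
  interpret M: abelian_group M using right_moduleD(1)[OF M] .
  note S = transport_simps[OF inj]
  note R = right_moduleD(2-)[OF M]
  have "abelian_group (transport \<iota> M)"
  proof (rule abelian_groupI, unfold S(1))
    fix x assume "x \<in> \<iota> ` carrier M"
    then obtain m where m: "m \<in> carrier M" "x = \<iota> m" by blast
    show "\<exists>y\<in>\<iota> ` carrier M. y \<oplus>\<^bsub>transport \<iota> M\<^esub> x = \<zero>\<^bsub>transport \<iota> M\<^esub>"
      using m by (intro bexI[of _ "\<iota> (\<ominus>\<^bsub>M\<^esub> m)"]) (auto simp: S M.l_neg)
  qed (auto simp: S M.a_ac)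
  then show ?thesis
    unfolding right_module_def S(1) using R by (auto simp: S)
qed

text \<open>Choose coefficients for each vector with respect to a finite spanning list. The
  coefficient list determines the vector, so M injects into the lists over K and from there into
  \<open>'n\<close>. Linear independence is irrelevant, since the choice only has to be injective,
  not linear.\<close>

lemma exists_copy:
  fixes K :: "('k, 'c) ring_scheme" and R :: "('k, 'r, 'x) module_scheme" and M :: "('r, 'm, 'y) rmod_scheme"
  assumes "fd_alg K R" "fd_right_module K R M" "large_type TYPE('n) K"
  obtains N :: "('r, 'n) rmod" and \<kappa> where "fd_right_module K R N" "\<kappa> \<in> rhom R M N"
    "bij_betw \<kappa> (carrier M) (carrier N)"
proof -
  interpret fd_alg K R by fact
  have M: "right_module R M" using assms(2) by (simp add: fd_right_module_def)
  interpret M: module K "scalar_space R M" using scalar_space_module[OF M] .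
  interpret MM: abelian_group M using right_moduleD(1)[OF M] .
  obtain \<iota> :: "'k list \<Rightarrow> 'n" where \<iota>: "inj_on \<iota> (lists (carrier K))"
    using assms(3) by (auto simp: large_type_def)
  obtain S where S: "finite S" "S \<subseteq> carrier M"
    "\<forall>v\<in>carrier M. \<exists>c\<in>S \<rightarrow> carrier K. v = (\<Oplus>\<^bsub>scalar_space R M\<^esub>s\<in>S. c s \<odot>\<^bsub>scalar_space R M\<^esub> s)"
    using assms(2) by (auto simp: fd_right_module_def fin_dim_def)
  obtain c where c: "\<And>v. v \<in> carrier M \<Longrightarrow> c v \<in> S \<rightarrow> carrier K \<and>
      v = (\<Oplus>\<^bsub>scalar_space R M\<^esub>s\<in>S. c v s \<odot>\<^bsub>scalar_space R M\<^esub> s)"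
    using bchoice[OF S(3)[unfolded Bex_def]] by blast
  obtain xs where xs: "set xs = S" using finite_list[OF S(1)] by blast
  define j where "j v = \<iota> (map (c v) xs)" for v
  have inj: "inj_on j (carrier M)"
  proof (rule inj_onI)
    fix v w assume v: "v \<in> carrier M" and w: "w \<in> carrier M" and eq: "j v = j w"
    have "map (c v) xs \<in> lists (carrier K)" "map (c w) xs \<in> lists (carrier K)"
      using c[OF v] c[OF w] xs by auto
    then have "map (c v) xs = map (c w) xs"
      using eq \<iota> by (auto simp: j_def dest: inj_onD)
    then have same: "c v s = c w s" if "s \<in> S" for s using that xs by auto
    have "(\<Oplus>\<^bsub>scalar_space R M\<^esub>s\<in>S. c v s \<odot>\<^bsub>scalar_space R M\<^esub> s) =
        (\<Oplus>\<^bsub>scalar_space R M\<^esub>s\<in>S. c w s \<odot>\<^bsub>scalar_space R M\<^esub> s)"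
    proof (rule M.finsum_cong')
      show "(\<lambda>s. c w s \<odot>\<^bsub>scalar_space R M\<^esub> s) \<in> S \<rightarrow> carrier (scalar_space R M)"
        using c[OF w] S(2) by (intro Pi_I M.smult_closed) auto
    qed (use same in auto)
    then show "v = w" using c[OF v] c[OF w] by simp
  qed
  let ?N = "transport j M"
  note T = transport_simps[OF inj]
  have N: "right_module R ?N" by (rule right_module_transport[OF M inj])
  let ?k = "restrict j (carrier M)"
  have k: "?k \<in> rhom R M ?N"
    by (rule rhomI) (use right_moduleD(2)[OF M] in \<open>auto simp: T\<close>)
  have "fin_dim K (scalar_space R ?N)"
    by (rule fin_dim_surj[OF M.module_axioms scalar_space_module[OF N], of j])
      (use assms(2) right_moduleD(2)[OF M] in \<open>auto simp: fd_right_module_def add_hom_def T\<close>)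
  moreover have "bij_betw ?k (carrier M) (carrier ?N)"
    using inj by (auto simp: bij_betw_def T inj_on_def)
  ultimately show ?thesis using that k N by (auto simp: fd_right_module_def)
qed

section \<open>Equivalences of linear categories\<close>

lemma linear_categoryD:
  assumes K: "field K" and C: "linear_category K C"
  shows "\<And>X Y. X \<in> Obj C \<Longrightarrow> Y \<in> Obj C \<Longrightarrow> module K (Hom C X Y)"
    and "\<And>X. X \<in> Obj C \<Longrightarrow> Ident C X \<in> Mor C X X"
    and "\<And>X Y Z f g. X \<in> Obj C \<Longrightarrow> Y \<in> Obj C \<Longrightarrow> Z \<in> Obj C \<Longrightarrow> f \<in> Mor C X Y \<Longrightarrow> g \<in> Mor C Y Z \<Longrightarrow>
      Comp C X Y Z g f \<in> Mor C X Z"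
    and "\<And>X Y f. X \<in> Obj C \<Longrightarrow> Y \<in> Obj C \<Longrightarrow> f \<in> Mor C X Y \<Longrightarrow> Comp C X X Y f (Ident C X) = f"
    and "\<And>X Y f. X \<in> Obj C \<Longrightarrow> Y \<in> Obj C \<Longrightarrow> f \<in> Mor C X Y \<Longrightarrow> Comp C X Y Y (Ident C Y) f = f"
    and "\<And>W X Y Z f g h. W \<in> Obj C \<Longrightarrow> X \<in> Obj C \<Longrightarrow> Y \<in> Obj C \<Longrightarrow> Z \<in> Obj C \<Longrightarrow>
      f \<in> Mor C W X \<Longrightarrow> g \<in> Mor C X Y \<Longrightarrow> h \<in> Mor C Y Z \<Longrightarrow>
      Comp C W Y Z h (Comp C W X Y g f) = Comp C W X Z (Comp C X Y Z h g) f"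
    and "\<And>X Y Z f f' g. X \<in> Obj C \<Longrightarrow> Y \<in> Obj C \<Longrightarrow> Z \<in> Obj C \<Longrightarrow>
      f \<in> Mor C X Y \<Longrightarrow> f' \<in> Mor C X Y \<Longrightarrow> g \<in> Mor C Y Z \<Longrightarrow>
      Comp C X Y Z g (f \<oplus>\<^bsub>Hom C X Y\<^esub> f') = Comp C X Y Z g f \<oplus>\<^bsub>Hom C X Z\<^esub> Comp C X Y Z g f'"
    and "\<And>X Y Z f g g'. X \<in> Obj C \<Longrightarrow> Y \<in> Obj C \<Longrightarrow> Z \<in> Obj C \<Longrightarrow>
      f \<in> Mor C X Y \<Longrightarrow> g \<in> Mor C Y Z \<Longrightarrow> g' \<in> Mor C Y Z \<Longrightarrow>
      Comp C X Y Z (g \<oplus>\<^bsub>Hom C Y Z\<^esub> g') f = Comp C X Y Z g f \<oplus>\<^bsub>Hom C X Z\<^esub> Comp C X Y Z g' f"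
    and "\<And>X Y Z k f g. X \<in> Obj C \<Longrightarrow> Y \<in> Obj C \<Longrightarrow> Z \<in> Obj C \<Longrightarrow> k \<in> carrier K \<Longrightarrow>
      f \<in> Mor C X Y \<Longrightarrow> g \<in> Mor C Y Z \<Longrightarrow>
      Comp C X Y Z g (k \<odot>\<^bsub>Hom C X Y\<^esub> f) = k \<odot>\<^bsub>Hom C X Z\<^esub> Comp C X Y Z g f"
    and "\<And>X Y Z k f g. X \<in> Obj C \<Longrightarrow> Y \<in> Obj C \<Longrightarrow> Z \<in> Obj C \<Longrightarrow> k \<in> carrier K \<Longrightarrow>
      f \<in> Mor C X Y \<Longrightarrow> g \<in> Mor C Y Z \<Longrightarrow>
      Comp C X Y Z (k \<odot>\<^bsub>Hom C Y Z\<^esub> g) f = k \<odot>\<^bsub>Hom C X Z\<^esub> Comp C X Y Z g f"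
proof -
  interpret K: field K by fact
  have bilin: "\<forall>X\<in>Obj C. \<forall>Y\<in>Obj C. \<forall>Z\<in>Obj C.
      \<forall>f\<in>Mor C X Y. \<forall>f'\<in>Mor C X Y. \<forall>g\<in>Mor C Y Z. \<forall>g'\<in>Mor C Y Z. \<forall>k\<in>carrier K.
        Comp C X Y Z g (f \<oplus>\<^bsub>Hom C X Y\<^esub> f') = Comp C X Y Z g f \<oplus>\<^bsub>Hom C X Z\<^esub> Comp C X Y Z g f' \<and>
        Comp C X Y Z (g \<oplus>\<^bsub>Hom C Y Z\<^esub> g') f = Comp C X Y Z g f \<oplus>\<^bsub>Hom C X Z\<^esub> Comp C X Y Z g' f \<and>
        Comp C X Y Z g (k \<odot>\<^bsub>Hom C X Y\<^esub> f) = k \<odot>\<^bsub>Hom C X Z\<^esub> Comp C X Y Z g f \<and>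
        Comp C X Y Z (k \<odot>\<^bsub>Hom C Y Z\<^esub> g) f = k \<odot>\<^bsub>Hom C X Z\<^esub> Comp C X Y Z g f"
    using C unfolding linear_category_def by (elim conjE)
  \<comment> \<open>The clause in the definition quantifies at once over both pairs of morphisms and
    a scalar. The zero scalar, and one morphism used twice, instantiate the variables absent from a
    given law.\<close>
  note b = bilin[rule_format, OF _ _ _ _ _ _ _ K.zero_closed]
  show "Comp C X Y Z g (f \<oplus>\<^bsub>Hom C X Y\<^esub> f') = Comp C X Y Z g f \<oplus>\<^bsub>Hom C X Z\<^esub> Comp C X Y Z g f'"
    if "X \<in> Obj C" "Y \<in> Obj C" "Z \<in> Obj C" "f \<in> Mor C X Y" "f' \<in> Mor C X Y" "g \<in> Mor C Y Z"
    for X Y Z f f' g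
    using b[OF that that(6)] by simp
  show "Comp C X Y Z (g \<oplus>\<^bsub>Hom C Y Z\<^esub> g') f = Comp C X Y Z g f \<oplus>\<^bsub>Hom C X Z\<^esub> Comp C X Y Z g' f"
    if "X \<in> Obj C" "Y \<in> Obj C" "Z \<in> Obj C" "f \<in> Mor C X Y" "g \<in> Mor C Y Z" "g' \<in> Mor C Y Z"
    for X Y Z f g g'
    using b[OF that(1-4,4-6)] by simp
qed (use C in \<open>simp_all add: linear_category_def\<close>)

lemma linear_functorD:
  assumes K: "field K" and F: "linear_functor K C D F F1"
  shows "\<And>X. X \<in> Obj C \<Longrightarrow> F X \<in> Obj D"
    and "\<And>X Y f. X \<in> Obj C \<Longrightarrow> Y \<in> Obj C \<Longrightarrow> f \<in> Mor C X Y \<Longrightarrow> F1 X Y f \<in> Mor D (F X) (F Y)"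
    and "\<And>X Y f g. X \<in> Obj C \<Longrightarrow> Y \<in> Obj C \<Longrightarrow> f \<in> Mor C X Y \<Longrightarrow> g \<in> Mor C X Y \<Longrightarrow>
      F1 X Y (f \<oplus>\<^bsub>Hom C X Y\<^esub> g) = F1 X Y f \<oplus>\<^bsub>Hom D (F X) (F Y)\<^esub> F1 X Y g"
    and "\<And>X Y f k. X \<in> Obj C \<Longrightarrow> Y \<in> Obj C \<Longrightarrow> f \<in> Mor C X Y \<Longrightarrow> k \<in> carrier K \<Longrightarrow>
      F1 X Y (k \<odot>\<^bsub>Hom C X Y\<^esub> f) = k \<odot>\<^bsub>Hom D (F X) (F Y)\<^esub> F1 X Y f"
    and "\<And>X. X \<in> Obj C \<Longrightarrow> F1 X X (Ident C X) = Ident D (F X)"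
    and "\<And>X Y Z f g. X \<in> Obj C \<Longrightarrow> Y \<in> Obj C \<Longrightarrow> Z \<in> Obj C \<Longrightarrow> f \<in> Mor C X Y \<Longrightarrow> g \<in> Mor C Y Z \<Longrightarrow>
      F1 X Z (Comp C X Y Z g f) = Comp D (F X) (F Y) (F Z) (F1 Y Z g) (F1 X Y f)"
proof -
  interpret K: field K by fact
  have lin: "\<forall>X\<in>Obj C. \<forall>Y\<in>Obj C. \<forall>f\<in>Mor C X Y. \<forall>g\<in>Mor C X Y. \<forall>k\<in>carrier K.
      F1 X Y (f \<oplus>\<^bsub>Hom C X Y\<^esub> g) = F1 X Y f \<oplus>\<^bsub>Hom D (F X) (F Y)\<^esub> F1 X Y g \<and>
      F1 X Y (k \<odot>\<^bsub>Hom C X Y\<^esub> f) = k \<odot>\<^bsub>Hom D (F X) (F Y)\<^esub> F1 X Y f"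
    using F unfolding linear_functor_def by (elim conjE)
  note l = lin[rule_format, OF _ _ _ _ K.zero_closed]
  show "F1 X Y (f \<oplus>\<^bsub>Hom C X Y\<^esub> g) = F1 X Y f \<oplus>\<^bsub>Hom D (F X) (F Y)\<^esub> F1 X Y g"
    if "X \<in> Obj C" "Y \<in> Obj C" "f \<in> Mor C X Y" "g \<in> Mor C X Y" for X Y f g
    using l[OF that] by simp
  show "F1 X Y (k \<odot>\<^bsub>Hom C X Y\<^esub> f) = k \<odot>\<^bsub>Hom D (F X) (F Y)\<^esub> F1 X Y f"
    if "X \<in> Obj C" "Y \<in> Obj C" "f \<in> Mor C X Y" "k \<in> carrier K" for X Y f k
    using lin[rule_format, OF that(1-3,3,4)] by simp
qed (use F in \<open>simp_all add: linear_functor_def\<close>)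

text \<open>The quasi-inverse is built by choice: G Y comes with mutually inverse
  \<open>\<epsilon> Y\<close> : F (G Y) \<rightarrow> Y and \<open>\<delta> Y\<close>, and G sends a
  morphism h to the preimage under F of \<delta> h \<epsilon>. Equations between morphisms of C are
  verified after applying F, which is injective on morphisms.\<close>

lemma equivalent_linear_categoriesI:
  assumes C: "linear_category K C" and D: "linear_category K D" and F: "linear_functor K C D F F1"
    and K: "field K"
    and ff: "\<And>X Y. X \<in> Obj C \<Longrightarrow> Y \<in> Obj C \<Longrightarrow> bij_betw (F1 X Y) (Mor C X Y) (Mor D (F X) (F Y))"
    and es: "\<And>Y. Y \<in> Obj D \<Longrightarrow> \<exists>X\<in>Obj C. \<exists>f. cat_iso D (F X) Y f"
  shows "equivalent_linear_categories K C D"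
proof -
  interpret K: field K by fact
  note CD = linear_categoryD[OF K C]
  note DD = linear_categoryD[OF K D]
  note FD = linear_functorD[OF K F]
  have "\<forall>Y\<in>Obj D. \<exists>X f g. X \<in> Obj C \<and> f \<in> Mor D (F X) Y \<and> g \<in> Mor D Y (F X) \<and>
      Comp D (F X) Y (F X) g f = Ident D (F X) \<and> Comp D Y (F X) Y f g = Ident D Y"
    using es unfolding cat_iso_def by blast
  then obtain G \<epsilon> \<delta> where G: "\<And>Y. Y \<in> Obj D \<Longrightarrow> G Y \<in> Obj C \<and> \<epsilon> Y \<in> Mor D (F (G Y)) Y \<and>
      \<delta> Y \<in> Mor D Y (F (G Y)) \<and> Comp D (F (G Y)) Y (F (G Y)) (\<delta> Y) (\<epsilon> Y) = Ident D (F (G Y)) \<and>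
      Comp D Y (F (G Y)) Y (\<epsilon> Y) (\<delta> Y) = Ident D Y"
    by metis
  have GC: "\<And>Y. Y \<in> Obj D \<Longrightarrow> G Y \<in> Obj C" and \<epsilon>: "\<And>Y. Y \<in> Obj D \<Longrightarrow> \<epsilon> Y \<in> Mor D (F (G Y)) Y"
    and \<delta>: "\<And>Y. Y \<in> Obj D \<Longrightarrow> \<delta> Y \<in> Mor D Y (F (G Y))"
    and \<delta>\<epsilon>: "\<And>Y. Y \<in> Obj D \<Longrightarrow> Comp D (F (G Y)) Y (F (G Y)) (\<delta> Y) (\<epsilon> Y) = Ident D (F (G Y))"
    and \<epsilon>\<delta>: "\<And>Y. Y \<in> Obj D \<Longrightarrow> Comp D Y (F (G Y)) Y (\<epsilon> Y) (\<delta> Y) = Ident D Y"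
    using G by auto
  have FG: "\<And>Y. Y \<in> Obj D \<Longrightarrow> F (G Y) \<in> Obj D" using GC FD(1) by auto
  define cnj where "cnj X Y h = Comp D (F (G X)) Y (F (G Y)) (\<delta> Y) (Comp D (F (G X)) X Y h (\<epsilon> X))" for X Y h
  define preim where "preim X Y = inv_into (Mor C X Y) (F1 X Y)" for X Y
  define G1 where "G1 X Y h = preim (G X) (G Y) (cnj X Y h)" for X Y h
  have preim: "preim X Y h \<in> Mor C X Y" "F1 X Y (preim X Y h) = h"
    if "X \<in> Obj C" "Y \<in> Obj C" "h \<in> Mor D (F X) (F Y)" for X Y h
    using ff[OF that(1,2)] that(3) inv_into_into[of h "F1 X Y" "Mor C X Y"]
      f_inv_into_f[of h "F1 X Y" "Mor C X Y"]
    by (auto simp: preim_def bij_betw_def)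
  have inj: "f = g" if "X \<in> Obj C" "Y \<in> Obj C" "f \<in> Mor C X Y" "g \<in> Mor C X Y" "F1 X Y f = F1 X Y g"
    for X Y f g
    using ff[OF that(1,2)] that(3-5) by (auto simp: bij_betw_def inj_on_def)
  have he: "Comp D (F (G X)) X Y h (\<epsilon> X) \<in> Mor D (F (G X)) Y"
    if "X \<in> Obj D" "Y \<in> Obj D" "h \<in> Mor D X Y" for X Y h
    using that FG \<epsilon> by (intro DD(3)) auto
  have cnj: "cnj X Y h \<in> Mor D (F (G X)) (F (G Y))" if "X \<in> Obj D" "Y \<in> Obj D" "h \<in> Mor D X Y" for X Y h
    unfolding cnj_def by (rule DD(3)) (use that FG \<delta> he in auto)
  have G1: "G1 X Y h \<in> Mor C (G X) (G Y)" "F1 (G X) (G Y) (G1 X Y h) = cnj X Y h"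
    if "X \<in> Obj D" "Y \<in> Obj D" "h \<in> Mor D X Y" for X Y h
    unfolding G1_def using preim[OF GC GC cnj] that by auto
  \<comment> \<open>Naturality of \<open>\<epsilon>\<close>. It proves that conjugation respects
    composition, and it reappears in both natural isomorphisms.\<close>
  have ecnj: "Comp D (F (G X)) (F (G Y)) Y (\<epsilon> Y) (cnj X Y h) = Comp D (F (G X)) X Y h (\<epsilon> X)"
    if "X \<in> Obj D" "Y \<in> Obj D" "h \<in> Mor D X Y" for X Y h
    unfolding cnj_def using that FG \<epsilon> \<delta> he DD(5) by (subst DD(6)) (auto simp: \<epsilon>\<delta>)
  have functorG: "linear_functor K D C G G1"
    unfolding linear_functor_def
  proof (intro conjI ballI)
    fix X Y h assume X: "X \<in> Obj D" and Y: "Y \<in> Obj D" and h: "h \<in> Mor D X Y"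
    show "G1 X Y h \<in> Mor C (G X) (G Y)" by (rule G1(1)[OF X Y h])
    fix h' k assume h': "h' \<in> Mor D X Y" and k: "k \<in> carrier K"
    interpret DXY: module K "Hom D X Y" by (rule DD(1)[OF X Y])
    interpret CXY: module K "Hom C (G X) (G Y)" by (rule CD(1)[OF GC[OF X] GC[OF Y]])
    note g = G1(1)[OF X Y h] G1(1)[OF X Y h']
    show "G1 X Y (h \<oplus>\<^bsub>Hom D X Y\<^esub> h') = G1 X Y h \<oplus>\<^bsub>Hom C (G X) (G Y)\<^esub> G1 X Y h'"
    proof (rule inj[OF GC[OF X] GC[OF Y]])
      show "F1 (G X) (G Y) (G1 X Y (h \<oplus>\<^bsub>Hom D X Y\<^esub> h')) = F1 (G X) (G Y) (G1 X Y h \<oplus>\<^bsub>Hom C (G X) (G Y)\<^esub> G1 X Y h')"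
        using X Y h h' g by (simp add: FD(3) GC G1 cnj_def DD(7,8) FG \<epsilon> \<delta> he)
    qed (use g X Y h h' G1(1) in auto)
    show "G1 X Y (k \<odot>\<^bsub>Hom D X Y\<^esub> h) = k \<odot>\<^bsub>Hom C (G X) (G Y)\<^esub> G1 X Y h"
    proof (rule inj[OF GC[OF X] GC[OF Y]])
      show "F1 (G X) (G Y) (G1 X Y (k \<odot>\<^bsub>Hom D X Y\<^esub> h)) = F1 (G X) (G Y) (k \<odot>\<^bsub>Hom C (G X) (G Y)\<^esub> G1 X Y h)"
        using X Y h k g by (simp add: FD(4) GC G1 cnj_def DD(9,10) FG \<epsilon> \<delta> he)
    qed (use g X Y h k G1(1) in auto)
  next
    fix X assume X: "X \<in> Obj D"
    show "G X \<in> Obj C" by (rule GC[OF X])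
    show "G1 X X (Ident D X) = Ident C (G X)"
    proof (rule inj[OF GC[OF X] GC[OF X]])
      show "F1 (G X) (G X) (G1 X X (Ident D X)) = F1 (G X) (G X) (Ident C (G X))"
        using X by (simp add: G1 DD(2) FD(5) GC cnj_def DD(5) FG \<epsilon> \<delta>\<epsilon>)
    qed (use X G1(1) DD(2) CD(2) GC in auto)
  next
    fix X Y Z f g assume X: "X \<in> Obj D" and Y: "Y \<in> Obj D" and Z: "Z \<in> Obj D"
      and f: "f \<in> Mor D X Y" and g: "g \<in> Mor D Y Z"
    have gf: "Comp D X Y Z g f \<in> Mor D X Z" by (rule DD(3)[OF X Y Z f g])
    have ge: "Comp D (F (G Y)) Y Z g (\<epsilon> Y) \<in> Mor D (F (G Y)) Z" by (rule he[OF Y Z g])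
    show "G1 X Z (Comp D X Y Z g f) = Comp C (G X) (G Y) (G Z) (G1 Y Z g) (G1 X Y f)"
    proof (rule inj[OF GC[OF X] GC[OF Z]])
      have "cnj X Z (Comp D X Y Z g f) =
          Comp D (F (G X)) Z (F (G Z)) (\<delta> Z) (Comp D (F (G X)) Y Z g (Comp D (F (G X)) X Y f (\<epsilon> X)))"
        unfolding cnj_def by (subst DD(6)[OF FG[OF X] X Y Z \<epsilon>[OF X] f g]) simp
      also have "\<dots> = Comp D (F (G X)) Z (F (G Z)) (\<delta> Z)
          (Comp D (F (G X)) Y Z g (Comp D (F (G X)) (F (G Y)) Y (\<epsilon> Y) (cnj X Y f)))"
        using ecnj[OF X Y f] by simp
      also have "\<dots> = Comp D (F (G X)) Z (F (G Z)) (\<delta> Z)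
          (Comp D (F (G X)) (F (G Y)) Z (Comp D (F (G Y)) Y Z g (\<epsilon> Y)) (cnj X Y f))"
        by (subst DD(6)[OF FG[OF X] FG[OF Y] Y Z cnj[OF X Y f] \<epsilon>[OF Y] g]) simp
      also have "\<dots> = Comp D (F (G X)) (F (G Y)) (F (G Z)) (cnj Y Z g) (cnj X Y f)"
        unfolding cnj_def[of Y Z g]
        by (rule DD(6)[OF FG[OF X] FG[OF Y] Z FG[OF Z] cnj[OF X Y f] ge \<delta>[OF Z]])
      finally show "F1 (G X) (G Z) (G1 X Z (Comp D X Y Z g f)) =
          F1 (G X) (G Z) (Comp C (G X) (G Y) (G Z) (G1 Y Z g) (G1 X Y f))"
        using X Y Z f g gf by (simp add: G1 FD(6) GC)
    qed (use X Y Z f g gf G1(1) CD(3) GC in auto)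
  qed
  have natD: "naturally_isomorphic D D (\<lambda>X. F (G X)) (\<lambda>X Y f. F1 (G X) (G Y) (G1 X Y f)) (\<lambda>X. X) (\<lambda>X Y f. f)"
    unfolding naturally_isomorphic_def cat_iso_def
    by (intro exI[of _ \<epsilon>] conjI ballI) (use \<epsilon> \<delta>\<epsilon> \<epsilon>\<delta> G1 ecnj in \<open>auto intro!: bexI[OF _ \<delta>]\<close>)
  \<comment> \<open>The unit is obtained by lifting the counit at F X along the fully faithful
    functor F.\<close>
  define \<eta> where "\<eta> X = preim (G (F X)) X (\<epsilon> (F X))" for X
  define \<eta>' where "\<eta>' X = preim X (G (F X)) (\<delta> (F X))" for X
  have \<eta>: "\<eta> X \<in> Mor C (G (F X)) X" "F1 (G (F X)) X (\<eta> X) = \<epsilon> (F X)"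
    "\<eta>' X \<in> Mor C X (G (F X))" "F1 X (G (F X)) (\<eta>' X) = \<delta> (F X)" "G (F X) \<in> Obj C" "F X \<in> Obj D"
    if "X \<in> Obj C" for X
    using that preim FD(1) GC \<epsilon> \<delta> by (auto simp: \<eta>_def \<eta>'_def)
  have natC: "naturally_isomorphic C C (\<lambda>X. G (F X)) (\<lambda>X Y f. G1 (F X) (F Y) (F1 X Y f)) (\<lambda>X. X) (\<lambda>X Y f. f)"
    unfolding naturally_isomorphic_def cat_iso_def
  proof (intro exI[of _ \<eta>] conjI ballI)
    fix X assume X: "X \<in> Obj C"
    note h = \<eta>[OF X]
    show "\<eta> X \<in> Mor C (G (F X)) X" by (rule h)
    show "\<exists>g\<in>Mor C X (G (F X)). Comp C (G (F X)) X (G (F X)) g (\<eta> X) = Ident C (G (F X)) \<and>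
        Comp C X (G (F X)) X (\<eta> X) g = Ident C X"
    proof (intro bexI[of _ "\<eta>' X"] conjI)
      show "Comp C (G (F X)) X (G (F X)) (\<eta>' X) (\<eta> X) = Ident C (G (F X))"
        by (rule inj[OF h(5) h(5)]) (use h X CD(2,3) in \<open>simp_all add: FD(5,6) \<delta>\<epsilon>\<close>)
      show "Comp C X (G (F X)) X (\<eta> X) (\<eta>' X) = Ident C X"
        by (rule inj[OF X X]) (use h X CD(2,3) in \<open>simp_all add: FD(5,6) \<epsilon>\<delta>\<close>)
    qed (rule h)
  next
    fix X Y f assume X: "X \<in> Obj C" and Y: "Y \<in> Obj C" and f: "f \<in> Mor C X Y"
    note hX = \<eta>[OF X] and hY = \<eta>[OF Y]
    have Ff: "F1 X Y f \<in> Mor D (F X) (F Y)" by (rule FD(2)[OF X Y f])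
    note g = G1[OF hX(6) hY(6) Ff]
    show "Comp C (G (F X)) (G (F Y)) Y (\<eta> Y) (G1 (F X) (F Y) (F1 X Y f)) = Comp C (G (F X)) X Y f (\<eta> X)"
    proof (rule inj[OF hX(5) Y])
      show "F1 (G (F X)) Y (Comp C (G (F X)) (G (F Y)) Y (\<eta> Y) (G1 (F X) (F Y) (F1 X Y f))) =
          F1 (G (F X)) Y (Comp C (G (F X)) X Y f (\<eta> X))"
        using hX hY g X Y f Ff by (simp add: FD(6) ecnj)
    qed (use hX hY g X Y f CD(3) in auto)
  qed
  show ?thesis
    unfolding equivalent_linear_categories_def using C D F functorG natC natD by blast
qed

lemma (in fd_alg) mod_cat_linear:
  fixes T :: "'m itself"
  shows "linear_category K (mod_cat T K A)"
proof -
  have R: "right_module A M" if "fd_right_module K A M" for M :: "('a, 'm) rmod"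
    using that by (simp add: fd_right_module_def)
  have ext: "restrict f (carrier M) = f" if "f \<in> rhom A M N" for f and M N :: "('a, 'm) rmod"
    using rhomD(4)[OF that] by (rule extensional_restrict)
  have sc: "f (m \<triangleleft>\<^bsub>M\<^esub> sc k) = f m \<triangleleft>\<^bsub>N\<^esub> sc k"
    if "f \<in> rhom A M N" "m \<in> carrier M" "k \<in> carrier K" for f k m and M N :: "('a, 'm) rmod"
    using rhomD(3)[OF that(1,2)] that(3) by auto
  have id: "compose (carrier M) f (\<lambda>m\<in>carrier M. m) = f" "compose (carrier M) (\<lambda>m\<in>carrier N. m) f = f"
    if "f \<in> rhom A M N" for f and M N :: "('a, 'm) rmod"
    by (rule extensionalityI[OF compose_extensional rhomD(4)[OF that]],
        use rhomD(1)[OF that] in \<open>simp add: compose_def\<close>)+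
  have dist: "compose (carrier L) g (\<lambda>m\<in>carrier L. f m \<oplus>\<^bsub>M\<^esub> f' m) =
      (\<lambda>m\<in>carrier L. compose (carrier L) g f m \<oplus>\<^bsub>N\<^esub> compose (carrier L) g f' m)"
    "compose (carrier L) g (\<lambda>m\<in>carrier L. f m \<triangleleft>\<^bsub>M\<^esub> sc k) = (\<lambda>m\<in>carrier L. compose (carrier L) g f m \<triangleleft>\<^bsub>N\<^esub> sc k)"
    "compose (carrier L) (\<lambda>m\<in>carrier M. g m \<oplus>\<^bsub>N\<^esub> g' m) f =
      (\<lambda>m\<in>carrier L. compose (carrier L) g f m \<oplus>\<^bsub>N\<^esub> compose (carrier L) g' f m)"
    "compose (carrier L) (\<lambda>m\<in>carrier M. g m \<triangleleft>\<^bsub>N\<^esub> sc k) f = (\<lambda>m\<in>carrier L. compose (carrier L) g f m \<triangleleft>\<^bsub>N\<^esub> sc k)"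
    if "f \<in> rhom A L M" "f' \<in> rhom A L M" "g \<in> rhom A M N" "g' \<in> rhom A M N" "k \<in> carrier K"
    for f f' g g' k and L M N :: "('a, 'm) rmod"
    using rhomD(1)[OF that(1)] rhomD(1)[OF that(2)] rhomD(2)[OF that(3)] sc[OF that(3)] that(5)
    by (auto simp: compose_def intro!: restrict_ext)
  have assoc: "compose (carrier L) h (compose (carrier L) g f) = compose (carrier L) (compose (carrier M) h g) f"
    if "f \<in> rhom A L M" for f g h and L M :: "('a, 'm) rmod"
    using rhomD(1)[OF that] by (auto simp: compose_def intro!: restrict_ext)
  show ?thesis
    unfolding linear_category_def mod_cat_def
    using R by (auto simp: hom_space_module rhom_id rhom_compose id assoc) (simp_all add: dist)
qed

section \<open>The bocs of an idempotent\<close>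

text \<open>W is any bimodule identified with Ae \<otimes> eA. Abstracting from D(A) keeps its
  description by functionals out of all bocs computations.\<close>

locale bocs_data = alg_idem K A e
  for K :: "('k, 'c) ring_scheme" and A :: "('k, 'a, 'x) module_scheme" and e :: 'a +
  fixes W :: "('a, 'a, 'w, 'y) bimod_scheme" and \<theta>
  assumes W: "bimodule K A A W" and \<theta>: "bimod_iso A A (Ae_eA A e) W \<theta>"
begin

sublocale E: tensor_product eAe Ae eA
  by (rule tensor_product.intro[OF Ae_right_module eA_left_module])

sublocale W: abelian_group W using left_moduleD(1)[OF bimoduleD(1)[OF W]] .

lemmas W_left = left_moduleD(2-)[OF bimoduleD(1)[OF W]]
lemmas W_right = right_moduleD(2-)[OF bimoduleD(2)[OF W]]
lemmas W_comm = bimoduleD(3)[OF W]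
lemmas W_central = bimoduleD(4)[OF W]

sublocale WW: tensor_product A W W
  by (rule tensor_product.intro[OF bimoduleD(2,1)[OF W]])

text \<open>In W these elements take the part of pure tensors: additive maps out of W are prescribed
  on them by \<open>lift_br\<close> and compared on them by \<open>W_eqI\<close>.\<close>

definition br where "br x y = \<theta> (E.pure x y)"

definition lift where "lift G \<beta> w = tensor_lift G \<beta> (inv_into (carrier E.T) \<theta> w)"

lemma e_Ae [simp]: "e \<in> carrier Ae" and e_eA [simp]: "e \<in> carrier eA"
  unfolding carrier_Ae carrier_eA by auto

lemma theta_rhom: "\<theta> \<in> rhom A E.T W" and theta_bij: "bij_betw \<theta> (carrier E.T) (carrier W)"
  and theta_left: "\<And>a t. a \<in> carrier A \<Longrightarrow> t \<in> carrier E.T \<Longrightarrow> \<theta> (a \<triangleright>\<^bsub>E.T\<^esub> t) = a \<triangleright>\<^bsub>W\<^esub> \<theta> t"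
  using \<theta> by (auto simp: bimod_iso_def bihom_def Ae_eA_def)

lemma br_closed [simp]: "x \<in> carrier Ae \<Longrightarrow> y \<in> carrier eA \<Longrightarrow> br x y \<in> carrier W"
  unfolding br_def using rhomD(1)[OF theta_rhom] E.pure_closed by blast

lemma br_add_left: "x \<in> carrier Ae \<Longrightarrow> x' \<in> carrier Ae \<Longrightarrow> y \<in> carrier eA \<Longrightarrow>
    br (x \<oplus>\<^bsub>A\<^esub> x') y = br x y \<oplus>\<^bsub>W\<^esub> br x' y"
  using E.pure_add_left[of x x' y] rhomD(2)[OF theta_rhom] by (simp add: br_def)

lemma br_add_right: "x \<in> carrier Ae \<Longrightarrow> y \<in> carrier eA \<Longrightarrow> y' \<in> carrier eA \<Longrightarrow>
    br x (y \<oplus>\<^bsub>A\<^esub> y') = br x y \<oplus>\<^bsub>W\<^esub> br x y'"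
  using E.pure_add_right[of x y y'] rhomD(2)[OF theta_rhom] by (simp add: br_def)

lemma br_balanced: "x \<in> carrier Ae \<Longrightarrow> r \<in> carrier eAe \<Longrightarrow> y \<in> carrier eA \<Longrightarrow>
    br (x \<otimes>\<^bsub>A\<^esub> r) y = br x (r \<otimes>\<^bsub>A\<^esub> y)"
  using E.pure_balanced[of x r y] by (simp add: br_def)

lemma br_ract: "x \<in> carrier Ae \<Longrightarrow> y \<in> carrier eA \<Longrightarrow> a \<in> carrier A \<Longrightarrow> br x y \<triangleleft>\<^bsub>W\<^esub> a = br x (y \<otimes>\<^bsub>A\<^esub> a)"
proof -
  assume x: "x \<in> carrier Ae" and y: "y \<in> carrier eA" and a: "a \<in> carrier A"
  have "E.pure x y \<triangleleft>\<^bsub>E.T\<^esub> a = E.pure x (y \<otimes>\<^bsub>A\<^esub> a)"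
    using E.ract_pure[OF eA_right_module _ x y a]
    by (auto simp: carrier_corner carrier_eA A.m_assoc simp del: mult_bimod_simps(1))
  then show ?thesis
    using rhomD(3)[OF theta_rhom E.pure_closed[OF x y] a] by (simp add: br_def)
qed

lemma br_lact: "x \<in> carrier Ae \<Longrightarrow> y \<in> carrier eA \<Longrightarrow> a \<in> carrier A \<Longrightarrow> a \<triangleright>\<^bsub>W\<^esub> br x y = br (a \<otimes>\<^bsub>A\<^esub> x) y"
proof -
  assume x: "x \<in> carrier Ae" and y: "y \<in> carrier eA" and a: "a \<in> carrier A"
  have "a \<triangleright>\<^bsub>E.T\<^esub> E.pure x y = E.pure (a \<otimes>\<^bsub>A\<^esub> x) y"
    using E.lact_pure[OF Ae_left_module _ x y a]
    by (auto simp: carrier_corner carrier_Ae A.m_assoc simp del: mult_bimod_simps(1))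
  then show ?thesis
    using theta_left[OF a E.pure_closed[OF x y]] by (simp add: br_def)
qed

lemma inv_theta_hom: "inv_into (carrier E.T) \<theta> \<in> add_hom W E.T"
proof (rule add_homI)
  have inj: "inj_on \<theta> (carrier E.T)" and im: "\<theta> ` carrier E.T = carrier W"
    using theta_bij by (auto simp: bij_betw_def)
  have cl: "inv_into (carrier E.T) \<theta> w \<in> carrier E.T" "\<theta> (inv_into (carrier E.T) \<theta> w) = w"
    if "w \<in> carrier W" for w
    using that im inv_into_into[of w \<theta> "carrier E.T"] f_inv_into_f[of w \<theta> "carrier E.T"] by auto
  fix v w assume v: "v \<in> carrier W" and w: "w \<in> carrier W"
  show "inv_into (carrier E.T) \<theta> v \<in> carrier E.T" by (rule cl(1)[OF v])
  show "inv_into (carrier E.T) \<theta> (v \<oplus>\<^bsub>W\<^esub> w) =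
      inv_into (carrier E.T) \<theta> v \<oplus>\<^bsub>E.T\<^esub> inv_into (carrier E.T) \<theta> w"
    using cl[OF v] cl[OF w] rhomD(2)[OF theta_rhom, of "inv_into (carrier E.T) \<theta> v" "inv_into (carrier E.T) \<theta> w"]
    by (intro inv_into_f_eq[OF inj]) auto
qed

lemma inv_theta_br: "x \<in> carrier Ae \<Longrightarrow> y \<in> carrier eA \<Longrightarrow> inv_into (carrier E.T) \<theta> (br x y) = E.pure x y"
  unfolding br_def using theta_bij E.pure_closed by (intro inv_into_f_f) (auto simp: bij_betw_def)

lemma lift_hom: "abelian_group G \<Longrightarrow> balanced eAe Ae eA G \<beta> \<Longrightarrow> lift G \<beta> \<in> add_hom W G"
  unfolding lift_def using add_hom_compose[OF inv_theta_hom E.tensor_lift_add_hom] by blast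

lemma lift_br: "abelian_group G \<Longrightarrow> balanced eAe Ae eA G \<beta> \<Longrightarrow> x \<in> carrier Ae \<Longrightarrow> y \<in> carrier eA \<Longrightarrow>
    lift G \<beta> (br x y) = \<beta> x y"
  unfolding lift_def by (simp only: inv_theta_br E.tensor_lift_pure)

lemma W_eqI:
  assumes "abelian_group G" "f \<in> add_hom W G" "g \<in> add_hom W G"
    and "\<And>x y. x \<in> carrier Ae \<Longrightarrow> y \<in> carrier eA \<Longrightarrow> f (br x y) = g (br x y)"
    and "w \<in> carrier W"
  shows "f w = g w"
proof -
  have \<theta>h: "\<theta> \<in> add_hom E.T W" by (rule rhomD(5)[OF theta_rhom])
  obtain t where t: "t \<in> carrier E.T" "w = \<theta> t"
    using theta_bij assms(5) by (auto simp: bij_betw_def)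
  have "f (\<theta> t) = g (\<theta> t)"
    by (rule E.tensor_eqI[OF assms(1) add_hom_compose[OF \<theta>h assms(2)] add_hom_compose[OF \<theta>h assms(3)] _ t(1)])
      (use assms(4) in \<open>simp add: br_def\<close>)
  then show ?thesis using t(2) by simp
qed

lemma W_ract_hom: "a \<in> carrier A \<Longrightarrow> (\<lambda>w. w \<triangleleft>\<^bsub>W\<^esub> a) \<in> add_hom W W"
  and W_lact_hom: "a \<in> carrier A \<Longrightarrow> (\<lambda>w. a \<triangleright>\<^bsub>W\<^esub> w) \<in> add_hom W W"
  using W_left W_right by (auto intro!: add_homI)

text \<open>Arranged so that for W = D(A) this definition and that of \<open>eps\<close> unfold to
  \<open>dual_mu\<close> and \<open>dual_eps\<close>.\<close>

definition mu where
  "mu = (\<lambda>w\<in>carrier W. lift WW.T (\<lambda>x y. WW.pure (br x e) (br e y)) w)"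

definition eps where
  "eps = (\<lambda>w\<in>carrier W. lift A (\<lambda>x y. x \<otimes>\<^bsub>A\<^esub> y) w)"

text \<open>An element r of eAe has to cross two kinds of tensor signs. Inside W, br(xr, e) = br(x,
  r) = br(x, e)r; over A it then passes to r br(e, y), and inside W again r br(e, y) = br(er, y) =
  br(e, ry).\<close>

lemma balanced_mu: "balanced eAe Ae eA WW.T (\<lambda>x y. WW.pure (br x e) (br e y))"
proof (rule balancedI)
  fix x r y assume x: "x \<in> carrier Ae" and r: "r \<in> carrier eAe" and y: "y \<in> carrier eA"
  have rA: "r \<in> carrier A" "r \<otimes>\<^bsub>A\<^esub> e = r" "e \<otimes>\<^bsub>A\<^esub> r = r" using r by (auto simp: carrier_corner)
  have "br (x \<otimes>\<^bsub>A\<^esub> r) e = br x e \<triangleleft>\<^bsub>W\<^esub> r"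
    using x r rA by (simp add: br_balanced br_ract del: mult_bimod_simps(1))
  moreover have "r \<triangleright>\<^bsub>W\<^esub> br e y = br e (r \<otimes>\<^bsub>A\<^esub> y)"
  proof -
    have "r \<triangleright>\<^bsub>W\<^esub> br e y = br (e \<otimes>\<^bsub>A\<^esub> r) y"
      using y rA by (simp add: br_lact del: mult_bimod_simps(1))
    also have "\<dots> = br e (r \<otimes>\<^bsub>A\<^esub> y)" by (rule br_balanced[OF e_Ae r y])
    finally show ?thesis .
  qed
  ultimately show "WW.pure (br (x \<triangleleft>\<^bsub>Ae\<^esub> r) e) (br e y) = WW.pure (br x e) (br e (r \<triangleright>\<^bsub>eA\<^esub> y))"
    using x y rA by (simp add: WW.pure_balanced del: mult_bimod_simps(1))
qed (simp_all add: br_add_left br_add_right WW.pure_add_left WW.pure_add_right del: mult_bimod_simps(1))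

lemma balanced_eps: "balanced eAe Ae eA A (\<lambda>x y. x \<otimes>\<^bsub>A\<^esub> y)"
  by (rule balancedI) (auto simp: carrier_Ae carrier_eA carrier_corner A.l_distr A.r_distr A.m_assoc
    simp del: mult_bimod_simps(1))

lemma restrict_hom: "f \<in> add_hom W G \<Longrightarrow> restrict f (carrier W) \<in> add_hom W G"
  by (auto simp: add_hom_def)

lemma mu_hom: "mu \<in> add_hom W WW.T"
  unfolding mu_def by (rule restrict_hom[OF lift_hom[OF WW.T.abelian_group_axioms balanced_mu]])

lemma mu_br: "x \<in> carrier Ae \<Longrightarrow> y \<in> carrier eA \<Longrightarrow> mu (br x y) = WW.pure (br x e) (br e y)"
  by (simp add: mu_def lift_br[OF WW.T.abelian_group_axioms balanced_mu] del: mult_bimod_simps(1))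

lemma eps_hom: "eps \<in> add_hom W A"
  unfolding eps_def by (rule restrict_hom[OF lift_hom[OF A.abelian_group_axioms balanced_eps]])

lemma eps_br: "x \<in> carrier Ae \<Longrightarrow> y \<in> carrier eA \<Longrightarrow> eps (br x y) = x \<otimes>\<^bsub>A\<^esub> y"
  by (simp add: eps_def lift_br[OF A.abelian_group_axioms balanced_eps] del: mult_bimod_simps(1))

lemma WW_ract_hom: "a \<in> carrier A \<Longrightarrow> (\<lambda>t. t \<triangleleft>\<^bsub>WW.T\<^esub> a) \<in> add_hom WW.T WW.T"
  using WW.ract_add_hom[OF bimoduleD(2)[OF W]] W_comm by blast

lemma WW_lact_hom: "a \<in> carrier A \<Longrightarrow> (\<lambda>t. a \<triangleright>\<^bsub>WW.T\<^esub> t) \<in> add_hom WW.T WW.T"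
  using WW.lact_add_hom[OF bimoduleD(1)[OF W]] W_comm by blast

lemma WW_ract_pure: "v \<in> carrier W \<Longrightarrow> w \<in> carrier W \<Longrightarrow> a \<in> carrier A \<Longrightarrow>
    WW.pure v w \<triangleleft>\<^bsub>WW.T\<^esub> a = WW.pure v (w \<triangleleft>\<^bsub>W\<^esub> a)"
  using WW.ract_pure[OF bimoduleD(2)[OF W]] W_comm by blast

lemma WW_lact_pure: "v \<in> carrier W \<Longrightarrow> w \<in> carrier W \<Longrightarrow> a \<in> carrier A \<Longrightarrow>
    a \<triangleright>\<^bsub>WW.T\<^esub> WW.pure v w = WW.pure (a \<triangleright>\<^bsub>W\<^esub> v) w"
  using WW.lact_pure[OF bimoduleD(1)[OF W]] W_comm by blast

lemma WW_right_module: "right_module A WW.T"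
  using WW.tensor_right_module[OF bimoduleD(2)[OF W] _ A.ring_axioms] W_comm by blast

lemma WW_left_module: "left_module A WW.T"
  using WW.tensor_left_module[OF A.ring_axioms bimoduleD(1)[OF W]] W_comm by blast

lemma mu_ract: "w \<in> carrier W \<Longrightarrow> a \<in> carrier A \<Longrightarrow> mu (w \<triangleleft>\<^bsub>W\<^esub> a) = mu w \<triangleleft>\<^bsub>WW.T\<^esub> a"
proof -
  assume w: "w \<in> carrier W" and a: "a \<in> carrier A"
  show ?thesis
    by (rule W_eqI[OF WW.T.abelian_group_axioms add_hom_compose[OF W_ract_hom[OF a] mu_hom]
      add_hom_compose[OF mu_hom WW_ract_hom[OF a]] _ w])
      (use a in \<open>simp_all add: br_ract mu_br eA_mult WW_ract_pure del: mult_bimod_simps(1)\<close>)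
qed

lemma mu_lact: "w \<in> carrier W \<Longrightarrow> a \<in> carrier A \<Longrightarrow> mu (a \<triangleright>\<^bsub>W\<^esub> w) = a \<triangleright>\<^bsub>WW.T\<^esub> mu w"
proof -
  assume w: "w \<in> carrier W" and a: "a \<in> carrier A"
  show ?thesis
    by (rule W_eqI[OF WW.T.abelian_group_axioms add_hom_compose[OF W_lact_hom[OF a] mu_hom]
      add_hom_compose[OF mu_hom WW_lact_hom[OF a]] _ w])
      (use a in \<open>simp_all add: br_lact mu_br Ae_mult WW_lact_pure del: mult_bimod_simps(1)\<close>)
qed

lemma A_mult_hom: "a \<in> carrier A \<Longrightarrow> (\<lambda>x. x \<otimes>\<^bsub>A\<^esub> a) \<in> add_hom A A"
  "a \<in> carrier A \<Longrightarrow> (\<lambda>x. a \<otimes>\<^bsub>A\<^esub> x) \<in> add_hom A A"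
  by (auto intro!: add_homI simp: A.l_distr A.r_distr)

lemma eps_ract: "w \<in> carrier W \<Longrightarrow> a \<in> carrier A \<Longrightarrow> eps (w \<triangleleft>\<^bsub>W\<^esub> a) = eps w \<otimes>\<^bsub>A\<^esub> a"
proof -
  assume w: "w \<in> carrier W" and a: "a \<in> carrier A"
  show ?thesis
    by (rule W_eqI[OF A.abelian_group_axioms add_hom_compose[OF W_ract_hom[OF a] eps_hom]
      add_hom_compose[OF eps_hom A_mult_hom(1)[OF a]] _ w])
      (simp only: br_ract eps_br eA_mult a, metis A.m_assoc Ae_A eA_A a)
qed

lemma eps_lact: "w \<in> carrier W \<Longrightarrow> a \<in> carrier A \<Longrightarrow> eps (a \<triangleright>\<^bsub>W\<^esub> w) = a \<otimes>\<^bsub>A\<^esub> eps w"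
proof -
  assume w: "w \<in> carrier W" and a: "a \<in> carrier A"
  show ?thesis
    by (rule W_eqI[OF A.abelian_group_axioms add_hom_compose[OF W_lact_hom[OF a] eps_hom]
      add_hom_compose[OF eps_hom A_mult_hom(2)[OF a]] _ w])
      (simp only: br_lact eps_br Ae_mult a, metis A.m_assoc Ae_A eA_A a)
qed

lemma W_id_hom: "(\<lambda>w. w) \<in> add_hom W W" by (rule add_homI) auto

sublocale WA: tensor_product A W "regular A"
  by (rule tensor_product.intro[OF bimoduleD(2)[OF W] regular_left_module])
sublocale AW: tensor_product A "regular A" W
  by (rule tensor_product.intro[OF regular_right_module bimoduleD(1)[OF W]])
sublocale WWl: tensor_product A WW.T W
  by (rule tensor_product.intro[OF WW_right_module bimoduleD(1)[OF W]])
sublocale WWr: tensor_product A W WW.T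
  by (rule tensor_product.intro[OF bimoduleD(2)[OF W] WW_left_module])

lemma eps_hom_regular: "eps \<in> add_hom W (regular A)"
  using eps_hom by (auto simp: add_hom_def)

text \<open>On br(x, y) the counit turns br(e, y) into y, which is moved across the tensor sign over
  A: br(x, e) \<otimes> y = br(x, e)y \<otimes> 1 = br(x, y) \<otimes> 1.\<close>

lemma right_counit:
  assumes w: "w \<in> carrier W"
  shows "tensor_map A W (regular A) (\<lambda>x. x) eps (mu w) = WA.pure w \<one>\<^bsub>A\<^esub>"
proof -
  note map = WW.tensor_map_hom[OF WA.tensor_product_axioms W_id_hom eps_hom_regular]
  have rhs: "(\<lambda>w. WA.pure w \<one>\<^bsub>A\<^esub>) \<in> add_hom W WA.T"
    by (rule add_homI) (auto simp: WA.pure_add_left)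
  show ?thesis
  proof (rule W_eqI[OF WA.T.abelian_group_axioms add_hom_compose[OF mu_hom map(1)] rhs _ w])
    fix x y assume x: "x \<in> carrier Ae" and y: "y \<in> carrier eA"
    have "tensor_map A W (regular A) (\<lambda>x. x) eps (mu (br x y)) = WA.pure (br x e) y"
      using x y by (simp add: mu_br map(2) eps_br eps_lact eA_e del: mult_bimod_simps(1))
    also have "\<dots> = WA.pure (br x e) (y \<otimes>\<^bsub>A\<^esub> \<one>\<^bsub>A\<^esub>)" using eA_A[OF y] by simp
    also have "\<dots> = WA.pure (br x e \<triangleleft>\<^bsub>W\<^esub> y) \<one>\<^bsub>A\<^esub>"
      using WA.pure_balanced[of "br x e" y "\<one>\<^bsub>A\<^esub>"] eA_A[OF y] x by (simp del: mult_bimod_simps(1)) simp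
    also have "\<dots> = WA.pure (br x y) \<one>\<^bsub>A\<^esub>"
      using x y eA_A[OF y] by (simp add: br_ract eA_e del: mult_bimod_simps(1))
    finally show "tensor_map A W (regular A) (\<lambda>x. x) eps (mu (br x y)) = WA.pure (br x y) \<one>\<^bsub>A\<^esub>" .
  qed (auto simp: eps_lact)
qed

lemma left_counit:
  assumes w: "w \<in> carrier W"
  shows "tensor_map A (regular A) W eps (\<lambda>x. x) (mu w) = AW.pure \<one>\<^bsub>A\<^esub> w"
proof -
  note map = WW.tensor_map_hom[OF AW.tensor_product_axioms eps_hom_regular W_id_hom]
  have rhs: "(\<lambda>w. AW.pure \<one>\<^bsub>A\<^esub> w) \<in> add_hom W AW.T"
    by (rule add_homI) (auto simp: AW.pure_add_right)
  show ?thesis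
  proof (rule W_eqI[OF AW.T.abelian_group_axioms add_hom_compose[OF mu_hom map(1)] rhs _ w])
    fix x y assume x: "x \<in> carrier Ae" and y: "y \<in> carrier eA"
    have "tensor_map A (regular A) W eps (\<lambda>x. x) (mu (br x y)) = AW.pure x (br e y)"
      using x y by (simp add: mu_br map(2) eps_br eps_ract Ae_e del: mult_bimod_simps(1))
    also have "\<dots> = AW.pure (\<one>\<^bsub>A\<^esub> \<otimes>\<^bsub>A\<^esub> x) (br e y)" using Ae_A[OF x] by simp
    also have "\<dots> = AW.pure \<one>\<^bsub>A\<^esub> (x \<triangleright>\<^bsub>W\<^esub> br e y)"
      using AW.pure_balanced[of "\<one>\<^bsub>A\<^esub>" x "br e y"] Ae_A[OF x] y by (simp del: mult_bimod_simps(1)) simp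
    also have "\<dots> = AW.pure \<one>\<^bsub>A\<^esub> (br x y)"
      using x y Ae_A[OF x] by (simp add: br_lact Ae_e del: mult_bimod_simps(1))
    finally show "tensor_map A (regular A) W eps (\<lambda>x. x) (mu (br x y)) = AW.pure \<one>\<^bsub>A\<^esub> (br x y)" .
  qed (auto simp: eps_ract)
qed

lemma balanced_assoc_inner:
  assumes "z \<in> carrier W"
  shows "balanced A W W WWr.T (\<lambda>x y. WWr.pure x (WW.pure y z))"
  by (rule balancedI) (use assms in \<open>auto simp: WWr.pure_add_left WWr.pure_add_right WW.pure_add_left
    WWr.pure_balanced WW_lact_pure\<close>)

lemma assoc_inner:
  assumes "z \<in> carrier W"
  shows "tensor_lift WWr.T (\<lambda>x y. WWr.pure x (WW.pure y z)) \<in> add_hom WW.T WWr.T"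
    and "\<And>x y. x \<in> carrier W \<Longrightarrow> y \<in> carrier W \<Longrightarrow>
      tensor_lift WWr.T (\<lambda>x y. WWr.pure x (WW.pure y z)) (WW.pure x y) = WWr.pure x (WW.pure y z)"
  using WW.tensor_lift_add_hom[OF WWr.T.abelian_group_axioms balanced_assoc_inner[OF assms]]
    WW.tensor_lift_pure[OF WWr.T.abelian_group_axioms balanced_assoc_inner[OF assms]] by auto

text \<open>The associator is a lift of a lift. Additivity and balancedness in z concern the inner
  lift, whose values are known only on pure tensors, so each equation is again compared
  there.\<close>

lemma balanced_assoc:
  "balanced A WW.T W WWr.T (\<lambda>s z. tensor_lift WWr.T (\<lambda>x y. WWr.pure x (WW.pure y z)) s)"
proof (rule balancedI)
  let ?h = "\<lambda>z s. tensor_lift WWr.T (\<lambda>x y. WWr.pure x (WW.pure y z)) s"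
  note h = assoc_inner
  fix s z assume s: "s \<in> carrier WW.T" and z: "z \<in> carrier W"
  show "?h z s \<in> carrier WWr.T" by (rule add_hom_closed[OF h(1)[OF z] s])
  {
    fix s' assume "s' \<in> carrier WW.T"
    then show "?h z (s \<oplus>\<^bsub>WW.T\<^esub> s') = ?h z s \<oplus>\<^bsub>WWr.T\<^esub> ?h z s'" by (rule add_hom_add[OF h(1)[OF z] s])
  next
    fix z' assume z': "z' \<in> carrier W"
    have sum: "(\<lambda>s. ?h z s \<oplus>\<^bsub>WWr.T\<^esub> ?h z' s) \<in> add_hom WW.T WWr.T"
      using add_hom_closed[OF h(1)[OF z]] add_hom_closed[OF h(1)[OF z']]
        add_hom_add[OF h(1)[OF z]] add_hom_add[OF h(1)[OF z']]
      by (intro add_homI) (auto simp: WWr.T.a_ac)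
    show "?h (z \<oplus>\<^bsub>W\<^esub> z') s = ?h z s \<oplus>\<^bsub>WWr.T\<^esub> ?h z' s"
      by (rule WW.tensor_eqI[OF WWr.T.abelian_group_axioms h(1)[OF W.a_closed[OF z z']] sum _ s])
        (use z z' in \<open>simp add: h(2) WW.pure_add_right WWr.pure_add_right\<close>)
  next
    fix a assume a: "a \<in> carrier A"
    show "?h z (s \<triangleleft>\<^bsub>WW.T\<^esub> a) = ?h (a \<triangleright>\<^bsub>W\<^esub> z) s"
      by (rule WW.tensor_eqI[OF WWr.T.abelian_group_axioms
          add_hom_compose[OF WW_ract_hom[OF a] h(1)[OF z]] h(1)[OF W_left(1)[OF z a]] _ s])
        (use z a W_left W_right in \<open>auto simp: h(2) WW_ract_pure WW.pure_balanced\<close>)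
  }
qed

lemma tensor_assoc_hom: "tensor_assoc A W \<in> add_hom WWl.T WWr.T"
  and tensor_assoc_pure: "\<And>x y z. x \<in> carrier W \<Longrightarrow> y \<in> carrier W \<Longrightarrow> z \<in> carrier W \<Longrightarrow>
    tensor_assoc A W (WWl.pure (WW.pure x y) z) = WWr.pure x (WW.pure y z)"
  unfolding tensor_assoc_def Let_def
  using WWl.tensor_lift_add_hom[OF WWr.T.abelian_group_axioms balanced_assoc]
    WWl.tensor_lift_pure[OF WWr.T.abelian_group_axioms balanced_assoc] assoc_inner(2) by auto

text \<open>Both sides send br(x, y) to br(x, e) \<otimes> (br(e, e) \<otimes> br(e, y)).\<close>

lemma coassoc:
  assumes w: "w \<in> carrier W"
  shows "tensor_assoc A W (tensor_map A WW.T W mu (\<lambda>x. x) (mu w)) = tensor_map A W WW.T (\<lambda>x. x) mu (mu w)"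
proof -
  note mapl = WW.tensor_map_hom[OF WWl.tensor_product_axioms mu_hom W_id_hom mu_ract refl]
  note mapr = WW.tensor_map_hom[OF WWr.tensor_product_axioms W_id_hom mu_hom refl mu_lact]
  show ?thesis
    by (rule W_eqI[OF WWr.T.abelian_group_axioms
        add_hom_compose[OF add_hom_compose[OF mu_hom mapl(1)] tensor_assoc_hom]
        add_hom_compose[OF mu_hom mapr(1)] _ w])
      (simp_all add: mu_br mapl(2) mapr(2) tensor_assoc_pure del: mult_bimod_simps(1))
qed

lemma bocs: "bocs K A W mu eps"
proof -
  have ext: "mu \<in> extensional (carrier W)" "eps \<in> extensional (carrier W)"
    by (auto simp: mu_def eps_def)
  have "mu \<in> rhom A W WW.T"
    by (rule rhomI) (use mu_hom ext mu_ract in \<open>auto simp: add_hom_def extensional_def\<close>)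
  moreover have "eps \<in> rhom A W (regular A)"
    by (rule rhomI) (use eps_hom ext eps_ract in \<open>auto simp: add_hom_def extensional_def\<close>)
  ultimately show ?thesis
    using W mu_lact eps_lact right_counit left_counit coassoc by (auto simp: bocs_def bihom_def)
qed

end

section \<open>Restriction of modules to the corner\<close>

context alg_idem
begin

text \<open>Only the carrier shrinks, the action is the old one. Over the corner, whose identity is
  e, it is unital because e fixes Me.\<close>

definition corner_mod :: "('a, 'm, 'z) rmod_scheme \<Rightarrow> ('a, 'm, 'z) rmod_scheme" where
  "corner_mod M = M\<lparr>carrier := (\<lambda>m. m \<triangleleft>\<^bsub>M\<^esub> e) ` carrier M\<rparr>"

lemma corner_mod_simps [simp]:
  "\<zero>\<^bsub>corner_mod M\<^esub> = \<zero>\<^bsub>M\<^esub>" "x \<oplus>\<^bsub>corner_mod M\<^esub> y = x \<oplus>\<^bsub>M\<^esub> y" "x \<triangleleft>\<^bsub>corner_mod M\<^esub> a = x \<triangleleft>\<^bsub>M\<^esub> a"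
  by (simp_all add: corner_mod_def)

lemma carrier_corner_mod:
  assumes "right_module A M"
  shows "carrier (corner_mod M) = {m \<in> carrier M. m \<triangleleft>\<^bsub>M\<^esub> e = m}"
proof -
  note R = right_moduleD(2-)[OF assms]
  have "m \<triangleleft>\<^bsub>M\<^esub> e \<triangleleft>\<^bsub>M\<^esub> e = m \<triangleleft>\<^bsub>M\<^esub> e" if "m \<in> carrier M" for m
    using R(4)[OF that e_closed e_closed] by simp
  moreover have "m \<in> (\<lambda>m. m \<triangleleft>\<^bsub>M\<^esub> e) ` carrier M" if "m \<in> carrier M" "m \<triangleleft>\<^bsub>M\<^esub> e = m" for m
    using that by (intro image_eqI[of _ _ m]) auto
  ultimately show ?thesis using R(1) by (auto simp: corner_mod_def)
qed

lemma corner_mod_right_module: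
  assumes M: "right_module A M"
  shows "right_module eAe (corner_mod M)"
proof -
  interpret M: abelian_group M using right_moduleD(1)[OF M] .
  note R = right_moduleD(2-)[OF M]
  have act: "(\<lambda>m. m \<triangleleft>\<^bsub>M\<^esub> e) \<in> add_hom M M" using R by (auto intro!: add_homI)
  have "abelian_group (corner_mod M)"
    by (rule sub_abelian_group[OF M.abelian_group_axioms])
      (use R add_hom_zero[OF M.abelian_group_axioms M.abelian_group_axioms act]
        add_hom_uminus[OF M.abelian_group_axioms M.abelian_group_axioms act]
        in \<open>auto simp: carrier_corner_mod[OF M]\<close>)
  moreover have "m \<triangleleft>\<^bsub>M\<^esub> a \<triangleleft>\<^bsub>M\<^esub> e = m \<triangleleft>\<^bsub>M\<^esub> a" if "m \<in> carrier M" "a \<in> carrier eAe" for m a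
    using that R(4)[of m a e] by (auto simp: carrier_corner)
  ultimately show ?thesis
    unfolding right_module_def using R
    by (auto simp: carrier_corner_mod[OF M] carrier_corner corner_simps)
qed

text \<open>Me has two K-structures, through the multiples of 1 in A and through those of e in eAe.
  Their agreement makes restriction to corners K-linear.\<close>

lemma corner_scalar:
  assumes M: "right_module A M" and m: "m \<in> carrier (corner_mod M)" and k: "k \<in> carrier K"
  shows "m \<triangleleft>\<^bsub>M\<^esub> (k \<odot>\<^bsub>A\<^esub> e) = m \<triangleleft>\<^bsub>M\<^esub> sc k"
proof -
  have "k \<odot>\<^bsub>A\<^esub> e = e \<otimes>\<^bsub>A\<^esub> sc k" using k by (simp add: mult_sc)
  then show ?thesis
    using right_moduleD(5)[OF M _ e_closed sc_closed[OF k]] m carrier_corner_mod[OF M] by auto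
qed

lemma fd_alg_corner: "fd_alg K eAe"
  by (rule fd_alg.intro[OF corner_fd_algebra])

sublocale Corner: fd_alg K eAe by (rule fd_alg_corner)

lemma corner_mod_fd:
  assumes M: "fd_right_module K A M"
  shows "fd_right_module K eAe (corner_mod M)"
proof -
  have R: "right_module A M" using M by (simp add: fd_right_module_def)
  note RD = right_moduleD(2-)[OF R]
  note C = corner_mod_right_module[OF R]
  have "fin_dim K (scalar_space eAe (corner_mod M))"
  proof (rule fin_dim_surj[OF scalar_space_module[OF R] Corner.scalar_space_module[OF C]])
    show "fin_dim K (scalar_space A M)" using M by (simp add: fd_right_module_def)
    show "(\<lambda>m. m \<triangleleft>\<^bsub>M\<^esub> e) \<in> add_hom (scalar_space A M) (scalar_space eAe (corner_mod M))"
      using RD by (auto intro!: add_homI simp: corner_mod_def)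
    show "carrier (scalar_space eAe (corner_mod M)) \<subseteq> (\<lambda>m. m \<triangleleft>\<^bsub>M\<^esub> e) ` carrier (scalar_space A M)"
      by (simp add: corner_mod_def)
    fix k m assume k: "k \<in> carrier K" and m: "m \<in> carrier (scalar_space A M)"
    have "m \<triangleleft>\<^bsub>M\<^esub> e \<in> carrier (corner_mod M)" using m by (auto simp: corner_mod_def)
    then show "(k \<odot>\<^bsub>scalar_space A M\<^esub> m) \<triangleleft>\<^bsub>M\<^esub> e = k \<odot>\<^bsub>scalar_space eAe (corner_mod M)\<^esub> (m \<triangleleft>\<^bsub>M\<^esub> e)"
      using corner_scalar[OF R _ k] m k RD(4)[of m "sc k" e] RD(4)[of m e "sc k"]
      by (simp add: corner_simps sc_central)
  qed
  then show ?thesis using C by (simp add: fd_right_module_def)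
qed

lemma eA_fd: "fd_right_module K A eA"
proof -
  have "fin_dim K (scalar_space A eA)"
  proof (rule fin_dim_surj[OF V.module_axioms scalar_space_module[OF eA_right_module] fin_dim])
    show "(\<lambda>a. e \<otimes>\<^bsub>A\<^esub> a) \<in> add_hom A (scalar_space A eA)"
      by (rule add_homI) (auto simp: A.r_distr)
  qed (auto simp: smult_mult)
  then show ?thesis using eA_right_module by (simp add: fd_right_module_def)
qed

end

context bocs_data
begin

subsection \<open>Hom spaces of the bocs\<close>

definition hat :: "('a, 'm) rmod \<Rightarrow> ('m \<Rightarrow> 'w \<Rightarrow> 'n) \<Rightarrow> 'm \<Rightarrow> 'n" where
  "hat M f = (\<lambda>m\<in>carrier (corner_mod M). f m (br e e))"

definition unhat :: "('a, 'm) rmod \<Rightarrow> ('a, 'n) rmod \<Rightarrow> ('m \<Rightarrow> 'n) \<Rightarrow> 'm \<Rightarrow> 'w \<Rightarrow> 'n" where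
  "unhat M N h = (\<lambda>m\<in>carrier M. \<lambda>w\<in>carrier W. lift N (\<lambda>x y. h (m \<triangleleft>\<^bsub>M\<^esub> x) \<triangleleft>\<^bsub>N\<^esub> y) w)"

lemma corner_act:
  assumes "right_module A M" "m \<in> carrier M" "x \<in> carrier Ae"
  shows "m \<triangleleft>\<^bsub>M\<^esub> x \<in> carrier (corner_mod M)"
  using right_moduleD(2)[OF assms(1,2) Ae_A[OF assms(3)]]
    right_moduleD(5)[OF assms(1,2) Ae_A[OF assms(3)] e_closed] Ae_e[OF assms(3)]
  by (simp add: carrier_corner_mod[OF assms(1)])

lemma bocs_homD:
  assumes f: "f \<in> rhom A M (hom_rmod A W N)"
  shows "\<And>m. m \<in> carrier M \<Longrightarrow> f m \<in> rhom A W N"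
    and "\<And>m m' w. m \<in> carrier M \<Longrightarrow> m' \<in> carrier M \<Longrightarrow> w \<in> carrier W \<Longrightarrow>
      f (m \<oplus>\<^bsub>M\<^esub> m') w = f m w \<oplus>\<^bsub>N\<^esub> f m' w"
    and "\<And>m a w. m \<in> carrier M \<Longrightarrow> a \<in> carrier A \<Longrightarrow> w \<in> carrier W \<Longrightarrow>
      f (m \<triangleleft>\<^bsub>M\<^esub> a) w = f m (a \<triangleright>\<^bsub>W\<^esub> w)"
  using rhomD(1-3)[OF f] by auto

text \<open>The element br(e, e) generates W as a bimodule, since br(x, y) = x br(e, e) y. Linearity
  of f in its first argument absorbs x, linearity of f(m x) absorbs y.\<close>

lemma bocs_hom_br:
  assumes f: "f \<in> rhom A M (hom_rmod A W N)" and M: "right_module A M"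
    and m: "m \<in> carrier M" and x: "x \<in> carrier Ae" and y: "y \<in> carrier eA"
  shows "f m (br x y) = f (m \<triangleleft>\<^bsub>M\<^esub> x) (br e e) \<triangleleft>\<^bsub>N\<^esub> y"
proof -
  have mx: "m \<triangleleft>\<^bsub>M\<^esub> x \<in> carrier M" using right_moduleD(2)[OF M m Ae_A[OF x]] .
  have "br x y = x \<triangleright>\<^bsub>W\<^esub> br e y" using br_lact[OF e_Ae y Ae_A[OF x]] Ae_e[OF x] by simp
  then have "f m (br x y) = f (m \<triangleleft>\<^bsub>M\<^esub> x) (br e y)"
    using bocs_homD(3)[OF f m Ae_A[OF x] br_closed[OF e_Ae y]] by simp
  also have "br e y = br e e \<triangleleft>\<^bsub>W\<^esub> y" using br_ract[OF e_Ae e_eA eA_A[OF y]] eA_e[OF y] by simp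
  also have "f (m \<triangleleft>\<^bsub>M\<^esub> x) (br e e \<triangleleft>\<^bsub>W\<^esub> y) = f (m \<triangleleft>\<^bsub>M\<^esub> x) (br e e) \<triangleleft>\<^bsub>N\<^esub> y"
    by (rule rhomD(3)[OF bocs_homD(1)[OF f mx] br_closed[OF e_Ae e_eA] eA_A[OF y]])
  finally show ?thesis .
qed

text \<open>The element br(e, e) commutes with the corner: for a in eAe, a br(e, e) = br(a, e) =
  br(e, a) = br(e, e) a. This yields eAe-linearity; the case a = e shows that the values lie in
  Ne.\<close>

lemma hat_rhom:
  assumes f: "f \<in> rhom A M (hom_rmod A W N)" and M: "right_module A M" and N: "right_module A N"
  shows "hat M f \<in> rhom eAe (corner_mod M) (corner_mod N)"
proof (rule rhomI)
  note fD = bocs_homD[OF f]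
  have ee: "br e e \<in> carrier W" by (rule br_closed[OF e_Ae e_eA])
  have C: "m \<in> carrier M \<and> m \<triangleleft>\<^bsub>M\<^esub> e = m" if "m \<in> carrier (corner_mod M)" for m
    using that by (simp add: carrier_corner_mod[OF M])
  have closed: "m \<triangleleft>\<^bsub>M\<^esub> a \<in> carrier (corner_mod M)" if "m \<in> carrier (corner_mod M)" "a \<in> carrier eAe" for m a
    using right_moduleD(2)[OF corner_mod_right_module[OF M] that] by simp
  interpret CM: abelian_group "corner_mod M" using right_moduleD(1)[OF corner_mod_right_module[OF M]] .
  fix m assume m: "m \<in> carrier (corner_mod M)"
  note m' = C[OF m, THEN conjunct1]
  have "f m (br e e) \<triangleleft>\<^bsub>N\<^esub> e = f m (br e e \<triangleleft>\<^bsub>W\<^esub> e)"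
    using rhomD(3)[OF fD(1)[OF m'] ee e_closed] by simp
  then show "hat M f m \<in> carrier (corner_mod N)"
    using m rhomD(1)[OF fD(1)[OF m'] ee] br_ract[OF e_Ae e_eA e_closed]
    by (simp add: hat_def carrier_corner_mod[OF N])
  {
    fix a assume a: "a \<in> carrier eAe"
    then have aA: "a \<in> carrier A" "a \<otimes>\<^bsub>A\<^esub> e = a" "e \<otimes>\<^bsub>A\<^esub> a = a" by (auto simp: carrier_corner)
    have aAe: "a \<in> carrier Ae" and aeA: "a \<in> carrier eA" using aA unfolding carrier_Ae carrier_eA by auto
    have "f (m \<triangleleft>\<^bsub>M\<^esub> a) (br e e) = f m (a \<triangleright>\<^bsub>W\<^esub> br e e)" by (rule fD(3)[OF m' aA(1) ee])
    also have "a \<triangleright>\<^bsub>W\<^esub> br e e = br (e \<otimes>\<^bsub>A\<^esub> a) e" using br_lact[OF e_Ae e_eA aA(1)] aA by simp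
    also have "\<dots> = br e (a \<otimes>\<^bsub>A\<^esub> e)" by (rule br_balanced[OF e_Ae a e_eA])
    also have "\<dots> = br e e \<triangleleft>\<^bsub>W\<^esub> a" using br_ract[OF e_Ae e_eA aA(1)] aA by simp
    also have "f m \<dots> = f m (br e e) \<triangleleft>\<^bsub>N\<^esub> a" by (rule rhomD(3)[OF fD(1)[OF m'] ee aA(1)])
    finally show "hat M f (m \<triangleleft>\<^bsub>corner_mod M\<^esub> a) = hat M f m \<triangleleft>\<^bsub>corner_mod N\<^esub> a"
      using m closed[OF m a] by (simp add: hat_def)
  next
    fix m2 assume m2: "m2 \<in> carrier (corner_mod M)"
    show "hat M f (m \<oplus>\<^bsub>corner_mod M\<^esub> m2) = hat M f m \<oplus>\<^bsub>corner_mod N\<^esub> hat M f m2"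
      using m m2 fD(2)[OF m' _ ee] C[OF m2] CM.a_closed[OF m m2] by (simp add: hat_def)
  }
qed (simp add: hat_def)

context
  fixes M :: "('a, 'm) rmod" and N :: "('a, 'n) rmod" and h
  assumes M: "right_module A M" and N: "right_module A N"
    and h: "h \<in> rhom eAe (corner_mod M) (corner_mod N)"
begin

interpretation N: abelian_group N using right_moduleD(1)[OF N] .

lemma h_closed: "m \<in> carrier (corner_mod M) \<Longrightarrow> h m \<in> carrier N \<and> h m \<triangleleft>\<^bsub>N\<^esub> e = h m"
  using rhomD(1)[OF h] by (simp add: carrier_corner_mod[OF N])

text \<open>Moving an element of eAe from x to y is exactly the eAe-linearity of h.\<close>

lemma balanced_unhat:
  assumes m: "m \<in> carrier M"
  shows "balanced eAe Ae eA N (\<lambda>x y. h (m \<triangleleft>\<^bsub>M\<^esub> x) \<triangleleft>\<^bsub>N\<^esub> y)"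
proof (rule balancedI)
  fix x y assume x: "x \<in> carrier Ae" and y: "y \<in> carrier eA"
  note mx = corner_act[OF M m x]
  show "h (m \<triangleleft>\<^bsub>M\<^esub> x) \<triangleleft>\<^bsub>N\<^esub> y \<in> carrier N"
    using right_moduleD(2)[OF N _ eA_A[OF y]] h_closed[OF mx] by blast
  {
    fix y' assume y': "y' \<in> carrier eA"
    show "h (m \<triangleleft>\<^bsub>M\<^esub> x) \<triangleleft>\<^bsub>N\<^esub> (y \<oplus>\<^bsub>eA\<^esub> y') = h (m \<triangleleft>\<^bsub>M\<^esub> x) \<triangleleft>\<^bsub>N\<^esub> y \<oplus>\<^bsub>N\<^esub> h (m \<triangleleft>\<^bsub>M\<^esub> x) \<triangleleft>\<^bsub>N\<^esub> y'"
      using right_moduleD(4)[OF N _ eA_A[OF y] eA_A[OF y']] h_closed[OF mx] by simp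
  next
    fix x' assume x': "x' \<in> carrier Ae"
    note mx' = corner_act[OF M m x']
    show "h (m \<triangleleft>\<^bsub>M\<^esub> (x \<oplus>\<^bsub>Ae\<^esub> x')) \<triangleleft>\<^bsub>N\<^esub> y = h (m \<triangleleft>\<^bsub>M\<^esub> x) \<triangleleft>\<^bsub>N\<^esub> y \<oplus>\<^bsub>N\<^esub> h (m \<triangleleft>\<^bsub>M\<^esub> x') \<triangleleft>\<^bsub>N\<^esub> y"
      using right_moduleD(4)[OF M m Ae_A[OF x] Ae_A[OF x']] rhomD(2)[OF h mx mx']
        right_moduleD(3)[OF N _ _ eA_A[OF y]] h_closed[OF mx] h_closed[OF mx'] by simp
  next
    fix r assume r: "r \<in> carrier eAe"
    then have rA: "r \<in> carrier A" by (simp add: carrier_corner)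
    show "h (m \<triangleleft>\<^bsub>M\<^esub> (x \<triangleleft>\<^bsub>Ae\<^esub> r)) \<triangleleft>\<^bsub>N\<^esub> y = h (m \<triangleleft>\<^bsub>M\<^esub> x) \<triangleleft>\<^bsub>N\<^esub> (r \<triangleright>\<^bsub>eA\<^esub> y)"
      using right_moduleD(5)[OF M m Ae_A[OF x] rA] rhomD(3)[OF h mx r]
        right_moduleD(5)[OF N _ rA eA_A[OF y]] h_closed[OF mx] by simp
  }
qed

lemma unhat_br:
  assumes m: "m \<in> carrier M" and x: "x \<in> carrier Ae" and y: "y \<in> carrier eA"
  shows "unhat M N h m (br x y) = h (m \<triangleleft>\<^bsub>M\<^esub> x) \<triangleleft>\<^bsub>N\<^esub> y"
  using m br_closed[OF x y] lift_br[OF N.abelian_group_axioms balanced_unhat[OF m] x y]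
  by (simp add: unhat_def)

lemma unhat_hom: "m \<in> carrier M \<Longrightarrow> unhat M N h m \<in> add_hom W N"
  using restrict_hom[OF lift_hom[OF N.abelian_group_axioms balanced_unhat]] by (simp add: unhat_def)

lemma N_ract_hom: "a \<in> carrier A \<Longrightarrow> (\<lambda>n. n \<triangleleft>\<^bsub>N\<^esub> a) \<in> add_hom N N"
  using right_moduleD(2,3)[OF N] by (auto intro!: add_homI)

lemma unhat_rhom: "unhat M N h \<in> rhom A M (hom_rmod A W N)"
proof (rule rhomI)
  interpret M: abelian_group M using right_moduleD(1)[OF M] .
  fix m assume m: "m \<in> carrier M"
  have "unhat M N h m \<in> rhom A W N"
  proof (rule rhomI)
    fix w a assume w: "w \<in> carrier W" and a: "a \<in> carrier A"
    show "unhat M N h m (w \<triangleleft>\<^bsub>W\<^esub> a) = unhat M N h m w \<triangleleft>\<^bsub>N\<^esub> a"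
    proof (rule W_eqI[OF N.abelian_group_axioms add_hom_compose[OF W_ract_hom[OF a] unhat_hom[OF m]]
          add_hom_compose[OF unhat_hom[OF m] N_ract_hom[OF a]] _ w])
      fix x y assume x: "x \<in> carrier Ae" and y: "y \<in> carrier eA"
      show "unhat M N h m (br x y \<triangleleft>\<^bsub>W\<^esub> a) = unhat M N h m (br x y) \<triangleleft>\<^bsub>N\<^esub> a"
        unfolding br_ract[OF x y a] unhat_br[OF m x y] unhat_br[OF m x eA_mult[OF a y]]
        using right_moduleD(5)[OF N _ eA_A[OF y] a] h_closed[OF corner_act[OF M m x]] by blast
    qed
  qed (use add_hom_closed[OF unhat_hom[OF m]] add_hom_add[OF unhat_hom[OF m]] m in \<open>auto simp: unhat_def\<close>)
  then show "unhat M N h m \<in> carrier (hom_rmod A W N)" by simp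
  {
    fix m' assume m': "m' \<in> carrier M"
    have sum: "(\<lambda>w. unhat M N h m w \<oplus>\<^bsub>N\<^esub> unhat M N h m' w) \<in> add_hom W N"
      using add_hom_closed[OF unhat_hom[OF m]] add_hom_add[OF unhat_hom[OF m]]
        add_hom_closed[OF unhat_hom[OF m']] add_hom_add[OF unhat_hom[OF m']]
      by (intro add_homI) (auto simp: N.a_ac)
    have "unhat M N h (m \<oplus>\<^bsub>M\<^esub> m') w = unhat M N h m w \<oplus>\<^bsub>N\<^esub> unhat M N h m' w" if w: "w \<in> carrier W" for w
    proof (rule W_eqI[OF N.abelian_group_axioms unhat_hom[OF M.a_closed[OF m m']] sum _ w])
      fix x y assume x: "x \<in> carrier Ae" and y: "y \<in> carrier eA"
      note mx = corner_act[OF M m x] and mx' = corner_act[OF M m' x]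
      show "unhat M N h (m \<oplus>\<^bsub>M\<^esub> m') (br x y) = unhat M N h m (br x y) \<oplus>\<^bsub>N\<^esub> unhat M N h m' (br x y)"
        unfolding unhat_br[OF m x y] unhat_br[OF m' x y] unhat_br[OF M.a_closed[OF m m'] x y]
        using right_moduleD(3)[OF M m m' Ae_A[OF x]] rhomD(2)[OF h mx mx']
          right_moduleD(3)[OF N _ _ eA_A[OF y]] h_closed[OF mx] h_closed[OF mx'] by simp
    qed
    then show "unhat M N h (m \<oplus>\<^bsub>M\<^esub> m') = unhat M N h m \<oplus>\<^bsub>hom_rmod A W N\<^esub> unhat M N h m'"
      using m m' by (intro extensionalityI[of _ "carrier W"]) (auto simp: unhat_def)
  next
    fix a assume a: "a \<in> carrier A"
    have ma: "m \<triangleleft>\<^bsub>M\<^esub> a \<in> carrier M" by (rule right_moduleD(2)[OF M m a])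
    have "unhat M N h (m \<triangleleft>\<^bsub>M\<^esub> a) w = unhat M N h m (a \<triangleright>\<^bsub>W\<^esub> w)" if w: "w \<in> carrier W" for w
    proof (rule W_eqI[OF N.abelian_group_axioms unhat_hom[OF ma]
          add_hom_compose[OF W_lact_hom[OF a] unhat_hom[OF m]] _ w])
      fix x y assume x: "x \<in> carrier Ae" and y: "y \<in> carrier eA"
      show "unhat M N h (m \<triangleleft>\<^bsub>M\<^esub> a) (br x y) = unhat M N h m (a \<triangleright>\<^bsub>W\<^esub> br x y)"
        unfolding br_lact[OF x y a] unhat_br[OF ma x y] unhat_br[OF m Ae_mult[OF a x] y]
        using right_moduleD(5)[OF M m a Ae_A[OF x]] by simp
    qed
    then show "unhat M N h (m \<triangleleft>\<^bsub>M\<^esub> a) = unhat M N h m \<triangleleft>\<^bsub>hom_rmod A W N\<^esub> a"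
      using m ma by (intro extensionalityI[of _ "carrier W"]) (auto simp: unhat_def)
  }
qed (simp add: unhat_def)

lemma hat_unhat: "hat M (unhat M N h) = h"
proof (rule rhom_eqI[OF hat_rhom[OF unhat_rhom M N] h])
  fix m assume m: "m \<in> carrier (corner_mod M)"
  then have "m \<in> carrier M" "m \<triangleleft>\<^bsub>M\<^esub> e = m" by (simp_all add: carrier_corner_mod[OF M])
  then show "hat M (unhat M N h) m = h m"
    using m unhat_br[OF _ e_Ae e_eA] h_closed[OF m] by (simp add: hat_def)
qed

end

lemma bocs_hom_eqI:
  assumes f: "f \<in> rhom A M (hom_rmod A W N)" and g: "g \<in> rhom A M (hom_rmod A W N)"
    and M: "right_module A M" and N: "right_module A N"
    and eq: "hat M f = hat M g"
  shows "f = g"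
proof (rule rhom_eqI[OF f g])
  fix m assume m: "m \<in> carrier M"
  note fm = bocs_homD(1)[OF f m] and gm = bocs_homD(1)[OF g m]
  show "f m = g m"
  proof (rule rhom_eqI[OF fm gm])
    fix w assume w: "w \<in> carrier W"
    show "f m w = g m w"
    proof (rule W_eqI[OF right_moduleD(1)[OF N] rhomD(5)[OF fm] rhomD(5)[OF gm] _ w])
      fix x y assume x: "x \<in> carrier Ae" and y: "y \<in> carrier eA"
      have "f (m \<triangleleft>\<^bsub>M\<^esub> x) (br e e) = g (m \<triangleleft>\<^bsub>M\<^esub> x) (br e e)"
        using fun_cong[OF eq, of "m \<triangleleft>\<^bsub>M\<^esub> x"] corner_act[OF M m x] by (simp add: hat_def)
      then show "f m (br x y) = g m (br x y)"
        by (simp only: bocs_hom_br[OF f M m x y] bocs_hom_br[OF g M m x y])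
    qed
  qed
qed

abbreviation bocs_cat :: "'m itself \<Rightarrow> ('k, ('a, 'm) rmod, 'm \<Rightarrow> 'w \<Rightarrow> 'm) lin_cat" where
  "bocs_cat T \<equiv> bocs_mod_cat T K A W mu eps"

lemma bocs_cat_simps:
  "Obj (bocs_cat T) = {M. fd_right_module K A M}"
  "Hom (bocs_cat T) M N = hom_space A M (hom_rmod A W N)"
  "Ident (bocs_cat T) M = (\<lambda>m\<in>carrier M. compose (carrier W) (\<lambda>a\<in>carrier A. m \<triangleleft>\<^bsub>M\<^esub> a) eps)"
  "Comp (bocs_cat T) L M N g f = (\<lambda>l\<in>carrier L.
     compose (carrier W) (hom_tensor_adj A W N (compose (carrier W) g (f l))) mu)"
  by (simp_all add: bocs_mod_cat_def)

text \<open>On br(x, y) the composite has the value g(f(l)(br(x, e)))(br(e, y)). Here f(l)(br(x, e))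
  is \<open>hat L f\<close> at lx and lies in Me, so g contributes \<open>hat M g\<close> at that
  point, followed by y. Composition in the bocs thus becomes composition of maps between
  corners.\<close>

lemma bocs_comp:
  fixes L M N :: "('a, 'm) rmod"
  assumes L: "right_module A L" and M: "right_module A M" and N: "right_module A N"
    and f: "f \<in> rhom A L (hom_rmod A W M)" and g: "g \<in> rhom A M (hom_rmod A W N)"
  shows "Comp (bocs_cat T) L M N g f = unhat L N (compose (carrier (corner_mod L)) (hat M g) (hat L f))"
    (is "?c = unhat L N ?h")
proof -
  interpret N: abelian_group N using right_moduleD(1)[OF N] .
  have h: "?h \<in> rhom eAe (corner_mod L) (corner_mod N)"
    by (rule rhom_compose[OF hat_rhom[OF f L M] hat_rhom[OF g M N] corner_mod_right_module[OF L]])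
  have "?c l = unhat L N ?h l" if l: "l \<in> carrier L" for l
  proof -
    note fl = bocs_homD(1)[OF f l]
    \<comment> \<open>Balancedness over A: g(f(l)(xa))(y) = g(f(l)(x)a)(y) = g(f(l)(x))(ay), by
      linearity of f(l) and then of g.\<close>
    have bal: "balanced A W W N (\<lambda>x y. compose (carrier W) g (f l) x y)"
      by (rule balancedI)
        (use rhomD(1-3)[OF fl] rhomD(1-3)[OF bocs_homD(1)[OF g]] bocs_homD(2,3)[OF g] W_right in
          \<open>auto simp: compose_def\<close>)
    note adj = WW.tensor_lift_add_hom[OF N.abelian_group_axioms bal]
      WW.tensor_lift_pure[OF N.abelian_group_axioms bal]
    have "hom_tensor_adj A W N (compose (carrier W) g (f l)) \<in> add_hom WW.T N"
      using adj(1) by (auto simp: hom_tensor_adj_def add_hom_def)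
    note c = restrict_hom[OF add_hom_compose[OF mu_hom this], folded compose_def]
    have "compose (carrier W) (hom_tensor_adj A W N (compose (carrier W) g (f l))) mu w = unhat L N ?h l w"
      if w: "w \<in> carrier W" for w
    proof (rule W_eqI[OF N.abelian_group_axioms c unhat_hom[OF L N h l] _ w])
      fix x y assume x: "x \<in> carrier Ae" and y: "y \<in> carrier eA"
      have xe: "br x e \<in> carrier W" and ey: "br e y \<in> carrier W" and ee: "br e e \<in> carrier W"
        by (rule br_closed[OF x e_eA] br_closed[OF e_Ae y] br_closed[OF e_Ae e_eA])+
      have flx: "f l (br x e) \<in> carrier M" by (rule rhomD(1)[OF fl xe])
      have lx: "l \<triangleleft>\<^bsub>L\<^esub> x \<in> carrier (corner_mod L)" by (rule corner_act[OF L l x])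
      \<comment> \<open>With y = e the general formula leaves a trailing action of e, which is the
        identity on Me.\<close>
      have flx': "f l (br x e) = hat L f (l \<triangleleft>\<^bsub>L\<^esub> x)"
      proof -
        have "hat L f (l \<triangleleft>\<^bsub>L\<^esub> x) \<in> carrier (corner_mod M)" by (rule rhomD(1)[OF hat_rhom[OF f L M] lx])
        then show ?thesis
          using bocs_hom_br[OF f L l x e_eA] lx by (simp add: hat_def carrier_corner_mod[OF M])
      qed
      have hf: "hat L f (l \<triangleleft>\<^bsub>L\<^esub> x) \<in> carrier (corner_mod M)" by (rule rhomD(1)[OF hat_rhom[OF f L M] lx])
      then have hfe: "hat L f (l \<triangleleft>\<^bsub>L\<^esub> x) \<in> carrier M" "hat L f (l \<triangleleft>\<^bsub>L\<^esub> x) \<triangleleft>\<^bsub>M\<^esub> e = hat L f (l \<triangleleft>\<^bsub>L\<^esub> x)"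
        by (simp_all add: carrier_corner_mod[OF M])
      have "compose (carrier W) (hom_tensor_adj A W N (compose (carrier W) g (f l))) mu (br x y) =
          g (f l (br x e)) (br e y)"
        using br_closed[OF x y] xe ey adj(2)[OF xe ey] WW.pure_closed[OF xe ey]
        by (simp add: compose_def mu_br[OF x y] hom_tensor_adj_def)
      also have "\<dots> = g (hat L f (l \<triangleleft>\<^bsub>L\<^esub> x)) (br e e) \<triangleleft>\<^bsub>N\<^esub> y"
        unfolding flx' using bocs_hom_br[OF g M hfe(1) e_Ae y] hfe(2) by simp
      also have "\<dots> = ?h (l \<triangleleft>\<^bsub>L\<^esub> x) \<triangleleft>\<^bsub>N\<^esub> y" using lx hf by (simp add: compose_def hat_def[of M])
      also have "\<dots> = unhat L N ?h l (br x y)" by (rule unhat_br[OF L N h l x y, symmetric])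
      finally show "compose (carrier W) (hom_tensor_adj A W N (compose (carrier W) g (f l))) mu (br x y) =
          unhat L N ?h l (br x y)" .
    qed
    then show ?thesis
      using l by (intro extensionalityI[of _ "carrier W"]) (auto simp: bocs_cat_simps unhat_def compose_def)
  qed
  then show ?thesis
    by (intro extensionalityI[of _ "carrier L"]) (auto simp: bocs_cat_simps unhat_def)
qed

text \<open>On br(x, y) the counit gives xy, and m(xy) = (mx)y is the formula of
  \<open>unhat\<close> for the identity map of Me.\<close>

lemma bocs_ident:
  fixes M :: "('a, 'm) rmod"
  assumes M: "right_module A M"
  shows "Ident (bocs_cat T) M = unhat M M (\<lambda>m\<in>carrier (corner_mod M). m)" (is "?c = unhat M M ?h")
proof -
  interpret M: abelian_group M using right_moduleD(1)[OF M] .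
  note h = rhom_id[OF corner_mod_right_module[OF M]]
  have "?c m = unhat M M ?h m" if m: "m \<in> carrier M" for m
  proof -
    have "(\<lambda>a\<in>carrier A. m \<triangleleft>\<^bsub>M\<^esub> a) \<in> add_hom A M"
      using right_moduleD(2,4)[OF M m] by (auto intro!: add_homI)
    note c = restrict_hom[OF add_hom_compose[OF eps_hom this], folded compose_def]
    have "compose (carrier W) (\<lambda>a\<in>carrier A. m \<triangleleft>\<^bsub>M\<^esub> a) eps w = unhat M M ?h m w" if w: "w \<in> carrier W" for w
    proof (rule W_eqI[OF M.abelian_group_axioms c unhat_hom[OF M M h m] _ w])
      fix x y assume x: "x \<in> carrier Ae" and y: "y \<in> carrier eA"
      show "compose (carrier W) (\<lambda>a\<in>carrier A. m \<triangleleft>\<^bsub>M\<^esub> a) eps (br x y) = unhat M M ?h m (br x y)"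
        unfolding unhat_br[OF M M h m x y]
        using br_closed[OF x y] corner_act[OF M m x] right_moduleD(5)[OF M m Ae_A[OF x] eA_A[OF y]] 
          Ae_A[OF x] eA_A[OF y]
        by (simp add: compose_def eps_br[OF x y])
    qed
    then show ?thesis
      using m by (intro extensionalityI[of _ "carrier W"]) (auto simp: bocs_cat_simps unhat_def compose_def)
  qed
  then show ?thesis
    by (intro extensionalityI[of _ "carrier M"]) (auto simp: bocs_cat_simps unhat_def)
qed

end

section \<open>The module category of the bocs\<close>

text \<open>\<open>linear_functor\<close> does not presuppose that its source satisfies the category
  laws. Once a functor is injective on morphisms, those laws can be read off in the target.\<close>

lemma linear_category_of_faithful:
  assumes K: "field K" and D: "linear_category K D" and F: "linear_functor K C D F F1"
    and inj: "\<And>X Y. X \<in> Obj C \<Longrightarrow> Y \<in> Obj C \<Longrightarrow> inj_on (F1 X Y) (Mor C X Y)"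
    and mod: "\<And>X Y. X \<in> Obj C \<Longrightarrow> Y \<in> Obj C \<Longrightarrow> module K (Hom C X Y)"
    and id: "\<And>X. X \<in> Obj C \<Longrightarrow> Ident C X \<in> Mor C X X"
    and comp: "\<And>X Y Z f g. X \<in> Obj C \<Longrightarrow> Y \<in> Obj C \<Longrightarrow> Z \<in> Obj C \<Longrightarrow> f \<in> Mor C X Y \<Longrightarrow> g \<in> Mor C Y Z \<Longrightarrow>
      Comp C X Y Z g f \<in> Mor C X Z"
  shows "linear_category K C"
proof -
  note DD = linear_categoryD[OF K D]
  note FD = linear_functorD[OF K F]
  have eqI: "f = g" if "F1 X Y f = F1 X Y g" "X \<in> Obj C" "Y \<in> Obj C" "f \<in> Mor C X Y" "g \<in> Mor C X Y" for X Y f g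
    using inj_onD[OF inj[OF that(2,3)] that(1,4,5)] .
  have add: "f \<oplus>\<^bsub>Hom C X Y\<^esub> g \<in> Mor C X Y"
    if "X \<in> Obj C" "Y \<in> Obj C" "f \<in> Mor C X Y" "g \<in> Mor C X Y" for X Y f g
    using abelian_groupE(1)[OF module.axioms(2)[OF mod[OF that(1,2)]]] that by blast
  have smult: "k \<odot>\<^bsub>Hom C X Y\<^esub> f \<in> Mor C X Y"
    if "X \<in> Obj C" "Y \<in> Obj C" "f \<in> Mor C X Y" "k \<in> carrier K" for X Y f k
    using module.smult_closed[OF mod[OF that(1,2)]] that by blast
  show ?thesis
    unfolding linear_category_def
  proof (intro conjI ballI)
    fix X Y f assume X: "X \<in> Obj C" and Y: "Y \<in> Obj C" and f: "f \<in> Mor C X Y"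
    show "Comp C X X Y f (Ident C X) = f"
      by (rule eqI[OF _ X Y comp[OF X X Y id[OF X] f] f])
        (simp add: FD(6)[OF X X Y id[OF X] f] FD(1,2,5) DD(4) X Y f)
    show "Comp C X Y Y (Ident C Y) f = f"
      by (rule eqI[OF _ X Y comp[OF X Y Y f id[OF Y]] f])
        (simp add: FD(6)[OF X Y Y f id[OF Y]] FD(1,2,5) DD(5) X Y f)
  next
    fix W X Y Z f g h assume "W \<in> Obj C" "X \<in> Obj C" "Y \<in> Obj C" "Z \<in> Obj C"
      "f \<in> Mor C W X" "g \<in> Mor C X Y" "h \<in> Mor C Y Z"
    then show "Comp C W Y Z h (Comp C W X Y g f) = Comp C W X Z (Comp C X Y Z h g) f"
      by (intro eqI[of W Z] comp[of W X Z] comp[of W Y Z] comp[of X Y Z] comp[of W X Y])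
        (simp_all add: FD(6)[of W Y Z] FD(6)[of W X Z] FD(6)[of W X Y] FD(6)[of X Y Z] comp FD(1,2) DD(6))
  next
    fix X Y Z f f' g g' k assume A: "X \<in> Obj C" "Y \<in> Obj C" "Z \<in> Obj C"
      "f \<in> Mor C X Y" "f' \<in> Mor C X Y" "g \<in> Mor C Y Z" "g' \<in> Mor C Y Z" "k \<in> carrier K"
    note c = comp[OF A(1-3)]
    note F6 = FD(6)[OF A(1-3)]
    show "Comp C X Y Z g (f \<oplus>\<^bsub>Hom C X Y\<^esub> f') = Comp C X Y Z g f \<oplus>\<^bsub>Hom C X Z\<^esub> Comp C X Y Z g f'"
      by (rule eqI[OF _ A(1,3)]) (use A in \<open>simp_all add: c add F6 FD(1-4) DD(7)\<close>)
    show "Comp C X Y Z (g \<oplus>\<^bsub>Hom C Y Z\<^esub> g') f = Comp C X Y Z g f \<oplus>\<^bsub>Hom C X Z\<^esub> Comp C X Y Z g' f"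
      by (rule eqI[OF _ A(1,3)]) (use A in \<open>simp_all add: c add F6 FD(1-4) DD(8)\<close>)
    show "Comp C X Y Z g (k \<odot>\<^bsub>Hom C X Y\<^esub> f) = k \<odot>\<^bsub>Hom C X Z\<^esub> Comp C X Y Z g f"
      by (rule eqI[OF _ A(1,3)]) (use A in \<open>simp_all add: c smult F6 FD(1-4) DD(9)\<close>)
    show "Comp C X Y Z (k \<odot>\<^bsub>Hom C Y Z\<^esub> g) f = k \<odot>\<^bsub>Hom C X Z\<^esub> Comp C X Y Z g f"
      by (rule eqI[OF _ A(1,3)]) (use A in \<open>simp_all add: c smult F6 FD(1-4) DD(10)\<close>)
  qed (use mod id comp in auto)
qed

lemma linear_functor_compose:
  assumes K: "field K" and F: "linear_functor K C D F F1" and G: "linear_functor K D E G G1"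
  shows "linear_functor K C E (\<lambda>X. G (F X)) (\<lambda>X Y f. G1 (F X) (F Y) (F1 X Y f))"
  unfolding linear_functor_def
  using linear_functorD[OF K F] linear_functorD[OF K G] by simp

lemma compose_rhom_bij:
  assumes "f \<in> rhom R L M" "g \<in> rhom R M N" "bij_betw f (carrier L) (carrier M)" "bij_betw g (carrier M) (carrier N)"
  shows "bij_betw (compose (carrier L) g f) (carrier L) (carrier N)"
proof -
  have "bij_betw (g \<circ> f) (carrier L) (carrier N)" using assms(3,4) by (rule bij_betw_trans)
  then show ?thesis by (rule bij_betw_cong[THEN iffD1, rotated]) (simp add: compose_def)
qed

context fd_alg
begin

lemma mod_cat_simps [simp]:
  "Obj (mod_cat T K A) = {M. fd_right_module K A M}" "Hom (mod_cat T K A) = hom_space A"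
  "Ident (mod_cat T K A) M = (\<lambda>m\<in>carrier M. m)" "Comp (mod_cat T K A) L M N g f = compose (carrier L) g f"
  by (simp_all add: mod_cat_def)

lemma rhom_bij_inverse:
  assumes M: "right_module A M" and N: "right_module A N" and f: "f \<in> rhom A M N"
    and bij: "bij_betw f (carrier M) (carrier N)"
  obtains g where "g \<in> rhom A N M" "compose (carrier M) g f = (\<lambda>m\<in>carrier M. m)"
    "compose (carrier N) f g = (\<lambda>m\<in>carrier N. m)" "bij_betw g (carrier N) (carrier M)"
    "\<forall>m\<in>carrier M. g (f m) = m" "\<forall>n\<in>carrier N. f (g n) = n"
proof (rule that)
  let ?g = "restrict (inv_into (carrier M) f) (carrier N)"
  have inj: "inj_on f (carrier M)" and im: "f ` carrier M = carrier N" using bij by (auto simp: bij_betw_def)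
  have gf: "?g (f m) = m" if "m \<in> carrier M" for m using that inj im by auto
  have fg: "f (?g n) = n" if "n \<in> carrier N" for n using that im by (auto simp: f_inv_into_f)
  show "?g \<in> rhom A N M" by (rule rhom_inv[OF f bij M N])
  show "compose (carrier M) ?g f = (\<lambda>m\<in>carrier M. m)" unfolding compose_def using gf by (rule restrict_ext)
  show "compose (carrier N) f ?g = (\<lambda>m\<in>carrier N. m)" unfolding compose_def using fg by (rule restrict_ext)
  have "bij_betw (inv_into (carrier M) f) (carrier N) (carrier M)" by (rule bij_betw_inv_into[OF bij])
  then show "bij_betw ?g (carrier N) (carrier M)" by (rule bij_betw_cong[THEN iffD1, rotated]) simp
  show "\<forall>m\<in>carrier M. ?g (f m) = m" "\<forall>n\<in>carrier N. f (?g n) = n"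
    using gf fg by auto
qed

lemma mod_cat_iso:
  assumes "fd_right_module K A M" "fd_right_module K A N" "f \<in> rhom A M N" "bij_betw f (carrier M) (carrier N)"
  shows "cat_iso (mod_cat T K A) M N f"
proof -
  have "right_module A M" "right_module A N" using assms by (auto simp: fd_right_module_def)
  then obtain g where "g \<in> rhom A N M" "compose (carrier M) g f = (\<lambda>m\<in>carrier M. m)"
    "compose (carrier N) f g = (\<lambda>m\<in>carrier N. m)"
    using rhom_bij_inverse assms(3,4) by metis
  then show ?thesis using assms(3) by (auto simp: cat_iso_def)
qed

text \<open>Bridges two carrier types: corners of modules over \<open>'m\<close> have carriers in
  \<open>'m\<close>, while the target category lives in \<open>'n\<close>. Each module gets a chosen
  copy with mutually inverse isomorphisms, and morphisms are conjugated by them.\<close>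

lemma copy_functor:
  assumes "large_type TYPE('n) K"
  obtains P :: "('a, 'm) rmod \<Rightarrow> ('a, 'n) rmod" and P1 where
    "linear_functor K (mod_cat TYPE('m) K A) (mod_cat TYPE('n) K A) P P1"
    "\<And>X Y. fd_right_module K A X \<Longrightarrow> fd_right_module K A Y \<Longrightarrow>
      bij_betw (P1 X Y) (rhom A X Y) (rhom A (P X) (P Y))"
    "\<And>X. fd_right_module K A X \<Longrightarrow> \<exists>\<kappa>\<in>rhom A X (P X). bij_betw \<kappa> (carrier X) (carrier (P X))"
proof -
  have "\<exists>(N :: ('a, 'n) rmod) \<kappa> \<kappa>'. fd_right_module K A N \<and> \<kappa> \<in> rhom A M N \<and> \<kappa>' \<in> rhom A N M \<and>
      bij_betw \<kappa> (carrier M) (carrier N) \<and> (\<forall>m\<in>carrier M. \<kappa>' (\<kappa> m) = m) \<and> (\<forall>n\<in>carrier N. \<kappa> (\<kappa>' n) = n)"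
    if M: "fd_right_module K A M" for M :: "('a, 'm) rmod"
  proof -
    obtain N :: "('a, 'n) rmod" and \<kappa> where N: "fd_right_module K A N" "\<kappa> \<in> rhom A M N"
      "bij_betw \<kappa> (carrier M) (carrier N)"
      using exists_copy[OF fd_alg_axioms M assms] by blast
    have "right_module A M" "right_module A N" using M N by (auto simp: fd_right_module_def)
    then obtain \<kappa>' where k: "\<kappa>' \<in> rhom A N M" "compose (carrier M) \<kappa>' \<kappa> = (\<lambda>m\<in>carrier M. m)"
      "compose (carrier N) \<kappa> \<kappa>' = (\<lambda>m\<in>carrier N. m)" "bij_betw \<kappa>' (carrier N) (carrier M)"
      "\<forall>m\<in>carrier M. \<kappa>' (\<kappa> m) = m" "\<forall>n\<in>carrier N. \<kappa> (\<kappa>' n) = n"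
      by (rule rhom_bij_inverse[OF _ _ N(2,3)])
    show ?thesis by (intro exI conjI) (rule N k)+
  qed
  \<comment> \<open>The copy and its two isomorphisms are packed into one value, and finite
    dimension becomes a premise of the property, so that a single choice over all records M yields
    them.\<close>
  then have "\<forall>M :: ('a, 'm) rmod. \<exists>p :: ('a, 'n) rmod \<times> ('m \<Rightarrow> 'n) \<times> ('n \<Rightarrow> 'm). fd_right_module K A M \<longrightarrow>
      fd_right_module K A (fst p) \<and> fst (snd p) \<in> rhom A M (fst p) \<and> snd (snd p) \<in> rhom A (fst p) M \<and>
      bij_betw (fst (snd p)) (carrier M) (carrier (fst p)) \<and>
      (\<forall>m\<in>carrier M. snd (snd p) (fst (snd p) m) = m) \<and>
      (\<forall>n\<in>carrier (fst p). fst (snd p) (snd (snd p) n) = n)"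
    by simp
  from choice[OF this] obtain p :: "('a, 'm) rmod \<Rightarrow> ('a, 'n) rmod \<times> ('m \<Rightarrow> 'n) \<times> ('n \<Rightarrow> 'm)" where
    p: "\<forall>M. fd_right_module K A M \<longrightarrow>
      fd_right_module K A (fst (p M)) \<and> fst (snd (p M)) \<in> rhom A M (fst (p M)) \<and>
      snd (snd (p M)) \<in> rhom A (fst (p M)) M \<and>
      bij_betw (fst (snd (p M))) (carrier M) (carrier (fst (p M))) \<and>
      (\<forall>m\<in>carrier M. snd (snd (p M)) (fst (snd (p M)) m) = m) \<and>
      (\<forall>n\<in>carrier (fst (p M)). fst (snd (p M)) (snd (snd (p M)) n) = n)"
    by (elim exE)
  define P where "P M = fst (p M)" for M
  define \<kappa> where "\<kappa> M = fst (snd (p M))" for M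
  define \<kappa>' where "\<kappa>' M = snd (snd (p M))" for M
  have P: "fd_right_module K A (P M)" and \<kappa>: "\<kappa> M \<in> rhom A M (P M)" and \<kappa>': "\<kappa>' M \<in> rhom A (P M) M"
    and bij: "bij_betw (\<kappa> M) (carrier M) (carrier (P M))"
    and \<kappa>'\<kappa>: "\<And>m. m \<in> carrier M \<Longrightarrow> \<kappa>' M (\<kappa> M m) = m"
    and \<kappa>\<kappa>': "\<And>n. n \<in> carrier (P M) \<Longrightarrow> \<kappa> M (\<kappa>' M n) = n"
    if "fd_right_module K A M" for M
    using p[THEN spec, THEN mp, OF that] unfolding P_def \<kappa>_def \<kappa>'_def by auto
  have R: "right_module A M" if "fd_right_module K A M" for M :: "('a, 'm) rmod"
    using that by (simp add: fd_right_module_def)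
  have R': "right_module A M" if "fd_right_module K A M" for M :: "('a, 'n) rmod"
    using that by (simp add: fd_right_module_def)
  define P1 where "P1 X Y f = (\<lambda>x\<in>carrier (P X). \<kappa> Y (f (\<kappa>' X x)))" for X Y f
  define Q1 where "Q1 X Y f = (\<lambda>x\<in>carrier X. \<kappa>' Y (f (\<kappa> X x)))" for X Y f
  have P1: "P1 X Y f \<in> rhom A (P X) (P Y)"
    if X: "fd_right_module K A X" and Y: "fd_right_module K A Y" and f: "f \<in> rhom A X Y" for X Y f
  proof -
    have "compose (carrier (P X)) (\<kappa> Y) (compose (carrier (P X)) f (\<kappa>' X)) \<in> rhom A (P X) (P Y)"
      by (intro rhom_compose[OF rhom_compose[OF \<kappa>'[OF X] f] \<kappa>[OF Y]] R' P X)
    also have "compose (carrier (P X)) (\<kappa> Y) (compose (carrier (P X)) f (\<kappa>' X)) = P1 X Y f"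
      by (auto simp: P1_def compose_def intro!: restrict_ext)
    finally show ?thesis .
  qed
  have Q1: "Q1 X Y f \<in> rhom A X Y"
    if X: "fd_right_module K A X" and Y: "fd_right_module K A Y" and f: "f \<in> rhom A (P X) (P Y)" for X Y f
  proof -
    have "compose (carrier X) (\<kappa>' Y) (compose (carrier X) f (\<kappa> X)) \<in> rhom A X Y"
      by (intro rhom_compose[OF rhom_compose[OF \<kappa>[OF X] f] \<kappa>'[OF Y]] R X)
    also have "compose (carrier X) (\<kappa>' Y) (compose (carrier X) f (\<kappa> X)) = Q1 X Y f"
      by (auto simp: Q1_def compose_def intro!: restrict_ext)
    finally show ?thesis .
  qed
  show ?thesis
  proof (rule that[of P P1])
    show "bij_betw (P1 X Y) (rhom A X Y) (rhom A (P X) (P Y))"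
      if X: "fd_right_module K A X" and Y: "fd_right_module K A Y" for X Y
    proof (rule bij_betwI[of _ _ _ "Q1 X Y"])
      show "P1 X Y \<in> rhom A X Y \<rightarrow> rhom A (P X) (P Y)" using P1[OF X Y] by auto
      show "Q1 X Y \<in> rhom A (P X) (P Y) \<rightarrow> rhom A X Y" using Q1[OF X Y] by auto
    next
      fix f assume f: "f \<in> rhom A X Y"
      show "Q1 X Y (P1 X Y f) = f"
        by (rule rhom_eqI[OF Q1[OF X Y P1[OF X Y f]] f])
          (use rhomD(1)[OF \<kappa>[OF X]] rhomD(1)[OF f] in \<open>simp add: Q1_def P1_def \<kappa>'\<kappa>[OF X] \<kappa>'\<kappa>[OF Y]\<close>)
    next
      fix f assume f: "f \<in> rhom A (P X) (P Y)"
      show "P1 X Y (Q1 X Y f) = f"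
        by (rule rhom_eqI[OF P1[OF X Y Q1[OF X Y f]] f])
          (use rhomD(1)[OF \<kappa>'[OF X]] rhomD(1)[OF f] in \<open>simp add: Q1_def P1_def \<kappa>\<kappa>'[OF X] \<kappa>\<kappa>'[OF Y]\<close>)
    qed
    show "\<exists>k\<in>rhom A X (P X). bij_betw k (carrier X) (carrier (P X))" if "fd_right_module K A X" for X
      using \<kappa>[OF that] bij[OF that] by blast
    show "linear_functor K (mod_cat TYPE('m) K A) (mod_cat TYPE('n) K A) P P1"
      unfolding linear_functor_def mod_cat_simps mem_Collect_eq hom_space_simps
    proof (intro conjI ballI; (unfold mem_Collect_eq)?)
      fix X Y :: "('a, 'm) rmod" and f g k assume X: "fd_right_module K A X" and Y: "fd_right_module K A Y"
        and f: "f \<in> rhom A X Y" and g: "g \<in> rhom A X Y" and k: "k \<in> carrier K"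
      note b = rhomD(1)[OF \<kappa>'[OF X]]
      show "P1 X Y (\<lambda>m\<in>carrier X. f m \<oplus>\<^bsub>Y\<^esub> g m) = (\<lambda>m\<in>carrier (P X). P1 X Y f m \<oplus>\<^bsub>P Y\<^esub> P1 X Y g m)"
        unfolding P1_def
        by (rule restrict_ext) (simp add: b rhomD(1)[OF f] rhomD(1)[OF g] rhomD(2)[OF \<kappa>[OF Y]])
      show "P1 X Y (\<lambda>m\<in>carrier X. f m \<triangleleft>\<^bsub>Y\<^esub> sc k) = (\<lambda>m\<in>carrier (P X). P1 X Y f m \<triangleleft>\<^bsub>P Y\<^esub> sc k)"
        unfolding P1_def
        by (rule restrict_ext) (simp add: b k rhomD(1)[OF f] rhomD(3)[OF \<kappa>[OF Y]])
    next
      fix X :: "('a, 'm) rmod" assume X: "fd_right_module K A X"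
      show "P1 X X (\<lambda>m\<in>carrier X. m) = (\<lambda>m\<in>carrier (P X). m)"
        unfolding P1_def by (rule restrict_ext) (simp add: rhomD(1)[OF \<kappa>'[OF X]] \<kappa>\<kappa>'[OF X])
    next
      fix X Y Z :: "('a, 'm) rmod" and f g assume X: "fd_right_module K A X" and Y: "fd_right_module K A Y" and Z: "fd_right_module K A Z"
        and f: "f \<in> rhom A X Y" and g: "g \<in> rhom A Y Z"
      show "P1 X Z (compose (carrier X) g f) = compose (carrier (P X)) (P1 Y Z g) (P1 X Y f)"
        unfolding P1_def compose_def
        by (rule restrict_ext)
          (simp add: rhomD(1)[OF \<kappa>'[OF X]] rhomD(1)[OF f] rhomD(1)[OF \<kappa>[OF Y]] \<kappa>'\<kappa>[OF Y])
    qed (use P P1 in auto)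
  qed
qed

end

text \<open>A corner module \<open>X\<close> is the corner of \<open>X \<otimes>\<^bsub>eAe\<^esub> eA\<close>. The left action in \<open>as_bimod\<close> is a dummy,
  needed only to fit the type of the tensor product.\<close>

definition as_bimod :: "('r, 'm) rmod \<Rightarrow> ('r, 'r, 'm) bimod" where
  "as_bimod X = \<lparr>carrier = carrier X, monoid.mult = undefined, one = undefined, ring.zero = \<zero>\<^bsub>X\<^esub>,
     ring.add = ring.add X, ract = ract X, lact = (\<lambda>_ m. m)\<rparr>"

lemma as_bimod_simps [simp]:
  "carrier (as_bimod X) = carrier X" "\<zero>\<^bsub>as_bimod X\<^esub> = \<zero>\<^bsub>X\<^esub>"
  "x \<oplus>\<^bsub>as_bimod X\<^esub> y = x \<oplus>\<^bsub>X\<^esub> y" "x \<triangleleft>\<^bsub>as_bimod X\<^esub> r = x \<triangleleft>\<^bsub>X\<^esub> r"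
  by (simp_all add: as_bimod_def)

lemma as_bimod_right_module: "right_module R X \<Longrightarrow> right_module R (as_bimod X)"
proof -
  assume X: "right_module R X"
  have "abelian_group (as_bimod X)"
    using abelian_groupE[OF right_moduleD(1)[OF X]] by (intro abelian_groupI) auto
  then show ?thesis using X by (simp add: right_module_def)
qed

text \<open>The maps x |-> x \<otimes> e and x \<otimes> y |-> x(ye) are mutually inverse between X
  and the corner of the tensor product; the second makes sense because ye lies in eAe. The tensor
  product has its carrier in another type, so it is replaced by a copy in \<open>'m\<close>, and for
  this its finite dimension is needed.\<close>

lemma (in alg_idem) corner_mod_ess_surj:
  fixes X :: "('a, 'n) rmod"
  assumes X: "fd_right_module K eAe X" and large: "large_type TYPE('m) K"
  shows "\<exists>(M :: ('a, 'm) rmod) \<psi>. fd_right_module K A M \<and> \<psi> \<in> rhom eAe X (corner_mod M) \<and>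
    bij_betw \<psi> (carrier X) (carrier (corner_mod M))"
proof -
  have XR: "right_module eAe X" using X by (simp add: fd_right_module_def)
  interpret X: abelian_group X using right_moduleD(1)[OF XR] .
  note XD = right_moduleD(2-)[OF XR]
  interpret T: tensor_product eAe "as_bimod X" eA
    by (rule tensor_product.intro[OF as_bimod_right_module[OF XR] eA_left_module])
  have comm: "(r \<triangleright>\<^bsub>eA\<^esub> y) \<triangleleft>\<^bsub>eA\<^esub> a = r \<triangleright>\<^bsub>eA\<^esub> (y \<triangleleft>\<^bsub>eA\<^esub> a)"
    if "r \<in> carrier eAe" "y \<in> carrier eA" "a \<in> carrier A" for r y a
    using that unfolding carrier_corner carrier_eA by (simp add: A.m_assoc)
  note ract_pure = T.ract_pure[OF eA_right_module comm, simplified as_bimod_simps mult_bimod_simps(2-)]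
  have TR: "right_module A T.T" by (rule T.tensor_right_module[OF eA_right_module comm A.ring_axioms])
  note TD = right_moduleD(2-)[OF TR]
  interpret XS: module K "scalar_space eAe X" by (rule Corner.scalar_space_module[OF XR])
  interpret eAS: module K "scalar_space A eA" by (rule scalar_space_module[OF eA_right_module])
  interpret TS: module K "scalar_space A T.T" by (rule scalar_space_module[OF TR])
  have eA_sub: "y \<in> carrier A" "e \<otimes>\<^bsub>A\<^esub> y = y" if "y \<in> carrier eA" for y using that unfolding carrier_eA by auto
  have eA_mult: "y \<otimes>\<^bsub>A\<^esub> a \<in> carrier eA" if "y \<in> carrier eA" "a \<in> carrier A" for y a
    using that unfolding carrier_eA by (simp add: A.m_assoc[symmetric])
  have e_eA: "e \<in> carrier eA" unfolding carrier_eA by simp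
  have fd: "fd_right_module K A T.T"
  proof -
    obtain S where S: "finite S" "S \<subseteq> carrier X"
      "\<And>W. submodule W K (scalar_space eAe X) \<Longrightarrow> S \<subseteq> W \<Longrightarrow> carrier X \<subseteq> W"
      using fin_dimE[OF XS.module_axioms] X unfolding fd_right_module_def scalar_space_simps by metis
    obtain Y where Y: "finite Y" "Y \<subseteq> carrier eA"
      "\<And>W. submodule W K (scalar_space A eA) \<Longrightarrow> Y \<subseteq> W \<Longrightarrow> carrier eA \<subseteq> W"
      using fin_dimE[OF eAS.module_axioms] eA_fd unfolding fd_right_module_def scalar_space_simps by metis
    have "fin_dim K (scalar_space A T.T)"
    proof (rule fin_dimI[OF TS.module_axioms, of "(\<lambda>(x, y). T.pure x y) ` (S \<times> Y)"])
      show "finite ((\<lambda>(x, y). T.pure x y) ` (S \<times> Y))" using S Y by simp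
      show "(\<lambda>(x, y). T.pure x y) ` (S \<times> Y) \<subseteq> carrier (scalar_space A T.T)"
      proof
        fix t assume "t \<in> (\<lambda>(x, y). T.pure x y) ` (S \<times> Y)"
        then obtain x y where "x \<in> S" "y \<in> Y" "t = T.pure x y" by auto
        then show "t \<in> carrier (scalar_space A T.T)"
          using T.pure_closed[of x y] subsetD[OF S(2), of x] subsetD[OF Y(2), of y]
          by (simp del: mult_bimod_simps(1))
      qed
      fix W assume W: "submodule W K (scalar_space A T.T)" "(\<lambda>(x, y). T.pure x y) ` (S \<times> Y) \<subseteq> W"
      note WD = submoduleD[OF TS.module_axioms W(1), unfolded scalar_space_simps]
      \<comment> \<open>Spanning in two stages. For a generator y in Y, the x with x \<otimes> y in
        W form a subspace containing S; afterwards, for any x, the y with x \<otimes> y in W form a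
        subspace containing Y.\<close>
      have 1: "T.pure x y \<in> W" if x: "x \<in> carrier X" and y: "y \<in> Y" for x y
      proof -
        have y': "y \<in> carrier eA" using y Y(2) by blast
        have hom: "(\<lambda>x. T.pure x y) \<in> add_hom X T.T"
          using y' by (auto intro!: add_homI simp: T.pure_add_left[simplified as_bimod_simps] T.pure_closed[simplified as_bimod_simps])
        have "submodule {x \<in> carrier X. T.pure x y \<in> W} K (scalar_space eAe X)"
        proof (rule submoduleI'[OF XS.module_axioms])
          show "\<zero>\<^bsub>scalar_space eAe X\<^esub> \<in> {x \<in> carrier X. T.pure x y \<in> W}"
            using add_hom_zero[OF X.abelian_group_axioms T.T.abelian_group_axioms hom] WD(2) by simp
        next
          fix k x assume k: "k \<in> carrier K" and x: "x \<in> {x \<in> carrier X. T.pure x y \<in> W}"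
          \<comment> \<open>On X the scalar k acts as ke, on the tensor product as k1 from the
            right. Balancing moves ke into eA, where (ke)y = y(k1).\<close>
          have ke: "k \<odot>\<^bsub>A\<^esub> e \<in> carrier eAe" using k by (simp add: carrier_corner smult_mult)
          have "T.pure (x \<triangleleft>\<^bsub>X\<^esub> (k \<odot>\<^bsub>A\<^esub> e)) y = T.pure x (k \<odot>\<^bsub>A\<^esub> e \<otimes>\<^bsub>A\<^esub> y)"
            using T.pure_balanced[of x "k \<odot>\<^bsub>A\<^esub> e" y] x y' ke by (simp del: mult_bimod_simps(1))
          also have "k \<odot>\<^bsub>A\<^esub> e \<otimes>\<^bsub>A\<^esub> y = y \<otimes>\<^bsub>A\<^esub> sc k"
            using k eA_sub[OF y'] by (simp add: smult_mult)
          also have "T.pure x \<dots> = T.pure x y \<triangleleft>\<^bsub>T.T\<^esub> sc k"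
            using ract_pure[OF _ _ _ _ y' sc_closed[OF k]] x by simp
          finally show "k \<odot>\<^bsub>scalar_space eAe X\<^esub> x \<in> {x \<in> carrier X. T.pure x y \<in> W}"
            using WD(4)[OF k] x XD(1)[OF _ ke] by (simp add: corner_simps)
        next
          fix x x' assume "x \<in> {x \<in> carrier X. T.pure x y \<in> W}" "x' \<in> {x \<in> carrier X. T.pure x y \<in> W}"
          then show "x \<oplus>\<^bsub>scalar_space eAe X\<^esub> x' \<in> {x \<in> carrier X. T.pure x y \<in> W}"
            using WD(3) add_hom_add[OF hom] by simp
        qed auto
        moreover have "S \<subseteq> {x \<in> carrier X. T.pure x y \<in> W}" using W(2) S(2) y by auto
        ultimately show ?thesis using S(3) x by blast
      qed
      have 2: "T.pure x y \<in> W" if x: "x \<in> carrier X" and y: "y \<in> carrier eA" for x y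
      proof -
        have hom: "T.pure x \<in> add_hom eA T.T"
          using x by (intro add_homI) (simp_all add: T.pure_add_right del: mult_bimod_simps)
        have "submodule {y \<in> carrier eA. T.pure x y \<in> W} K (scalar_space A eA)"
        proof (rule submoduleI'[OF eAS.module_axioms])
          show "\<zero>\<^bsub>scalar_space A eA\<^esub> \<in> {y \<in> carrier eA. T.pure x y \<in> W}"
            using add_hom_zero[OF eA_abelian_group T.T.abelian_group_axioms hom] WD(2)
            unfolding carrier_eA by simp
        next
          fix k y assume k: "k \<in> carrier K" and y: "y \<in> {y \<in> carrier eA. T.pure x y \<in> W}"
          have "T.pure x (y \<otimes>\<^bsub>A\<^esub> sc k) = T.pure x y \<triangleleft>\<^bsub>T.T\<^esub> sc k"
            using ract_pure[OF _ _ _ x _ sc_closed[OF k]] y by simp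
          then show "k \<odot>\<^bsub>scalar_space A eA\<^esub> y \<in> {y \<in> carrier eA. T.pure x y \<in> W}"
            using WD(4)[OF k] y eA_mult[OF _ sc_closed[OF k]] by (simp del: mult_bimod_simps(1))
        next
          fix y y' assume "y \<in> {y \<in> carrier eA. T.pure x y \<in> W}" "y' \<in> {y \<in> carrier eA. T.pure x y \<in> W}"
          then show "y \<oplus>\<^bsub>scalar_space A eA\<^esub> y' \<in> {y \<in> carrier eA. T.pure x y \<in> W}"
            using WD(3) add_hom_add[OF hom] abelian_groupE(1)[OF eA_abelian_group]
            by (simp del: mult_bimod_simps(1))
        qed auto
        moreover have "Y \<subseteq> {y \<in> carrier eA. T.pure x y \<in> W}" using 1[OF x] Y(2) by blast
        ultimately show ?thesis using Y(3) y by blast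
      qed
      show "carrier (scalar_space A T.T) \<subseteq> W"
      proof
        fix t assume "t \<in> carrier (scalar_space A T.T)"
        then have "t \<in> addspan T.T {T.pure x y | x y. x \<in> carrier (as_bimod X) \<and> y \<in> carrier eA}"
          using T.tensor_addspan by simp
        then show "t \<in> W"
        proof induction
          case (incl t)
          then obtain x y where "t = T.pure x y" "x \<in> carrier X" "y \<in> carrier eA" by auto
          then show ?case using 2 by simp
        qed (use WD in auto)
      qed
    qed
    then show ?thesis using TR by (simp add: fd_right_module_def)
  qed
  obtain M :: "('a, 'm) rmod" and \<kappa> where M: "fd_right_module K A M" "\<kappa> \<in> rhom A T.T M"
    "bij_betw \<kappa> (carrier T.T) (carrier M)"
    using exists_copy[OF fd_alg_axioms fd large] by blast
  have MR: "right_module A M" using M by (simp add: fd_right_module_def)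
  note \<kappa> = rhomD(1-3)[OF M(2)]
  have pe: "T.pure x e \<in> carrier T.T" if "x \<in> carrier X" for x using T.pure_closed[OF _ e_eA] that by simp
  have ract_e: "T.pure x y \<triangleleft>\<^bsub>T.T\<^esub> e = T.pure x (y \<otimes>\<^bsub>A\<^esub> e)" if "x \<in> carrier X" "y \<in> carrier eA" for x y
    using ract_pure[OF _ _ _ that e_closed] by simp
  have bal: "balanced eAe (as_bimod X) eA X (\<lambda>x y. x \<triangleleft>\<^bsub>X\<^esub> (y \<otimes>\<^bsub>A\<^esub> e))"
  proof -
    have ye: "y \<otimes>\<^bsub>A\<^esub> e \<in> carrier eAe" if "y \<in> carrier eA" for y
      using eA_sub[OF that] by (simp add: carrier_corner A.m_assoc[symmetric]) (simp add: A.m_assoc)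
    show ?thesis
    proof (rule balancedI, unfold as_bimod_simps)
      fix x y assume x: "x \<in> carrier X" and y: "y \<in> carrier eA"
      show "x \<triangleleft>\<^bsub>X\<^esub> (y \<otimes>\<^bsub>A\<^esub> e) \<in> carrier X" by (rule XD(1)[OF x ye[OF y]])
      {
        fix y' assume y': "y' \<in> carrier eA"
        show "x \<triangleleft>\<^bsub>X\<^esub> ((y \<oplus>\<^bsub>eA\<^esub> y') \<otimes>\<^bsub>A\<^esub> e) = x \<triangleleft>\<^bsub>X\<^esub> (y \<otimes>\<^bsub>A\<^esub> e) \<oplus>\<^bsub>X\<^esub> x \<triangleleft>\<^bsub>X\<^esub> (y' \<otimes>\<^bsub>A\<^esub> e)"
          using XD(3)[OF x ye[OF y] ye[OF y']] eA_sub(1)[OF y] eA_sub(1)[OF y']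
          by (simp add: A.l_distr corner_simps)
      next
        fix x' assume x': "x' \<in> carrier X"
        show "(x \<oplus>\<^bsub>X\<^esub> x') \<triangleleft>\<^bsub>X\<^esub> (y \<otimes>\<^bsub>A\<^esub> e) = x \<triangleleft>\<^bsub>X\<^esub> (y \<otimes>\<^bsub>A\<^esub> e) \<oplus>\<^bsub>X\<^esub> x' \<triangleleft>\<^bsub>X\<^esub> (y \<otimes>\<^bsub>A\<^esub> e)"
          by (rule XD(2)[OF x x' ye[OF y]])
      next
        fix r assume r: "r \<in> carrier eAe"
        then have rA: "r \<in> carrier A" by (simp add: carrier_corner)
        show "x \<triangleleft>\<^bsub>X\<^esub> r \<triangleleft>\<^bsub>X\<^esub> (y \<otimes>\<^bsub>A\<^esub> e) = x \<triangleleft>\<^bsub>X\<^esub> ((r \<triangleright>\<^bsub>eA\<^esub> y) \<otimes>\<^bsub>A\<^esub> e)"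
          using XD(4)[OF x r ye[OF y]] eA_sub(1)[OF y] rA by (simp add: A.m_assoc corner_simps)
      }
    qed
  qed
  let ?l = "tensor_lift X (\<lambda>x y. x \<triangleleft>\<^bsub>X\<^esub> (y \<otimes>\<^bsub>A\<^esub> e))"
  note l = T.tensor_lift_add_hom[OF X.abelian_group_axioms bal]
    T.tensor_lift_pure[OF X.abelian_group_axioms bal]
  have lpe: "?l (T.pure x e) = x" if "x \<in> carrier X" for x
    using l(2)[of x e] that e_eA XD(5)[OF that] by (simp add: corner_simps del: mult_bimod_simps(1))
  have hom: "(\<lambda>x. T.pure x e) \<in> add_hom X T.T"
    using e_eA pe by (auto intro!: add_homI simp: T.pure_add_left[simplified as_bimod_simps] simp del: mult_bimod_simps(1))
  \<comment> \<open>Since ye is in eAe, it can be balanced to the left: x \<otimes> ye = x(ye)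
    \<otimes> e. So every element fixed by e has the form z \<otimes> e, which gives
    surjectivity.\<close>
  have rec: "t \<triangleleft>\<^bsub>T.T\<^esub> e = T.pure (?l t) e" if t: "t \<in> carrier T.T" for t
  proof (rule T.tensor_eqI[OF T.T.abelian_group_axioms _ add_hom_compose[OF l(1) hom] _ t])
    show "(\<lambda>t. t \<triangleleft>\<^bsub>T.T\<^esub> e) \<in> add_hom T.T T.T" using TD(1,2) by (auto intro!: add_homI)
    fix x y assume "x \<in> carrier (as_bimod X)" and y: "y \<in> carrier eA"
    then have x: "x \<in> carrier X" by simp
    have ye: "y \<otimes>\<^bsub>A\<^esub> e \<in> carrier eAe"
      using eA_sub[OF y] by (simp add: carrier_corner A.m_assoc[symmetric]) (simp add: A.m_assoc)
    have "T.pure (x \<triangleleft>\<^bsub>X\<^esub> (y \<otimes>\<^bsub>A\<^esub> e)) e = T.pure x (y \<otimes>\<^bsub>A\<^esub> e \<otimes>\<^bsub>A\<^esub> e)"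
      using T.pure_balanced[of x "y \<otimes>\<^bsub>A\<^esub> e" e] x ye e_eA by (simp del: mult_bimod_simps(1))
    then show "T.pure x y \<triangleleft>\<^bsub>T.T\<^esub> e = T.pure (?l (T.pure x y)) e"
      using x y eA_sub(1)[OF y] by (simp add: ract_e l(2) A.m_assoc del: mult_bimod_simps(1))
  qed
  define \<psi> where "\<psi> = (\<lambda>x\<in>carrier X. \<kappa> (T.pure x e))"
  have \<psi>: "\<psi> \<in> rhom eAe X (corner_mod M)"
  proof (rule rhomI)
    fix x assume x: "x \<in> carrier X"
    have "\<kappa> (T.pure x e) \<triangleleft>\<^bsub>M\<^esub> e = \<kappa> (T.pure x e)"
      using \<kappa>(3)[OF pe[OF x] e_closed] ract_e[OF x e_eA] by simp
    then show "\<psi> x \<in> carrier (corner_mod M)"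
      using x \<kappa>(1)[OF pe[OF x]] by (simp add: \<psi>_def carrier_corner_mod[OF MR])
    fix r assume r: "r \<in> carrier eAe"
    then have rA: "r \<in> carrier A" "e \<otimes>\<^bsub>A\<^esub> r = r" "r \<otimes>\<^bsub>A\<^esub> e = r" by (auto simp: carrier_corner)
    have "T.pure (x \<triangleleft>\<^bsub>X\<^esub> r) e = T.pure x (r \<otimes>\<^bsub>A\<^esub> e)"
      using T.pure_balanced[of x r e] x r e_eA by (simp del: mult_bimod_simps(1))
    also have "\<dots> = T.pure x e \<triangleleft>\<^bsub>T.T\<^esub> r"
      using ract_pure[OF _ _ _ x e_eA rA(1)] rA by simp
    finally show "\<psi> (x \<triangleleft>\<^bsub>X\<^esub> r) = \<psi> x \<triangleleft>\<^bsub>corner_mod M\<^esub> r"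
      using x XD(1)[OF x r] \<kappa>(3)[OF pe[OF x] rA(1)] by (simp add: \<psi>_def)
  next
    fix x x' assume x: "x \<in> carrier X" and x': "x' \<in> carrier X"
    show "\<psi> (x \<oplus>\<^bsub>X\<^esub> x') = \<psi> x \<oplus>\<^bsub>corner_mod M\<^esub> \<psi> x'"
      using x x' \<kappa>(2)[OF pe[OF x] pe[OF x']] add_hom_add[OF hom x x'] by (simp add: \<psi>_def)
  qed (simp add: \<psi>_def)
  have inj\<kappa>: "inj_on \<kappa> (carrier T.T)" and im\<kappa>: "\<kappa> ` carrier T.T = carrier M"
    using M(3) by (auto simp: bij_betw_def)
  have "bij_betw \<psi> (carrier X) (carrier (corner_mod M))"
    unfolding bij_betw_def
  proof
    show "inj_on \<psi> (carrier X)"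
    proof (rule inj_onI)
      fix x x' assume x: "x \<in> carrier X" and x': "x' \<in> carrier X" and eq: "\<psi> x = \<psi> x'"
      from eq have "\<kappa> (T.pure x e) = \<kappa> (T.pure x' e)"
        unfolding \<psi>_def restrict_apply'[OF x] restrict_apply'[OF x'] .
      then have "T.pure x e = T.pure x' e" by (rule inj_onD[OF inj\<kappa> _ pe[OF x] pe[OF x']])
      then have "?l (T.pure x e) = ?l (T.pure x' e)" by (rule arg_cong)
      then show "x = x'" unfolding lpe[OF x] lpe[OF x'] .
    qed
    show "\<psi> ` carrier X = carrier (corner_mod M)"
    proof
      show "\<psi> ` carrier X \<subseteq> carrier (corner_mod M)" using rhomD(1)[OF \<psi>] by blast
      show "carrier (corner_mod M) \<subseteq> \<psi> ` carrier X"
      proof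
        fix m assume "m \<in> carrier (corner_mod M)"
        then have m: "m \<in> carrier M" "m \<triangleleft>\<^bsub>M\<^esub> e = m" by (simp_all add: carrier_corner_mod[OF MR])
        then obtain t where t: "t \<in> carrier T.T" "m = \<kappa> t" using im\<kappa> by blast
        have "m = \<kappa> (t \<triangleleft>\<^bsub>T.T\<^esub> e)" using m(2) \<kappa>(3)[OF t(1) e_closed] t(2) by simp
        also have "\<dots> = \<psi> (?l t)" using rec[OF t(1)] add_hom_closed[OF l(1) t(1)] by (simp add: \<psi>_def)
        finally show "m \<in> \<psi> ` carrier X" using add_hom_closed[OF l(1) t(1)] by blast
      qed
    qed
  qed
  then show ?thesis using M(1) \<psi> by (intro exI conjI)
qed

context bocs_data
begin

lemma hat_functor:
  "linear_functor K (bocs_cat TYPE('m)) (mod_cat TYPE('m) K eAe) corner_mod (\<lambda>M N. hat M)"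
proof -
  have R: "right_module A M" if "fd_right_module K A M" for M :: "('a, 'm) rmod"
    using that by (simp add: fd_right_module_def)
  have ee: "br e e \<in> carrier W" by (rule br_closed[OF e_Ae e_eA])
  have C: "m \<in> carrier M" if "m \<in> carrier (corner_mod M)" "fd_right_module K A M" for m and M :: "('a, 'm) rmod"
    using that(1) by (simp add: carrier_corner_mod[OF R[OF that(2)]])
  show ?thesis
    unfolding linear_functor_def bocs_cat_simps(1,2) Corner.mod_cat_simps hom_space_simps
  proof (intro conjI ballI; (unfold mem_Collect_eq)?)
    fix M :: "('a, 'm) rmod" assume "fd_right_module K A M"
    then show "fd_right_module K eAe (corner_mod M)" by (rule corner_mod_fd)
  next
    fix M N :: "('a, 'm) rmod" and f assume M: "fd_right_module K A M" and N: "fd_right_module K A N"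
      and f: "f \<in> rhom A M (hom_rmod A W N)"
    show "hat M f \<in> rhom eAe (corner_mod M) (corner_mod N)"
      by (rule hat_rhom[OF f R[OF M] R[OF N]])
  next
    fix M N :: "('a, 'm) rmod" and f g k assume M: "fd_right_module K A M" and N: "fd_right_module K A N"
      and f: "f \<in> rhom A M (hom_rmod A W N)" and g: "g \<in> rhom A M (hom_rmod A W N)" and k: "k \<in> carrier K"
    show "hat M (\<lambda>m\<in>carrier M. f m \<oplus>\<^bsub>hom_rmod A W N\<^esub> g m) =
        (\<lambda>m\<in>carrier (corner_mod M). hat M f m \<oplus>\<^bsub>corner_mod N\<^esub> hat M g m)"
      unfolding hat_def by (rule restrict_ext) (use C[OF _ M] ee in simp)
    show "hat M (\<lambda>m\<in>carrier M. f m \<triangleleft>\<^bsub>hom_rmod A W N\<^esub> sc k) =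
        (\<lambda>m\<in>carrier (corner_mod M). hat M f m \<triangleleft>\<^bsub>corner_mod N\<^esub> (k \<odot>\<^bsub>eAe\<^esub> \<one>\<^bsub>eAe\<^esub>))"
    proof -
      \<comment> \<open>In the bocs a scalar acts through the left action on W. K-centrality of W
        turns it into a right action, linearity of f(m) moves it to N, and on Ne the scalars of A
        and of eAe agree.\<close>
      have "f m (sc k \<triangleright>\<^bsub>W\<^esub> br e e) = f m (br e e) \<triangleleft>\<^bsub>N\<^esub> (k \<odot>\<^bsub>A\<^esub> e)" if m: "m \<in> carrier (corner_mod M)" for m
      proof -
        have "f m (sc k \<triangleright>\<^bsub>W\<^esub> br e e) = f m (br e e) \<triangleleft>\<^bsub>N\<^esub> sc k"
          using W_central[OF k ee] rhomD(3)[OF bocs_homD(1)[OF f C[OF m M]] ee sc_closed[OF k]] by simp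
        moreover have "f m (br e e) \<in> carrier (corner_mod N)"
          using rhomD(1)[OF hat_rhom[OF f R[OF M] R[OF N]] m] m by (simp add: hat_def)
        ultimately show ?thesis using corner_scalar[OF R[OF N] _ k] by simp
      qed
      then show ?thesis
        unfolding hat_def by (intro restrict_ext) (use C[OF _ M] ee in \<open>simp add: corner_simps\<close>)
    qed
  next
    fix M :: "('a, 'm) rmod" assume M: "fd_right_module K A M"
    show "hat M (Ident (bocs_cat TYPE('m)) M) = (\<lambda>m\<in>carrier (corner_mod M). m)"
      unfolding bocs_ident[OF R[OF M]]
      by (rule hat_unhat[OF R[OF M] R[OF M] rhom_id[OF corner_mod_right_module[OF R[OF M]]]])
  next
    fix L M N :: "('a, 'm) rmod" and f g assume L: "fd_right_module K A L" and M: "fd_right_module K A M"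
      and N: "fd_right_module K A N" and f: "f \<in> rhom A L (hom_rmod A W M)" and g: "g \<in> rhom A M (hom_rmod A W N)"
    note LR = R[OF L] and MR = R[OF M] and NR = R[OF N]
    show "hat L (Comp (bocs_cat TYPE('m)) L M N g f) = compose (carrier (corner_mod L)) (hat M g) (hat L f)"
      unfolding bocs_comp[OF LR MR NR f g]
      by (rule hat_unhat[OF LR NR rhom_compose[OF hat_rhom[OF f LR MR] hat_rhom[OF g MR NR] corner_mod_right_module[OF LR]]])
  qed
qed

lemma hat_bij:
  fixes M N :: "('a, 'm) rmod"
  assumes M: "right_module A M" and N: "right_module A N"
  shows "bij_betw (hat M) (rhom A M (hom_rmod A W N)) (rhom eAe (corner_mod M) (corner_mod N))"
proof (rule bij_betw_byWitness[of _ "unhat M N"])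
  show "\<forall>f\<in>rhom A M (hom_rmod A W N). unhat M N (hat M f) = f"
  proof
    fix f assume f: "f \<in> rhom A M (hom_rmod A W N)"
    note h = hat_rhom[OF f M N]
    show "unhat M N (hat M f) = f"
      by (rule bocs_hom_eqI[OF unhat_rhom[OF M N h] f M N hat_unhat[OF M N h]])
  qed
qed (use hat_unhat[OF M N] unhat_rhom[OF M N] hat_rhom[OF _ M N] in auto)

lemma bocs_cat_linear: "linear_category K (bocs_cat TYPE('m))"
proof -
  have R: "right_module A M" if "fd_right_module K A M" for M :: "('a, 'm) rmod"
    using that by (simp add: fd_right_module_def)
  show ?thesis
  proof (rule linear_category_of_faithful[OF K.field_axioms Corner.mod_cat_linear hat_functor];
      unfold bocs_cat_simps(1,2) hom_space_simps mem_Collect_eq)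
    fix M N :: "('a, 'm) rmod" assume M: "fd_right_module K A M" and N: "fd_right_module K A N"
    show "inj_on (hat M) (rhom A M (hom_rmod A W N))"
      using hat_bij[OF R[OF M] R[OF N]] by (simp add: bij_betw_def)
    show "module K (hom_space A M (hom_rmod A W N))"
      by (rule hom_space_module[OF R[OF M] hom_rmod_right_module[OF A.ring_axioms W R[OF N]]])
  next
    fix M :: "('a, 'm) rmod" assume M: "fd_right_module K A M"
    show "Ident (bocs_cat TYPE('m)) M \<in> rhom A M (hom_rmod A W M)"
      unfolding bocs_ident[OF R[OF M]]
      by (rule unhat_rhom[OF R[OF M] R[OF M] rhom_id[OF corner_mod_right_module[OF R[OF M]]]])
  next
    fix L M N :: "('a, 'm) rmod" and f g assume L: "fd_right_module K A L" and M: "fd_right_module K A M"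
      and N: "fd_right_module K A N" and f: "f \<in> rhom A L (hom_rmod A W M)" and g: "g \<in> rhom A M (hom_rmod A W N)"
    note LR = R[OF L] and MR = R[OF M] and NR = R[OF N]
    show "Comp (bocs_cat TYPE('m)) L M N g f \<in> rhom A L (hom_rmod A W N)"
      unfolding bocs_comp[OF LR MR NR f g]
      by (rule unhat_rhom[OF LR NR rhom_compose[OF hat_rhom[OF f LR MR] hat_rhom[OF g MR NR] corner_mod_right_module[OF LR]]])
  qed
qed

text \<open>The functor is restriction to corners followed by copying. The copies need
  \<open>'n\<close> to be large; essential surjectivity needs \<open>'m\<close> to be large, as it
  must hold a copy of X \<otimes> eA.\<close>

theorem bocs_cat_equivalent:
  assumes large_m: "large_type TYPE('m) K" and large_n: "large_type TYPE('n) K"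
  shows "equivalent_linear_categories K (bocs_cat TYPE('m)) (mod_cat TYPE('n) K eAe)"
proof -
  have R: "right_module A M" if "fd_right_module K A M" for M :: "('a, 'm) rmod"
    using that by (simp add: fd_right_module_def)
  obtain P :: "('a, 'm) rmod \<Rightarrow> ('a, 'n) rmod" and P1 where
    P: "linear_functor K (mod_cat TYPE('m) K eAe) (mod_cat TYPE('n) K eAe) P P1"
    and P1: "\<And>X Y. fd_right_module K eAe X \<Longrightarrow> fd_right_module K eAe Y \<Longrightarrow>
      bij_betw (P1 X Y) (rhom eAe X Y) (rhom eAe (P X) (P Y))"
    and copy: "\<And>X. fd_right_module K eAe X \<Longrightarrow> \<exists>\<kappa>\<in>rhom eAe X (P X). bij_betw \<kappa> (carrier X) (carrier (P X))"
    using Corner.copy_functor[OF large_n, where ?'m = 'm] by metis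
  show ?thesis
  proof (rule equivalent_linear_categoriesI[OF bocs_cat_linear Corner.mod_cat_linear
        linear_functor_compose[OF K.field_axioms hat_functor P] K.field_axioms];
      unfold bocs_cat_simps(1,2) Corner.mod_cat_simps hom_space_simps mem_Collect_eq)
    fix M N :: "('a, 'm) rmod" assume M: "fd_right_module K A M" and N: "fd_right_module K A N"
    show "bij_betw (\<lambda>f. P1 (corner_mod M) (corner_mod N) (hat M f)) (rhom A M (hom_rmod A W N))
        (rhom eAe (P (corner_mod M)) (P (corner_mod N)))"
      using bij_betw_trans[OF hat_bij[OF R[OF M] R[OF N]] P1[OF corner_mod_fd[OF M] corner_mod_fd[OF N]]]
      by (simp add: comp_def)
  next
    fix X :: "('a, 'n) rmod" assume X: "fd_right_module K eAe X"
    obtain M :: "('a, 'm) rmod" and \<psi> where M: "fd_right_module K A M" "\<psi> \<in> rhom eAe X (corner_mod M)"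
      "bij_betw \<psi> (carrier X) (carrier (corner_mod M))"
      using corner_mod_ess_surj[OF X large_m] by blast
    note CM = corner_mod_fd[OF M(1)]
    obtain \<kappa> where \<kappa>: "\<kappa> \<in> rhom eAe (corner_mod M) (P (corner_mod M))"
      "bij_betw \<kappa> (carrier (corner_mod M)) (carrier (P (corner_mod M)))"
      using copy[OF CM] by blast
    have XR: "right_module eAe X" using X by (simp add: fd_right_module_def)
    have PM: "fd_right_module K eAe (P (corner_mod M))"
      using linear_functorD(1)[OF K.field_axioms P] CM by simp
    then have PR: "right_module eAe (P (corner_mod M))" by (simp add: fd_right_module_def)
    obtain g where g: "g \<in> rhom eAe (P (corner_mod M)) X" "bij_betw g (carrier (P (corner_mod M))) (carrier X)"
      by (rule Corner.rhom_bij_inverse[OF XR PR rhom_compose[OF M(2) \<kappa>(1) XR]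
          compose_rhom_bij[OF M(2) \<kappa>(1) M(3) \<kappa>(2)]]) (rule that)
    show "\<exists>M\<in>{M. fd_right_module K A M}. \<exists>f. cat_iso (mod_cat TYPE('n) K eAe) (P (corner_mod M)) X f"
      using Corner.mod_cat_iso[OF PM X g] M(1) by blast
  qed
qed

end

section \<open>Finite direct powers\<close>

lemma direct_power_simps [simp]:
  "carrier (direct_power n M) = {..<n} \<rightarrow>\<^sub>E carrier M"
  "\<zero>\<^bsub>direct_power n M\<^esub> = (\<lambda>i\<in>{..<n}. \<zero>\<^bsub>M\<^esub>)"
  "x \<oplus>\<^bsub>direct_power n M\<^esub> y = (\<lambda>i\<in>{..<n}. x i \<oplus>\<^bsub>M\<^esub> y i)"
  "x \<triangleleft>\<^bsub>direct_power n M\<^esub> a = (\<lambda>i\<in>{..<n}. x i \<triangleleft>\<^bsub>M\<^esub> a)"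
  by (simp_all add: direct_power_def)

definition unit_vec :: "nat \<Rightarrow> ('a, 'm, 'y) rmod_scheme \<Rightarrow> nat \<Rightarrow> 'm \<Rightarrow> nat \<Rightarrow> 'm" where
  "unit_vec n M i m = (\<lambda>j\<in>{..<n}. if i = j then m else \<zero>\<^bsub>M\<^esub>)"

context
  fixes A :: "('a, 'x) ring_scheme" and M :: "('a, 'm, 'y) rmod_scheme" and n :: nat
  assumes M: "right_module A M"
begin

interpretation M: abelian_group M using right_moduleD(1)[OF M] .

lemma right_act_hom: "a \<in> carrier A \<Longrightarrow> (\<lambda>m. m \<triangleleft>\<^bsub>M\<^esub> a) \<in> add_hom M M"
  using right_moduleD(2,3)[OF M] by (auto intro!: add_homI)

lemma zero_act: "a \<in> carrier A \<Longrightarrow> \<zero>\<^bsub>M\<^esub> \<triangleleft>\<^bsub>M\<^esub> a = \<zero>\<^bsub>M\<^esub>"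
  by (rule add_hom_zero[OF M.abelian_group_axioms M.abelian_group_axioms right_act_hom])

lemma direct_power_right_module: "right_module A (direct_power n M)"
proof -
  note R = right_moduleD(2-)[OF M]
  have mem: "x i \<in> carrier M" if "x \<in> {..<n} \<rightarrow>\<^sub>E carrier M" "i < n" for x i using that by auto
  have ag: "abelian_group (direct_power n M)"
  proof (rule pointwise_abelian_group[OF M.abelian_group_axioms subset_refl])
  qed (auto intro!: restrict_PiE)
  have one: "(\<lambda>i\<in>{..<n}. x i \<triangleleft>\<^bsub>M\<^esub> \<one>\<^bsub>A\<^esub>) = x" if "x \<in> {..<n} \<rightarrow>\<^sub>E carrier M" for x
    using that mem[OF that] R(5) by (intro extensionalityI[of _ "{..<n}"]) (auto simp: PiE_def)
  show ?thesis
    unfolding right_module_def direct_power_simps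
    using ag R mem one by (auto intro!: restrict_ext)
qed

lemma unit_vec_closed: "m \<in> carrier M \<Longrightarrow> unit_vec n M i m \<in> carrier (direct_power n M)"
  by (auto simp: unit_vec_def)

lemma unit_vec_hom: "unit_vec n M i \<in> add_hom M (direct_power n M)"
  by (rule add_homI) (auto simp: unit_vec_def intro!: restrict_ext)

lemma unit_vec_act: "m \<in> carrier M \<Longrightarrow> a \<in> carrier A \<Longrightarrow>
    unit_vec n M i (m \<triangleleft>\<^bsub>M\<^esub> a) = unit_vec n M i m \<triangleleft>\<^bsub>direct_power n M\<^esub> a"
  by (auto simp: unit_vec_def zero_act intro!: restrict_ext)

lemma direct_power_sum:
  assumes x: "x \<in> carrier (direct_power n M)"
  shows "x = (\<Oplus>\<^bsub>direct_power n M\<^esub>i\<in>{..<n}. unit_vec n M i (x i))" (is "_ = ?r")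
proof -
  interpret P: abelian_group "direct_power n M" using right_moduleD(1)[OF direct_power_right_module] .
  have mem: "x i \<in> carrier M" if "i < n" for i using that x by auto
  have u: "(\<lambda>i. unit_vec n M i (x i)) \<in> {..<n} \<rightarrow> carrier (direct_power n M)"
    using unit_vec_closed mem by (intro Pi_I) blast
  have r: "?r \<in> carrier (direct_power n M)" by (rule P.finsum_closed[OF u])
  show ?thesis
  proof (rule extensionalityI[of _ "{..<n}"])
    fix j assume j: "j \<in> {..<n}"
    have "(\<lambda>y. y j) \<in> add_hom (direct_power n M) M"
      by (rule add_homI) (use j in auto)
    then have "?r j = (\<Oplus>\<^bsub>M\<^esub>i\<in>{..<n}. unit_vec n M i (x i) j)"
      by (rule add_hom_finsum[OF P.abelian_group_axioms M.abelian_group_axioms _ u])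
    also have "\<dots> = (\<Oplus>\<^bsub>M\<^esub>i\<in>{..<n}. if j = i then x i else \<zero>\<^bsub>M\<^esub>)"
      by (rule M.finsum_cong') (use j mem in \<open>auto simp: unit_vec_def\<close>)
    also have "\<dots> = x j" by (rule M.add.finprod_singleton) (use j mem in auto)
    finally show "x j = ?r j" by simp
  qed (use x r in \<open>auto simp: PiE_def\<close>)
qed

end

lemma (in fd_alg) direct_power_fd:
  assumes "fd_right_module K A M"
  shows "fd_right_module K A (direct_power n M)"
proof -
  have M: "right_module A M" using assms by (simp add: fd_right_module_def)
  interpret S: module K "scalar_space A M" by (rule scalar_space_module[OF M])
  interpret M: abelian_group M using right_moduleD(1)[OF M] .
  note PR = direct_power_right_module[OF M, of n]
  interpret P: abelian_group "direct_power n M" using right_moduleD(1)[OF PR] .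
  interpret PS: module K "scalar_space A (direct_power n M)" by (rule scalar_space_module[OF PR])
  obtain X where X: "finite X" "X \<subseteq> carrier M"
    "\<And>W. submodule W K (scalar_space A M) \<Longrightarrow> X \<subseteq> W \<Longrightarrow> carrier M \<subseteq> W"
    using fin_dimE[OF S.module_axioms] assms unfolding fd_right_module_def scalar_space_simps by metis
  have uc: "unit_vec n M i m \<in> carrier (direct_power n M)" if "m \<in> carrier M" for i m
    by (rule unit_vec_closed[OF M that])
  have "fin_dim K (scalar_space A (direct_power n M))"
  proof (rule fin_dimI[OF PS.module_axioms, of "(\<lambda>(i, m). unit_vec n M i m) ` ({..<n} \<times> X)"])
    show "finite ((\<lambda>(i, m). unit_vec n M i m) ` ({..<n} \<times> X))" using X by simp
    show "(\<lambda>(i, m). unit_vec n M i m) ` ({..<n} \<times> X) \<subseteq> carrier (scalar_space A (direct_power n M))"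
      using uc X(2) by (auto simp del: direct_power_simps)
    fix W assume W: "submodule W K (scalar_space A (direct_power n M))"
      "(\<lambda>(i, m). unit_vec n M i m) ` ({..<n} \<times> X) \<subseteq> W"
    note WD = submoduleD[OF PS.module_axioms W(1), unfolded scalar_space_simps]
    have 1: "unit_vec n M i m \<in> W" if i: "i < n" and m: "m \<in> carrier M" for i m
    proof -
      note hom = unit_vec_hom[OF M, of n i]
      have "submodule {m \<in> carrier M. unit_vec n M i m \<in> W} K (scalar_space A M)"
      proof (rule submoduleI'[OF S.module_axioms])
        show "\<zero>\<^bsub>scalar_space A M\<^esub> \<in> {m \<in> carrier M. unit_vec n M i m \<in> W}"
          using add_hom_zero[OF M.abelian_group_axioms P.abelian_group_axioms hom] WD(2) by simp
      next
        fix k m assume k: "k \<in> carrier K" and m: "m \<in> {m \<in> carrier M. unit_vec n M i m \<in> W}"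
        then show "k \<odot>\<^bsub>scalar_space A M\<^esub> m \<in> {m \<in> carrier M. unit_vec n M i m \<in> W}"
          using WD(4)[OF k] unit_vec_act[OF M _ sc_closed[OF k], of m n i] right_moduleD(2)[OF M _ sc_closed[OF k]]
          by (simp del: direct_power_simps)
      next
        fix x y assume "x \<in> {m \<in> carrier M. unit_vec n M i m \<in> W}" "y \<in> {m \<in> carrier M. unit_vec n M i m \<in> W}"
        then show "x \<oplus>\<^bsub>scalar_space A M\<^esub> y \<in> {m \<in> carrier M. unit_vec n M i m \<in> W}"
          using WD(3) add_hom_add[OF hom] by (simp del: direct_power_simps)
      qed auto
      moreover have "X \<subseteq> {m \<in> carrier M. unit_vec n M i m \<in> W}" using W(2) X(2) i by auto
      ultimately show ?thesis using X(3) m by blast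
    qed
    show "carrier (scalar_space A (direct_power n M)) \<subseteq> W"
    proof
      fix x assume "x \<in> carrier (scalar_space A (direct_power n M))"
      then have x: "x \<in> carrier (direct_power n M)" by simp
      have "(\<Oplus>\<^bsub>scalar_space A (direct_power n M)\<^esub>i\<in>{..<n}. unit_vec n M i (x i)) \<in> W"
        by (rule submodule_finsum[OF PS.module_axioms W(1)], rule 1) (use x in auto)
      moreover have "(\<Oplus>\<^bsub>scalar_space A (direct_power n M)\<^esub>i\<in>{..<n}. unit_vec n M i (x i)) =
          (\<Oplus>\<^bsub>direct_power n M\<^esub>i\<in>{..<n}. unit_vec n M i (x i))"
      proof -
        \<comment> \<open>The two sums are taken in different records over the same group; the
          identity, being additive, identifies them.\<close>
        have "(\<lambda>x. x) \<in> add_hom (direct_power n M) (scalar_space A (direct_power n M))"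
          by (rule add_homI) simp_all
        from add_hom_finsum[OF P.abelian_group_axioms PS.abelian_group_axioms this, of "\<lambda>i. unit_vec n M i (x i)" "{..<n}"]
        show ?thesis using uc x by (simp add: Pi_iff PiE_iff)
      qed
      ultimately show "x \<in> W" using direct_power_sum[OF M x] by simp
    qed
  qed
  then show ?thesis using PR by (simp add: fd_right_module_def)
qed


section \<open>Endomorphism algebras of generators over symmetric algebras\<close>

text \<open>The retraction \<pi> of a power of M onto its summand B, restricted to the i-th
  coordinate, is a homomorphism w_i from M to B. Splitting the image of 1 into coordinates gives 1 =
  \<Sum> w_i(f(1)_i).\<close>

lemma generator_trace:
  assumes B: "ring B" and M: "right_module B M" and gen: "generator B M"
  shows "\<one>\<^bsub>B\<^esub> \<in> addspan B {u m | u m. u \<in> rhom B M (regular B) \<and> m \<in> carrier M}"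
proof -
  interpret B: ring B by fact
  interpret M: abelian_group M using right_moduleD(1)[OF M] .
  obtain n S Z f where dec: "direct_sum_decomp B (direct_power n M) S Z"
    and f: "f \<in> rhom B (regular B) ((direct_power n M)\<lparr>carrier := S\<rparr>)" and bij: "bij_betw f (carrier B) S"
    using gen by (auto simp: generator_def iso_to_direct_summand_def)
  define P where "P = direct_power n M"
  have PR: "right_module B P" unfolding P_def by (rule direct_power_right_module[OF M])
  interpret P: abelian_group P using right_moduleD(1)[OF PR] .
  note PD = right_moduleD(2-)[OF PR]
  have SZ: "S \<subseteq> carrier P" "Z \<subseteq> carrier P" "right_module B (P\<lparr>carrier := S\<rparr>)" "right_module B (P\<lparr>carrier := Z\<rparr>)"
    "S \<inter> Z = {\<zero>\<^bsub>P\<^esub>}" "\<And>x. x \<in> carrier P \<Longrightarrow> \<exists>s\<in>S. \<exists>z\<in>Z. x = s \<oplus>\<^bsub>P\<^esub> z"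
    using dec unfolding direct_sum_decomp_def P_def by auto
  \<comment> \<open>A decomposition only provides modules on restricted records. Negatives formed
    there have to be identified with those of P.\<close>
  have sub: "x \<oplus>\<^bsub>P\<^esub> y \<in> X" "x \<triangleleft>\<^bsub>P\<^esub> b \<in> X" "\<ominus>\<^bsub>P\<^esub> x \<in> X"
    if X: "right_module B (P\<lparr>carrier := X\<rparr>)" "X \<subseteq> carrier P" and x: "x \<in> X" "y \<in> X" "b \<in> carrier B" for X x y b
  proof -
    interpret X: abelian_group "P\<lparr>carrier := X\<rparr>" using right_moduleD(1)[OF X(1)] .
    show "x \<oplus>\<^bsub>P\<^esub> y \<in> X" using X.a_closed[of x y] x by simp
    show "x \<triangleleft>\<^bsub>P\<^esub> b \<in> X" using right_moduleD(2)[OF X(1), of x b] x by simp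
    obtain y where "y \<in> X" "y \<oplus>\<^bsub>P\<^esub> x = \<zero>\<^bsub>P\<^esub>"
      using abelian_groupE(6)[OF X.abelian_group_axioms, of x] x by auto
    moreover from this have "\<ominus>\<^bsub>P\<^esub> x = y" using X(2) x by (intro P.minus_equality) auto
    ultimately show "\<ominus>\<^bsub>P\<^esub> x \<in> X" by simp
  qed
  have uniq: "s = s'" if "s \<in> S" "s' \<in> S" "z \<in> Z" "z' \<in> Z" "s \<oplus>\<^bsub>P\<^esub> z = s' \<oplus>\<^bsub>P\<^esub> z'" for s s' z z'
  proof -
    have c: "s \<in> carrier P" "s' \<in> carrier P" "z \<in> carrier P" "z' \<in> carrier P" using that SZ(1,2) by auto
    have "s \<oplus>\<^bsub>P\<^esub> \<ominus>\<^bsub>P\<^esub> s' = (s \<oplus>\<^bsub>P\<^esub> z) \<oplus>\<^bsub>P\<^esub> (\<ominus>\<^bsub>P\<^esub> z \<oplus>\<^bsub>P\<^esub> \<ominus>\<^bsub>P\<^esub> s')"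
      using c by (simp add: P.a_assoc P.r_neg2)
    also have "\<dots> = z' \<oplus>\<^bsub>P\<^esub> (s' \<oplus>\<^bsub>P\<^esub> (\<ominus>\<^bsub>P\<^esub> s' \<oplus>\<^bsub>P\<^esub> \<ominus>\<^bsub>P\<^esub> z))" unfolding that(5) using c by (simp add: P.a_ac)
    also have "\<dots> = z' \<oplus>\<^bsub>P\<^esub> \<ominus>\<^bsub>P\<^esub> z" using c by (simp add: P.r_neg2)
    finally have eq: "s \<oplus>\<^bsub>P\<^esub> \<ominus>\<^bsub>P\<^esub> s' = z' \<oplus>\<^bsub>P\<^esub> \<ominus>\<^bsub>P\<^esub> z" .
    have "s \<oplus>\<^bsub>P\<^esub> \<ominus>\<^bsub>P\<^esub> s' \<in> S"
      using sub(1)[OF SZ(3,1) that(1) sub(3)[OF SZ(3,1) that(2) that(2) B.one_closed] B.one_closed] .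
    moreover have "z' \<oplus>\<^bsub>P\<^esub> \<ominus>\<^bsub>P\<^esub> z \<in> Z"
      using sub(1)[OF SZ(4,2) that(4) sub(3)[OF SZ(4,2) that(3) that(3) B.one_closed] B.one_closed] .
    ultimately have "s \<oplus>\<^bsub>P\<^esub> \<ominus>\<^bsub>P\<^esub> s' = \<zero>\<^bsub>P\<^esub>" using eq SZ(5) by auto
    then show "s = s'" using P.minus_equality[of s "\<ominus>\<^bsub>P\<^esub> s'"] c by simp
  qed
  define pr where "pr x = (THE s. s \<in> S \<and> (\<exists>z\<in>Z. x = s \<oplus>\<^bsub>P\<^esub> z))" for x
  have pr_eq: "pr (s \<oplus>\<^bsub>P\<^esub> z) = s" if "s \<in> S" "z \<in> Z" for s z
    unfolding pr_def
  proof (rule the_equality)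
    show "s \<in> S \<and> (\<exists>z'\<in>Z. s \<oplus>\<^bsub>P\<^esub> z = s \<oplus>\<^bsub>P\<^esub> z')" using that by blast
    show "s' = s" if s': "s' \<in> S \<and> (\<exists>z'\<in>Z. s \<oplus>\<^bsub>P\<^esub> z = s' \<oplus>\<^bsub>P\<^esub> z')" for s'
      using uniq \<open>s \<in> S\<close> \<open>z \<in> Z\<close> s' by blast
  qed
  have fi: "inj_on f (carrier B)" "f ` carrier B = S" using bij by (auto simp: bij_betw_def)
  \<comment> \<open>The retraction: project to the summand S along Z, then undo the isomorphism f
    from B onto S.\<close>
  define \<pi> where "\<pi> x = inv_into (carrier B) f (pr x)" for x
  have \<pi>_eq: "\<pi> (f b \<oplus>\<^bsub>P\<^esub> z) = b" if "b \<in> carrier B" "z \<in> Z" for b z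
    unfolding \<pi>_def using pr_eq[of "f b" z] that fi by auto
  have ex: "\<exists>b\<in>carrier B. \<exists>z\<in>Z. x = f b \<oplus>\<^bsub>P\<^esub> z" if "x \<in> carrier P" for x
    using SZ(6)[OF that] fi(2) by blast
  have fS: "f b \<in> S" "f b \<in> carrier P" if "b \<in> carrier B" for b using that fi(2) SZ(1) by auto
  have fD: "f (b \<oplus>\<^bsub>B\<^esub> c) = f b \<oplus>\<^bsub>P\<^esub> f c" "f (b \<otimes>\<^bsub>B\<^esub> c) = f b \<triangleleft>\<^bsub>P\<^esub> c"
    if "b \<in> carrier B" "c \<in> carrier B" for b c
    using rhomD(2,3)[OF f] that unfolding P_def by simp_all
  have Zc: "z \<in> carrier P" if "z \<in> Z" for z using that SZ(2) by auto
  have \<pi>: "\<pi> \<in> add_hom P B"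
  proof (rule add_homI)
    fix x assume x: "x \<in> carrier P"
    then obtain b z where b: "b \<in> carrier B" "z \<in> Z" "x = f b \<oplus>\<^bsub>P\<^esub> z" using ex by blast
    show "\<pi> x \<in> carrier B" using b \<pi>_eq by simp
    fix y assume "y \<in> carrier P"
    then obtain c w where c: "c \<in> carrier B" "w \<in> Z" "y = f c \<oplus>\<^bsub>P\<^esub> w" using ex by blast
    have "x \<oplus>\<^bsub>P\<^esub> y = f (b \<oplus>\<^bsub>B\<^esub> c) \<oplus>\<^bsub>P\<^esub> (z \<oplus>\<^bsub>P\<^esub> w)"
      using b c fS Zc by (simp add: fD P.a_ac)
    then show "\<pi> (x \<oplus>\<^bsub>P\<^esub> y) = \<pi> x \<oplus>\<^bsub>B\<^esub> \<pi> y"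
      using \<pi>_eq[OF b(1,2)] \<pi>_eq[OF c(1,2)] b c sub(1)[OF SZ(4,2) b(2) c(2) B.one_closed]
      by (simp add: \<pi>_eq)
  qed
  have \<pi>_act: "\<pi> (x \<triangleleft>\<^bsub>P\<^esub> c) = \<pi> x \<otimes>\<^bsub>B\<^esub> c" if x: "x \<in> carrier P" and c: "c \<in> carrier B" for x c
  proof -
    obtain b z where b: "b \<in> carrier B" "z \<in> Z" "x = f b \<oplus>\<^bsub>P\<^esub> z" using ex[OF x] by blast
    have "x \<triangleleft>\<^bsub>P\<^esub> c = f (b \<otimes>\<^bsub>B\<^esub> c) \<oplus>\<^bsub>P\<^esub> (z \<triangleleft>\<^bsub>P\<^esub> c)"
      using b c fS(2) Zc PD(2) by (simp add: fD)
    then show ?thesis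
      using \<pi>_eq[OF b(1,2)] b c sub(2)[OF SZ(4,2) b(2) b(2) c] by (simp add: \<pi>_eq)
  qed
  define w where "w i = (\<lambda>m\<in>carrier M. \<pi> (unit_vec n M i m))" for i
  have uc: "unit_vec n M i m \<in> carrier P" if "m \<in> carrier M" for i m
    unfolding P_def by (rule unit_vec_closed[OF M that])
  have w: "w i \<in> rhom B M (regular B)" for i
  proof (rule rhomI)
    fix m assume m: "m \<in> carrier M"
    show "w i m \<in> carrier (regular B)" using m add_hom_closed[OF \<pi> uc[OF m]] by (simp add: w_def)
    show "w i (m \<oplus>\<^bsub>M\<^esub> m') = w i m \<oplus>\<^bsub>regular B\<^esub> w i m'" if "m' \<in> carrier M" for m'
      using m that add_hom_add[OF unit_vec_hom[OF M, of n i] m that, folded P_def]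
        add_hom_add[OF \<pi> uc[OF m] uc[OF that]] by (simp add: w_def)
    show "w i (m \<triangleleft>\<^bsub>M\<^esub> b) = w i m \<triangleleft>\<^bsub>regular B\<^esub> b" if "b \<in> carrier B" for b
      using m that unit_vec_act[OF M m that, of n i, folded P_def] \<pi>_act[OF uc[OF m] that]
        right_moduleD(2)[OF M m that] by (simp add: w_def)
  qed (simp add: w_def)
  have f1: "f \<one>\<^bsub>B\<^esub> \<in> carrier P" by (rule fS(2)[OF B.one_closed])
  have g: "f \<one>\<^bsub>B\<^esub> i \<in> carrier M" if "i < n" for i using f1 that unfolding P_def by auto
  have z0: "\<zero>\<^bsub>P\<^esub> \<in> Z" using SZ(5) by blast
  have "\<one>\<^bsub>B\<^esub> = \<pi> (f \<one>\<^bsub>B\<^esub>)"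
    using \<pi>_eq[OF B.one_closed z0] f1 by simp
  also have "\<dots> = \<pi> (\<Oplus>\<^bsub>P\<^esub>i\<in>{..<n}. unit_vec n M i (f \<one>\<^bsub>B\<^esub> i))"
    using direct_power_sum[OF M, of "f \<one>\<^bsub>B\<^esub>" n, folded P_def, OF f1] by (rule arg_cong)
  also have "\<dots> = (\<Oplus>\<^bsub>B\<^esub>i\<in>{..<n}. \<pi> (unit_vec n M i (f \<one>\<^bsub>B\<^esub> i)))"
    by (rule add_hom_finsum[OF P.abelian_group_axioms B.abelian_group_axioms \<pi>]) (use uc g in auto)
  also have "\<dots> \<in> addspan B {u m | u m. u \<in> rhom B M (regular B) \<and> m \<in> carrier M}"
  proof (rule addspan_finsum_closed[OF B.abelian_group_axioms])
    show "{u m | u m. u \<in> rhom B M (regular B) \<and> m \<in> carrier M} \<subseteq> carrier B"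
      using rhomD(1)[of _ B M "regular B"] by auto
    fix i assume "i \<in> {..<n}"
    then have "\<pi> (unit_vec n M i (f \<one>\<^bsub>B\<^esub> i)) = w i (f \<one>\<^bsub>B\<^esub> i)" using g by (simp add: w_def)
    then show "\<pi> (unit_vec n M i (f \<one>\<^bsub>B\<^esub> i)) \<in> addspan B {u m | u m. u \<in> rhom B M (regular B) \<and> m \<in> carrier M}"
      using w g \<open>i \<in> {..<n}\<close> by (intro addspan.incl) auto
  qed
  finally show ?thesis .
qed

text \<open>Throughout, \<open>\<phi> a m\<close> is the product am: through \<open>\<phi>\<close>
  the algebra A acts on M from the left, while B acts from the right.\<close>

locale gendo_data = alg_idem K A e + B: fd_alg K B
  for K :: "('k, 'c) ring_scheme" and A :: "('k, 'a, 'x) module_scheme" and e :: 'a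
    and B :: "('k, 'b, 'y) module_scheme" +
  fixes M :: "('b, 'v) rmod" and \<phi> and \<theta>B
  assumes M_fd: "fd_right_module K B M" and M_gen: "generator B M"
    and \<phi>: "algebra_iso K A (End_algebra B M) \<phi>"
    and \<theta>B: "bimod_iso B B (regular B) (dual_bimod K B) \<theta>B"
begin

lemma M_right: "right_module B M" using M_fd by (simp add: fd_right_module_def)

sublocale M: abelian_group M using right_moduleD(1)[OF M_right] .

lemmas MD = right_moduleD(2-)[OF M_right]

sublocale MS: module K "scalar_space B M" by (rule B.scalar_space_module[OF M_right])

lemma MS_fd: "fin_dim K (scalar_space B M)" using M_fd by (simp add: fd_right_module_def)

lemma End_simps:
  "carrier (End_algebra B M) = rhom B M M"
  "f \<otimes>\<^bsub>End_algebra B M\<^esub> g = compose (carrier M) f g"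
  "f \<oplus>\<^bsub>End_algebra B M\<^esub> g = (\<lambda>m\<in>carrier M. f m \<oplus>\<^bsub>M\<^esub> g m)"
  "\<one>\<^bsub>End_algebra B M\<^esub> = (\<lambda>m\<in>carrier M. m)"
  "k \<odot>\<^bsub>End_algebra B M\<^esub> f = (\<lambda>m\<in>carrier M. f m \<triangleleft>\<^bsub>M\<^esub> B.sc k)"
  by (simp_all add: End_algebra_def hom_space_def)

lemma phi_bij: "bij_betw \<phi> (carrier A) (rhom B M M)"
  and phi_ring_hom: "\<phi> \<in> ring_hom A (End_algebra B M)"
  using \<phi> by (auto simp: algebra_iso_def ring_iso_def End_simps)

lemma phi_rhom: "a \<in> carrier A \<Longrightarrow> \<phi> a \<in> rhom B M M"
  using phi_bij by (auto simp: bij_betw_def)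

lemmas act_closed = rhomD(1)[OF phi_rhom]
lemmas act_add_right = rhomD(2)[OF phi_rhom]
lemmas act_ract = rhomD(3)[OF phi_rhom]

lemma act_add_left: "a \<in> carrier A \<Longrightarrow> b \<in> carrier A \<Longrightarrow> m \<in> carrier M \<Longrightarrow> \<phi> (a \<oplus>\<^bsub>A\<^esub> b) m = \<phi> a m \<oplus>\<^bsub>M\<^esub> \<phi> b m"
  using ring_hom_add[OF phi_ring_hom] by (simp add: End_simps)

lemma act_mult: "a \<in> carrier A \<Longrightarrow> b \<in> carrier A \<Longrightarrow> m \<in> carrier M \<Longrightarrow> \<phi> (a \<otimes>\<^bsub>A\<^esub> b) m = \<phi> a (\<phi> b m)"
  using ring_hom_mult[OF phi_ring_hom] by (simp add: End_simps compose_def)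

lemma act_one: "m \<in> carrier M \<Longrightarrow> \<phi> \<one>\<^bsub>A\<^esub> m = m"
  using ring_hom_one[OF phi_ring_hom] by (simp add: End_simps)

lemma act_smult: "k \<in> carrier K \<Longrightarrow> a \<in> carrier A \<Longrightarrow> m \<in> carrier M \<Longrightarrow> \<phi> (k \<odot>\<^bsub>A\<^esub> a) m = \<phi> a m \<triangleleft>\<^bsub>M\<^esub> B.sc k"
  using \<phi> by (simp add: algebra_iso_def End_simps)

lemma act_eqI:
  assumes "a \<in> carrier A" "b \<in> carrier A" "\<And>m. m \<in> carrier M \<Longrightarrow> \<phi> a m = \<phi> b m"
  shows "a = b"
proof -
  have "\<phi> a = \<phi> b" by (rule rhom_eqI[OF phi_rhom[OF assms(1)] phi_rhom[OF assms(2)] assms(3)])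
  then show ?thesis using phi_bij assms(1,2) by (auto simp: bij_betw_def inj_on_def)
qed

lemma act_zero: "m \<in> carrier M \<Longrightarrow> \<phi> \<zero>\<^bsub>A\<^esub> m = \<zero>\<^bsub>M\<^esub>"
proof -
  assume m: "m \<in> carrier M"
  have "(\<lambda>a. \<phi> a m) \<in> add_hom A M" by (rule add_homI) (use m act_closed act_add_left in auto)
  from add_hom_zero[OF A.abelian_group_axioms M.abelian_group_axioms this] show ?thesis .
qed

lemma act_eq_zeroI:
  "a \<in> carrier A \<Longrightarrow> (\<And>m. m \<in> carrier M \<Longrightarrow> \<phi> a m = \<zero>\<^bsub>M\<^esub>) \<Longrightarrow> a = \<zero>\<^bsub>A\<^esub>"
  by (rule act_eqI) (simp_all add: act_zero)

lemma act_full: "f \<in> rhom B M M \<Longrightarrow> \<exists>a\<in>carrier A. \<forall>m\<in>carrier M. \<phi> a m = f m"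
proof -
  assume "f \<in> rhom B M M"
  then obtain a where "a \<in> carrier A" "\<phi> a = f" using phi_bij by (metis bij_betw_def imageE)
  then show ?thesis by auto
qed


subsection \<open>The symmetrizing form\<close>

definition \<tau> where "\<tau> = \<theta>B \<one>\<^bsub>B\<^esub>"

lemma thetaB: "\<theta>B \<in> rhom B (regular B) (dual_bimod K B)" "bij_betw \<theta>B (carrier B) (functionals K B)"
  "\<And>b x. b \<in> carrier B \<Longrightarrow> x \<in> carrier B \<Longrightarrow> \<theta>B (b \<otimes>\<^bsub>B\<^esub> x) = b \<triangleright>\<^bsub>dual_bimod K B\<^esub> \<theta>B x"
  using \<theta>B by (auto simp: bimod_iso_def bihom_def)

lemma tau_functional: "\<tau> \<in> functionals K B"
  using rhomD(1)[OF thetaB(1), of "\<one>\<^bsub>B\<^esub>"] by (simp add: \<tau>_def)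

lemmas tauD = functionalsD[OF tau_functional]

lemma thetaB_tau: "b \<in> carrier B \<Longrightarrow> x \<in> carrier B \<Longrightarrow> \<theta>B b x = \<tau> (b \<otimes>\<^bsub>B\<^esub> x)"
  using rhomD(3)[OF thetaB(1), of "\<one>\<^bsub>B\<^esub>" b] by (simp add: \<tau>_def)

lemma thetaB_tau': "b \<in> carrier B \<Longrightarrow> x \<in> carrier B \<Longrightarrow> \<theta>B b x = \<tau> (x \<otimes>\<^bsub>B\<^esub> b)"
  using thetaB(3)[of b "\<one>\<^bsub>B\<^esub>"] by (simp add: \<tau>_def)

text \<open>Right linearity of \<open>\<theta>B\<close> shows that it sends b to x |-> \<tau>(bx),
  left linearity that it sends b to x |-> \<tau>(xb).\<close>

lemma tau_comm: "b \<in> carrier B \<Longrightarrow> x \<in> carrier B \<Longrightarrow> \<tau> (b \<otimes>\<^bsub>B\<^esub> x) = \<tau> (x \<otimes>\<^bsub>B\<^esub> b)"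
  using thetaB_tau thetaB_tau' by simp

lemma tau_repr:
  assumes "f \<in> functionals K B"
  shows "\<exists>b\<in>carrier B. \<forall>x\<in>carrier B. f x = \<tau> (b \<otimes>\<^bsub>B\<^esub> x)"
proof -
  obtain b where "b \<in> carrier B" "f = \<theta>B b" using thetaB(2) assms by (auto simp: bij_betw_def)
  then show ?thesis using thetaB_tau by auto
qed

lemma tau_inj:
  assumes b: "b \<in> carrier B" and c: "c \<in> carrier B"
    and eq: "\<And>x. x \<in> carrier B \<Longrightarrow> \<tau> (b \<otimes>\<^bsub>B\<^esub> x) = \<tau> (c \<otimes>\<^bsub>B\<^esub> x)"
  shows "b = c"
proof -
  have "\<theta>B b \<in> functionals K B" "\<theta>B c \<in> functionals K B"
    using rhomD(1)[OF thetaB(1), of b] rhomD(1)[OF thetaB(1), of c] b c by simp_all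
  then have "\<theta>B b = \<theta>B c"
    using functionalsD(2) eq by (intro extensionalityI[of _ "carrier B"]) (auto simp: thetaB_tau b c)
  then show ?thesis using thetaB(2) b c by (auto simp: bij_betw_def inj_on_def)
qed


subsection \<open>The module \<open>Hom\<^sub>B(M, B)\<close>\<close>

abbreviation U where "U \<equiv> rhom B M (regular B)"

lemma UD:
  assumes "u \<in> U"
  shows "\<And>m. m \<in> carrier M \<Longrightarrow> u m \<in> carrier B"
    and "\<And>m n. m \<in> carrier M \<Longrightarrow> n \<in> carrier M \<Longrightarrow> u (m \<oplus>\<^bsub>M\<^esub> n) = u m \<oplus>\<^bsub>B\<^esub> u n"
    and "\<And>m b. m \<in> carrier M \<Longrightarrow> b \<in> carrier B \<Longrightarrow> u (m \<triangleleft>\<^bsub>M\<^esub> b) = u m \<otimes>\<^bsub>B\<^esub> b"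
    and "u \<in> extensional (carrier M)" "u \<in> add_hom M B"
  using rhomD[OF assms] by (auto simp: add_hom_def)

lemma UI:
  assumes "\<And>m. m \<in> carrier M \<Longrightarrow> u m \<in> carrier B"
    and "\<And>m n. m \<in> carrier M \<Longrightarrow> n \<in> carrier M \<Longrightarrow> u (m \<oplus>\<^bsub>M\<^esub> n) = u m \<oplus>\<^bsub>B\<^esub> u n"
    and "\<And>m b. m \<in> carrier M \<Longrightarrow> b \<in> carrier B \<Longrightarrow> u (m \<triangleleft>\<^bsub>M\<^esub> b) = u m \<otimes>\<^bsub>B\<^esub> b"
    and "\<And>m. m \<notin> carrier M \<Longrightarrow> u m = undefined"
  shows "u \<in> U"
  by (rule rhomI) (use assms in auto)

lemma tau_U_functional: "u \<in> U \<Longrightarrow> (\<lambda>m\<in>carrier M. \<tau> (u m)) \<in> functionals K (scalar_space B M)"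
  using UD(1-3)[of u] tauD(3-5) MD(1)
  by (intro functionalsI) (auto simp: B.mult_sc)

text \<open>For fixed m, the functional x |-> f(mx) on B is x |-> \<tau>(bx) for some b, which
  becomes u(m). Nondegeneracy of \<tau> makes this b unique, and uniqueness forces u to be additive
  and B-linear.\<close>

lemma U_repr:
  assumes f: "f \<in> functionals K (scalar_space B M)"
  shows "\<exists>u\<in>U. \<forall>m\<in>carrier M. \<tau> (u m) = f m"
proof -
  note fD = functionalsD(3-5)[OF f, unfolded scalar_space_simps]
  have "\<exists>b\<in>carrier B. \<forall>x\<in>carrier B. f (m \<triangleleft>\<^bsub>M\<^esub> x) = \<tau> (b \<otimes>\<^bsub>B\<^esub> x)" if m: "m \<in> carrier M" for m
  proof -
    have "(\<lambda>x\<in>carrier B. f (m \<triangleleft>\<^bsub>M\<^esub> x)) \<in> functionals K B"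
    proof (rule functionalsI)
      fix k x assume k: "k \<in> carrier K" and x: "x \<in> carrier B"
      have "m \<triangleleft>\<^bsub>M\<^esub> (k \<odot>\<^bsub>B\<^esub> x) = m \<triangleleft>\<^bsub>M\<^esub> x \<triangleleft>\<^bsub>M\<^esub> B.sc k"
        using MD(4)[OF m x B.sc_closed[OF k]] k x by (simp add: B.mult_sc)
      then show "(\<lambda>x\<in>carrier B. f (m \<triangleleft>\<^bsub>M\<^esub> x)) (k \<odot>\<^bsub>B\<^esub> x) = k \<otimes>\<^bsub>K\<^esub> (\<lambda>x\<in>carrier B. f (m \<triangleleft>\<^bsub>M\<^esub> x)) x"
        using fD(3)[OF k MD(1)[OF m x]] k x by simp
    qed (use m fD MD(1,3) in auto)
    from tau_repr[OF this] show ?thesis by auto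
  qed
  then have "\<forall>m\<in>carrier M. \<exists>b. b \<in> carrier B \<and> (\<forall>x\<in>carrier B. f (m \<triangleleft>\<^bsub>M\<^esub> x) = \<tau> (b \<otimes>\<^bsub>B\<^esub> x))" by blast
  from bchoice[OF this] obtain u0 where u0: "\<forall>m\<in>carrier M. u0 m \<in> carrier B \<and> (\<forall>x\<in>carrier B. f (m \<triangleleft>\<^bsub>M\<^esub> x) = \<tau> (u0 m \<otimes>\<^bsub>B\<^esub> x))"
    by (elim exE)
  define u where "u = restrict u0 (carrier M)"
  have u: "u m \<in> carrier B" "f (m \<triangleleft>\<^bsub>M\<^esub> x) = \<tau> (u m \<otimes>\<^bsub>B\<^esub> x)" if "m \<in> carrier M" "x \<in> carrier B" for m x
    using u0 that by (auto simp: u_def)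
  have "u \<in> U"
  proof (rule UI)
    fix m assume m: "m \<in> carrier M"
    show um: "u m \<in> carrier B" using u(1)[OF m B.A.one_closed] .
    show "u (m \<oplus>\<^bsub>M\<^esub> n) = u m \<oplus>\<^bsub>B\<^esub> u n" if n: "n \<in> carrier M" for n
    proof (rule tau_inj)
      fix x assume x: "x \<in> carrier B"
      have un: "u n \<in> carrier B" using u(1)[OF n x] .
      have "\<tau> (u (m \<oplus>\<^bsub>M\<^esub> n) \<otimes>\<^bsub>B\<^esub> x) = f (m \<triangleleft>\<^bsub>M\<^esub> x) \<oplus>\<^bsub>K\<^esub> f (n \<triangleleft>\<^bsub>M\<^esub> x)"
        using u(2)[OF M.a_closed[OF m n] x] MD(2)[OF m n x] fD(2)[OF MD(1)[OF m x] MD(1)[OF n x]] by simp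
      also have "\<dots> = \<tau> ((u m \<oplus>\<^bsub>B\<^esub> u n) \<otimes>\<^bsub>B\<^esub> x)"
        using u(2)[OF m x] u(2)[OF n x] um un x by (simp add: B.A.l_distr tauD(4))
      finally show "\<tau> (u (m \<oplus>\<^bsub>M\<^esub> n) \<otimes>\<^bsub>B\<^esub> x) = \<tau> ((u m \<oplus>\<^bsub>B\<^esub> u n) \<otimes>\<^bsub>B\<^esub> x)" .
    qed (use u(1)[OF _ B.A.one_closed] m n um in auto)
    show "u (m \<triangleleft>\<^bsub>M\<^esub> b) = u m \<otimes>\<^bsub>B\<^esub> b" if b: "b \<in> carrier B" for b
    proof (rule tau_inj)
      fix x assume x: "x \<in> carrier B"
      show "\<tau> (u (m \<triangleleft>\<^bsub>M\<^esub> b) \<otimes>\<^bsub>B\<^esub> x) = \<tau> (u m \<otimes>\<^bsub>B\<^esub> b \<otimes>\<^bsub>B\<^esub> x)"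
        using u(2)[OF MD(1)[OF m b] x] u(2)[OF m B.A.m_closed[OF b x]] MD(4)[OF m b x] um b x
        by (simp add: B.A.m_assoc)
    qed (use u(1)[OF _ B.A.one_closed] MD(1)[OF m b] um b in auto)
  qed (simp add: u_def)
  moreover have "\<tau> (u m) = f m" if m: "m \<in> carrier M" for m
    using u(2)[OF m B.A.one_closed] u(1)[OF m B.A.one_closed] MD(5)[OF m] by simp
  ultimately show ?thesis by blast
qed

lemma U_eqI:
  assumes u: "u \<in> U" and v: "v \<in> U" and eq: "\<And>m. m \<in> carrier M \<Longrightarrow> \<tau> (u m) = \<tau> (v m)"
  shows "u = v"
proof (rule rhom_eqI[OF u v])
  fix m assume m: "m \<in> carrier M"
  show "u m = v m"
    by (rule tau_inj) (use UD(1)[OF u m] UD(1)[OF v m] UD(3)[OF u m] UD(3)[OF v m] eq MD(1)[OF m] in metis)+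
qed

text \<open>A functional that is 1 at m - n exists, and by \<open>U_repr\<close> it has the form
  \<tau> u.\<close>

lemma U_separates:
  assumes m: "m \<in> carrier M" and n: "n \<in> carrier M" and eq: "\<And>u. u \<in> U \<Longrightarrow> \<tau> (u m) = \<tau> (u n)"
  shows "m = n"
proof (rule ccontr)
  assume neq: "m \<noteq> n"
  have d: "m \<ominus>\<^bsub>M\<^esub> n \<in> carrier M" using m n by simp
  have "m \<ominus>\<^bsub>M\<^esub> n \<noteq> \<zero>\<^bsub>M\<^esub>"
  proof
    assume "m \<ominus>\<^bsub>M\<^esub> n = \<zero>\<^bsub>M\<^esub>"
    then have "\<ominus>\<^bsub>M\<^esub> (\<ominus>\<^bsub>M\<^esub> n) = m" using m n by (intro M.minus_equality) (auto simp: a_minus_def)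
    then show False using neq n by simp
  qed
  moreover have "submodule {\<zero>\<^bsub>M\<^esub>} K (scalar_space B M)"
    by (rule submoduleI'[OF MS.module_axioms]) (use zero_act[OF M_right] in auto)
  ultimately obtain f where f: "f \<in> functionals K (scalar_space B M)" "f (m \<ominus>\<^bsub>M\<^esub> n) = \<one>\<^bsub>K\<^esub>"
    using separating_functional[OF K.field_axioms MS.module_axioms, of "{\<zero>\<^bsub>M\<^esub>}" "m \<ominus>\<^bsub>M\<^esub> n"] d by auto
  obtain u where u: "u \<in> U" "\<tau> (u (m \<ominus>\<^bsub>M\<^esub> n)) = f (m \<ominus>\<^bsub>M\<^esub> n)" using U_repr[OF f(1)] d by blast
  have tu: "(\<lambda>m. \<tau> (u m)) \<in> add_hom M K" by (rule add_hom_compose[OF UD(5)[OF u(1)] tauD(1)])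
  have "\<tau> (u (m \<ominus>\<^bsub>M\<^esub> n)) = \<tau> (u m) \<oplus>\<^bsub>K\<^esub> \<ominus>\<^bsub>K\<^esub> \<tau> (u n)"
    unfolding a_minus_def
    using add_hom_add[OF tu m M.a_inv_closed[OF n]] add_hom_uminus[OF M.abelian_group_axioms K.abelian_group_axioms tu n]
    by simp
  also have "\<dots> = \<zero>\<^bsub>K\<^esub>" using eq[OF u(1)] add_hom_closed[OF tu n] by (simp add: K.r_neg)
  finally show False using u(2) f(2) K.one_not_zero by simp
qed

lemma U_zero_separates:
  assumes m: "m \<in> carrier M" and z: "\<And>u. u \<in> U \<Longrightarrow> u m = \<zero>\<^bsub>B\<^esub>"
  shows "m = \<zero>\<^bsub>M\<^esub>"
proof (rule U_separates[OF m M.zero_closed])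
  fix u assume u: "u \<in> U"
  show "\<tau> (u m) = \<tau> (u \<zero>\<^bsub>M\<^esub>)"
    using z[OF u] add_hom_zero[OF M.abelian_group_axioms B.A.abelian_group_axioms UD(5)[OF u]] by simp
qed

section \<open>The bimodule Hom_B(M, B) and the endomorphisms x |-> m u(x)\<close>

definition uact :: "('v \<Rightarrow> 'b) \<Rightarrow> 'a \<Rightarrow> 'v \<Rightarrow> 'b" where
  "uact u a = (\<lambda>m\<in>carrier M. u (\<phi> a m))"

definition bmul :: "'b \<Rightarrow> ('v \<Rightarrow> 'b) \<Rightarrow> 'v \<Rightarrow> 'b" where
  "bmul b u = (\<lambda>m\<in>carrier M. b \<otimes>\<^bsub>B\<^esub> u m)"

text \<open>The element of A that acts as x |-> m u(x), written mu for short. By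
  \<open>act_eqI\<close> it is the only one, so \<open>SOME\<close> makes no real choice.\<close>

definition op :: "'v \<Rightarrow> ('v \<Rightarrow> 'b) \<Rightarrow> 'a" where
  "op m u = (SOME a. a \<in> carrier A \<and> (\<forall>x\<in>carrier M. \<phi> a x = m \<triangleleft>\<^bsub>M\<^esub> u x))"

lemma uact_apply [simp]: "m \<in> carrier M \<Longrightarrow> uact u a m = u (\<phi> a m)" by (simp add: uact_def)
lemma bmul_apply [simp]: "m \<in> carrier M \<Longrightarrow> bmul b u m = b \<otimes>\<^bsub>B\<^esub> u m" by (simp add: bmul_def)

lemma uact_U: "u \<in> U \<Longrightarrow> a \<in> carrier A \<Longrightarrow> uact u a \<in> U"
  using UD(1-3)[of u] act_closed act_add_right act_ract MD(1)
  by (intro UI) (auto simp: uact_def)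

lemma bmul_U: "u \<in> U \<Longrightarrow> b \<in> carrier B \<Longrightarrow> bmul b u \<in> U"
  using UD(1-3)[of u] MD(1) by (intro UI) (auto simp: bmul_def B.A.r_distr B.A.m_assoc)

lemma op_props:
  assumes m: "m \<in> carrier M" and u: "u \<in> U"
  shows "op m u \<in> carrier A" "\<And>x. x \<in> carrier M \<Longrightarrow> \<phi> (op m u) x = m \<triangleleft>\<^bsub>M\<^esub> u x"
proof -
  have "(\<lambda>x\<in>carrier M. m \<triangleleft>\<^bsub>M\<^esub> u x) \<in> rhom B M M"
    by (rule rhomI) (use UD(1-3)[OF u] MD m in auto)
  from act_full[OF this] have "\<exists>a. a \<in> carrier A \<and> (\<forall>x\<in>carrier M. \<phi> a x = m \<triangleleft>\<^bsub>M\<^esub> u x)" by auto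
  from someI_ex[OF this, folded op_def]
  show "op m u \<in> carrier A" "\<And>x. x \<in> carrier M \<Longrightarrow> \<phi> (op m u) x = m \<triangleleft>\<^bsub>M\<^esub> u x" by auto
qed

lemmas op_closed = op_props(1) and op_act = op_props(2)

text \<open>This rule and the following ones are the associativity laws of the Morita context formed
  by A, B, M and Hom_B(M, B): a(mu) = (am)u, (mu)a = m(ua), (mu)(nv) = (m u(n))v and w(mu) =
  w(m)u.\<close>

lemma op_mult_left: "m \<in> carrier M \<Longrightarrow> u \<in> U \<Longrightarrow> a \<in> carrier A \<Longrightarrow> a \<otimes>\<^bsub>A\<^esub> op m u = op (\<phi> a m) u"
  by (rule act_eqI) (simp_all add: op_closed act_closed act_mult op_act act_ract UD(1))

lemma op_mult_right: "m \<in> carrier M \<Longrightarrow> u \<in> U \<Longrightarrow> a \<in> carrier A \<Longrightarrow> op m u \<otimes>\<^bsub>A\<^esub> a = op m (uact u a)"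
  by (rule act_eqI) (simp_all add: op_closed act_closed act_mult op_act uact_U)

lemma op_op: "m \<in> carrier M \<Longrightarrow> u \<in> U \<Longrightarrow> n \<in> carrier M \<Longrightarrow> v \<in> U \<Longrightarrow>
    op m u \<otimes>\<^bsub>A\<^esub> op n v = op (m \<triangleleft>\<^bsub>M\<^esub> u n) v"
  by (simp add: op_mult_left op_closed op_act)

lemma uact_op: "w \<in> U \<Longrightarrow> m \<in> carrier M \<Longrightarrow> u \<in> U \<Longrightarrow> uact w (op m u) = bmul (w m) u"
  by (rule rhom_eqI[OF uact_U[OF _ op_closed] bmul_U]) (simp_all add: op_act UD)

lemma op_hom_left: "u \<in> U \<Longrightarrow> (\<lambda>m. op m u) \<in> add_hom M A"
  by (rule add_homI, simp add: op_closed, rule act_eqI)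
    (simp_all add: op_closed op_act act_add_left MD UD(1))

lemma uact_uact: "u \<in> U \<Longrightarrow> a \<in> carrier A \<Longrightarrow> b \<in> carrier A \<Longrightarrow> uact (uact u a) b = uact u (a \<otimes>\<^bsub>A\<^esub> b)"
  by (rule rhom_eqI[OF uact_U[OF uact_U] uact_U]) (simp_all add: act_mult act_closed)

definition eM where "eM = {m \<in> carrier M. \<phi> e m = m}"
text \<open>Precomposition with e fixes u exactly when u vanishes on (1 - e)M, so this is Hom_B(eM,
  B).\<close>

definition Ue where "Ue = {u \<in> U. uact u e = u}"

lemma eM_M: "m \<in> eM \<Longrightarrow> m \<in> carrier M" and eM_e: "m \<in> eM \<Longrightarrow> \<phi> e m = m" by (simp_all add: eM_def)
lemma Ue_U: "u \<in> Ue \<Longrightarrow> u \<in> U" and Ue_e: "u \<in> Ue \<Longrightarrow> uact u e = u" by (simp_all add: Ue_def)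

lemma eA_act: "y \<in> carrier eA \<Longrightarrow> m \<in> carrier M \<Longrightarrow> \<phi> y m \<in> eM"
  using act_mult[of e y m] act_closed unfolding carrier_eA eM_def by simp

lemma e_uact: "u \<in> U \<Longrightarrow> uact u e \<in> Ue"
  using uact_uact[of u e e] uact_U by (simp add: Ue_def)

lemma eM_act: "b \<in> carrier B \<Longrightarrow> m \<in> eM \<Longrightarrow> m \<triangleleft>\<^bsub>M\<^esub> b \<in> eM"
  using act_ract[of e m b] MD(1) by (simp add: eM_def)

lemma Ue_bmul: "b \<in> carrier B \<Longrightarrow> u \<in> Ue \<Longrightarrow> bmul b u \<in> Ue"
proof -
  assume b: "b \<in> carrier B" and u: "u \<in> Ue"
  have "uact (bmul b u) e = bmul b (uact u e)"
    by (rule rhom_eqI[OF uact_U[OF bmul_U[OF Ue_U[OF u] b] e_closed] bmul_U[OF uact_U[OF Ue_U[OF u] e_closed] b]])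
      (simp add: act_closed)
  then show ?thesis using u b bmul_U by (simp add: Ue_def)
qed

lemma op_eA: "m \<in> eM \<Longrightarrow> u \<in> U \<Longrightarrow> op m u \<in> carrier eA"
  using op_mult_left[of m u e] op_closed unfolding carrier_eA eM_def by simp

lemma op_Ae: "m \<in> carrier M \<Longrightarrow> u \<in> Ue \<Longrightarrow> op m u \<in> carrier Ae"
  using op_mult_right[of m u e] op_closed unfolding carrier_Ae Ue_def by simp

lemma op_eAe: "m \<in> eM \<Longrightarrow> u \<in> Ue \<Longrightarrow> op m u \<in> carrier eAe"
  using op_eA[of m u] op_Ae[of m u] unfolding carrier_eA carrier_Ae carrier_corner eM_def Ue_def by simp

lemma trace_one: "\<one>\<^bsub>B\<^esub> \<in> addspan B {u m | u m. u \<in> U \<and> m \<in> carrier M}"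
  by (rule generator_trace[OF B.A.ring_axioms M_right M_gen])

lemma trace_subset: "{u m | u m. u \<in> U \<and> m \<in> X} \<subseteq> carrier B" if "X \<subseteq> carrier M"
  using that UD(1) by blast

text \<open>The expression of 1 as a sum of values u(x) is used twice: it turns mbu(x) = 0 into mb =
  0, and then b = \<Sum> u(m)b = \<Sum> u(mb) into b = 0.\<close>

lemma faithful_ract:
  assumes b: "b \<in> carrier B" and z: "\<And>m u x. m \<in> carrier M \<Longrightarrow> u \<in> U \<Longrightarrow> x \<in> carrier M \<Longrightarrow> m \<triangleleft>\<^bsub>M\<^esub> b \<triangleleft>\<^bsub>M\<^esub> u x = \<zero>\<^bsub>M\<^esub>"
  shows "b = \<zero>\<^bsub>B\<^esub>"
proof -
  have mb: "m \<triangleleft>\<^bsub>M\<^esub> b = \<zero>\<^bsub>M\<^esub>" if m: "m \<in> carrier M" for m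
  proof -
    have f: "(\<lambda>c. m \<triangleleft>\<^bsub>M\<^esub> b \<triangleleft>\<^bsub>M\<^esub> c) \<in> add_hom B M" using MD b m by (auto intro!: add_homI)
    have g: "(\<lambda>c. \<zero>\<^bsub>M\<^esub>) \<in> add_hom B M" by (auto intro!: add_homI)
    have "m \<triangleleft>\<^bsub>M\<^esub> b \<triangleleft>\<^bsub>M\<^esub> \<one>\<^bsub>B\<^esub> = \<zero>\<^bsub>M\<^esub>"
      by (rule addspan_eq[OF B.A.abelian_group_axioms M.abelian_group_axioms trace_subset[OF subset_refl] f g _ trace_one])
        (use z m in auto)
    then show ?thesis using MD b m by simp
  qed
  have f: "(\<lambda>c. c \<otimes>\<^bsub>B\<^esub> b) \<in> add_hom B B" using b by (auto intro!: add_homI simp: B.A.l_distr)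
  have g: "(\<lambda>c. \<zero>\<^bsub>B\<^esub>) \<in> add_hom B B" by (auto intro!: add_homI)
  have "\<one>\<^bsub>B\<^esub> \<otimes>\<^bsub>B\<^esub> b = \<zero>\<^bsub>B\<^esub>"
  proof (rule addspan_eq[OF B.A.abelian_group_axioms B.A.abelian_group_axioms trace_subset[OF subset_refl] f g _ trace_one])
    fix c assume "c \<in> {u m | u m. u \<in> U \<and> m \<in> carrier M}"
    then obtain u m where c: "c = u m" "u \<in> U" "m \<in> carrier M" by blast
    then have "c \<otimes>\<^bsub>B\<^esub> b = u \<zero>\<^bsub>M\<^esub>" using UD(3)[OF c(2,3) b] mb[OF c(3)] by simp
    then show "c \<otimes>\<^bsub>B\<^esub> b = \<zero>\<^bsub>B\<^esub>"
      using add_hom_zero[OF M.abelian_group_axioms B.A.abelian_group_axioms UD(5)[OF c(2)]] by simp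
  qed
  then show ?thesis using b by simp
qed

text \<open>Otherwise a nonzero \<open>b\<close> is \<open>\<tau>\<close>-orthogonal to the two-sided ideal on the right; then \<open>eM b = 0\<close>, so
  \<open>eA\<close> annihilates all the maps \<open>x \<mapsto> m b u(x)\<close>.\<close>

lemma one_in_corner_trace:
  assumes faithful: "faithful_module A eA"
  shows "\<one>\<^bsub>B\<^esub> \<in> addspan B {u m | u m. u \<in> Ue \<and> m \<in> eM}"
proof -
  let ?J = "addspan B {u m | u m. u \<in> U \<and> m \<in> eM}"
  have eMsub: "eM \<subseteq> carrier M" by (auto simp: eM_def)
  have "\<one>\<^bsub>B\<^esub> \<in> ?J"
  proof (rule ccontr)
    assume not: "\<one>\<^bsub>B\<^esub> \<notin> ?J"
    \<comment> \<open>The elements bu again lie in U, so \<open>?J\<close> is a left ideal. Being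
      stable under \<open>B.sc k\<close>, it is a subspace, and a functional can separate 1 from
      it.\<close>
    have left: "b \<otimes>\<^bsub>B\<^esub> c \<in> ?J" if b: "b \<in> carrier B" and c: "c \<in> ?J" for b c
    proof (rule addspan_image[OF B.A.abelian_group_axioms B.A.abelian_group_axioms _ trace_subset[OF eMsub] _ c])
      show "(\<lambda>c. b \<otimes>\<^bsub>B\<^esub> c) \<in> add_hom B B" using b by (auto intro!: add_homI simp: B.A.r_distr)
      fix c assume "c \<in> {u m | u m. u \<in> U \<and> m \<in> eM}"
      then obtain u m where c: "c = u m" "u \<in> U" "m \<in> eM" by blast
      then have "b \<otimes>\<^bsub>B\<^esub> c = bmul b u m" using eM_M by simp
      then show "b \<otimes>\<^bsub>B\<^esub> c \<in> ?J" using c bmul_U[OF c(2) b] by (intro addspan.incl) blast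
    qed
    have Jsub: "?J \<subseteq> carrier B" by (rule addspan_subset[OF B.A.abelian_group_axioms trace_subset[OF eMsub]])
    have "submodule ?J K B"
    proof (rule submoduleI'[OF B.V.module_axioms Jsub addspan.zero addspan.add])
      fix k x assume k: "k \<in> carrier K" and x: "x \<in> ?J"
      have "k \<odot>\<^bsub>B\<^esub> x = B.sc k \<otimes>\<^bsub>B\<^esub> x" using k x Jsub by (intro B.sc_mult[symmetric]) auto
      then show "k \<odot>\<^bsub>B\<^esub> x \<in> ?J" using left[OF B.sc_closed[OF k] x] by simp
    qed
    then obtain f where f: "f \<in> functionals K B" "f \<one>\<^bsub>B\<^esub> = \<one>\<^bsub>K\<^esub>" "\<And>x. x \<in> ?J \<Longrightarrow> f x = \<zero>\<^bsub>K\<^esub>"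
      using separating_functional[OF K.field_axioms B.V.module_axioms _ B.A.one_closed not] by blast
    obtain b where b: "b \<in> carrier B" "\<And>x. x \<in> carrier B \<Longrightarrow> f x = \<tau> (b \<otimes>\<^bsub>B\<^esub> x)"
      using tau_repr[OF f(1)] by blast
    have tau0: "\<tau> \<zero>\<^bsub>B\<^esub> = \<zero>\<^bsub>K\<^esub>"
      by (rule add_hom_zero[OF B.A.abelian_group_axioms K.abelian_group_axioms tauD(1)])
    have eMb: "m \<triangleleft>\<^bsub>M\<^esub> b = \<zero>\<^bsub>M\<^esub>" if m: "m \<in> eM" for m
    proof (rule U_zero_separates[OF MD(1)[OF eM_M[OF m] b(1)]])
      fix u assume u: "u \<in> U"
      have um: "u m \<in> carrier B" by (rule UD(1)[OF u eM_M[OF m]])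
      have "u m \<otimes>\<^bsub>B\<^esub> b = \<zero>\<^bsub>B\<^esub>"
      proof (rule tau_inj)
        fix x assume x: "x \<in> carrier B"
        \<comment> \<open>By cyclicity \<tau>(u(m)bx) = \<tau>(bxu(m)), and xu(m) lies in the left
          ideal on which \<tau>(b -) vanishes.\<close>
        have "x \<otimes>\<^bsub>B\<^esub> u m \<in> ?J" using u m by (intro left[OF x] addspan.incl) blast
        then have "\<tau> (b \<otimes>\<^bsub>B\<^esub> (x \<otimes>\<^bsub>B\<^esub> u m)) = \<zero>\<^bsub>K\<^esub>" 
          using f(3)[of "x \<otimes>\<^bsub>B\<^esub> u m"] b(2)[of "x \<otimes>\<^bsub>B\<^esub> u m"] x um by simp
        moreover have "\<tau> (b \<otimes>\<^bsub>B\<^esub> (x \<otimes>\<^bsub>B\<^esub> u m)) = \<tau> (u m \<otimes>\<^bsub>B\<^esub> b \<otimes>\<^bsub>B\<^esub> x)"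
          using tau_comm[of "b \<otimes>\<^bsub>B\<^esub> x" "u m"] b(1) x um by (simp add: B.A.m_assoc)
        ultimately show "\<tau> (u m \<otimes>\<^bsub>B\<^esub> b \<otimes>\<^bsub>B\<^esub> x) = \<tau> (\<zero>\<^bsub>B\<^esub> \<otimes>\<^bsub>B\<^esub> x)" using tau0 x by simp
      qed (use um b in auto)
      then show "u (m \<triangleleft>\<^bsub>M\<^esub> b) = \<zero>\<^bsub>B\<^esub>" using UD(3)[OF u eM_M[OF m] b(1)] by simp
    qed
    have "b = \<zero>\<^bsub>B\<^esub>"
    proof (rule faithful_ract[OF b(1)])
      fix m u x assume m: "m \<in> carrier M" and u: "u \<in> U" and x: "x \<in> carrier M"
      have mb: "m \<triangleleft>\<^bsub>M\<^esub> b \<in> carrier M" by (rule MD(1)[OF m b(1)])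
      have "op (m \<triangleleft>\<^bsub>M\<^esub> b) u = \<zero>\<^bsub>A\<^esub>"
      proof -
        have "y \<otimes>\<^bsub>A\<^esub> op (m \<triangleleft>\<^bsub>M\<^esub> b) u = \<zero>\<^bsub>A\<^esub>" if y: "y \<in> carrier eA" for y
        proof -
          have yA: "y \<in> carrier A" using y unfolding carrier_eA by simp
          show ?thesis
          proof (rule act_eq_zeroI)
            fix z assume z: "z \<in> carrier M"
            have "\<phi> (y \<otimes>\<^bsub>A\<^esub> op (m \<triangleleft>\<^bsub>M\<^esub> b) u) z = \<phi> y m \<triangleleft>\<^bsub>M\<^esub> b \<triangleleft>\<^bsub>M\<^esub> u z"
              using yA m b(1) u z mb by (simp add: act_mult op_closed op_act act_ract UD(1) MD(1))
            also have "\<dots> = \<zero>\<^bsub>M\<^esub>"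
              using eMb[OF eA_act[OF y m]] zero_act[OF M_right UD(1)[OF u z]] by simp
            finally show "\<phi> (y \<otimes>\<^bsub>A\<^esub> op (m \<triangleleft>\<^bsub>M\<^esub> b) u) z = \<zero>\<^bsub>M\<^esub>" .
          qed (use yA op_closed[OF mb u] in simp)
        qed
        then have "\<forall>y\<in>carrier eA. y \<triangleleft>\<^bsub>eA\<^esub> op (m \<triangleleft>\<^bsub>M\<^esub> b) u = \<zero>\<^bsub>eA\<^esub>"
          unfolding mult_bimod_simps(2,4) by (rule ballI)
        then show ?thesis
          by (rule mp[OF bspec[OF faithful[unfolded faithful_module_def] op_closed[OF mb u]]])
      qed
      then show "m \<triangleleft>\<^bsub>M\<^esub> b \<triangleleft>\<^bsub>M\<^esub> u x = \<zero>\<^bsub>M\<^esub>" using op_act[OF mb u x] act_zero[OF x] by simp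
    qed
    then have "f \<one>\<^bsub>B\<^esub> = \<zero>\<^bsub>K\<^esub>" using b(2)[OF B.A.one_closed] tau0 by simp
    then show False using f(2) K.one_not_zero by simp
  qed
  \<comment> \<open>Replacing u by ue does not change its values on eM.\<close>
  moreover have "{u m | u m. u \<in> U \<and> m \<in> eM} \<subseteq> {u m | u m. u \<in> Ue \<and> m \<in> eM}"
  proof
    fix c assume "c \<in> {u m | u m. u \<in> U \<and> m \<in> eM}"
    then obtain u m where c: "c = u m" "u \<in> U" "m \<in> eM" by blast
    have "c = uact u e m" using c(1) eM_M[OF c(3)] eM_e[OF c(3)] by simp
    then show "c \<in> {u m | u m. u \<in> Ue \<and> m \<in> eM}" using e_uact[OF c(2)] c(3) by (intro CollectI exI conjI)
  qed
  ultimately show ?thesis by (rule addspan_mono)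
qed

end

section \<open>Hom_B(M, B) as a right A-module, and the consequences of injectivity of eA\<close>

context gendo_data
begin

definition Umod :: "('a, 'v \<Rightarrow> 'b) rmod" where
  "Umod = \<lparr>carrier = U, monoid.mult = undefined, one = undefined, ring.zero = (\<lambda>m\<in>carrier M. \<zero>\<^bsub>B\<^esub>),
     ring.add = (\<lambda>u v. \<lambda>m\<in>carrier M. u m \<oplus>\<^bsub>B\<^esub> v m), ract = uact\<rparr>"

lemma Umod_simps [simp]:
  "carrier Umod = U" "\<zero>\<^bsub>Umod\<^esub> = (\<lambda>m\<in>carrier M. \<zero>\<^bsub>B\<^esub>)"
  "u \<oplus>\<^bsub>Umod\<^esub> v = (\<lambda>m\<in>carrier M. u m \<oplus>\<^bsub>B\<^esub> v m)" "u \<triangleleft>\<^bsub>Umod\<^esub> a = uact u a"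
  by (simp_all add: Umod_def)

lemmas U_pointwise = rhom_pointwise_closed[OF M_right B.regular_right_module, simplified mult_bimod_simps]

lemma uact_one: "u \<in> U \<Longrightarrow> uact u \<one>\<^bsub>A\<^esub> = u"
  by (rule rhom_eqI[OF uact_U]) (simp_all add: act_one)

lemma Umod_right_module: "right_module A Umod"
proof -
  have "abelian_group Umod"
    by (rule pointwise_abelian_group[OF right_moduleD(1)[OF B.regular_right_module] rhom_subset
      rhom_pointwise_closed[OF M_right B.regular_right_module]]) simp_all
  moreover have "uact (\<lambda>m\<in>carrier M. u m \<oplus>\<^bsub>B\<^esub> v m) a = (\<lambda>m\<in>carrier M. uact u a m \<oplus>\<^bsub>B\<^esub> uact v a m)"
    if "a \<in> carrier A" for u v a
    using that by (auto simp: uact_def act_closed intro!: restrict_ext)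
  moreover have "uact u (a \<oplus>\<^bsub>A\<^esub> b) = (\<lambda>m\<in>carrier M. uact u a m \<oplus>\<^bsub>B\<^esub> uact u b m)"
    if "u \<in> U" "a \<in> carrier A" "b \<in> carrier A" for u a b
    using that UD(2)[OF that(1)] by (auto simp: uact_def act_add_left act_closed intro!: restrict_ext)
  ultimately show ?thesis
    unfolding right_module_def Umod_simps using uact_U uact_uact uact_one by simp
qed

text \<open>The inverse of u |-> \<tau> u from Hom_B(M, B) to D(M); the choice is unique by
  \<open>U_eqI\<close>. It transports finite dimension and reflexivity from M to Hom_B(M,
  B).\<close>

definition rep :: "('v \<Rightarrow> 'k) \<Rightarrow> 'v \<Rightarrow> 'b" where
  "rep f = (SOME u. u \<in> U \<and> (\<forall>m\<in>carrier M. \<tau> (u m) = f m))"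

abbreviation DM where "DM \<equiv> dual_space K (scalar_space B M)"

lemma rep: 
  assumes "f \<in> functionals K (scalar_space B M)"
  shows "rep f \<in> U" "\<And>m. m \<in> carrier M \<Longrightarrow> \<tau> (rep f m) = f m"
proof -
  have "\<exists>u. u \<in> U \<and> (\<forall>m\<in>carrier M. \<tau> (u m) = f m)" using U_repr[OF assms] by (simp add: Bex_def)
  from someI_ex[OF this, folded rep_def]
  show "rep f \<in> U" "\<And>m. m \<in> carrier M \<Longrightarrow> \<tau> (rep f m) = f m" by auto
qed

lemma rep_tau: "u \<in> U \<Longrightarrow> rep (\<lambda>m\<in>carrier M. \<tau> (u m)) = u"
  by (rule U_eqI) (use rep[OF tau_U_functional] in auto)

lemma DM_module: "module K DM" by (rule dual_space_module[OF MS.module_axioms])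

lemma rep_add:
  assumes f: "f \<in> functionals K (scalar_space B M)" and g: "g \<in> functionals K (scalar_space B M)"
  shows "rep (f \<oplus>\<^bsub>DM\<^esub> g) = (\<lambda>m\<in>carrier M. rep f m \<oplus>\<^bsub>B\<^esub> rep g m)"
proof -
  interpret D: module K DM by (rule DM_module)
  have fg: "f \<oplus>\<^bsub>DM\<^esub> g \<in> functionals K (scalar_space B M)" using D.M.a_closed[of f g] f g by simp
  show ?thesis
    by (rule U_eqI[OF rep(1)[OF fg] U_pointwise(2)[OF rep(1)[OF f] rep(1)[OF g]]])
      (use rep(2)[OF fg] rep(2)[OF f] rep(2)[OF g] UD(1)[OF rep(1)[OF f]] UD(1)[OF rep(1)[OF g]]
        in \<open>simp add: tauD(4)\<close>)
qed

lemma rep_hom: "rep \<in> add_hom DM Umod"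
  by (rule add_homI) (simp_all add: rep(1) rep_add del: dual_space_simps(3))

lemma U_smult: "u \<in> U \<Longrightarrow> k \<in> carrier K \<Longrightarrow> m \<in> carrier M \<Longrightarrow> uact u (sc k) m = k \<odot>\<^bsub>B\<^esub> u m"
  by (simp add: act_smult act_one UD(1,3) B.mult_sc)

lemma rep_smult:
  assumes f: "f \<in> functionals K (scalar_space B M)" and k: "k \<in> carrier K"
  shows "rep (k \<odot>\<^bsub>DM\<^esub> f) = uact (rep f) (sc k)"
proof -
  interpret D: module K DM by (rule DM_module)
  have kf: "k \<odot>\<^bsub>DM\<^esub> f \<in> functionals K (scalar_space B M)" using D.smult_closed[OF k, of f] f by simp
  show ?thesis
  proof (rule U_eqI[OF rep(1)[OF kf] uact_U[OF rep(1)[OF f] sc_closed[OF k]]])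
    fix m assume m: "m \<in> carrier M"
    show "\<tau> (rep (k \<odot>\<^bsub>DM\<^esub> f) m) = \<tau> (uact (rep f) (sc k) m)"
      using rep(2)[OF kf m] rep(2)[OF f m] U_smult[OF rep(1)[OF f] k m] UD(1)[OF rep(1)[OF f] m] m k
      by (simp add: tauD(5) del: uact_apply)
  qed
qed

lemma Umod_fd: "fd_right_module K A Umod"
proof -
  have "fin_dim K (scalar_space A Umod)"
  proof (rule fin_dim_surj[OF DM_module scalar_space_module[OF Umod_right_module]
        dual_space_fin_dim[OF K.field_axioms MS.module_axioms MS_fd], of rep])
    show "rep \<in> add_hom DM (scalar_space A Umod)"
      using rep_hom unfolding add_hom_def by simp
    show "carrier (scalar_space A Umod) \<subseteq> rep ` carrier DM"
    proof
      fix u assume "u \<in> carrier (scalar_space A Umod)"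
      then have u: "u \<in> U" by simp
      show "u \<in> rep ` carrier DM"
        using rep_tau[OF u] tau_U_functional[OF u] by (intro image_eqI[of _ _ "\<lambda>m\<in>carrier M. \<tau> (u m)"]) auto
    qed
    fix k f assume k: "k \<in> carrier K" and "f \<in> carrier DM"
    then have f: "f \<in> functionals K (scalar_space B M)" by simp
    show "rep (k \<odot>\<^bsub>DM\<^esub> f) = k \<odot>\<^bsub>scalar_space A Umod\<^esub> rep f" using rep_smult[OF f k] by simp
  qed
  then show ?thesis using Umod_right_module by (simp add: fd_right_module_def)
qed

text \<open>\<open>eA\<close> embeds into a finite power of \<open>Hom\<^sub>B(M, B)\<close>, and the embedding splits by injectivity.\<close>

lemma injective_splitting:
  assumes inj: "injective_module TYPE('m) K A eA" and large: "large_type TYPE('m) K"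
  obtains n u r where "\<And>i. i < n \<Longrightarrow> u i \<in> U" "r \<in> rhom A (direct_power n Umod) eA"
    "\<And>y. y \<in> carrier eA \<Longrightarrow> r (\<lambda>i\<in>{..<n}. uact (u i) y) = y"
proof -
  obtain S d where S: "finite S" "S \<subseteq> carrier M" "\<And>s. s \<in> S \<Longrightarrow> d s \<in> functionals K (scalar_space B M)"
    "\<And>m. m \<in> carrier M \<Longrightarrow> m = (\<Oplus>\<^bsub>scalar_space B M\<^esub>s\<in>S. d s m \<odot>\<^bsub>scalar_space B M\<^esub> s)"
    using dual_basis[OF K.field_axioms MS.module_axioms MS_fd] unfolding scalar_space_simps by blast
  obtain h where h: "bij_betw h {0..<card S} S" using ex_bij_betw_nat_finite[OF S(1)] by blast
  define n where "n = card S"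
  \<comment> \<open>The u_i represent coordinate functionals of M, so a vector m is determined by
    all \<tau>(u_i(m)). Hence y is determined by the family of the u_i y, and the map into the power
    is injective.\<close>
  define u where "u i = rep (d (h i))" for i
  have hS: "h i \<in> S" if "i < n" for i using h that by (auto simp: n_def bij_betw_def)
  have u: "u i \<in> U" if "i < n" for i unfolding u_def by (rule rep(1)[OF S(3)[OF hS[OF that]]])
  define P where "P = direct_power n Umod"
  have PR: "right_module A P" unfolding P_def by (rule direct_power_right_module[OF Umod_right_module])
  have Pfd: "fd_right_module K A P" unfolding P_def by (rule direct_power_fd[OF Umod_fd])
  define \<iota> where "\<iota> = (\<lambda>y\<in>carrier eA. \<lambda>i\<in>{..<n}. uact (u i) y)"
  have eA_A: "y \<in> carrier A" if "y \<in> carrier eA" for y using that unfolding carrier_eA by simp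
  note eAD = right_moduleD[OF eA_right_module]
  interpret eAg: abelian_group eA by (rule eAD(1))
  have \<iota>: "\<iota> \<in> rhom A eA P"
  proof (rule rhomI)
    fix y assume y: "y \<in> carrier eA"
    show "\<iota> y \<in> carrier P" using y u uact_U eA_A[OF y] by (auto simp: \<iota>_def P_def)
    show "\<iota> (y \<oplus>\<^bsub>eA\<^esub> z) = \<iota> y \<oplus>\<^bsub>P\<^esub> \<iota> z" if z: "z \<in> carrier eA" for z
      using y z eAg.a_closed[OF y z] right_moduleD(4)[OF Umod_right_module _ eA_A[OF y] eA_A[OF z]] u
      unfolding \<iota>_def P_def by (auto intro!: restrict_ext simp del: mult_bimod_simps(1))
    show "\<iota> (y \<triangleleft>\<^bsub>eA\<^esub> a) = \<iota> y \<triangleleft>\<^bsub>P\<^esub> a" if a: "a \<in> carrier A" for a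
      using y a eAD(2)[OF y a] uact_uact[OF u eA_A[OF y] a]
      unfolding \<iota>_def P_def by (auto intro!: restrict_ext simp del: mult_bimod_simps(1))
  qed (simp add: \<iota>_def)
  have \<iota>_inj: "inj_on \<iota> (carrier eA)"
  proof (rule inj_onI)
    fix y z assume y: "y \<in> carrier eA" and z: "z \<in> carrier eA" and eq: "\<iota> y = \<iota> z"
    show "y = z"
    proof (rule act_eqI[OF eA_A[OF y] eA_A[OF z]])
      fix m assume m: "m \<in> carrier M"
      note ym = act_closed[OF eA_A[OF y] m] and zm = act_closed[OF eA_A[OF z] m]
      have "d s (\<phi> y m) = d s (\<phi> z m)" if s: "s \<in> S" for s
      proof -
        have "s \<in> h ` {0..<card S}" using h s by (simp add: bij_betw_def)
        then obtain i where i: "i < n" "h i = s" by (auto simp: n_def)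
        have "uact (u i) y = uact (u i) z"
          using fun_cong[OF eq, of i] y z i(1) by (simp add: \<iota>_def del: mult_bimod_simps(1))
        from fun_cong[OF this, of m] have "u i (\<phi> y m) = u i (\<phi> z m)" using m by simp
        then show ?thesis
          using rep(2)[OF S(3)[OF s] ym] rep(2)[OF S(3)[OF s] zm] i(2) by (simp add: u_def)
      qed
      then have "(\<Oplus>\<^bsub>scalar_space B M\<^esub>s\<in>S. d s (\<phi> y m) \<odot>\<^bsub>scalar_space B M\<^esub> s) =
          (\<Oplus>\<^bsub>scalar_space B M\<^esub>s\<in>S. d s (\<phi> z m) \<odot>\<^bsub>scalar_space B M\<^esub> s)"
      proof (intro MS.finsum_cong' Pi_I)
          fix s assume "s \<in> S"
          then show "d s (\<phi> z m) \<odot>\<^bsub>scalar_space B M\<^esub> s \<in> carrier (scalar_space B M)"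
            using S(2) functionalsD(3)[OF S(3)] zm by (intro MS.smult_closed) auto
        qed auto
      then show "\<phi> y m = \<phi> z m" using S(4)[OF ym] S(4)[OF zm] by simp
    qed
  qed
  \<comment> \<open>Injectivity of eA is stated for modules with carrier in \<open>'m\<close>. Both
    eA and the power are replaced by copies there, and the resulting extension is carried
    back.\<close>
  obtain X :: "('a, 'm) rmod" and \<kappa> where X: "fd_right_module K A X" "\<kappa> \<in> rhom A eA X"
    "bij_betw \<kappa> (carrier eA) (carrier X)"
    using exists_copy[OF fd_alg_axioms eA_fd large] by blast
  obtain Y :: "('a, 'm) rmod" and \<sigma> where Y: "fd_right_module K A Y" "\<sigma> \<in> rhom A P Y"
    "bij_betw \<sigma> (carrier P) (carrier Y)"
    using exists_copy[OF fd_alg_axioms Pfd large] by blast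
  have XR: "right_module A X" and YR: "right_module A Y" using X Y by (auto simp: fd_right_module_def)
  obtain \<kappa>' where \<kappa>': "\<kappa>' \<in> rhom A X eA" "compose (carrier eA) \<kappa>' \<kappa> = (\<lambda>m\<in>carrier eA. m)"
      "compose (carrier X) \<kappa> \<kappa>' = (\<lambda>m\<in>carrier X. m)" "bij_betw \<kappa>' (carrier X) (carrier eA)"
      "\<forall>m\<in>carrier eA. \<kappa>' (\<kappa> m) = m" "\<forall>n\<in>carrier X. \<kappa> (\<kappa>' n) = n"
    by (rule rhom_bij_inverse[OF eA_right_module XR X(2,3)])
  let ?j = "compose (carrier X) \<iota> \<kappa>'" 
  let ?i = "compose (carrier X) \<sigma> ?j"
  have j: "?j \<in> rhom A X P" by (rule rhom_compose[OF \<kappa>'(1) \<iota> XR])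
  have i: "?i \<in> rhom A X Y" by (rule rhom_compose[OF j Y(2) XR])
  have "inj_on ?i (carrier X)"
  proof (rule inj_onI)
    fix x y assume x: "x \<in> carrier X" and y: "y \<in> carrier X" and eq: "?i x = ?i y"
    note kx = rhomD(1)[OF \<kappa>'(1) x] and ky = rhomD(1)[OF \<kappa>'(1) y]
    have "\<sigma> (\<iota> (\<kappa>' x)) = \<sigma> (\<iota> (\<kappa>' y))" using eq x y by (simp add: compose_def)
    then have "\<iota> (\<kappa>' x) = \<iota> (\<kappa>' y)"
      using Y(3) rhomD(1)[OF \<iota> kx] rhomD(1)[OF \<iota> ky] by (auto simp: bij_betw_def inj_on_def)
    then have "\<kappa>' x = \<kappa>' y" by (rule inj_onD[OF \<iota>_inj _ kx ky])
    then show "x = y" using \<kappa>'(6) x y by metis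
  qed
  with inj[unfolded injective_module_def] X(1) Y(1) i \<kappa>'(1)
  obtain g where g: "g \<in> rhom A Y eA" "\<forall>x\<in>carrier X. g (?i x) = \<kappa>' x" by meson
  define r where "r = compose (carrier P) g \<sigma>"
  have r: "r \<in> rhom A P eA" unfolding r_def by (rule rhom_compose[OF Y(2) g(1) PR])
  have "r (\<iota> y) = y" if y: "y \<in> carrier eA" for y
  proof -
    note ky = rhomD(1)[OF X(2) y]
    have "g (?i (\<kappa> y)) = y" using g(2) ky \<kappa>'(5) y by auto
    then show ?thesis
      using \<kappa>'(5) y ky rhomD(1)[OF \<iota> y] by (simp add: r_def compose_def del: mult_bimod_simps(1))
  qed
  then have "r (\<lambda>i\<in>{..<n}. uact (u i) y) = y" if "y \<in> carrier eA" for y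
    using that by (simp add: \<iota>_def del: mult_bimod_simps(1))
  then show ?thesis using that u r unfolding P_def by blast
qed

text \<open>The splitting r expresses e as the sum of the elements r(v placed in coordinate i) for v
  = u_i e in Ue. Writing v = \<Sum> w(g)v = \<Sum> w(gv), A-linearity of r gives r(v) = \<Sum>
  r(w)(gv) = \<Sum> (r(w)g)v, and r(w)g is in eM because r(w) is in eA.\<close>

lemma e_in_trace:
  assumes inj: "injective_module TYPE('m) K A eA" and large: "large_type TYPE('m) K"
  shows "e \<in> addspan A {op x v | x v. x \<in> eM \<and> v \<in> Ue}" (is "e \<in> addspan A ?X")
proof -
  obtain n u r where u: "\<And>i. i < n \<Longrightarrow> u i \<in> U" and r: "r \<in> rhom A (direct_power n Umod) eA"
    and re: "\<And>y. y \<in> carrier eA \<Longrightarrow> r (\<lambda>i\<in>{..<n}. uact (u i) y) = y"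
    using injective_splitting[OF inj large] by blast
  define P where "P = direct_power n Umod"
  have PR: "right_module A P" unfolding P_def by (rule direct_power_right_module[OF Umod_right_module])
  interpret P: abelian_group P using right_moduleD(1)[OF PR] .
  interpret Um: abelian_group Umod using right_moduleD(1)[OF Umod_right_module] .
  note rD = rhomD[OF r, folded P_def]
  have rA: "r \<in> add_hom P A"
    using rD(1,2) unfolding add_hom_def carrier_eA by simp
  have Xsub: "?X \<subseteq> carrier A" using op_closed eM_M Ue_U by blast
  have uv: "unit_vec n Umod i v \<in> carrier P" if "v \<in> U" for i v
    unfolding P_def by (rule unit_vec_closed[OF Umod_right_module]) (simp add: that)
  have e_eA: "e \<in> carrier eA" unfolding carrier_eA by simp
  have comp: "r (unit_vec n Umod i v) \<in> addspan A ?X" if v: "v \<in> Ue" for i v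
  proof -
    \<comment> \<open>F is additive in c, so membership for c = 1 follows from membership for the
      values c = w(g), whose sums include 1.\<close>
    define F where "F c = r (unit_vec n Umod i (bmul c v))" for c
    have vU: "v \<in> U" by (rule Ue_U[OF v])
    have bhom: "(\<lambda>c. bmul c v) \<in> add_hom B Umod"
      by (rule add_homI) (use bmul_U[OF vU] UD(1)[OF vU] in \<open>auto simp: bmul_def B.A.l_distr intro!: restrict_ext\<close>)
    have Fhom: "F \<in> add_hom B A"
      unfolding F_def
      by (rule add_hom_compose[OF bhom add_hom_compose[OF _ rA]])
        (unfold P_def, rule unit_vec_hom[OF Umod_right_module])
    have "F \<one>\<^bsub>B\<^esub> \<in> addspan A ?X"
    proof (rule addspan_image[OF B.A.abelian_group_axioms A.abelian_group_axioms Fhom trace_subset[OF subset_refl] _ trace_one])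
      fix c assume "c \<in> {u m | u m. u \<in> U \<and> m \<in> carrier M}"
      then obtain w g where c: "c = w g" "w \<in> U" "g \<in> carrier M" by blast
      have og: "op g v \<in> carrier A" by (rule op_closed[OF c(3) vU])
      have "F c = r (unit_vec n Umod i (w \<triangleleft>\<^bsub>Umod\<^esub> op g v))"
        unfolding F_def c(1) using uact_op[OF c(2,3) vU] by simp
      also have "\<dots> = r (unit_vec n Umod i w \<triangleleft>\<^bsub>P\<^esub> op g v)"
        using unit_vec_act[OF Umod_right_module _ og, of w n i] c(2) by (simp add: P_def)
      also have "\<dots> = r (unit_vec n Umod i w) \<otimes>\<^bsub>A\<^esub> op g v"
        using rD(3)[OF uv[OF c(2)] og] by simp
      also have "\<dots> = op (\<phi> (r (unit_vec n Umod i w)) g) v"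
        by (rule op_mult_left[OF c(3) vU add_hom_closed[OF rA uv[OF c(2)]]])
      also have "\<dots> \<in> addspan A ?X"
        using eA_act[OF rD(1)[OF uv[OF c(2)]] c(3)] v by (intro addspan.incl) blast
      finally show "F c \<in> addspan A ?X" .
    qed
    moreover have "bmul \<one>\<^bsub>B\<^esub> v = v"
      by (rule rhom_eqI[OF bmul_U[OF vU B.A.one_closed] vU]) (simp add: UD(1)[OF vU])
    ultimately show ?thesis by (simp add: F_def)
  qed
  let ?y = "\<lambda>i\<in>{..<n}. uact (u i) e"
  have y: "?y \<in> carrier P" using u uact_U by (auto simp: P_def)
  have "e = r ?y" by (rule re[OF e_eA, symmetric])
  also have "\<dots> = r (\<Oplus>\<^bsub>P\<^esub>i\<in>{..<n}. unit_vec n Umod i (?y i))"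
    unfolding P_def by (rule arg_cong[OF direct_power_sum[OF Umod_right_module y[unfolded P_def]]])
  also have "\<dots> = (\<Oplus>\<^bsub>A\<^esub>i\<in>{..<n}. r (unit_vec n Umod i (?y i)))"
    by (rule add_hom_finsum[OF P.abelian_group_axioms A.abelian_group_axioms rA]) (use uv u uact_U in auto)
  also have "\<dots> \<in> addspan A ?X"
    by (rule addspan_finsum_closed[OF A.abelian_group_axioms Xsub]) (use comp e_uact u in auto)
  finally show ?thesis .
qed

end

text \<open>Fixes finite expressions e = \<Sum> x_j v_j and 1 = \<Sum> p_i(q_i). The first defines
  the form \<open>lam\<close>, the second the map \<open>\<omega>\<close>, so both become explicit
  sums.\<close>

locale trace_data = gendo_data K A e B M \<phi> \<theta>B
  for K :: "('k, 'c) ring_scheme" and A :: "('k, 'a, 'x) module_scheme" and e :: 'a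
    and B :: "('k, 'b, 'y) module_scheme" and M :: "('b, 'v) rmod" and \<phi> and \<theta>B +
  fixes n :: nat and xs :: "nat \<Rightarrow> 'v" and vs :: "nat \<Rightarrow> 'v \<Rightarrow> 'b"
    and r :: nat and ps :: "nat \<Rightarrow> 'v \<Rightarrow> 'b" and qs :: "nat \<Rightarrow> 'v"
  assumes xs: "j < n \<Longrightarrow> xs j \<in> eM" and vs: "j < n \<Longrightarrow> vs j \<in> Ue"
    and e_sum: "e = (\<Oplus>\<^bsub>A\<^esub>j\<in>{..<n}. op (xs j) (vs j))"
    and ps: "i < r \<Longrightarrow> ps i \<in> Ue" and qs: "i < r \<Longrightarrow> qs i \<in> eM"
    and one_sum: "\<one>\<^bsub>B\<^esub> = (\<Oplus>\<^bsub>B\<^esub>i\<in>{..<r}. ps i (qs i))"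
begin

lemmas xsM = eM_M[OF xs] and vsU = Ue_U[OF vs] and psU = Ue_U[OF ps] and qsM = eM_M[OF qs]

subsection \<open>The trace form on the corner\<close>

text \<open>The expression for e makes the x_j and v_j a dual basis of the right B-module eM. On eAe
  this is the Hattori-Stallings trace of an endomorphism of eM followed by \<tau>; on A it is a |->
  lam(eae), because v_j e = v_j and e x_j = x_j.\<close>

definition lam :: "'a \<Rightarrow> 'k" where
  "lam a = (\<Oplus>\<^bsub>K\<^esub>j\<in>{..<n}. \<tau> (vs j (\<phi> a (xs j))))"

lemma lam_term_closed: "a \<in> carrier A \<Longrightarrow> j < n \<Longrightarrow> \<tau> (vs j (\<phi> a (xs j))) \<in> carrier K"
  by (rule tauD(3)[OF UD(1)[OF vsU act_closed[OF _ xsM]]])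

lemma lam_closed: "a \<in> carrier A \<Longrightarrow> lam a \<in> carrier K"
  unfolding lam_def by (rule K.finsum_closed) (auto intro: lam_term_closed)

lemma lam_add: "a \<in> carrier A \<Longrightarrow> b \<in> carrier A \<Longrightarrow> lam (a \<oplus>\<^bsub>A\<^esub> b) = lam a \<oplus>\<^bsub>K\<^esub> lam b"
proof -
  assume a: "a \<in> carrier A" and b: "b \<in> carrier A"
  have "lam (a \<oplus>\<^bsub>A\<^esub> b) = (\<Oplus>\<^bsub>K\<^esub>j\<in>{..<n}. \<tau> (vs j (\<phi> a (xs j))) \<oplus>\<^bsub>K\<^esub> \<tau> (vs j (\<phi> b (xs j))))"
    unfolding lam_def
    by (rule K.finsum_cong')
      (use lam_term_closed a b in \<open>auto simp: act_add_left xsM UD(1,2)[OF vsU] act_closed tauD(4)\<close>)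
  also have "\<dots> = lam a \<oplus>\<^bsub>K\<^esub> lam b"
    unfolding lam_def by (rule K.finsum_addf) (use lam_term_closed a b in auto)
  finally show ?thesis .
qed

lemma lam_hom: "lam \<in> add_hom A K"
  by (rule add_homI) (auto simp: lam_closed lam_add)

lemma lam_smult: "k \<in> carrier K \<Longrightarrow> a \<in> carrier A \<Longrightarrow> lam (k \<odot>\<^bsub>A\<^esub> a) = k \<otimes>\<^bsub>K\<^esub> lam a"
proof -
  assume k: "k \<in> carrier K" and a: "a \<in> carrier A"
  have khom: "(\<lambda>x. k \<otimes>\<^bsub>K\<^esub> x) \<in> add_hom K K" using k by (auto intro!: add_homI simp: K.r_distr)
  have "k \<otimes>\<^bsub>K\<^esub> lam a = (\<Oplus>\<^bsub>K\<^esub>j\<in>{..<n}. k \<otimes>\<^bsub>K\<^esub> \<tau> (vs j (\<phi> a (xs j))))"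
    unfolding lam_def
    by (rule add_hom_finsum[OF K.abelian_group_axioms K.abelian_group_axioms khom]) (use lam_term_closed a in auto)
  also have "\<dots> = lam (k \<odot>\<^bsub>A\<^esub> a)"
    unfolding lam_def
    by (rule K.finsum_cong')
      (use lam_term_closed a k in \<open>auto simp: act_smult xsM UD(1,3)[OF vsU] act_closed B.mult_sc tauD(5)\<close>)
  finally show ?thesis by simp
qed

lemma e_act_sum: "m \<in> carrier M \<Longrightarrow> \<phi> e m = (\<Oplus>\<^bsub>M\<^esub>j\<in>{..<n}. xs j \<triangleleft>\<^bsub>M\<^esub> vs j m)"
proof -
  assume m: "m \<in> carrier M"
  have "(\<lambda>a. \<phi> a m) \<in> add_hom A M" by (rule add_homI) (use m act_closed act_add_left in auto)
  then have "\<phi> (\<Oplus>\<^bsub>A\<^esub>j\<in>{..<n}. op (xs j) (vs j)) m = (\<Oplus>\<^bsub>M\<^esub>j\<in>{..<n}. \<phi> (op (xs j) (vs j)) m)"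
    by (rule add_hom_finsum[OF A.abelian_group_axioms M.abelian_group_axioms])
      (use op_closed xsM vsU in auto)
  also have "\<dots> = (\<Oplus>\<^bsub>M\<^esub>j\<in>{..<n}. xs j \<triangleleft>\<^bsub>M\<^esub> vs j m)"
    by (rule M.finsum_cong') (use op_act xsM vsU m MD(1) UD(1) in auto)
  finally show ?thesis unfolding e_sum[symmetric] .
qed

text \<open>Symmetry of \<tau> exchanges v_j(m) and u(x_j), after which \<Sum> x_j v_j(m) = em = m.
  The value no longer involves the dual basis.\<close>

lemma lam_op:
  assumes m: "m \<in> eM" and u: "u \<in> U"
  shows "lam (op m u) = \<tau> (u m)"
proof -
  have mM: "m \<in> carrier M" by (rule eM_M[OF m])
  have tu: "(\<lambda>m. \<tau> (u m)) \<in> add_hom M K" by (rule add_hom_compose[OF UD(5)[OF u] tauD(1)])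
  have "lam (op m u) = (\<Oplus>\<^bsub>K\<^esub>j\<in>{..<n}. \<tau> (u (xs j \<triangleleft>\<^bsub>M\<^esub> vs j m)))"
    unfolding lam_def
  proof (rule K.finsum_cong')
    fix j assume "j \<in> {..<n}"
    then have j: "j < n" by simp
    have c: "u (xs j) \<in> carrier B" "vs j m \<in> carrier B" using UD(1)[OF u xsM[OF j]] UD(1)[OF vsU[OF j] mM] by auto
    have "\<tau> (vs j (\<phi> (op m u) (xs j))) = \<tau> (vs j m \<otimes>\<^bsub>B\<^esub> u (xs j))"
      using op_act[OF mM u xsM[OF j]] UD(3)[OF vsU[OF j] mM c(1)] by simp
    also have "\<dots> = \<tau> (u (xs j) \<otimes>\<^bsub>B\<^esub> vs j m)" by (rule tau_comm[OF c(2,1)])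
    also have "\<dots> = \<tau> (u (xs j \<triangleleft>\<^bsub>M\<^esub> vs j m))" using UD(3)[OF u xsM[OF j] c(2)] by simp
    finally show "\<tau> (vs j (\<phi> (op m u) (xs j))) = \<tau> (u (xs j \<triangleleft>\<^bsub>M\<^esub> vs j m))" .
  qed (use add_hom_closed[OF tu] MD(1) xsM UD(1)[OF vsU _] mM in auto)
  also have "\<dots> = \<tau> (u (\<Oplus>\<^bsub>M\<^esub>j\<in>{..<n}. xs j \<triangleleft>\<^bsub>M\<^esub> vs j m))"
    by (rule add_hom_finsum[OF M.abelian_group_axioms K.abelian_group_axioms tu, symmetric])
      (use MD(1) xsM UD(1)[OF vsU _] mM in auto)
  also have "\<dots> = \<tau> (u m)" using e_act_sum[OF mM] eM_e[OF m] by simp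
  finally show ?thesis .
qed

lemma sum_mult_left:
  assumes "a \<in> carrier A" "\<And>i. i \<in> I \<Longrightarrow> f i \<in> carrier A"
  shows "a \<otimes>\<^bsub>A\<^esub> (\<Oplus>\<^bsub>A\<^esub>i\<in>I. f i) = (\<Oplus>\<^bsub>A\<^esub>i\<in>I. a \<otimes>\<^bsub>A\<^esub> f i)"
proof -
  have "(\<lambda>x. a \<otimes>\<^bsub>A\<^esub> x) \<in> add_hom A A" using assms(1) by (auto intro!: add_homI simp: A.r_distr)
  from add_hom_finsum[OF A.abelian_group_axioms A.abelian_group_axioms this, of f I] show ?thesis
    using assms(2) by auto
qed

lemma sum_mult_right:
  assumes "a \<in> carrier A" "\<And>i. i \<in> I \<Longrightarrow> f i \<in> carrier A"
  shows "(\<Oplus>\<^bsub>A\<^esub>i\<in>I. f i) \<otimes>\<^bsub>A\<^esub> a = (\<Oplus>\<^bsub>A\<^esub>i\<in>I. f i \<otimes>\<^bsub>A\<^esub> a)"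
proof -
  have "(\<lambda>x. x \<otimes>\<^bsub>A\<^esub> a) \<in> add_hom A A" using assms(1) by (auto intro!: add_homI simp: A.l_distr)
  from add_hom_finsum[OF A.abelian_group_axioms A.abelian_group_axioms this, of f I] show ?thesis
    using assms(2) by auto
qed

text \<open>Write a = ae = \<Sum> a(x_j v_j). Then a(x_j v_j)b is the operator of a x_j and v_j b,
  with lam-value \<tau>(v_j(b a x_j)), which is the j-th term of lam(ba). Membership of a in eAe
  gives ae = a and puts a x_j in eM.\<close>

lemma lam_comm:
  assumes a: "a \<in> carrier eAe" and b: "b \<in> carrier A"
  shows "lam (a \<otimes>\<^bsub>A\<^esub> b) = lam (b \<otimes>\<^bsub>A\<^esub> a)"
proof -
  have aA: "a \<in> carrier A" "e \<otimes>\<^bsub>A\<^esub> a = a" "a \<otimes>\<^bsub>A\<^esub> e = a" using a by (auto simp: carrier_corner)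
  have aeA: "a \<in> carrier eA" using aA unfolding carrier_eA by simp
  have oc: "op (xs j) (vs j) \<in> carrier A" if "j < n" for j by (rule op_closed[OF xsM vsU]) (use that in auto)
  have "a \<otimes>\<^bsub>A\<^esub> b = (a \<otimes>\<^bsub>A\<^esub> e) \<otimes>\<^bsub>A\<^esub> b" using aA by simp
  also have "\<dots> = (\<Oplus>\<^bsub>A\<^esub>j\<in>{..<n}. a \<otimes>\<^bsub>A\<^esub> op (xs j) (vs j)) \<otimes>\<^bsub>A\<^esub> b"
    using sum_mult_left[OF aA(1), of "{..<n}" "\<lambda>j. op (xs j) (vs j)"] oc by (simp add: e_sum[symmetric])
  also have "\<dots> = (\<Oplus>\<^bsub>A\<^esub>j\<in>{..<n}. a \<otimes>\<^bsub>A\<^esub> op (xs j) (vs j) \<otimes>\<^bsub>A\<^esub> b)"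
    by (rule sum_mult_right[OF b]) (use oc aA in auto)
  finally have "lam (a \<otimes>\<^bsub>A\<^esub> b) = (\<Oplus>\<^bsub>K\<^esub>j\<in>{..<n}. lam (a \<otimes>\<^bsub>A\<^esub> op (xs j) (vs j) \<otimes>\<^bsub>A\<^esub> b))"
    using add_hom_finsum[OF A.abelian_group_axioms K.abelian_group_axioms lam_hom, of "\<lambda>j. a \<otimes>\<^bsub>A\<^esub> op (xs j) (vs j) \<otimes>\<^bsub>A\<^esub> b" "{..<n}"]
      oc aA b by (simp add: Pi_iff)
  also have "\<dots> = lam (b \<otimes>\<^bsub>A\<^esub> a)"
    unfolding lam_def[of "b \<otimes>\<^bsub>A\<^esub> a"]
  proof (rule K.finsum_cong')
    fix j assume "j \<in> {..<n}"
    then have j: "j < n" by simp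
    note x = xsM[OF j] and v = vsU[OF j]
    have ax: "\<phi> a (xs j) \<in> eM" by (rule eA_act[OF aeA x])
    have "a \<otimes>\<^bsub>A\<^esub> op (xs j) (vs j) \<otimes>\<^bsub>A\<^esub> b = op (\<phi> a (xs j)) (uact (vs j) b)"
      using op_mult_left[OF x v aA(1)] op_mult_right[OF eM_M[OF ax] v b] by simp
    then show "lam (a \<otimes>\<^bsub>A\<^esub> op (xs j) (vs j) \<otimes>\<^bsub>A\<^esub> b) = \<tau> (vs j (\<phi> (b \<otimes>\<^bsub>A\<^esub> a) (xs j)))"
      using lam_op[OF ax uact_U[OF v b]] eM_M[OF ax] act_mult[OF b aA(1) x] by simp
  qed (use lam_term_closed aA b in auto)
  finally show ?thesis .
qed

subsection \<open>The isomorphism \<open>Ae \<otimes>\<^bsub>eAe\<^esub> eA \<cong> D(A)\<close>\<close>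

sublocale E: tensor_product eAe Ae eA
  by (rule tensor_product.intro[OF Ae_right_module eA_left_module])

lemma eAe_A: "s \<in> carrier eAe \<Longrightarrow> s \<in> carrier A"
  unfolding carrier_corner by auto

lemma eAe_eA: "s \<in> carrier eAe \<Longrightarrow> s \<in> carrier eA"
  unfolding carrier_eA carrier_corner by auto

definition pairing :: "'a \<Rightarrow> 'a \<Rightarrow> 'a \<Rightarrow> 'k" where
  "pairing x y = (\<lambda>a\<in>carrier A. lam (y \<otimes>\<^bsub>A\<^esub> a \<otimes>\<^bsub>A\<^esub> x))"

lemma pairing_functional:
  assumes x: "x \<in> carrier A" and y: "y \<in> carrier A"
  shows "pairing x y \<in> functionals K A"
  by (rule functionalsI)
    (use x y in \<open>auto simp: pairing_def lam_closed lam_add lam_smult A.l_distr A.r_distr smult_mult\<close>)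

text \<open>Moving s from x to y is the symmetry of \<open>lam\<close>: lam(yaxs) =
  lam(syax).\<close>

lemma balanced_pairing: "balanced eAe Ae eA (dual_bimod K A) pairing"
proof (rule balancedI)
  fix x y assume x: "x \<in> carrier Ae" and y: "y \<in> carrier eA"
  note xA = Ae_A[OF x] and yA = eA_A[OF y]
  show "pairing x y \<in> functionals K A" by (rule pairing_functional[OF xA yA])
  show "pairing x (y \<oplus>\<^bsub>eA\<^esub> y') = pairing x y \<oplus>\<^bsub>dual_bimod K A\<^esub> pairing x y'" if y': "y' \<in> carrier eA" for y'
    using xA yA eA_A[OF y'] by (auto simp: pairing_def A.l_distr lam_add intro!: restrict_ext)
  show "pairing (x \<oplus>\<^bsub>Ae\<^esub> x') y = pairing x y \<oplus>\<^bsub>dual_bimod K A\<^esub> pairing x' y" if x': "x' \<in> carrier Ae" for x'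
    using xA yA Ae_A[OF x'] by (auto simp: pairing_def A.r_distr lam_add intro!: restrict_ext)
  show "pairing (x \<triangleleft>\<^bsub>Ae\<^esub> s) y = pairing x (s \<triangleright>\<^bsub>eA\<^esub> y)" if s: "s \<in> carrier eAe" for s
  proof -
    have "lam (y \<otimes>\<^bsub>A\<^esub> a \<otimes>\<^bsub>A\<^esub> (x \<otimes>\<^bsub>A\<^esub> s)) = lam (s \<otimes>\<^bsub>A\<^esub> y \<otimes>\<^bsub>A\<^esub> a \<otimes>\<^bsub>A\<^esub> x)" if a: "a \<in> carrier A" for a
      using lam_comm[OF s, of "y \<otimes>\<^bsub>A\<^esub> a \<otimes>\<^bsub>A\<^esub> x"] xA yA a eAe_A[OF s] by (simp add: A.m_assoc)
    then show ?thesis by (auto simp: pairing_def intro!: restrict_ext)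
  qed
qed

definition \<Theta> :: "('a \<times> 'a \<Rightarrow>\<^sub>0 int) set \<Rightarrow> 'a \<Rightarrow> 'k" where
  "\<Theta> = (\<lambda>t\<in>carrier E.T. tensor_lift (dual_bimod K A) pairing t)"

lemma DA_group: "abelian_group (dual_bimod K A)" by (rule dual_bimod_abelian_group[OF V.module_axioms])

lemma Theta_hom: "\<Theta> \<in> add_hom E.T (dual_bimod K A)"
  using E.tensor_lift_add_hom[OF DA_group balanced_pairing] E.T.a_closed by (auto simp: \<Theta>_def add_hom_def)

lemma Theta_pure: "x \<in> carrier Ae \<Longrightarrow> y \<in> carrier eA \<Longrightarrow> \<Theta> (E.pure x y) = pairing x y"
  using E.tensor_lift_pure[OF DA_group balanced_pairing, of x y] E.pure_closed[of x y]
  by (simp add: \<Theta>_def del: mult_bimod_simps(1))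

lemma E_ract_pure: "x \<in> carrier Ae \<Longrightarrow> y \<in> carrier eA \<Longrightarrow> a \<in> carrier A \<Longrightarrow>
    E.pure x y \<triangleleft>\<^bsub>E.T\<^esub> a = E.pure x (y \<otimes>\<^bsub>A\<^esub> a)"
  and E_lact_pure: "x \<in> carrier Ae \<Longrightarrow> y \<in> carrier eA \<Longrightarrow> a \<in> carrier A \<Longrightarrow>
    a \<triangleright>\<^bsub>E.T\<^esub> E.pure x y = E.pure (a \<otimes>\<^bsub>A\<^esub> x) y"
  and E_ract_hom: "a \<in> carrier A \<Longrightarrow> (\<lambda>t. t \<triangleleft>\<^bsub>E.T\<^esub> a) \<in> add_hom E.T E.T"
  and E_lact_hom: "a \<in> carrier A \<Longrightarrow> (\<lambda>t. a \<triangleright>\<^bsub>E.T\<^esub> t) \<in> add_hom E.T E.T"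
  and E_right: "right_module A E.T"
proof -
  have c1: "(s \<triangleright>\<^bsub>eA\<^esub> y) \<triangleleft>\<^bsub>eA\<^esub> a = s \<triangleright>\<^bsub>eA\<^esub> (y \<triangleleft>\<^bsub>eA\<^esub> a)"
    if "s \<in> carrier eAe" "y \<in> carrier eA" "a \<in> carrier A" for s y a
    using that unfolding carrier_corner carrier_eA by (simp add: A.m_assoc)
  have c2: "(a \<triangleright>\<^bsub>Ae\<^esub> x) \<triangleleft>\<^bsub>Ae\<^esub> s = a \<triangleright>\<^bsub>Ae\<^esub> (x \<triangleleft>\<^bsub>Ae\<^esub> s)"
    if "s \<in> carrier eAe" "x \<in> carrier Ae" "a \<in> carrier A" for s x a
    using that unfolding carrier_corner carrier_Ae by (simp add: A.m_assoc)
  show "E.pure x y \<triangleleft>\<^bsub>E.T\<^esub> a = E.pure x (y \<otimes>\<^bsub>A\<^esub> a)"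
    if "x \<in> carrier Ae" "y \<in> carrier eA" "a \<in> carrier A" for x y a
    using E.ract_pure[OF eA_right_module _ that] c1 by simp
  show "a \<triangleright>\<^bsub>E.T\<^esub> E.pure x y = E.pure (a \<otimes>\<^bsub>A\<^esub> x) y"
    if "x \<in> carrier Ae" "y \<in> carrier eA" "a \<in> carrier A" for x y a
    using E.lact_pure[OF Ae_left_module _ that] c2 by simp
  show "(\<lambda>t. t \<triangleleft>\<^bsub>E.T\<^esub> a) \<in> add_hom E.T E.T" if "a \<in> carrier A" for a
    by (rule E.ract_add_hom[OF eA_right_module _ that]) (rule c1)
  show "(\<lambda>t. a \<triangleright>\<^bsub>E.T\<^esub> t) \<in> add_hom E.T E.T" if "a \<in> carrier A" for a
    by (rule E.lact_add_hom[OF Ae_left_module _ that]) (rule c2)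
  show "right_module A E.T" by (rule E.tensor_right_module[OF eA_right_module _ A.ring_axioms]) (rule c1)
qed

lemma Theta_bihom: "\<Theta> \<in> bihom A A E.T (dual_bimod K A)"
proof -
  note D = dual_bimodule
  note DR = right_moduleD(2,3)[OF bimoduleD(2)[OF D]] and DL = left_moduleD(2,3)[OF bimoduleD(1)[OF D]]
  have ract: "\<Theta> (t \<triangleleft>\<^bsub>E.T\<^esub> b) = \<Theta> t \<triangleleft>\<^bsub>dual_bimod K A\<^esub> b" if t: "t \<in> carrier E.T" and b: "b \<in> carrier A" for t b
  proof (rule E.tensor_eqI[OF DA_group add_hom_compose[OF E_ract_hom[OF b] Theta_hom] add_hom_compose[OF Theta_hom] _ t])
    show "(\<lambda>f. f \<triangleleft>\<^bsub>dual_bimod K A\<^esub> b) \<in> add_hom (dual_bimod K A) (dual_bimod K A)"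
      using DR b by (intro add_homI)
    fix x y assume x: "x \<in> carrier Ae" and y: "y \<in> carrier eA"
    show "\<Theta> (E.pure x y \<triangleleft>\<^bsub>E.T\<^esub> b) = \<Theta> (E.pure x y) \<triangleleft>\<^bsub>dual_bimod K A\<^esub> b"
      unfolding E_ract_pure[OF x y b] Theta_pure[OF x y] Theta_pure[OF x eA_mult[OF b y]]
      using Ae_A[OF x] eA_A[OF y] b by (auto simp: pairing_def A.m_assoc intro!: restrict_ext)
  qed
  have lact: "\<Theta> (b \<triangleright>\<^bsub>E.T\<^esub> t) = b \<triangleright>\<^bsub>dual_bimod K A\<^esub> \<Theta> t" if t: "t \<in> carrier E.T" and b: "b \<in> carrier A" for t b
  proof (rule E.tensor_eqI[OF DA_group add_hom_compose[OF E_lact_hom[OF b] Theta_hom] add_hom_compose[OF Theta_hom] _ t])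
    show "(\<lambda>f. b \<triangleright>\<^bsub>dual_bimod K A\<^esub> f) \<in> add_hom (dual_bimod K A) (dual_bimod K A)"
      using DL b by (intro add_homI)
    fix x y assume x: "x \<in> carrier Ae" and y: "y \<in> carrier eA"
    show "\<Theta> (b \<triangleright>\<^bsub>E.T\<^esub> E.pure x y) = b \<triangleright>\<^bsub>dual_bimod K A\<^esub> \<Theta> (E.pure x y)"
      unfolding E_lact_pure[OF x y b] Theta_pure[OF x y] Theta_pure[OF Ae_mult[OF b x] y]
      using Ae_A[OF x] eA_A[OF y] b by (auto simp: pairing_def A.m_assoc intro!: restrict_ext)
  qed
  have "\<Theta> \<in> rhom A E.T (dual_bimod K A)"
    by (rule rhomI)
      (rule add_hom_closed[OF Theta_hom] add_hom_add[OF Theta_hom] ract | simp add: \<Theta>_def)+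
  then show ?thesis using lact by (simp add: bihom_def)
qed

lemma Ue_trace_subset: "{u m | u m. u \<in> Ue \<and> m \<in> eM} \<subseteq> carrier B"
  using UD(1) Ue_U eM_M by blast

lemma one_trace: "\<one>\<^bsub>B\<^esub> \<in> addspan B {u m | u m. u \<in> Ue \<and> m \<in> eM}"
proof -
  have "(\<Oplus>\<^bsub>B\<^esub>i\<in>{..<r}. ps i (qs i)) \<in> addspan B {u m | u m. u \<in> Ue \<and> m \<in> eM}"
  proof (rule addspan_finsum_closed[OF B.A.abelian_group_axioms Ue_trace_subset])
    fix i assume "i \<in> {..<r}"
    then have "ps i \<in> Ue" "qs i \<in> eM" using ps qs by auto
    then show "ps i (qs i) \<in> addspan B {u m | u m. u \<in> Ue \<and> m \<in> eM}"
      by (intro addspan.incl CollectI exI[of _ "ps i"] exI[of _ "qs i"]) simp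
  qed
  then show ?thesis by (simp only: one_sum[symmetric])
qed

text \<open>Let a be a common zero of the image. For x = mq and y = pu the form gives
  \<tau>(q(p)u(am)) = 0. The values q(p) sum to 1, so \<tau>(u(am)) = 0 for all u, hence am = 0 for
  all m and a = 0.\<close>

lemma Theta_surj: "\<Theta> ` carrier E.T = functionals K A"
proof (rule functionals_eq_of_no_common_zero[OF K.field_axioms V.module_axioms fin_dim])
  note ED = right_moduleD(2)[OF E_right]
  show "submodule (\<Theta> ` carrier E.T) K (dual_space K A)"
  proof (rule submoduleI'[OF dual_space_module[OF V.module_axioms]])
    show "\<Theta> ` carrier E.T \<subseteq> carrier (dual_space K A)" using add_hom_closed[OF Theta_hom] by auto
    have "\<Theta> \<zero>\<^bsub>E.T\<^esub> = \<zero>\<^bsub>dual_space K A\<^esub>"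
      using add_hom_zero[OF E.T.abelian_group_axioms DA_group Theta_hom] by simp
    then show "\<zero>\<^bsub>dual_space K A\<^esub> \<in> \<Theta> ` carrier E.T" by (rule image_eqI[OF sym]) simp
  next
    fix f g assume "f \<in> \<Theta> ` carrier E.T" "g \<in> \<Theta> ` carrier E.T"
    then obtain s t where st: "s \<in> carrier E.T" "t \<in> carrier E.T" "f = \<Theta> s" "g = \<Theta> t" by (elim imageE)
    have "f \<oplus>\<^bsub>dual_space K A\<^esub> g = \<Theta> (s \<oplus>\<^bsub>E.T\<^esub> t)" using add_hom_add[OF Theta_hom st(1,2)] st(3,4) by simp
    then show "f \<oplus>\<^bsub>dual_space K A\<^esub> g \<in> \<Theta> ` carrier E.T" by (rule image_eqI) (rule E.T.a_closed[OF st(1,2)])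
  next
    fix k f assume k: "k \<in> carrier K" and "f \<in> \<Theta> ` carrier E.T"
    then obtain t where t: "t \<in> carrier E.T" "f = \<Theta> t" by (elim imageE)
    have "\<Theta> (t \<triangleleft>\<^bsub>E.T\<^esub> sc k) = \<Theta> t \<triangleleft>\<^bsub>dual_bimod K A\<^esub> sc k"
      using Theta_bihom rhomD(3)[of \<Theta> A E.T "dual_bimod K A" t "sc k"] t k by (simp add: bihom_def del: dual_bimod_simps)
    also have "\<dots> = k \<odot>\<^bsub>dual_space K A\<^esub> f"
      using functionalsD(5)[OF add_hom_closed[OF Theta_hom t(1)] k] k t(2)
      by (auto simp: smult_mult intro!: restrict_ext)
    finally have "k \<odot>\<^bsub>dual_space K A\<^esub> f = \<Theta> (t \<triangleleft>\<^bsub>E.T\<^esub> sc k)" by (rule sym)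
    then show "k \<odot>\<^bsub>dual_space K A\<^esub> f \<in> \<Theta> ` carrier E.T" by (rule image_eqI) (rule ED[OF t(1) sc_closed[OF k]])
  qed
next
  fix a assume a: "a \<in> carrier A" and z: "\<And>f. f \<in> \<Theta> ` carrier E.T \<Longrightarrow> f a = \<zero>\<^bsub>K\<^esub>"
  have z': "lam (y \<otimes>\<^bsub>A\<^esub> a \<otimes>\<^bsub>A\<^esub> x) = \<zero>\<^bsub>K\<^esub>" if x: "x \<in> carrier Ae" and y: "y \<in> carrier eA" for x y
    using z[OF imageI[OF E.pure_closed[OF x y]]] a by (simp add: Theta_pure[OF x y] pairing_def)
  show "a = \<zero>\<^bsub>A\<^esub>"
  proof (rule act_eq_zeroI[OF a])
    fix m assume m: "m \<in> carrier M"
    have am: "\<phi> a m \<in> carrier M" by (rule act_closed[OF a m])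
    have tz: "\<tau> (u (\<phi> a m)) = \<zero>\<^bsub>K\<^esub>" if u: "u \<in> U" for u
    proof -
      let ?c = "u (\<phi> a m)"
      have c: "?c \<in> carrier B" by (rule UD(1)[OF u am])
      have f: "(\<lambda>b. \<tau> (b \<otimes>\<^bsub>B\<^esub> ?c)) \<in> add_hom B K"
        using c tauD(3,4) by (auto intro!: add_homI simp: B.A.l_distr)
      have g: "(\<lambda>b. \<zero>\<^bsub>K\<^esub>) \<in> add_hom B K" by (auto intro!: add_homI)
      have "\<tau> (\<one>\<^bsub>B\<^esub> \<otimes>\<^bsub>B\<^esub> ?c) = \<zero>\<^bsub>K\<^esub>"
      proof (rule addspan_eq[OF B.A.abelian_group_axioms K.abelian_group_axioms Ue_trace_subset f g _ one_trace])
        fix b assume "b \<in> {u m | u m. u \<in> Ue \<and> m \<in> eM}"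
        then obtain q p where b: "b = q p" "q \<in> Ue" "p \<in> eM" by blast
        note qU = Ue_U[OF b(2)] and pM = eM_M[OF b(3)]
        have "op p u \<otimes>\<^bsub>A\<^esub> a \<otimes>\<^bsub>A\<^esub> op m q = op (p \<triangleleft>\<^bsub>M\<^esub> ?c) q"
          using op_mult_right[OF pM u a] op_op[OF pM uact_U[OF u a] m qU] m by simp
        then have "lam (op (p \<triangleleft>\<^bsub>M\<^esub> ?c) q) = \<zero>\<^bsub>K\<^esub>" using z'[OF op_Ae[OF m b(2)] op_eA[OF b(3) u]] by simp
        then show "\<tau> (b \<otimes>\<^bsub>B\<^esub> ?c) = \<zero>\<^bsub>K\<^esub>"
          using lam_op[OF eM_act[OF c b(3)] qU] UD(3)[OF qU pM c] b(1) by simp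
      qed
      then show ?thesis using c by simp
    qed
    show "\<phi> a m = \<zero>\<^bsub>M\<^esub>"
    proof (rule U_separates[OF am M.zero_closed])
      fix u assume u: "u \<in> U"
      have "\<tau> (u \<zero>\<^bsub>M\<^esub>) = \<zero>\<^bsub>K\<^esub>"
        by (rule add_hom_zero[OF M.abelian_group_axioms K.abelian_group_axioms add_hom_compose[OF UD(5)[OF u] tauD(1)]])
      then show "\<tau> (u (\<phi> a m)) = \<tau> (u \<zero>\<^bsub>M\<^esub>)" using tz[OF u] by simp
    qed
  qed
qed

text \<open>The image of \<open>m \<otimes> u\<close> under \<open>M \<otimes>\<^sub>B Hom\<^sub>B(M, B) \<cong> Ae \<otimes>\<^bsub>eAe\<^esub> eA\<close>.\<close>

definition \<omega> where "\<omega> m u = (\<Oplus>\<^bsub>E.T\<^esub>i\<in>{..<r}. E.pure (op m (ps i)) (op (qs i) u))"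

lemma omega_term_closed:
  "m \<in> carrier M \<Longrightarrow> u \<in> U \<Longrightarrow> i < r \<Longrightarrow> E.pure (op m (ps i)) (op (qs i) u) \<in> carrier E.T"
  by (rule E.pure_closed[OF op_Ae[OF _ ps] op_eA[OF qs]])

lemma omega_closed: "m \<in> carrier M \<Longrightarrow> u \<in> U \<Longrightarrow> \<omega> m u \<in> carrier E.T"
  unfolding \<omega>_def by (rule E.T.finsum_closed) (use omega_term_closed in auto)

lemma sum_op_one:
  assumes m: "m \<in> carrier M" and u: "u \<in> U"
  shows "(\<Oplus>\<^bsub>A\<^esub>i\<in>{..<r}. op (m \<triangleleft>\<^bsub>M\<^esub> ps i (qs i)) u) = op m u"
proof -
  have c: "ps i (qs i) \<in> carrier B" if "i < r" for i by (rule UD(1)[OF psU qsM]) (use that in auto)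
  have hom: "(\<lambda>b. op (m \<triangleleft>\<^bsub>M\<^esub> b) u) \<in> add_hom B A"
    by (rule add_hom_compose[OF _ op_hom_left[OF u]]) (use MD(1,3) m in \<open>auto intro!: add_homI\<close>)
  have "(\<Oplus>\<^bsub>A\<^esub>i\<in>{..<r}. op (m \<triangleleft>\<^bsub>M\<^esub> ps i (qs i)) u) = op (m \<triangleleft>\<^bsub>M\<^esub> (\<Oplus>\<^bsub>B\<^esub>i\<in>{..<r}. ps i (qs i))) u"
    by (rule add_hom_finsum[OF B.A.abelian_group_axioms A.abelian_group_axioms hom, symmetric]) (use c in auto)
  then show ?thesis using MD(5)[OF m] by (simp add: one_sum[symmetric])
qed

lemma pure_hom_right: "x \<in> carrier Ae \<Longrightarrow> E.pure x \<in> add_hom eA E.T"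
  and pure_hom_left: "y \<in> carrier eA \<Longrightarrow> (\<lambda>x. E.pure x y) \<in> add_hom Ae E.T"
  using E.balanced_pure by (simp_all add: balanced_def del: mult_bimod_simps)

lemma eA_finsum:
  assumes "\<And>i. i \<in> I \<Longrightarrow> f i \<in> carrier eA"
  shows "(\<Oplus>\<^bsub>eA\<^esub>i\<in>I. f i) = (\<Oplus>\<^bsub>A\<^esub>i\<in>I. f i)"
proof -
  have "(\<lambda>x. x) \<in> add_hom eA A" by (rule add_homI) (auto intro: eA_A simp del: mult_bimod_simps(1))
  from add_hom_finsum[OF eA_abelian_group A.abelian_group_axioms this, of f I] show ?thesis using assms by auto
qed

lemma Ae_finsum:
  assumes "\<And>i. i \<in> I \<Longrightarrow> f i \<in> carrier Ae"
  shows "(\<Oplus>\<^bsub>Ae\<^esub>i\<in>I. f i) = (\<Oplus>\<^bsub>A\<^esub>i\<in>I. f i)"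
proof -
  have "(\<lambda>x. x) \<in> add_hom Ae A" by (rule add_homI) (auto intro: Ae_A simp del: mult_bimod_simps(1))
  from add_hom_finsum[OF Ae_abelian_group A.abelian_group_axioms this, of f I] show ?thesis using assms by auto
qed

text \<open>With m = xq, each (xq)p_i equals x(q p_i), and q p_i is in eAe, so it crosses the tensor
  sign. On the right \<Sum> q p_i(q_i)u collapses to qu, and the chosen p_i and q_i disappear.
  \<open>omega_right\<close> is the mirror image.\<close>

lemma omega_left:
  assumes x: "x \<in> carrier Ae" and q: "q \<in> eM" and u: "u \<in> U"
  shows "\<omega> (\<phi> x q) u = E.pure x (op q u)"
proof -
  note xA = Ae_A[OF x] and qM = eM_M[OF q]
  have cl: "op (q \<triangleleft>\<^bsub>M\<^esub> ps i (qs i)) u \<in> carrier eA" if "i < r" for i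
    by (rule op_eA[OF eM_act[OF UD(1)[OF psU qsM] q] u]) (use that in auto)
  have "\<omega> (\<phi> x q) u = (\<Oplus>\<^bsub>E.T\<^esub>i\<in>{..<r}. E.pure x (op (q \<triangleleft>\<^bsub>M\<^esub> ps i (qs i)) u))"
    unfolding \<omega>_def
  proof (rule E.T.finsum_cong')
    fix i assume "i \<in> {..<r}"
    then have i: "i < r" by simp
    have s: "op q (ps i) \<in> carrier eAe" by (rule op_eAe[OF q ps[OF i]])
    have "E.pure (op (\<phi> x q) (ps i)) (op (qs i) u) = E.pure (x \<triangleleft>\<^bsub>Ae\<^esub> op q (ps i)) (op (qs i) u)"
      using op_mult_left[OF qM psU[OF i] xA] by simp
    also have "\<dots> = E.pure x (op q (ps i) \<otimes>\<^bsub>A\<^esub> op (qs i) u)"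
      using E.pure_balanced[OF x s op_eA[OF qs[OF i] u]] by simp
    also have "\<dots> = E.pure x (op (q \<triangleleft>\<^bsub>M\<^esub> ps i (qs i)) u)"
      using op_op[OF qM psU[OF i] qsM[OF i] u] by simp
    finally show "E.pure (op (\<phi> x q) (ps i)) (op (qs i) u) = E.pure x (op (q \<triangleleft>\<^bsub>M\<^esub> ps i (qs i)) u)" .
  next
    show "(\<lambda>i. E.pure x (op (q \<triangleleft>\<^bsub>M\<^esub> ps i (qs i)) u)) \<in> {..<r} \<rightarrow> carrier E.T"
      using E.pure_closed[OF x cl] by simp
  qed simp
  also have "\<dots> = E.pure x (\<Oplus>\<^bsub>eA\<^esub>i\<in>{..<r}. op (q \<triangleleft>\<^bsub>M\<^esub> ps i (qs i)) u)"
    by (rule add_hom_finsum[OF eA_abelian_group E.T.abelian_group_axioms pure_hom_right[OF x], symmetric])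
      (use cl in \<open>simp del: mult_bimod_simps(1)\<close>)
  also have "(\<Oplus>\<^bsub>eA\<^esub>i\<in>{..<r}. op (q \<triangleleft>\<^bsub>M\<^esub> ps i (qs i)) u) = op q u"
    using eA_finsum[of "{..<r}" "\<lambda>i. op (q \<triangleleft>\<^bsub>M\<^esub> ps i (qs i)) u"] cl sum_op_one[OF qM u]
    by (simp del: mult_bimod_simps(1))
  finally show ?thesis .
qed

lemma omega_right:
  assumes m: "m \<in> carrier M" and p: "p \<in> Ue" and y: "y \<in> carrier eA"
  shows "\<omega> m (uact p y) = E.pure (op m p) y"
proof -
  note yA = eA_A[OF y] and pU = Ue_U[OF p]
  have cl: "op (m \<triangleleft>\<^bsub>M\<^esub> ps i (qs i)) p \<in> carrier Ae" if "i < r" for i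
    by (rule op_Ae[OF MD(1)[OF m UD(1)[OF psU qsM]] p]) (use that in auto)
  have "\<omega> m (uact p y) = (\<Oplus>\<^bsub>E.T\<^esub>i\<in>{..<r}. E.pure (op (m \<triangleleft>\<^bsub>M\<^esub> ps i (qs i)) p) y)"
    unfolding \<omega>_def
  proof (rule E.T.finsum_cong')
    fix i assume "i \<in> {..<r}"
    then have i: "i < r" by simp
    have s: "op (qs i) p \<in> carrier eAe" by (rule op_eAe[OF qs[OF i] p])
    have "E.pure (op m (ps i)) (op (qs i) (uact p y)) = E.pure (op m (ps i)) (op (qs i) p \<triangleright>\<^bsub>eA\<^esub> y)"
      using op_mult_right[OF qsM[OF i] pU yA] by simp
    also have "\<dots> = E.pure (op m (ps i) \<otimes>\<^bsub>A\<^esub> op (qs i) p) y"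
      using E.pure_balanced[OF op_Ae[OF m ps[OF i]] s y] by simp
    also have "\<dots> = E.pure (op (m \<triangleleft>\<^bsub>M\<^esub> ps i (qs i)) p) y"
      using op_op[OF m psU[OF i] qsM[OF i] pU] by simp
    finally show "E.pure (op m (ps i)) (op (qs i) (uact p y)) = E.pure (op (m \<triangleleft>\<^bsub>M\<^esub> ps i (qs i)) p) y" .
  next
    show "(\<lambda>i. E.pure (op (m \<triangleleft>\<^bsub>M\<^esub> ps i (qs i)) p) y) \<in> {..<r} \<rightarrow> carrier E.T"
      using E.pure_closed[OF cl y] by simp
  qed simp
  also have "\<dots> = E.pure (\<Oplus>\<^bsub>Ae\<^esub>i\<in>{..<r}. op (m \<triangleleft>\<^bsub>M\<^esub> ps i (qs i)) p) y"
    by (rule add_hom_finsum[OF Ae_abelian_group E.T.abelian_group_axioms pure_hom_left[OF y], symmetric])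
      (use cl in \<open>simp del: mult_bimod_simps(1)\<close>)
  also have "(\<Oplus>\<^bsub>Ae\<^esub>i\<in>{..<r}. op (m \<triangleleft>\<^bsub>M\<^esub> ps i (qs i)) p) = op m p"
    using Ae_finsum[of "{..<r}" "\<lambda>i. op (m \<triangleleft>\<^bsub>M\<^esub> ps i (qs i)) p"] cl sum_op_one[OF m pU]
    by (simp del: mult_bimod_simps(1))
  finally show ?thesis .
qed

end

section \<open>Functionals on Ae \<otimes> eA and injectivity of \<open>\<Theta>\<close>\<close>

context gendo_data
begin

lemma op_hom_right: "m \<in> carrier M \<Longrightarrow> op m \<in> add_hom Umod A"
proof (rule add_homI)
  assume m: "m \<in> carrier M"
  show "op m u \<in> carrier A" if "u \<in> carrier Umod" for u using op_closed m that by simp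
  fix u v assume "u \<in> carrier Umod" "v \<in> carrier Umod"
  then have u: "u \<in> U" and v: "v \<in> U" by simp_all
  have uv: "u \<oplus>\<^bsub>Umod\<^esub> v \<in> U" using U_pointwise(2)[OF u v] by simp
  show "op m (u \<oplus>\<^bsub>Umod\<^esub> v) = op m u \<oplus>\<^bsub>A\<^esub> op m v"
  proof (rule act_eqI[OF op_closed[OF m uv] A.a_closed[OF op_closed[OF m u] op_closed[OF m v]]])
    fix x assume x: "x \<in> carrier M"
    have "\<phi> (op m (u \<oplus>\<^bsub>Umod\<^esub> v)) x = m \<triangleleft>\<^bsub>M\<^esub> (u x \<oplus>\<^bsub>B\<^esub> v x)" using op_act[OF m uv x] x by simp
    also have "\<dots> = \<phi> (op m u \<oplus>\<^bsub>A\<^esub> op m v) x"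
      using MD(3)[OF m UD(1)[OF u x] UD(1)[OF v x]] act_add_left[OF op_closed[OF m u] op_closed[OF m v] x]
        op_act[OF m u x] op_act[OF m v x] by simp
    finally show "\<phi> (op m (u \<oplus>\<^bsub>Umod\<^esub> v)) x = \<phi> (op m u \<oplus>\<^bsub>A\<^esub> op m v) x" .
  qed
qed

lemma bmul_hom: "u \<in> U \<Longrightarrow> (\<lambda>b. bmul b u) \<in> add_hom B Umod"
  by (rule add_homI) (use bmul_U[of u] UD(1)[of u] in \<open>auto simp: bmul_def B.A.l_distr intro!: restrict_ext\<close>)

end

context trace_data
begin

lemma Umod_group: "abelian_group Umod" by (rule right_moduleD(1)[OF Umod_right_module])

lemma omega_hom_left: "u \<in> U \<Longrightarrow> (\<lambda>m. \<omega> m u) \<in> add_hom M E.T"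
  unfolding \<omega>_def
proof (rule add_hom_sum[OF M.abelian_group_axioms E.T.abelian_group_axioms])
  fix i assume u: "u \<in> U" and "i \<in> {..<r}"
  then have i: "i < r" by simp
  have "(\<lambda>m. op m (ps i)) \<in> add_hom M Ae"
    using op_Ae[OF _ ps[OF i]] add_hom_add[OF op_hom_left[OF psU[OF i]]]
    by (intro add_homI) (simp_all del: mult_bimod_simps(1))
  from add_hom_compose[OF this pure_hom_left[OF op_eA[OF qs[OF i] u]]]
  show "(\<lambda>m. E.pure (op m (ps i)) (op (qs i) u)) \<in> add_hom M E.T" .
qed

lemma omega_hom_right: "m \<in> carrier M \<Longrightarrow> \<omega> m \<in> add_hom Umod E.T"
proof -
  assume m: "m \<in> carrier M"
  have "(\<lambda>u. \<Oplus>\<^bsub>E.T\<^esub>i\<in>{..<r}. E.pure (op m (ps i)) (op (qs i) u)) \<in> add_hom Umod E.T"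
  proof (rule add_hom_sum[OF Umod_group E.T.abelian_group_axioms])
    fix i assume "i \<in> {..<r}"
    then have i: "i < r" by simp
    have "op (qs i) \<in> add_hom Umod eA"
      using op_eA[OF qs[OF i]] add_hom_add[OF op_hom_right[OF qsM[OF i]]]
      by (intro add_homI) (simp_all del: mult_bimod_simps(1) Umod_simps(3))
    from add_hom_compose[OF this pure_hom_right[OF op_Ae[OF m ps[OF i]]]]
    show "(\<lambda>u. E.pure (op m (ps i)) (op (qs i) u)) \<in> add_hom Umod E.T" .
  qed
  moreover have "\<omega> m = (\<lambda>u. \<Oplus>\<^bsub>E.T\<^esub>i\<in>{..<r}. E.pure (op m (ps i)) (op (qs i) u))"
    by (rule ext) (simp add: \<omega>_def)
  ultimately show ?thesis by simp
qed

text \<open>Left multiplication by b maps a value u(m) to the value (bu)(m), and bu stays in Ue; so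
  the span of these values contains b as soon as it contains 1.\<close>

lemma corner_trace_full:
  assumes b: "b \<in> carrier B"
  shows "b \<in> addspan B {u m | u m. u \<in> Ue \<and> m \<in> eM}"
proof -
  have "b \<otimes>\<^bsub>B\<^esub> \<one>\<^bsub>B\<^esub> \<in> addspan B {u m | u m. u \<in> Ue \<and> m \<in> eM}"
  proof (rule addspan_image[OF B.A.abelian_group_axioms B.A.abelian_group_axioms _ Ue_trace_subset _ one_trace])
    show "(\<lambda>c. b \<otimes>\<^bsub>B\<^esub> c) \<in> add_hom B B" using b by (auto intro!: add_homI simp: B.A.r_distr)
    fix c assume "c \<in> {u m | u m. u \<in> Ue \<and> m \<in> eM}"
    then obtain u m where c: "c = u m" "u \<in> Ue" "m \<in> eM" by blast
    have "b \<otimes>\<^bsub>B\<^esub> c = bmul b u m" using c eM_M[OF c(3)] by simp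
    then show "b \<otimes>\<^bsub>B\<^esub> c \<in> addspan B {u m | u m. u \<in> Ue \<and> m \<in> eM}"
      using c Ue_bmul[OF b c(2)] by (intro addspan.incl CollectI exI[of _ "bmul b u"] exI[of _ m]) simp
  qed
  then show ?thesis using b by simp
qed

text \<open>By additivity b may be taken as p(q) with p in Ue and q in eM. Then both sides are mp
  \<otimes> qu: the left one by \<open>omega_left\<close> with x = mp, the right one by
  \<open>omega_right\<close> with y = qu.\<close>

lemma omega_balanced:
  assumes m: "m \<in> carrier M" and u: "u \<in> U" and b: "b \<in> carrier B"
  shows "\<omega> (m \<triangleleft>\<^bsub>M\<^esub> b) u = \<omega> m (bmul b u)"
proof (rule addspan_eq[OF B.A.abelian_group_axioms E.T.abelian_group_axioms Ue_trace_subset _ _ _ corner_trace_full[OF b]])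
  have "(\<lambda>b. m \<triangleleft>\<^bsub>M\<^esub> b) \<in> add_hom B M" using MD(1,3) m by (auto intro!: add_homI)
  then show "(\<lambda>b. \<omega> (m \<triangleleft>\<^bsub>M\<^esub> b) u) \<in> add_hom B E.T" by (rule add_hom_compose[OF _ omega_hom_left[OF u]])
  show "(\<lambda>b. \<omega> m (bmul b u)) \<in> add_hom B E.T" by (rule add_hom_compose[OF bmul_hom[OF u] omega_hom_right[OF m]])
  fix c assume "c \<in> {u m | u m. u \<in> Ue \<and> m \<in> eM}"
  then obtain p q where c: "c = p q" "p \<in> Ue" "q \<in> eM" by blast
  note pU = Ue_U[OF c(2)] and qM = eM_M[OF c(3)]
  have "\<omega> (m \<triangleleft>\<^bsub>M\<^esub> c) u = E.pure (op m p) (op q u)"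
    using omega_left[OF op_Ae[OF m c(2)] c(3) u] op_act[OF m pU qM] c(1) by simp
  moreover have "\<omega> m (bmul c u) = E.pure (op m p) (op q u)"
    using omega_right[OF m c(2) op_eA[OF c(3) u]] uact_op[OF pU qM u] c(1) by simp
  ultimately show "\<omega> (m \<triangleleft>\<^bsub>M\<^esub> c) u = \<omega> m (bmul c u)" by simp
qed

lemma omega_uact:
  assumes m: "m \<in> carrier M" and u: "u \<in> U" and a: "a \<in> carrier A"
  shows "\<omega> m (uact u a) = \<omega> m u \<triangleleft>\<^bsub>E.T\<^esub> a"
proof -
  have tc: "E.pure (op m (ps i)) (op (qs i) u) \<in> carrier E.T" if "i < r" for i
    by (rule omega_term_closed[OF m u that])
  have "\<omega> m u \<triangleleft>\<^bsub>E.T\<^esub> a = (\<Oplus>\<^bsub>E.T\<^esub>i\<in>{..<r}. E.pure (op m (ps i)) (op (qs i) u) \<triangleleft>\<^bsub>E.T\<^esub> a)"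
    unfolding \<omega>_def
    by (rule add_hom_finsum[OF E.T.abelian_group_axioms E.T.abelian_group_axioms E_ract_hom[OF a]]) (use tc in auto)
  also have "\<dots> = \<omega> m (uact u a)"
    unfolding \<omega>_def
  proof (rule E.T.finsum_cong')
    show "(\<lambda>i. E.pure (op m (ps i)) (op (qs i) (uact u a))) \<in> {..<r} \<rightarrow> carrier E.T"
      using omega_term_closed[OF m uact_U[OF u a]] by auto
    fix i assume "i \<in> {..<r}"
    then have i: "i < r" by simp
    show "E.pure (op m (ps i)) (op (qs i) u) \<triangleleft>\<^bsub>E.T\<^esub> a = E.pure (op m (ps i)) (op (qs i) (uact u a))"
      using E_ract_pure[OF op_Ae[OF m ps[OF i]] op_eA[OF qs[OF i] u] a] op_mult_right[OF qsM[OF i] u a] by simp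
  qed simp
  finally show ?thesis by (rule sym)
qed

text \<open>For fixed m, u |-> f(\<omega>(m, u)) is a functional on Hom_B(M, B), which is D(M); by
  reflexivity it is u |-> \<tau>(u(v)) for a vector v. Calling this vector \<alpha>(m), additivity
  and balancedness of \<open>\<omega>\<close> make \<alpha> an endomorphism of M over B, hence the
  action of some a in A.\<close>

lemma E_fun_repr:
  assumes f: "f \<in> functionals K (scalar_space A E.T)"
  shows "\<exists>a\<in>carrier A. \<forall>x\<in>carrier Ae. \<forall>y\<in>carrier eA. lam (y \<otimes>\<^bsub>A\<^esub> a \<otimes>\<^bsub>A\<^esub> x) = f (E.pure x y)"
proof -
  note fD = functionalsD(3-5)[OF f, unfolded scalar_space_simps]
  have fh: "f \<in> add_hom E.T K" by (rule add_homI) (use fD in auto)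
  have "\<exists>v. v \<in> carrier M \<and> (\<forall>u\<in>U. \<tau> (u v) = f (\<omega> m u))" if m: "m \<in> carrier M" for m
  proof -
    interpret D: module K DM by (rule DM_module)
    \<comment> \<open>Passing through \<open>rep\<close> turns the functional on Hom_B(M, B) into
      one on the dual space of M, where \<open>bidual_eval\<close> applies.\<close>
    define G where "G = (\<lambda>\<psi>\<in>carrier DM. f (\<omega> m (rep \<psi>)))"
    have "G \<in> functionals K DM"
    proof (rule functionalsI)
      fix \<psi> assume \<psi>: "\<psi> \<in> carrier DM"
      note om = omega_closed[OF m rep(1)] 
      have \<psi>': "\<psi> \<in> functionals K (scalar_space B M)" using \<psi> by simp
      show "G \<psi> \<in> carrier K" using \<psi> fD(1)[OF om[OF \<psi>']] by (simp add: G_def)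
      show "G (\<psi> \<oplus>\<^bsub>DM\<^esub> \<chi>) = G \<psi> \<oplus>\<^bsub>K\<^esub> G \<chi>" if \<chi>: "\<chi> \<in> carrier DM" for \<chi>
      proof -
        have "rep (\<psi> \<oplus>\<^bsub>DM\<^esub> \<chi>) = rep \<psi> \<oplus>\<^bsub>Umod\<^esub> rep \<chi>" by (rule add_hom_add[OF rep_hom \<psi> \<chi>])
        then show ?thesis
          using add_hom_add[OF omega_hom_right[OF m], of "rep \<psi>" "rep \<chi>"] rep(1) \<psi> \<chi> fD(2) om D.M.a_closed[OF \<psi> \<chi>]
          by (simp add: G_def del: dual_space_simps(3) Umod_simps(3))
      qed
      fix k assume k: "k \<in> carrier K"
      have "rep (k \<odot>\<^bsub>DM\<^esub> \<psi>) = uact (rep \<psi>) (sc k)" by (rule rep_smult[OF \<psi>' k])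
      then show "G (k \<odot>\<^bsub>DM\<^esub> \<psi>) = k \<otimes>\<^bsub>K\<^esub> G \<psi>"
        using omega_uact[OF m rep(1)[OF \<psi>'] sc_closed[OF k]] fD(3)[OF k om[OF \<psi>']] \<psi> D.smult_closed[OF k \<psi>]
        by (simp add: G_def del: dual_space_simps(4))
    qed (simp add: G_def)
    then obtain v where v: "v \<in> carrier M" "\<And>\<psi>. \<psi> \<in> functionals K (scalar_space B M) \<Longrightarrow> G \<psi> = \<psi> v"
      using bidual_eval[OF K.field_axioms MS.module_axioms MS_fd] unfolding scalar_space_simps by metis
    have "\<tau> (u v) = f (\<omega> m u)" if u: "u \<in> U" for u
      using v(2)[OF tau_U_functional[OF u]] v(1) rep_tau[OF u] tau_U_functional[OF u] by (simp add: G_def)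
    then show ?thesis using v(1) by blast
  qed
  then have "\<forall>m\<in>carrier M. \<exists>v. v \<in> carrier M \<and> (\<forall>u\<in>U. \<tau> (u v) = f (\<omega> m u))" by (rule ballI)
  from bchoice[OF this] obtain \<alpha>0 where \<alpha>0: "\<forall>m\<in>carrier M. \<alpha>0 m \<in> carrier M \<and> (\<forall>u\<in>U. \<tau> (u (\<alpha>0 m)) = f (\<omega> m u))"
    by (elim exE)
  define \<alpha> where "\<alpha> = restrict \<alpha>0 (carrier M)"
  have \<alpha>: "\<alpha> m \<in> carrier M" "\<And>u. u \<in> U \<Longrightarrow> \<tau> (u (\<alpha> m)) = f (\<omega> m u)" if "m \<in> carrier M" for m
    using \<alpha>0 that by (auto simp: \<alpha>_def)
  have "\<alpha> \<in> rhom B M M"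
  proof (rule rhomI)
    fix m assume m: "m \<in> carrier M"
    show "\<alpha> m \<in> carrier M" by (rule \<alpha>(1)[OF m])
    show "\<alpha> (m \<oplus>\<^bsub>M\<^esub> n) = \<alpha> m \<oplus>\<^bsub>M\<^esub> \<alpha> n" if n: "n \<in> carrier M" for n
    proof (rule U_separates[OF \<alpha>(1)[OF M.a_closed[OF m n]] M.a_closed[OF \<alpha>(1)[OF m] \<alpha>(1)[OF n]]])
      fix u assume u: "u \<in> U"
      show "\<tau> (u (\<alpha> (m \<oplus>\<^bsub>M\<^esub> n))) = \<tau> (u (\<alpha> m \<oplus>\<^bsub>M\<^esub> \<alpha> n))"
        using \<alpha>(2)[OF M.a_closed[OF m n] u] \<alpha>(2)[OF m u] \<alpha>(2)[OF n u] add_hom_add[OF omega_hom_left[OF u] m n]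
          fD(2)[OF omega_closed[OF m u] omega_closed[OF n u]] UD(2)[OF u \<alpha>(1)[OF m] \<alpha>(1)[OF n]]
          tauD(4)[OF UD(1)[OF u \<alpha>(1)[OF m]] UD(1)[OF u \<alpha>(1)[OF n]]] by simp
    qed
    show "\<alpha> (m \<triangleleft>\<^bsub>M\<^esub> b) = \<alpha> m \<triangleleft>\<^bsub>M\<^esub> b" if b: "b \<in> carrier B" for b
    proof (rule U_separates[OF \<alpha>(1)[OF MD(1)[OF m b]] MD(1)[OF \<alpha>(1)[OF m] b]])
      fix u assume u: "u \<in> U"
      have "\<tau> (u (\<alpha> (m \<triangleleft>\<^bsub>M\<^esub> b))) = \<tau> (bmul b u (\<alpha> m))"
        using \<alpha>(2)[OF MD(1)[OF m b] u] \<alpha>(2)[OF m bmul_U[OF u b]] omega_balanced[OF m u b] by simp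
      also have "\<dots> = \<tau> (u (\<alpha> m \<triangleleft>\<^bsub>M\<^esub> b))"
        using \<alpha>(1)[OF m] UD(3)[OF u \<alpha>(1)[OF m] b] tau_comm[OF b UD(1)[OF u \<alpha>(1)[OF m]]] by simp
      finally show "\<tau> (u (\<alpha> (m \<triangleleft>\<^bsub>M\<^esub> b))) = \<tau> (u (\<alpha> m \<triangleleft>\<^bsub>M\<^esub> b))" .
    qed
  qed (simp add: \<alpha>_def)
  then obtain a where a: "a \<in> carrier A" "\<And>m. m \<in> carrier M \<Longrightarrow> \<phi> a m = \<alpha> m" using act_full by metis
  \<comment> \<open>The j-th term of lam(yax) is f(\<omega>(x x_j, v_j y)) = f(x \<otimes> (x_j
    v_j)y) by \<open>omega_left\<close>. The sum over j restores ey = y.\<close>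
  have "lam (y \<otimes>\<^bsub>A\<^esub> a \<otimes>\<^bsub>A\<^esub> x) = f (E.pure x y)" if x: "x \<in> carrier Ae" and y: "y \<in> carrier eA" for x y
  proof -
    note xA = Ae_A[OF x] and yA = eA_A[OF y]
    have cl: "op (xs j) (vs j) \<otimes>\<^bsub>A\<^esub> y \<in> carrier eA" if "j < n" for j
      by (rule eA_mult[OF yA eAe_eA[OF op_eAe[OF xs vs]]]) (use that in auto)
    have "lam (y \<otimes>\<^bsub>A\<^esub> a \<otimes>\<^bsub>A\<^esub> x) = (\<Oplus>\<^bsub>K\<^esub>j\<in>{..<n}. f (E.pure x (op (xs j) (vs j) \<otimes>\<^bsub>A\<^esub> y)))"
      unfolding lam_def
    proof (rule K.finsum_cong')
      show "(\<lambda>j. f (E.pure x (op (xs j) (vs j) \<otimes>\<^bsub>A\<^esub> y))) \<in> {..<n} \<rightarrow> carrier K"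
        using fD(1)[OF E.pure_closed[OF x cl]] by auto
      fix j assume "j \<in> {..<n}"
      then have j: "j < n" by simp
      note xj = xsM[OF j] and vj = vsU[OF j]
      have xx: "\<phi> x (xs j) \<in> carrier M" by (rule act_closed[OF xA xj])
      have "vs j (\<phi> (y \<otimes>\<^bsub>A\<^esub> a \<otimes>\<^bsub>A\<^esub> x) (xs j)) = uact (vs j) y (\<alpha> (\<phi> x (xs j)))"
        using xA yA a xj xx \<alpha>(1)[OF xx] by (simp add: act_mult)
      then have "\<tau> (vs j (\<phi> (y \<otimes>\<^bsub>A\<^esub> a \<otimes>\<^bsub>A\<^esub> x) (xs j))) = f (\<omega> (\<phi> x (xs j)) (uact (vs j) y))"
        using \<alpha>(2)[OF xx uact_U[OF vj yA]] by simp
      also have "\<dots> = f (E.pure x (op (xs j) (vs j) \<otimes>\<^bsub>A\<^esub> y))"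
        using omega_left[OF x xs[OF j] uact_U[OF vj yA]] op_mult_right[OF xj vj yA] by simp
      finally show "\<tau> (vs j (\<phi> (y \<otimes>\<^bsub>A\<^esub> a \<otimes>\<^bsub>A\<^esub> x) (xs j))) = f (E.pure x (op (xs j) (vs j) \<otimes>\<^bsub>A\<^esub> y))" .
    qed simp
    also have "\<dots> = f (E.pure x (\<Oplus>\<^bsub>eA\<^esub>j\<in>{..<n}. op (xs j) (vs j) \<otimes>\<^bsub>A\<^esub> y))"
      by (rule add_hom_finsum[OF eA_abelian_group K.abelian_group_axioms add_hom_compose[OF pure_hom_right[OF x] fh], symmetric])
        (use cl in \<open>simp del: mult_bimod_simps(1)\<close>)
    also have "(\<Oplus>\<^bsub>eA\<^esub>j\<in>{..<n}. op (xs j) (vs j) \<otimes>\<^bsub>A\<^esub> y) = (\<Oplus>\<^bsub>A\<^esub>j\<in>{..<n}. op (xs j) (vs j) \<otimes>\<^bsub>A\<^esub> y)"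
      by (rule eA_finsum) (use cl in auto)
    also have "\<dots> = e \<otimes>\<^bsub>A\<^esub> y"
      using sum_mult_right[OF yA, of "{..<n}" "\<lambda>j. op (xs j) (vs j)"] op_closed[OF xsM vsU]
      by (simp add: e_sum[symmetric])
    also have "\<dots> = y" by (rule eA_e[OF y])
    finally show ?thesis .
  qed
  then show ?thesis using a(1) by blast
qed

text \<open>A nonzero difference s - t is detected by a functional, which by
  \<open>E_fun_repr\<close> has the form d |-> \<Theta>(d)(a). But \<Theta>(s - t) = 0.\<close>

lemma Theta_inj: "inj_on \<Theta> (carrier E.T)"
proof (rule inj_onI)
  fix s t assume s: "s \<in> carrier E.T" and t: "t \<in> carrier E.T" and eq: "\<Theta> s = \<Theta> t"
  show "s = t"
  proof (rule ccontr)
    assume neq: "s \<noteq> t"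
    interpret ES: module K "scalar_space A E.T" by (rule scalar_space_module[OF E_right])
    interpret DA: abelian_group "dual_bimod K A" by (rule DA_group)
    let ?d = "s \<oplus>\<^bsub>E.T\<^esub> \<ominus>\<^bsub>E.T\<^esub> t"
    have d: "?d \<in> carrier E.T" using s t by simp
    have d0: "?d \<noteq> \<zero>\<^bsub>E.T\<^esub>"
    proof
      assume "?d = \<zero>\<^bsub>E.T\<^esub>"
      then have "\<ominus>\<^bsub>E.T\<^esub> (\<ominus>\<^bsub>E.T\<^esub> t) = s" using s t by (intro E.T.minus_equality) auto
      then show False using neq t by simp
    qed
    have "submodule {\<zero>\<^bsub>E.T\<^esub>} K (scalar_space A E.T)"
      by (rule submoduleI'[OF ES.module_axioms]) (use zero_act[OF E_right] in auto)
    then obtain f where f: "f \<in> functionals K (scalar_space A E.T)" "f ?d = \<one>\<^bsub>K\<^esub>"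
      using separating_functional[OF K.field_axioms ES.module_axioms, of "{\<zero>\<^bsub>E.T\<^esub>}" ?d] d d0 by auto
    obtain a where a: "a \<in> carrier A"
      "\<forall>x\<in>carrier Ae. \<forall>y\<in>carrier eA. lam (y \<otimes>\<^bsub>A\<^esub> a \<otimes>\<^bsub>A\<^esub> x) = f (E.pure x y)"
      using E_fun_repr[OF f(1)] by (elim bexE)
    have ev: "(\<lambda>g. g a) \<in> add_hom (dual_bimod K A) K"
      by (rule add_homI) (use a functionalsD(3)[of _ K A] in auto)
    have "f ?d = \<Theta> ?d a"
    proof (rule E.tensor_eqI[OF K.abelian_group_axioms _ add_hom_compose[OF Theta_hom ev] _ d])
      show "f \<in> add_hom E.T K"
        by (rule add_homI) (use functionalsD(3,4)[OF f(1)] in auto)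
      fix x y assume x: "x \<in> carrier Ae" and y: "y \<in> carrier eA"
      show "f (E.pure x y) = \<Theta> (E.pure x y) a"
        using a(2)[THEN bspec[OF _ x], THEN bspec[OF _ y]] a(1) by (simp add: Theta_pure[OF x y] pairing_def)
    qed
    also have "\<Theta> ?d = \<Theta> t \<oplus>\<^bsub>dual_bimod K A\<^esub> \<ominus>\<^bsub>dual_bimod K A\<^esub> \<Theta> t"
      using add_hom_add[OF Theta_hom s E.T.a_inv_closed[OF t]]
        add_hom_uminus[OF E.T.abelian_group_axioms DA_group Theta_hom t] eq by simp
    also have "\<dots> = \<zero>\<^bsub>dual_bimod K A\<^esub>" by (rule DA.r_neg[OF add_hom_closed[OF Theta_hom t]])
    finally show False using f(2) a(1) K.one_not_zero by simp
  qed
qed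

theorem Theta_iso: "bimod_iso A A (Ae_eA A e) (dual_bimod K A) \<Theta>"
  using Theta_bihom Theta_inj Theta_surj by (simp add: bimod_iso_def bij_betw_def Ae_eA_def)

end

text \<open>Unpacks the two span memberships, of e from injectivity and of 1 from faithfulness, into
  the finite families over which \<open>trace_data\<close> is formulated.\<close>

lemma (in gendo_data) Ae_eA_iso_dual:
  assumes inj: "injective_module TYPE('m) K A eA" and large: "large_type TYPE('m) K"
    and faithful: "faithful_module A eA"
  shows "\<exists>\<theta>. bimod_iso A A (Ae_eA A e) (dual_bimod K A) \<theta>"
proof -
  obtain n f where f: "\<And>j. j < n \<Longrightarrow> f j \<in> {op x v | x v. x \<in> eM \<and> v \<in> Ue}" "e = (\<Oplus>\<^bsub>A\<^esub>j\<in>{..<n::nat}. f j)"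
    by (rule addspan_finsum[OF A.abelian_group_axioms _ e_in_trace[OF inj large]])
      (use op_closed eM_M Ue_U in auto)
  have "\<forall>j\<in>{..<n}. \<exists>p. fst p \<in> eM \<and> snd p \<in> Ue \<and> f j = op (fst p) (snd p)"
  proof
    fix j assume "j \<in> {..<n}"
    then have "f j \<in> {op x v | x v. x \<in> eM \<and> v \<in> Ue}" using f(1) by simp
    then obtain x v where "f j = op x v" "x \<in> eM" "v \<in> Ue" by blast
    then show "\<exists>p. fst p \<in> eM \<and> snd p \<in> Ue \<and> f j = op (fst p) (snd p)" by (intro exI[of _ "(x, v)"]) simp
  qed
  from bchoice[OF this] obtain xv where xv: "\<forall>j\<in>{..<n}. fst (xv j) \<in> eM \<and> snd (xv j) \<in> Ue \<and> f j = op (fst (xv j)) (snd (xv j))"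
    by (elim exE)
  obtain r g where g: "\<And>i. i < r \<Longrightarrow> g i \<in> {u m | u m. u \<in> Ue \<and> m \<in> eM}"
    "\<one>\<^bsub>B\<^esub> = (\<Oplus>\<^bsub>B\<^esub>i\<in>{..<r::nat}. g i)"
    by (rule addspan_finsum[OF B.A.abelian_group_axioms _ one_in_corner_trace[OF faithful]])
      (use UD(1)[OF Ue_U eM_M] in auto)
  have "\<forall>i\<in>{..<r}. \<exists>p. fst p \<in> Ue \<and> snd p \<in> eM \<and> g i = fst p (snd p)"
  proof
    fix i assume "i \<in> {..<r}"
    then have "g i \<in> {u m | u m. u \<in> Ue \<and> m \<in> eM}" using g(1) by simp
    then obtain u m where "g i = u m" "u \<in> Ue" "m \<in> eM" by blast
    then show "\<exists>p. fst p \<in> Ue \<and> snd p \<in> eM \<and> g i = fst p (snd p)" by (intro exI[of _ "(u, m)"]) simp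
  qed
  from bchoice[OF this] obtain pq where pq: "\<forall>i\<in>{..<r}. fst (pq i) \<in> Ue \<and> snd (pq i) \<in> eM \<and> g i = fst (pq i) (snd (pq i))"
    by (elim exE)
  interpret trace_data K A e B M \<phi> \<theta>B n "\<lambda>j. fst (xv j)" "\<lambda>j. snd (xv j)" r "\<lambda>i. fst (pq i)" "\<lambda>i. snd (pq i)"
  proof (intro trace_data.intro trace_data_axioms.intro gendo_data_axioms)
    have "(\<Oplus>\<^bsub>A\<^esub>j\<in>{..<n}. f j) = (\<Oplus>\<^bsub>A\<^esub>j\<in>{..<n}. op (fst (xv j)) (snd (xv j)))"
      using xv op_closed[OF eM_M Ue_U] by (intro A.finsum_cong') auto
    with f(2) show "e = (\<Oplus>\<^bsub>A\<^esub>j\<in>{..<n}. op (fst (xv j)) (snd (xv j)))" by (rule trans)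
    have "(\<Oplus>\<^bsub>B\<^esub>i\<in>{..<r}. g i) = (\<Oplus>\<^bsub>B\<^esub>i\<in>{..<r}. fst (pq i) (snd (pq i)))"
      using pq UD(1)[OF Ue_U eM_M] by (intro B.A.finsum_cong') auto
    with g(2) show "\<one>\<^bsub>B\<^esub> = (\<Oplus>\<^bsub>B\<^esub>i\<in>{..<r}. fst (pq i) (snd (pq i)))" by (rule trans)
  qed (use xv pq in auto)
  show ?thesis using Theta_iso by blast
qed

theorem theoremB:
  fixes K :: "('k, 'c) ring_scheme" and A :: "('k, 'a) module" and e :: 'a
  assumes "field K"
    and "gendo_symmetric TYPE('b \<times> 'v) K A"
    and "e \<in> carrier A" and "e \<otimes>\<^bsub>A\<^esub> e = e"
    and "large_type TYPE('m) K" and "large_type TYPE('n) K"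
    and "minimal_faithful_proj_inj TYPE('m) K A (right_ideal_of A e)"
  shows "(\<exists>\<theta>. bimod_iso A A (Ae_eA A e) (dual_bimod K A) \<theta>) \<and>
    (\<forall>\<theta>. bimod_iso A A (Ae_eA A e) (dual_bimod K A) \<theta> \<longrightarrow>
      bocs K A (dual_bimod K A) (dual_mu K A e \<theta>) (dual_eps K A e \<theta>) \<and>
      equivalent_linear_categories K
        (bocs_mod_cat TYPE('m) K A (dual_bimod K A) (dual_mu K A e \<theta>) (dual_eps K A e \<theta>))
        (mod_cat TYPE('n) K (corner A e)))"
proof -
  have A: "fd_algebra K A" using assms(2) by (simp add: gendo_symmetric_def)
  interpret alg_idem K A e
    by (intro alg_idem.intro fd_alg.intro alg_idem_axioms.intro A assms(3,4))
  obtain B :: "('k, 'b) module" and M :: "('b, 'v) rmod" and \<phi> where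
    B: "symmetric_algebra K B" "fd_right_module K B M" "generator B M" "algebra_iso K A (End_algebra B M) \<phi>"
    using assms(2) unfolding gendo_symmetric_def by (elim conjE exE)
  obtain \<theta>B where \<theta>B: "bimod_iso B B (regular B) (dual_bimod K B) \<theta>B"
    using B(1) unfolding symmetric_algebra_def by (elim conjE exE)
  have Bfd: "fd_algebra K B" using B(1) by (simp add: symmetric_algebra_def)
  interpret gendo_data K A e B M \<phi> \<theta>B
    by (intro gendo_data.intro alg_idem_axioms fd_alg.intro gendo_data_axioms.intro Bfd B(2-4) \<theta>B)
  have "\<exists>\<theta>. bimod_iso A A (Ae_eA A e) (dual_bimod K A) \<theta>"
    using Ae_eA_iso_dual[OF _ assms(5)] assms(7) unfolding minimal_faithful_proj_inj_def by blast
  moreover have "bocs K A (dual_bimod K A) (dual_mu K A e \<theta>) (dual_eps K A e \<theta>) \<and>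
      equivalent_linear_categories K
        (bocs_mod_cat TYPE('m) K A (dual_bimod K A) (dual_mu K A e \<theta>) (dual_eps K A e \<theta>))
        (mod_cat TYPE('n) K (corner A e))"
    if \<theta>: "bimod_iso A A (Ae_eA A e) (dual_bimod K A) \<theta>" for \<theta>
  proof -
    interpret bocs_data K A e "dual_bimod K A" \<theta>
      by (intro bocs_data.intro alg_idem_axioms bocs_data_axioms.intro dual_bimodule \<theta>)
    have "dual_mu K A e \<theta> = mu" "dual_eps K A e \<theta> = eps"
      by (simp_all add: dual_mu_def mu_def dual_eps_def eps_def lift_def br_def Ae_eA_def)
    then show ?thesis using bocs bocs_cat_equivalent[OF assms(5,6)] by simp
  qed
  ultimately show ?thesis by blast
qed

end
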